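(* Let $s\in\mathbb{N}_0$, $n>s$, and let $\varphi\in H^s(\mathbb{R}^d)$ and $\widetilde\varphi\in H^{-s}(\mathbb{R}^d)$ have compact supports. Then the quasi-projection operator $Q_j(f)=\sum_{k\in\mathbb{Z}^d}\langle f,\widetilde\varphi_{jk}\rangle\varphi_{jk}$ provides simultaneous approximation order $(s,n)$ in $H^s(\mathbb{R}^d)$ if and only if there are constants $C_{\varphi,\widetilde\varphi},C_\varphi>0$ such that for all $\xi\in\mathbb{T}^d$ $$\left|1-\overline{\widehat{\widetilde\varphi}(\xi)}\,\widehat\varphi(\xi)\right|\le C_{\varphi,\widetilde\varphi}|\xi|^n,\qquad \sum_{k\in\mathbb{Z}^d,\,k\neq\mathbf{0}}(1+|\xi+k|^2)^s\,|\widehat\varphi(\xi+k)|^2\le C_\varphi|\xi|^{2n}.$$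
   Context: $M\in\mathbb{Z}^{d\times d}$ is a fixed dilation matrix, i.e. all its eigenvalues are greater than 1 in modulus; $m=|\det M|$; $M^*$ is its (conjugate) transpose, $M^{*j}=(M^* )^j$, $M^{*-j}=(M^* )^{-j}$, and $\|\cdot\|$ is the operator norm of matrices induced by the Euclidean norm $|\cdot|$. $\mathbb{N}_0=\mathbb{N}\cup\{0\}$, $\mathbf{0}$ is the origin of $\mathbb{R}^d$ and $\mathbb{T}^d=[-\frac12,\frac12)^d$. For a function (or tempered distribution) $g$ on $\mathbb{R}^d$, $g_{jk}(x)=m^{j/2}g(M^jx+k)$, $j\in\mathbb{Z}$, $k\in\mathbb{Z}^d$. The Fourier transform is $\widehat f(\xi)=\int_{\mathbb{R}^d}f(x)e^{-2\pi i(x,\xi)}dx$, extended to tempered distributions. For real $s$, $H^s(\mathbb{R}^d)$ is the space of tempered distributions $f$ with $\|f\|_{H^s}^2=\int_{\mathbb{R}^d}|\widehat f(\xi)|^2(1+|\xi|^2)^s\,d\xi<\infty$. For $f\in H^s(\mathbb{R}^d)$, $g\in H^{-s}(\mathbb{R}^d)$ the pairing is $\langle f,g\rangle=\int_{\mathbb{R}^d}\widehat f(\xi)\overline{\widehat g(\xi)}\,d\xi$. The seminorm is $|f|_{H^r}^2=\int_{\mathbb{R}^d}|\xi|^{2r}|\widehat f(\xi)|^2d\xi$. Under the stated hypotheses on $\varphi,\widetilde\varphi$ the series defining $Q_j(f)$ converges unconditionally in $H^s(\mathbb{R}^d)$ for every $f\in H^s(\mathbb{R}^d)$ and $j\in\mathbb{Z}$.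 Definition. For $s\in\mathbb{N}_0$ and $n>s$, $Q_j$ provides simultaneous approximation order $(s,n)$ in $H^s(\mathbb{R}^d)$ if there is a constant $C$, not depending on $j$ and $f$, such that for all $f\in H^n(\mathbb{R}^d)$ and all $j\in\mathbb{Z}$ $$\sum_{r=0}^{s}\|M^{*j}\|^{-r}\left|f-\sum_{k\in\mathbb{Z}^d}\langle f,\widetilde\varphi_{jk}\rangle\varphi_{jk}\right|_{H^r}\le C\,\|M^{*-j}\|^{n}\,|f|_{H^n}.$$ *)

theory Defs
  imports "HOL-Analysis.Analysis"
begin

section \<open>Schwartz functions\<close>

text \<open>Iterated partial derivatives along a list of directions; used only for
  functions all of whose iterated derivatives are (totally) differentiable.\<close>

definition iter_deriv :: "'a list \<Rightarrow> ('a::euclidean_space \<Rightarrow> complex) \<Rightarrow> 'a \<Rightarrow> complex" where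
  "iter_deriv bs \<psi> = foldr (\<lambda>b g x. frechet_derivative g (at x) b) bs \<psi>"

definition smooth :: "('a::euclidean_space \<Rightarrow> complex) \<Rightarrow> bool" where
  "smooth \<psi> \<longleftrightarrow> (\<forall>bs\<in>lists Basis. \<forall>x. iter_deriv bs \<psi> differentiable (at x))"

definition schwartz :: "('a::euclidean_space \<Rightarrow> complex) set" where
  "schwartz = {\<psi>. smooth \<psi> \<and>
     (\<forall>N. \<forall>bs\<in>lists Basis. bounded (range (\<lambda>x. (1 + norm x) ^ N *\<^sub>R iter_deriv bs \<psi> x)))}"

definition schwartz_seminorm :: "nat \<Rightarrow> ('a::euclidean_space \<Rightarrow> complex) \<Rightarrow> real" where
  "schwartz_seminorm N \<psi> =
     (SUP (bs, x) \<in> {bs \<in> lists Basis. length bs \<le> N} \<times> UNIV.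
        (1 + norm x) ^ N * cmod (iter_deriv bs \<psi> x))"

definition fourier :: "('a::euclidean_space \<Rightarrow> complex) \<Rightarrow> 'a \<Rightarrow> complex" where
  "fourier \<psi> \<xi> = (LINT x|lborel. \<psi> x * cis (- 2 * pi * (x \<bullet> \<xi>)))"


section \<open>Tempered distributions\<close>

text \<open>A distribution is a functional on all functions that is set to 0 outside the
  Schwartz space, so that equality of distributions is equality in HOL.\<close>

type_synonym 'a distr = "('a \<Rightarrow> complex) \<Rightarrow> complex"

definition tempered :: "'a::euclidean_space distr set" where
  "tempered = {T.
     (\<forall>\<psi>. \<psi> \<notin> schwartz \<longrightarrow> T \<psi> = 0) \<and>
     (\<forall>\<psi>\<in>schwartz. \<forall>\<eta>\<in>schwartz. T (\<lambda>x. \<psi> x + \<eta> x) = T \<psi> + T \<eta>) \<and>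
     (\<forall>c. \<forall>\<psi>\<in>schwartz. T (\<lambda>x. c * \<psi> x) = c * T \<psi>) \<and>
     (\<exists>N C. \<forall>\<psi>\<in>schwartz. cmod (T \<psi>) \<le> C * schwartz_seminorm N \<psi>)}"

definition fourier_distr :: "'a::euclidean_space distr \<Rightarrow> 'a distr" where
  "fourier_distr T \<psi> = (if \<psi> \<in> schwartz then T (fourier \<psi>) else 0)"

definition represents :: "('a::euclidean_space \<Rightarrow> complex) \<Rightarrow> 'a distr \<Rightarrow> bool" where
  "represents g T \<longleftrightarrow> g \<in> borel_measurable lborel \<and>
     (\<forall>\<psi>\<in>schwartz. integrable lborel (\<lambda>\<xi>. g \<xi> * \<psi> \<xi>) \<and> T \<psi> = (LINT \<xi>|lborel. g \<xi> * \<psi> \<xi>))"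

text \<open>The Fourier transform of \<open>T\<close> as a function, if it is one. It is determined only
  almost everywhere, except when there is a continuous version (as for every compactly
  supported distribution): then that unique version is chosen, so point values make sense.\<close>

definition fhat :: "'a::euclidean_space distr \<Rightarrow> 'a \<Rightarrow> complex" where
  "fhat T = (SOME g. represents g (fourier_distr T) \<and>
     ((\<exists>h. continuous_on UNIV h \<and> represents h (fourier_distr T)) \<longrightarrow> continuous_on UNIV g))"

definition vanishes_on :: "'a::euclidean_space distr \<Rightarrow> 'a set \<Rightarrow> bool" where
  "vanishes_on T U \<longleftrightarrow> (\<forall>\<psi>\<in>schwartz.
     compact (closure {x. \<psi> x \<noteq> 0}) \<and> closure {x. \<psi> x \<noteq> 0} \<subseteq> U \<longrightarrow> T \<psi> = 0)"

definition distr_support :: "'a::euclidean_space distr \<Rightarrow> 'a set" where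
  "distr_support T = - \<Union>{U. open U \<and> vanishes_on T U}"


section \<open>Sobolev spaces\<close>

definition sobolev :: "real \<Rightarrow> 'a::euclidean_space distr set" where
  "sobolev s = {T \<in> tempered. (\<exists>g. represents g (fourier_distr T)) \<and>
     integrable lborel (\<lambda>\<xi>. (cmod (fhat T \<xi>))\<^sup>2 * (1 + (norm \<xi>)\<^sup>2) powr s)}"

definition sobolev_norm :: "real \<Rightarrow> 'a::euclidean_space distr \<Rightarrow> real" where
  "sobolev_norm s T = sqrt (LINT \<xi>|lborel. (cmod (fhat T \<xi>))\<^sup>2 * (1 + (norm \<xi>)\<^sup>2) powr s)"

text \<open>For \<open>r = 0\<close> the weight \<open>0 powr 0 = 0\<close> at the origin only matters on a null set.\<close>

definition sobolev_seminorm :: "real \<Rightarrow> 'a::euclidean_space distr \<Rightarrow> real" where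
  "sobolev_seminorm r T = sqrt (LINT \<xi>|lborel. norm \<xi> powr (2 * r) * (cmod (fhat T \<xi>))\<^sup>2)"

definition pairing :: "'a::euclidean_space distr \<Rightarrow> 'a distr \<Rightarrow> complex" where
  "pairing f g = (LINT \<xi>|lborel. fhat f \<xi> * cnj (fhat g \<xi>))"


section \<open>Dilation matrices and quasi-projection operators\<close>

definition dilation_matrix :: "int^'d^'d \<Rightarrow> bool" where
  "dilation_matrix M \<longleftrightarrow> (\<forall>(\<mu>::complex) (v::complex^'d).
     v \<noteq> 0 \<and> map_matrix of_int M *v v = \<mu> *s v \<longrightarrow> cmod \<mu> > 1)"

definition real_mat :: "int^'d^'d \<Rightarrow> real^'d^'d" where
  "real_mat M = map_matrix real_of_int M"

definition real_vec :: "int^'d \<Rightarrow> real^'d" where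
  "real_vec k = (\<chi> i. real_of_int (k $ i))"

definition mat_powi :: "real^'d^'d \<Rightarrow> int \<Rightarrow> real^'d^'d" where
  "mat_powi A j = (if j \<ge> 0 then (((**) A) ^^ nat j) (mat 1)
                   else (((**) (matrix_inv A)) ^^ nat (- j)) (mat 1))"

definition op_norm :: "real^'d^'d \<Rightarrow> real" where
  "op_norm A = onorm (\<lambda>x. A *v x)"

text \<open>The distribution \<open>T(A x + b)\<close> for invertible \<open>A\<close>, via the substitution
  \<open>y = A x + b\<close> in the integral of \<open>T(A x + b) \<psi>(x)\<close>.\<close>

definition affine_distr :: "real^'d^'d \<Rightarrow> real^'d \<Rightarrow> (real^'d) distr \<Rightarrow> (real^'d) distr" where
  "affine_distr A b T \<psi> = (if \<psi> \<in> schwartz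
     then T (\<lambda>y. \<psi> (matrix_inv A *v (y - b))) / of_real \<bar>det A\<bar> else 0)"

definition dil_shift :: "int^'d^'d \<Rightarrow> int \<Rightarrow> int^'d \<Rightarrow> (real^'d) distr \<Rightarrow> (real^'d) distr" where
  "dil_shift M j k g \<psi> = of_real (\<bar>real_of_int (det M)\<bar> powr (real_of_int j / 2)) *
     affine_distr (mat_powi (real_mat M) j) (real_vec k) g \<psi>"

text \<open>The sum in \<open>H\<^sup>s\<close> of the series over all of \<open>\<int>\<^sup>d\<close>: unconditional convergence is
  convergence of the net of finite partial sums.\<close>

definition quasi_proj ::
  "real \<Rightarrow> int^'d^'d \<Rightarrow> (real^'d) distr \<Rightarrow> (real^'d) distr \<Rightarrow> int \<Rightarrow> (real^'d) distr \<Rightarrow> (real^'d) distr" where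
  "quasi_proj s M \<phi> \<phi>' j f = (THE g. g \<in> sobolev s \<and>
     ((\<lambda>F. sobolev_norm s
        (\<lambda>\<psi>. g \<psi> - (\<Sum>k\<in>F. pairing f (dil_shift M j k \<phi>') * dil_shift M j k \<phi> \<psi>)))
      \<longlongrightarrow> 0) (finite_subsets_at_top (UNIV :: (int^'d) set)))"

definition simultaneous_approx_order ::
  "int^'d^'d \<Rightarrow> (real^'d) distr \<Rightarrow> (real^'d) distr \<Rightarrow> nat \<Rightarrow> real \<Rightarrow> bool" where
  "simultaneous_approx_order M \<phi> \<phi>' s n \<longleftrightarrow> (\<exists>C. \<forall>f\<in>sobolev n. \<forall>j::int.
     (\<Sum>r=0..s. inverse (op_norm (mat_powi (transpose (real_mat M)) j)) ^ r *
        sobolev_seminorm (real r) (\<lambda>\<psi>. f \<psi> - quasi_proj (real s) M \<phi> \<phi>' j f \<psi>))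
     \<le> C * op_norm (mat_powi (transpose (real_mat M)) (- j)) powr n * sobolev_seminorm n f)"

definition unit_cube :: "(real^'d) set" where
  "unit_cube = {\<xi>. \<forall>i. - 1/2 \<le> \<xi> $ i \<and> \<xi> $ i < 1/2}"

end

theory Submission
  imports Defs "HOL-Probability.Probability"
begin

text \<open>Cutting off near the support shows that the Fourier transform of a compactly supported
  distribution is reproduced by convolution with a Schwartz function; hence the symbols
  \<open>p = fhat \<phi>\<close> and \<open>q = fhat \<phi>'\<close> are continuous and their weighted square sums over
  \<open>\<xi> + \<int>\<^sup>d\<close> are bounded uniformly in \<open>\<xi>\<close>.

  Write \<open>B = M\<^sup>*\<^sup>j\<close> and \<open>F u = fhat f (B u)\<close>. Up to normalisation the coefficients
  \<open>\<langle>f, \<phi>'\<^sub>j\<^sub>k\<rangle>\<close> are the Fourier coefficients of the periodisation \<open>per F\<close> of \<open>F * cnj q\<close>, so the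
  \<open>L\<^sup>2\<close> theory of Fourier series identifies the Fourier transform of \<open>Q\<^sub>j f\<close> at \<open>B u\<close> with
  \<open>per F u * p u\<close>. The substitution \<open>\<xi> = B u\<close> then removes the dilation: the approximation order
  amounts to \<open>\<integral> |F - per F * p|\<^sup>2 (1 + |u|\<^sup>2)\<^sup>s \<le> K \<integral> |u|\<^sup>2\<^sup>n |F|\<^sup>2\<close> for all \<open>F\<close>.

  On each coset \<open>\<zeta> + \<int>\<^sup>d\<close> with \<open>\<zeta>\<close> in the cube this follows from the two conditions by splitting
  off the term of \<open>per F\<close> at the origin, the other points of the coset being at distance at least
  \<open>1/2\<close> from 0. Conversely, if \<open>F\<close> is the indicator of a subset of the cube, then
  \<open>per F = F * cnj q\<close> there, so the estimate yields both conditions almost everywhere on the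
  cube, and everywhere by continuity; near 0 the factor \<open>|q|\<^sup>2\<close> is bounded below because
  \<open>cnj q * p\<close> is close to 1.\<close>

section \<open>Schwartz functions\<close>

text \<open>The weights with exponents \<open>s\<close> and \<open>- s\<close> of the two symbols
  cancel in the Cauchy-Schwarz inequality on each coset. Bounded lattice sums and continuity are
  therefore what compact support has to deliver, and the locale \<open>symbol_pair\<close> records
  the bounds. The conditions of the theorem speak of point values, so a particular version of a
  transform is needed: \<open>fhat\<close> selects the continuous one, and the convolution formula
  is what shows that there is one. As \<open>quasi_proj\<close> is a definite description, the
  series must be shown to have a limit, and only one, before its transform can be computed.
  Unconditional convergence comes from best approximation: once a finite index set contains the
  frequencies of a good trigonometric polynomial, no larger set can do worse than that polynomial.
  One constant serves all \<open>j\<close> because each side scales correctly: \<open>|B u|\<close>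
  is at most the norm of \<open>B\<close> times \<open>|u|\<close>, which the negative power on the
  left absorbs, and \<open>|u|\<close> is at most the norm of the inverse of \<open>B\<close> times
  \<open>|B u|\<close>, which is the factor on the right. In the converse the choice
  \<open>j = 0\<close> makes \<open>B\<close> the identity.\<close>

definition pd :: "'a::euclidean_space \<Rightarrow> ('a \<Rightarrow> complex) \<Rightarrow> 'a \<Rightarrow> complex" where
  "pd b f x = frechet_derivative f (at x) b"

definition rapid :: "('a::real_normed_vector \<Rightarrow> complex) \<Rightarrow> bool" where
  "rapid f \<longleftrightarrow> (\<forall>N. \<exists>C. \<forall>x. (1 + norm x) ^ N * cmod (f x) \<le> C)"

definition slow :: "('a::real_normed_vector \<Rightarrow> complex) \<Rightarrow> bool" where
  "slow f \<longleftrightarrow> (\<exists>N C. \<forall>x. cmod (f x) \<le> C * (1 + norm x) ^ N)"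

lemma pd_eq: "(f has_derivative f') (at x) \<Longrightarrow> pd b f x = f' b"
  unfolding pd_def by (metis frechet_derivative_at)

lemma has_derivative_pd:
  "f differentiable (at x) \<Longrightarrow> (f has_derivative (\<lambda>h. pd h f x)) (at x)"
  unfolding pd_def by (simp add: frechet_derivative_works[symmetric])

text \<open>\<open>iter_deriv_Cons\<close> peels off the derivative taken last,
  \<open>iter_deriv_snoc\<close> the one taken first. The first keeps iterated derivatives inside a
  class closed under \<open>pd\<close>; the second shows that a derivative of a Schwartz function is
  again one.\<close>

lemma iter_deriv_Nil [simp]: "iter_deriv [] f = f"
  and iter_deriv_Cons: "iter_deriv (b # bs) f = pd b (iter_deriv bs f)"
  and iter_deriv_snoc: "iter_deriv (bs @ [b]) f = iter_deriv bs (pd b f)"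
  by (simp_all add: iter_deriv_def pd_def[abs_def])

lemma rapid_iff_bounded:
  "rapid f \<longleftrightarrow> (\<forall>N. bounded (range (\<lambda>x. (1 + norm x) ^ N *\<^sub>R f x)))"
  unfolding rapid_def bounded_iff by (simp add: abs_mult)

lemma rapidE:
  assumes "rapid f"
  obtains C where "C > 0" "\<And>x. (1 + norm x) ^ N * cmod (f x) \<le> C"
proof -
  obtain C where C: "\<And>x. (1 + norm x) ^ N * cmod (f x) \<le> C"
    using assms unfolding rapid_def by blast
  show thesis
    by (rule that[of "max C 1"]) (use C in \<open>auto simp: le_max_iff_disj\<close>)
qed

lemma rapid_bound:
  assumes "(1 + norm x) ^ N * a \<le> C"
  shows "a \<le> C / (1 + norm x) ^ N"
proof -
  have "(1 + norm x) ^ N > 0" by (intro zero_less_power add_pos_nonneg) auto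
  then show ?thesis using assms by (simp add: pos_le_divide_eq mult.commute)
qed

section \<open>Rapid decay under sums and under multipliers of polynomial growth\<close>

lemma rapid_add:
  assumes "rapid f" "rapid g" shows "rapid (\<lambda>x. f x + g x)"
  unfolding rapid_def
proof
  fix N
  obtain C where C: "\<And>x. (1 + norm x) ^ N * cmod (f x) \<le> C" using rapidE[OF assms(1)] by metis
  obtain D where D: "\<And>x. (1 + norm x) ^ N * cmod (g x) \<le> D" using rapidE[OF assms(2)] by metis
  have "(1 + norm x) ^ N * cmod (f x + g x) \<le> C + D" for x
  proof -
    have "(1 + norm x) ^ N * cmod (f x + g x) \<le> (1 + norm x) ^ N * (cmod (f x) + cmod (g x))"
      by (intro mult_left_mono norm_triangle_ineq) simp
    also have "\<dots> \<le> C + D" using C[of x] D[of x] by (simp add: distrib_left)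
    finally show ?thesis .
  qed
  then show "\<exists>C. \<forall>x. (1 + norm x) ^ N * cmod (f x + g x) \<le> C" by blast
qed

lemma rapid_slow_mult:
  assumes "slow p" "rapid f" shows "rapid (\<lambda>x. p x * f x)"
  unfolding rapid_def
proof
  fix N
  obtain M C where C: "\<And>x. cmod (p x) \<le> C * (1 + norm x) ^ M" using assms(1) unfolding slow_def by blast
  \<comment> \<open>The growth of \<open>p\<close> of degree \<open>M\<close> is paid for with
    \<open>M\<close> additional orders of decay of \<open>f\<close>.\<close>
  obtain D where D: "\<And>x. (1 + norm x) ^ (N + M) * cmod (f x) \<le> D" using rapidE[OF assms(2)] by metis
  have "(1 + norm x) ^ N * cmod (p x * f x) \<le> \<bar>C\<bar> * D" for x
  proof -
    have "cmod (p x) \<le> \<bar>C\<bar> * (1 + norm x) ^ M"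
      using C[of x] by (smt (verit) mult_right_mono norm_ge_zero zero_le_power)
    then have "(1 + norm x) ^ N * (cmod (p x) * cmod (f x)) \<le> (1 + norm x) ^ N * ((\<bar>C\<bar> * (1 + norm x) ^ M) * cmod (f x))"
      by (intro mult_left_mono mult_right_mono) auto
    also have "\<dots> = \<bar>C\<bar> * ((1 + norm x) ^ (N + M) * cmod (f x))" by (simp add: power_add)
    also have "\<dots> \<le> \<bar>C\<bar> * D" by (intro mult_left_mono D) auto
    finally show ?thesis by (simp add: norm_mult)
  qed
  then show "\<exists>C. \<forall>x. (1 + norm x) ^ N * cmod (p x * f x) \<le> C" by blast
qed

lemma slow_const: "slow (\<lambda>x. c)"
  unfolding slow_def by (rule exI[of _ 0], rule exI[of _ "cmod c"]) simp

lemma rapid_imp_slow: "rapid f \<Longrightarrow> slow f"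
  unfolding rapid_def slow_def
  by (rule exI[of _ 0]) (drule spec[of _ 0], simp)

lemma rapid_cmult: "rapid f \<Longrightarrow> rapid (\<lambda>x. c * f x)"
  by (rule rapid_slow_mult[OF slow_const])

lemma rapid_zero: "rapid (\<lambda>x. 0)"
  unfolding rapid_def by auto

lemma schwartz_rapid_iter: "f \<in> schwartz \<Longrightarrow> bs \<in> lists Basis \<Longrightarrow> rapid (iter_deriv bs f)"
  unfolding schwartz_def rapid_iff_bounded by blast

lemma schwartz_rapid: "f \<in> schwartz \<Longrightarrow> rapid f"
  using schwartz_rapid_iter[of f "[]"] by simp

lemma schwartz_differentiable: "f \<in> schwartz \<Longrightarrow> f differentiable (at x)"
  unfolding schwartz_def smooth_def
  by (drule CollectD, drule conjunct1, drule bspec[of _ _ "[]"]) auto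

lemma schwartz_pd:
  assumes "f \<in> schwartz" "b \<in> Basis" shows "pd b f \<in> schwartz"
  unfolding schwartz_def smooth_def mem_Collect_eq
proof (intro conjI ballI allI)
  fix bs x assume "bs \<in> lists (Basis :: 'a set)"
  then have "bs @ [b] \<in> lists Basis" using assms(2) by auto
  then have "iter_deriv (bs @ [b]) f differentiable (at x)"
    using assms(1) unfolding schwartz_def smooth_def by blast
  then show "iter_deriv bs (pd b f) differentiable (at x)" by (simp add: iter_deriv_snoc)
next
  fix N bs assume "bs \<in> lists (Basis :: 'a set)"
  then have "bs @ [b] \<in> lists Basis" using assms(2) by auto
  then show "bounded (range (\<lambda>x. (1 + norm x) ^ N *\<^sub>R iter_deriv bs (pd b f) x))"
    using assms(1) unfolding schwartz_def iter_deriv_snoc[symmetric] by blast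
qed

text \<open>Being Schwartz is a coinductive property: iterated derivatives never leave a class that
  is closed under \<open>pd\<close>, so decay and differentiability of the members suffice. This
  takes the place of an induction over multi-indices in each closure proof.\<close>

lemma schwartz_coinduct:
  assumes "f \<in> X" "\<And>f. f \<in> X \<Longrightarrow> rapid f" "\<And>f x. f \<in> X \<Longrightarrow> f differentiable (at x)"
    and "\<And>f b. f \<in> X \<Longrightarrow> b \<in> Basis \<Longrightarrow> pd b f \<in> X"
  shows "f \<in> schwartz"
proof -
  have *: "iter_deriv bs f \<in> X" if "bs \<in> lists Basis" for bs
    using that by (induction bs) (auto simp: iter_deriv_Cons assms)
  show ?thesis
    unfolding schwartz_def smooth_def using * assms(2,3) by (auto simp: rapid_iff_bounded)
qed

text \<open>Product and chain rule send a member of a class only to a sum of members, so the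
  coinduction has to work up to linear combinations. The rule \<open>zero\<close> supplies the empty
  sum in \<open>lin_sum\<close>.\<close>

inductive_set lin :: "('a \<Rightarrow> complex) set \<Rightarrow> ('a \<Rightarrow> complex) set" for X where
  base: "f \<in> X \<Longrightarrow> f \<in> lin X"
| zero: "(\<lambda>x. 0) \<in> lin X"
| add: "f \<in> lin X \<Longrightarrow> g \<in> lin X \<Longrightarrow> (\<lambda>x. f x + g x) \<in> lin X"
| scale: "f \<in> lin X \<Longrightarrow> (\<lambda>x. c * f x) \<in> lin X"

lemma lin_sum: "finite I \<Longrightarrow> (\<And>i. i \<in> I \<Longrightarrow> f i \<in> lin X) \<Longrightarrow> (\<lambda>x. \<Sum>i\<in>I. f i x) \<in> lin X"
  by (induction I rule: finite_induct) (auto intro: lin.intros)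

lemma pd_add:
  "f differentiable (at x) \<Longrightarrow> g differentiable (at x) \<Longrightarrow> pd b (\<lambda>x. f x + g x) x = pd b f x + pd b g x"
  by (rule pd_eq) (intro has_derivative_add has_derivative_pd)

lemma pd_cmult:
  "f differentiable (at x) \<Longrightarrow> pd b (\<lambda>x. c * f x) x = c * pd b f x"
  by (rule pd_eq) (intro has_derivative_mult_right has_derivative_pd)

lemma pd_mult:
  "f differentiable (at x) \<Longrightarrow> g differentiable (at x) \<Longrightarrow>
    pd b (\<lambda>x. f x * g x) x = pd b f x * g x + f x * pd b g x"
  by (subst pd_eq[OF has_derivative_mult[OF has_derivative_pd has_derivative_pd]]) auto

text \<open>Decay, differentiability and closure under \<open>pd\<close> all pass from
  \<open>X\<close> to \<open>lin X\<close> by linearity, so the plain coinduction applies to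
  \<open>lin X\<close>.\<close>

lemma schwartz_coinduct_lin:
  assumes "f \<in> X" "\<And>f. f \<in> X \<Longrightarrow> rapid f" "\<And>f x. f \<in> X \<Longrightarrow> f differentiable (at x)"
    and "\<And>f b. f \<in> X \<Longrightarrow> b \<in> Basis \<Longrightarrow> pd b f \<in> lin X"
  shows "f \<in> schwartz"
proof (rule schwartz_coinduct[of f "lin X"])
  show "f \<in> lin X" by (rule lin.base[OF assms(1)])
  show "rapid g" if "g \<in> lin X" for g
    using that by induction (auto intro: assms rapid_add rapid_cmult rapid_zero)
  show diff: "g differentiable (at x)" if "g \<in> lin X" for g x
    using that by (induction arbitrary: x) (auto intro: assms)
  show "pd b g \<in> lin X" if "g \<in> lin X" "b \<in> Basis" for g b
    using that(1)
  proof induction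
    case (base f)
    then show ?case using assms(4) that(2) by blast
  next
    case zero
    have "pd b (\<lambda>x. 0) = (\<lambda>x. 0)" by (rule ext, rule pd_eq) simp
    then show ?case by (simp add: lin.zero)
  next
    case (add f g)
    have "pd b (\<lambda>x. f x + g x) = (\<lambda>x. pd b f x + pd b g x)"
      by (rule ext, rule pd_add) (use add diff in auto)
    then show ?case using add lin.add by metis
  next
    case (scale f c)
    have "pd b (\<lambda>x. c * f x) = (\<lambda>x. c * pd b f x)"
      by (rule ext, rule pd_cmult) (use scale diff in auto)
    then show ?case using scale lin.scale by metis
  qed
qed

text \<open>The span of the Schwartz functions is itself a class as required by
  \<open>schwartz_coinduct\<close>. This yields closure under sums and scalar multiples in one
  stroke.\<close>

lemma schwartz_lin:
  assumes "f \<in> lin schwartz" shows "f \<in> schwartz"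
proof (rule schwartz_coinduct[of f "lin schwartz"])
  show "f \<in> lin schwartz" by fact
  show "rapid g" if "g \<in> lin schwartz" for g
    using that by induction (auto intro: schwartz_rapid rapid_add rapid_cmult rapid_zero)
  show diff: "g differentiable (at x)" if "g \<in> lin schwartz" for g and x :: 'a
    using that by (induction arbitrary: x) (auto intro: schwartz_differentiable)
  show "pd b g \<in> lin schwartz" if "g \<in> lin schwartz" "b \<in> Basis" for g and b :: 'a
    using that(1)
  proof induction
    case (base f)
    then show ?case using schwartz_pd that(2) by (blast intro: lin.base)
  next
    case zero
    have "pd b (\<lambda>x. 0) = (\<lambda>x. 0)" by (rule ext, rule pd_eq) simp
    then show ?case by (simp add: lin.zero)
  next
    case (add f g)
    have "pd b (\<lambda>x. f x + g x) = (\<lambda>x. pd b f x + pd b g x)"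
      by (rule ext, rule pd_add) (use add diff in auto)
    then show ?case using add lin.add by metis
  next
    case (scale f c)
    have "pd b (\<lambda>x. c * f x) = (\<lambda>x. c * pd b f x)"
      by (rule ext, rule pd_cmult) (use scale diff in auto)
    then show ?case using scale lin.scale by metis
  qed
qed

lemma schwartz_add: "f \<in> schwartz \<Longrightarrow> g \<in> schwartz \<Longrightarrow> (\<lambda>x. f x + g x) \<in> schwartz"
  by (rule schwartz_lin) (auto intro: lin.intros)

lemma schwartz_cmult: "f \<in> schwartz \<Longrightarrow> (\<lambda>x. c * f x) \<in> schwartz"
  by (rule schwartz_lin) (auto intro: lin.intros)

lemma schwartz_diff: "f \<in> schwartz \<Longrightarrow> g \<in> schwartz \<Longrightarrow> (\<lambda>x. f x - g x) \<in> schwartz"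
  using schwartz_add[of f "\<lambda>x. (-1) * g x"] schwartz_cmult[of g "-1"] by simp

text \<open>By the Leibniz rule, products of a multiplier in \<open>P\<close> with a Schwartz
  function reproduce themselves up to sums, provided that \<open>P\<close> is closed under
  \<open>pd\<close>. The instances are the Schwartz functions, affine functions and
  characters.\<close>

lemma schwartz_mult_class:
  assumes "p \<in> P" "f \<in> schwartz"
    and P: "\<And>p. p \<in> P \<Longrightarrow> slow p" "\<And>p x. p \<in> P \<Longrightarrow> p differentiable (at x)"
    "\<And>p b. p \<in> P \<Longrightarrow> b \<in> Basis \<Longrightarrow> pd b p \<in> P"
  shows "(\<lambda>x. p x * f x) \<in> schwartz"
proof (rule schwartz_coinduct_lin[where X="{\<lambda>x. p x * f x | p f. p \<in> P \<and> f \<in> schwartz}"])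
  show "(\<lambda>x. p x * f x) \<in> {\<lambda>x. p x * f x |p f. p \<in> P \<and> f \<in> schwartz}" using assms by blast
next
  fix g assume "g \<in> {\<lambda>x. p x * f x |p f. p \<in> P \<and> f \<in> schwartz}"
  then show "rapid g" using P rapid_slow_mult schwartz_rapid by blast
next
  fix g x assume "g \<in> {\<lambda>x. p x * f x |p f. p \<in> P \<and> f \<in> schwartz}"
  then show "g differentiable (at x)" using P(2) schwartz_differentiable differentiable_mult by blast
next
  fix g and b :: 'a assume "g \<in> {\<lambda>x. p x * f x |p f. p \<in> P \<and> f \<in> schwartz}" and b: "b \<in> Basis"
  then obtain p f where g: "g = (\<lambda>x. p x * f x)" "p \<in> P" "f \<in> schwartz" by blast
  have *: "pd b g = (\<lambda>x. pd b p x * f x + p x * pd b f x)"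
    unfolding g(1) by (rule ext, rule pd_mult) (use g P schwartz_differentiable in auto)
  show "pd b g \<in> lin {\<lambda>x. p x * f x |p f. p \<in> P \<and> f \<in> schwartz}"
    unfolding * by (rule lin.add; rule lin.base) (use g P(3)[OF _ b] schwartz_pd[OF _ b] in blast)+
qed

lemma schwartz_mult: "f \<in> schwartz \<Longrightarrow> g \<in> schwartz \<Longrightarrow> (\<lambda>x. f x * g x) \<in> schwartz"
  by (rule schwartz_mult_class[of f schwartz])
    (auto intro: rapid_imp_slow schwartz_rapid schwartz_differentiable schwartz_pd)

lemma schwartz_coord:
  fixes f :: "'a::euclidean_space \<Rightarrow> complex"
  assumes "f \<in> schwartz" shows "(\<lambda>x. of_real (x \<bullet> v) * f x) \<in> schwartz"
\<comment> \<open>The class consists of affine functions because the derivative of a linear one is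
  constant and must stay in the class.\<close>
proof (rule schwartz_mult_class[where P="{\<lambda>x. c + d * of_real (x \<bullet> v) | c d. True}"])
  show "(\<lambda>x. complex_of_real (x \<bullet> v)) \<in> {\<lambda>x. c + d * of_real (x \<bullet> v) | c d. True}"
    by (rule CollectI, rule exI[of _ 0], rule exI[of _ 1]) simp
next
  fix p :: "'a \<Rightarrow> complex" assume "p \<in> {\<lambda>x. c + d * of_real (x \<bullet> v) | c d. True}"
  then obtain c d where p: "p = (\<lambda>x. c + d * of_real (x \<bullet> v))" by blast
  have "cmod (p x) \<le> (cmod c + cmod d * norm v) * (1 + norm x) ^ 1" for x
  proof -
    have "cmod (p x) \<le> cmod c + cmod d * (norm x * norm v)"
      unfolding p by (rule order_trans[OF norm_triangle_ineq]) (auto simp: norm_mult Cauchy_Schwarz_ineq2 mult_left_mono)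
    also have "\<dots> \<le> cmod c + cmod d * (norm x * norm v) + (cmod c * norm x + cmod d * norm v)" by simp
    finally show ?thesis by (simp add: algebra_simps)
  qed
  then show "slow p" unfolding slow_def by blast
next
  fix p :: "'a \<Rightarrow> complex" and x assume "p \<in> {\<lambda>x. c + d * of_real (x \<bullet> v) | c d. True}"
  then show "p differentiable (at x)"
    by (elim CollectE exE conjE, hypsubst, intro differentiable_add differentiable_mult differentiable_const)
      (rule bounded_linear_imp_differentiable, rule bounded_linear_compose[OF bounded_linear_of_real], rule bounded_linear_inner_left)
next
  fix p :: "'a \<Rightarrow> complex" and b :: 'a assume "p \<in> {\<lambda>x. c + d * of_real (x \<bullet> v) | c d. True}"
  then obtain c d where p: "p = (\<lambda>x. c + d * of_real (x \<bullet> v))" by blast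
  have "pd b p = (\<lambda>x. d * of_real (b \<bullet> v) + 0 * of_real (x \<bullet> v))"
    unfolding p by (rule ext, subst pd_eq) (auto intro!: derivative_eq_intros)
  then show "pd b p \<in> {\<lambda>x. c + d * of_real (x \<bullet> v) | c d. True}" by blast
qed fact

lemma has_derivative_cis_inner:
  "((\<lambda>x. cis (x \<bullet> v)) has_derivative (\<lambda>h. of_real (h \<bullet> v) * (\<i> * cis (x \<bullet> v)))) (at x)"
proof -
  have "((\<lambda>x. \<i> * complex_of_real (x \<bullet> v)) has_derivative (\<lambda>h. \<i> * of_real (h \<bullet> v))) (at x)"
    by (intro has_derivative_mult_right bounded_linear.has_derivative[OF bounded_linear_of_real]
        bounded_linear_imp_has_derivative bounded_linear_inner_left)
  from has_derivative_compose[OF this DERIV_exp[unfolded has_field_derivative_def]] show ?thesis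
    unfolding cis_conv_exp by (rule has_derivative_eq_rhs) (simp add: fun_eq_iff)
qed

lemma schwartz_cis:
  fixes f :: "'a::euclidean_space \<Rightarrow> complex"
  assumes "f \<in> schwartz" shows "(\<lambda>x. cis (x \<bullet> v) * f x) \<in> schwartz"
proof (rule schwartz_mult_class[where P="{\<lambda>x. c * cis (x \<bullet> v) | c. True}"])
  show "(\<lambda>x. cis (x \<bullet> v)) \<in> {\<lambda>x. c * cis (x \<bullet> v) | c. True}"
    by (rule CollectI, rule exI[of _ 1]) simp
next
  fix p :: "'a \<Rightarrow> complex" assume "p \<in> {\<lambda>x. c * cis (x \<bullet> v) | c. True}"
  then obtain c where p: "p = (\<lambda>x. c * cis (x \<bullet> v))" by blast
  show "slow p" unfolding slow_def p
    by (rule exI[of _ 0], rule exI[of _ "cmod c"]) (simp add: norm_mult)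
next
  fix p :: "'a \<Rightarrow> complex" and x assume "p \<in> {\<lambda>x. c * cis (x \<bullet> v) | c. True}"
  then show "p differentiable (at x)"
    using differentiableI[OF has_derivative_mult_right[OF has_derivative_cis_inner]] by blast
next
  fix p :: "'a \<Rightarrow> complex" and b :: 'a assume "p \<in> {\<lambda>x. c * cis (x \<bullet> v) | c. True}"
  then obtain c where p: "p = (\<lambda>x. c * cis (x \<bullet> v))" by blast
  have "pd b p = (\<lambda>x. (c * of_real (b \<bullet> v) * \<i>) * cis (x \<bullet> v))"
    unfolding p by (rule ext, subst pd_eq) (auto intro!: derivative_eq_intros has_derivative_cis_inner simp: scaleR_conv_of_real mult_ac)
  then show "pd b p \<in> {\<lambda>x. c * cis (x \<bullet> v) | c. True}" by blast
qed fact

text \<open>The bound \<open>norm x \<le> c * norm (A x)\<close> turns decay of \<open>f\<close> in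
  \<open>A x\<close> into decay in \<open>x\<close>; it says that \<open>A\<close> is injective with
  bounded inverse on its range.\<close>

lemma schwartz_compose_linear:
  fixes f :: "'b::euclidean_space \<Rightarrow> complex" and A :: "'a::euclidean_space \<Rightarrow> 'b"
  assumes "f \<in> schwartz" "linear A" and A: "\<And>x. norm x \<le> c * norm (A x)"
  shows "(\<lambda>x. f (A x)) \<in> schwartz"
proof (rule schwartz_coinduct_lin[where X="{\<lambda>x. f (A x) | f. f \<in> schwartz}"])
  show "(\<lambda>x. f (A x)) \<in> {\<lambda>x. f (A x) | f. f \<in> schwartz}" using assms by blast
next
  fix g assume "g \<in> {\<lambda>x. f (A x) | f. f \<in> schwartz}"
  then obtain f where g: "g = (\<lambda>x. f (A x))" "f \<in> schwartz" by blast
  show "rapid g" unfolding rapid_def g(1)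
  proof
    fix N
    obtain D where D: "\<And>x. (1 + norm x) ^ N * cmod (f x) \<le> D"
      using rapidE[OF schwartz_rapid[OF g(2)]] by metis
    have "(1 + norm x) ^ N * cmod (f (A x)) \<le> (1 + \<bar>c\<bar>) ^ N * D" for x
    proof -
      have "norm x \<le> \<bar>c\<bar> * norm (A x)"
        using A[of x] by (smt (verit) mult_right_mono norm_ge_zero)
      then have "1 + norm x \<le> (1 + \<bar>c\<bar>) * (1 + norm (A x))"
        by (simp add: algebra_simps) (smt (verit) norm_ge_zero)
      then have "(1 + norm x) ^ N \<le> ((1 + \<bar>c\<bar>) * (1 + norm (A x))) ^ N"
        by (intro power_mono) auto
      then have "(1 + norm x) ^ N * cmod (f (A x)) \<le> (1 + \<bar>c\<bar>) ^ N * ((1 + norm (A x)) ^ N * cmod (f (A x)))"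
        unfolding power_mult_distrib mult.assoc[symmetric] by (intro mult_right_mono) auto
      also have "\<dots> \<le> (1 + \<bar>c\<bar>) ^ N * D" by (intro mult_left_mono D) auto
      finally show ?thesis .
    qed
    then show "\<exists>C. \<forall>x. (1 + norm x) ^ N * cmod (f (A x)) \<le> C" by blast
  qed
next
  fix g x assume "g \<in> {\<lambda>x. f (A x) | f. f \<in> schwartz}"
  then show "g differentiable (at x)"
    using differentiable_chain_at[of A x] schwartz_differentiable linear_imp_differentiable[OF assms(2)]
    by (auto simp: o_def)
next
  fix g and b :: 'a assume "g \<in> {\<lambda>x. f (A x) | f. f \<in> schwartz}" and b: "b \<in> Basis"
  then obtain f where g: "g = (\<lambda>x. f (A x))" "f \<in> schwartz" by blast
  \<comment> \<open>Expanding \<open>A b\<close> in the basis rewrites the derivative with partial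
    derivatives of \<open>f\<close>, each of which is again a Schwartz function composed with
    \<open>A\<close>.\<close>
  have *: "pd b g x = (\<Sum>e\<in>Basis. of_real (A b \<bullet> e) * pd e f (A x))" for x
  proof -
    have d: "(f has_derivative (\<lambda>h. pd h f (A x))) (at (A x))"
      by (rule has_derivative_pd[OF schwartz_differentiable[OF g(2)]])
    have "((f \<circ> A) has_derivative ((\<lambda>h. pd h f (A x)) \<circ> A)) (at x)"
      by (rule diff_chain_at[OF linear_imp_has_derivative[OF assms(2)] d])
    then have "pd b g x = pd (A b) f (A x)"
      unfolding g(1) by (subst pd_eq) (auto simp: o_def)
    also have "\<dots> = pd (\<Sum>e\<in>Basis. (A b \<bullet> e) *\<^sub>R e) f (A x)" by (simp add: euclidean_representation)
    also have "\<dots> = (\<Sum>e\<in>Basis. (A b \<bullet> e) *\<^sub>R pd e f (A x))"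
      by (simp add: linear_sum[OF has_derivative_linear[OF d]] linear_scale[OF has_derivative_linear[OF d]])
    finally show ?thesis by (simp add: scaleR_conv_of_real)
  qed
  have "(\<lambda>x. \<Sum>e\<in>Basis. of_real (A b \<bullet> e) * pd e f (A x)) \<in> lin {\<lambda>x. f (A x) | f. f \<in> schwartz}"
    by (intro lin_sum lin.scale lin.base) (use g schwartz_pd in auto)
  then show "pd b g \<in> lin {\<lambda>x. f (A x) | f. f \<in> schwartz}" using * by presburger
qed

lemma schwartz_reflect: "f \<in> schwartz \<Longrightarrow> (\<lambda>x. f (- x)) \<in> schwartz"
  by (rule schwartz_compose_linear[of f uminus 1]) (auto simp: linear_iff)

lemma schwartz_translate:
  fixes f :: "'a::euclidean_space \<Rightarrow> complex"
  assumes "f \<in> schwartz" shows "(\<lambda>x. f (x + a)) \<in> schwartz"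
proof (rule schwartz_coinduct[where X="{\<lambda>x. f (x + a) | f. f \<in> schwartz}"])
  show "(\<lambda>x. f (x + a)) \<in> {\<lambda>x. f (x + a) | f. f \<in> schwartz}" using assms by blast
next
  fix g assume "g \<in> {\<lambda>x. f (x + a) | f. f \<in> schwartz}"
  then obtain f where g: "g = (\<lambda>x. f (x + a))" "f \<in> schwartz" by blast
  show "rapid g" unfolding rapid_def g(1)
  proof
    fix N
    obtain D where D: "\<And>x. (1 + norm x) ^ N * cmod (f x) \<le> D"
      using rapidE[OF schwartz_rapid[OF g(2)]] by metis
    have "(1 + norm x) ^ N * cmod (f (x + a)) \<le> (1 + norm a) ^ N * D" for x
    proof -
      have "norm x \<le> norm (x + a) + norm a" using norm_triangle_ineq4[of "x + a" a] by simp
      then have "1 + norm x \<le> (1 + norm a) * (1 + norm (x + a))"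
        by (simp add: algebra_simps) (smt (verit) norm_ge_zero mult_nonneg_nonneg)
      then have "(1 + norm x) ^ N \<le> ((1 + norm a) * (1 + norm (x + a))) ^ N"
        by (intro power_mono) auto
      then have "(1 + norm x) ^ N * cmod (f (x + a)) \<le> (1 + norm a) ^ N * ((1 + norm (x + a)) ^ N * cmod (f (x + a)))"
        unfolding power_mult_distrib mult.assoc[symmetric] by (intro mult_right_mono) auto
      also have "\<dots> \<le> (1 + norm a) ^ N * D" by (intro mult_left_mono D) auto
      finally show ?thesis .
    qed
    then show "\<exists>C. \<forall>x. (1 + norm x) ^ N * cmod (f (x + a)) \<le> C" by blast
  qed
next
  fix g x assume "g \<in> {\<lambda>x. f (x + a) | f. f \<in> schwartz}"
  then show "g differentiable (at x)"
    using differentiable_chain_at[of "\<lambda>x. x + a" x] schwartz_differentiable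
    by (auto simp: o_def)
next
  fix g and b :: 'a assume "g \<in> {\<lambda>x. f (x + a) | f. f \<in> schwartz}" and b: "b \<in> Basis"
  then obtain f where g: "g = (\<lambda>x. f (x + a))" "f \<in> schwartz" by blast
  have "pd b g x = pd b f (x + a)" for x
  proof -
    have d: "(f has_derivative (\<lambda>h. pd h f (x + a))) (at (x + a))"
      by (rule has_derivative_pd[OF schwartz_differentiable[OF g(2)]])
    have "((\<lambda>x. x + a) has_derivative (\<lambda>h. h)) (at x)" by (auto intro!: derivative_eq_intros)
    from diff_chain_at[OF this d] show ?thesis
      unfolding g(1) by (subst pd_eq) (auto simp: o_def)
  qed
  then have "pd b g = (\<lambda>x. pd b f (x + a))" by blast
  then show "pd b g \<in> {\<lambda>x. f (x + a) | f. f \<in> schwartz}" using schwartz_pd[OF g(2) b] by blast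
qed

lemma schwartz_continuous: "f \<in> schwartz \<Longrightarrow> continuous_on UNIV f"
  by (simp add: continuous_at_imp_continuous_on differentiable_imp_continuous_within schwartz_differentiable)

lemma schwartz_measurable: "f \<in> schwartz \<Longrightarrow> f \<in> borel_measurable borel"
  by (intro borel_measurable_continuous_onI schwartz_continuous)

section \<open>Bump functions\<close>

text \<open>Infinite differentiability in one real variable, read as a greatest fixed point: there
  is a derivative, and it has the property again.\<close>

coinductive sm :: "(real \<Rightarrow> real) \<Rightarrow> bool" where
  "(\<And>x. (f has_real_derivative f' x) (at x)) \<Longrightarrow> sm f' \<Longrightarrow> sm f"

lemma smE:
  assumes "sm f" obtains f' where "\<And>x. (f has_real_derivative f' x) (at x)" "sm f'"
  using assms by (cases rule: sm.cases) blast

lemma sm_coinduct: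
  assumes "X f" "\<And>f. X f \<Longrightarrow> \<exists>f'. (\<forall>x. (f has_real_derivative f' x) (at x)) \<and> X f'"
  shows "sm f"
  using assms(1)
proof (coinduction arbitrary: f rule: sm.coinduct)
  case (sm f)
  then show ?case using assms(2)[OF sm] by blast
qed

text \<open>The factor \<open>c\<close> belongs to the invariant because the chain rule multiplies
  it by \<open>a\<close> at each step.\<close>

lemma sm_affine:
  assumes "sm f" shows "sm (\<lambda>t. c * f (a * t + b))"
proof (rule sm_coinduct[where X="\<lambda>g. \<exists>c f. g = (\<lambda>t. c * f (a * t + b)) \<and> sm f"])
  show "\<exists>d g. (\<lambda>t. c * f (a * t + b)) = (\<lambda>t. d * g (a * t + b)) \<and> sm g" using assms by blast
next
  fix g assume "\<exists>c f. g = (\<lambda>t. c * f (a * t + b)) \<and> sm f"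
  then obtain c f where g: "g = (\<lambda>t. c * f (a * t + b))" "sm f" by blast
  obtain f' where f': "\<And>x. (f has_real_derivative f' x) (at x)" "sm f'" using g(2) by (rule smE) blast
  have "(g has_real_derivative (c * a) * f' (a * t + b)) (at t)" for t
    unfolding g(1) by (rule derivative_eq_intros DERIV_chain2[OF f'(1)] refl | simp)+
  then show "\<exists>f'. (\<forall>x. (g has_real_derivative f' x) (at x)) \<and> (\<exists>c f. f' = (\<lambda>t. c * f (a * t + b)) \<and> sm f)"
    using f'(2) by (intro exI[of _ "\<lambda>t. (c * a) * f' (a * t + b)"]) blast
qed

text \<open>Products of smooth functions are not closed under differentiation, but sums of such
  products are; this is the invariant for the coinduction that proves \<open>sm_mult\<close> and
  \<open>sm_add\<close>.\<close>

inductive sm_sum :: "(real \<Rightarrow> real) \<Rightarrow> bool" where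
  mult: "sm f \<Longrightarrow> sm g \<Longrightarrow> sm_sum (\<lambda>x. f x * g x)"
| add: "sm_sum f \<Longrightarrow> sm_sum g \<Longrightarrow> sm_sum (\<lambda>x. f x + g x)"

lemma sm_sum_imp_sm:
  assumes "sm_sum f" shows "sm f"
proof (rule sm_coinduct[where X=sm_sum, OF assms])
  fix f assume "sm_sum f"
  then show "\<exists>f'. (\<forall>x. (f has_real_derivative f' x) (at x)) \<and> sm_sum f'"
  proof induction
    case (mult f g)
    obtain f' where f': "\<And>x. (f has_real_derivative f' x) (at x)" "sm f'" using mult(1) by (rule smE) blast
    obtain g' where g': "\<And>x. (g has_real_derivative g' x) (at x)" "sm g'" using mult(2) by (rule smE) blast
    have "((\<lambda>x. f x * g x) has_real_derivative f' x * g x + g' x * f x) (at x)" for x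
      by (rule DERIV_mult[OF f'(1) g'(1)])
    moreover have "sm_sum (\<lambda>x. f' x * g x + g' x * f x)"
      by (rule sm_sum.add; rule sm_sum.mult) (use mult f' g' in auto)
    ultimately show ?case by (intro exI[of _ "\<lambda>x. f' x * g x + g' x * f x"]) simp
  next
    case (add f g)
    then obtain f' g' where "\<forall>x. (f has_real_derivative f' x) (at x)" "sm_sum f'"
      "\<forall>x. (g has_real_derivative g' x) (at x)" "sm_sum g'" by blast
    then have "(\<forall>x. ((\<lambda>x. f x + g x) has_real_derivative f' x + g' x) (at x)) \<and> sm_sum (\<lambda>x. f' x + g' x)"
      by (auto intro: DERIV_add sm_sum.add)
    then show ?case by (rule exI[of _ "\<lambda>x. f' x + g' x"])
  qed
qed

lemma sm_const: "sm (\<lambda>x. c)"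
proof (rule sm_coinduct[where X="\<lambda>f. \<exists>c. f = (\<lambda>x. c)"])
  fix f :: "real \<Rightarrow> real" assume "\<exists>c. f = (\<lambda>x. c)"
  then show "\<exists>f'. (\<forall>x. (f has_real_derivative f' x) (at x)) \<and> (\<exists>c. f' = (\<lambda>x. c))"
    by (intro exI[of _ "\<lambda>x. 0"]) auto
qed blast

lemma sm_mult: "sm f \<Longrightarrow> sm g \<Longrightarrow> sm (\<lambda>x. f x * g x)"
  by (rule sm_sum_imp_sm) (rule sm_sum.mult)

lemma sm_add:
  assumes "sm f" "sm g" shows "sm (\<lambda>x. f x + g x)"
  \<comment> \<open>A sum is a sum of products with the constant factor 1.\<close>
  using sm_sum_imp_sm[OF sm_sum.add[OF sm_sum.mult[OF assms(1) sm_const[of 1]] sm_sum.mult[OF assms(2) sm_const[of 1]]]] by simp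

text \<open>The classical flat function \<open>exp (- 1 / t)\<close>, with a polynomial in
  \<open>1 / t\<close> as a factor so that the family is closed under differentiation: the
  derivative has the polynomial \<open>x^2 (p - p')\<close> instead of \<open>p\<close>, which is
  \<open>pCons 0 (pCons 0 (p - pderiv p))\<close>.\<close>

definition flat :: "real poly \<Rightarrow> real \<Rightarrow> real" where
  "flat p t = (if t \<le> 0 then 0 else poly p (1 / t) * exp (- (1 / t)))"

lemma poly_exp_tendsto_0: "((\<lambda>y. poly p y * exp (- y)) \<longlongrightarrow> (0::real)) at_top"
proof -
  have "((\<lambda>y. \<Sum>i\<le>degree p. coeff p i * (y ^ i / exp y)) \<longlongrightarrow> (\<Sum>i\<le>degree p. coeff p i * 0)) at_top"
    by (intro tendsto_sum tendsto_mult tendsto_const tendsto_power_div_exp_0)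
  then show ?thesis
    by (simp add: poly_altdef sum_distrib_right exp_minus divide_inverse mult.assoc)
qed

lemma flat_DERIV: "(flat p has_real_derivative flat (pCons 0 (pCons 0 (p - pderiv p))) t) (at t)"
proof -
  consider "t < 0" | "t > 0" | "t = 0" by linarith
  then show ?thesis
  proof cases
    case 1
    have "((\<lambda>t. 0) has_real_derivative 0) (at t)" by simp
    then have "(flat p has_real_derivative 0) (at t)"
      by (rule has_field_derivative_transform_within_open[where S="{..<0}"]) (use 1 in \<open>auto simp: flat_def\<close>)
    then show ?thesis using 1 by (simp add: flat_def)
  next
    case 2
    have "((\<lambda>t. poly p (1 / t) * exp (- (1 / t))) has_real_derivative
        (poly (pderiv p) (1 / t) * (- 1 / (t * t))) * exp (- (1 / t)) + (exp (- (1 / t)) * (1 / (t * t))) * poly p (1 / t)) (at t)"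
      by (rule DERIV_mult[OF DERIV_chain2[OF poly_DERIV]])
        (use 2 in \<open>auto intro!: derivative_eq_intros simp: field_simps\<close>)
    then have "(flat p has_real_derivative
        (poly (pderiv p) (1 / t) * (- 1 / (t * t))) * exp (- (1 / t)) + (exp (- (1 / t)) * (1 / (t * t))) * poly p (1 / t)) (at t)"
      by (rule has_field_derivative_transform_within_open[where S="{0<..}"]) (use 2 in \<open>auto simp: flat_def\<close>)
    then show ?thesis
      by (rule DERIV_cong) (use 2 in \<open>simp add: flat_def field_simps\<close>)
  next
    case 3
    \<comment> \<open>With \<open>y = 1 / h\<close> the quotient is a polynomial in \<open>y\<close>
      times \<open>exp (- y)\<close>, which tends to 0 at infinity.\<close>
    have "((\<lambda>h. flat p h / h) \<longlongrightarrow> 0) (at_right 0)"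
    proof (rule Lim_transform_eventually)
      show "((\<lambda>h. poly (pCons 0 p) (inverse h) * exp (- inverse h)) \<longlongrightarrow> 0) (at_right 0)"
        by (rule filterlim_compose[OF poly_exp_tendsto_0 filterlim_inverse_at_top_right])
      show "\<forall>\<^sub>F h in at_right 0. poly (pCons 0 p) (inverse h) * exp (- inverse h) = flat p h / h"
        unfolding eventually_at_filter by (auto simp: flat_def field_simps)
    qed
    moreover have "((\<lambda>h. flat p h / h) \<longlongrightarrow> 0) (at_left 0)"
    proof (rule Lim_transform_eventually)
      show "((\<lambda>h. 0 :: real) \<longlongrightarrow> 0) (at_left 0)" by simp
      show "\<forall>\<^sub>F h in at_left (0::real). 0 = flat p h / h"
        unfolding eventually_at_filter by (auto simp: flat_def)
    qed
    ultimately have "((\<lambda>h. flat p h / h) \<longlongrightarrow> 0) (at 0)" by (rule filterlim_split_at[rotated])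
    then show ?thesis unfolding DERIV_def 3 by (simp add: flat_def)
  qed
qed

lemma sm_flat: "sm (flat p)"
proof (coinduction arbitrary: p rule: sm.coinduct)
  case sm
  show ?case using flat_DERIV by blast
qed

text \<open>The step is the normalised antiderivative of a smooth \<open>k\<close> that is positive
  on (0,1) and zero elsewhere. Monotonicity and the two constant pieces follow from the sign and the
  zeros of \<open>k\<close>.\<close>

lemma smooth_step_exists:
  "\<exists>\<tau>. sm \<tau> \<and> mono \<tau> \<and> (\<forall>t\<le>0. \<tau> t = 0) \<and> (\<forall>t\<ge>1. \<tau> t = (1::real))"
proof -
  \<comment> \<open>The factors \<open>1\<close> and \<open>-1\<close> are spelled out so that the
    term has the shape of \<open>sm_affine\<close>; the same holds for \<open>\<tau>\<close>
    below.\<close>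
  define k where "k t = flat 1 t * (1 * flat 1 ((-1) * t + 1))" for t :: real
  have smk: "sm k" unfolding k_def by (intro sm_mult sm_flat sm_affine)
  then obtain k' where k': "\<And>x. (k has_real_derivative k' x) (at x)" by (rule smE) blast
  have k0: "k t \<ge> 0" for t by (simp add: k_def flat_def)
  have kp: "k t > 0" if "0 < t" "t < 1" for t using that by (simp add: k_def flat_def)
  have kz: "k t = 0" if "t \<le> 0 \<or> t \<ge> 1" for t using that by (auto simp: k_def flat_def)
  obtain F where F: "\<And>x. (F has_vector_derivative k x) (at x)"
  proof -
    have "\<exists>F. \<forall>x. -\<infinity> < ereal x \<longrightarrow> ereal x < \<infinity> \<longrightarrow> (F has_vector_derivative k x) (at x)"
      by (rule einterval_antiderivative) (use k' DERIV_isCont in auto)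
    then show thesis using that by auto
  qed
  then have F': "(F has_real_derivative k x) (at x)" for x
    by (simp add: has_real_derivative_iff_has_vector_derivative)
  have monoF: "F x \<le> F y" if "x \<le> y" for x y
    by (rule DERIV_nonneg_imp_nondecreasing[OF that]) (use F' k0 in blast)
  have F_const0: "F t = F 0" if "t \<le> 0" for t
  proof (rule antisym[OF monoF[OF that]])
    show "F 0 \<le> F t"
    proof (rule DERIV_nonpos_imp_nonincreasing[OF that])
      fix x assume "t \<le> x" "x \<le> 0"
      then show "\<exists>y. (F has_real_derivative y) (at x) \<and> y \<le> 0" using F'[of x] kz[of x] by auto
    qed
  qed
  have F_const1: "F t = F 1" if "1 \<le> t" for t
  proof (rule antisym[OF _ monoF[OF that]])
    show "F t \<le> F 1"
    proof (rule DERIV_nonpos_imp_nonincreasing[OF that])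
      fix x assume "1 \<le> x" "x \<le> t"
      then show "\<exists>y. (F has_real_derivative y) (at x) \<and> y \<le> 0" using F'[of x] kz[of x] by auto
    qed
  qed
  have lt: "F 0 < F 1"
  proof -
    obtain z where "0 < z" "z < 1" "F 1 - F 0 = (1 - 0) * k z"
      using MVT2[of 0 1 F k] F' by auto
    then show ?thesis using kp[of z] by simp
  qed
  have smF: "sm F" by (rule sm.intros[OF F' smk])
  define \<tau> where "\<tau> t = 1 / (F 1 - F 0) * F (1 * t + 0) + (- F 0 / (F 1 - F 0))" for t
  have \<tau>: "\<tau> t = (F t - F 0) / (F 1 - F 0)" for t by (simp add: \<tau>_def diff_divide_distrib)
  have "sm \<tau>" unfolding \<tau>_def by (intro sm_add sm_affine smF sm_const)
  moreover have "mono \<tau>"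
  proof (rule monoI)
    fix x y :: real assume "x \<le> y"
    then show "\<tau> x \<le> \<tau> y" unfolding \<tau> by (intro divide_right_mono diff_right_mono monoF) (use lt in auto)
  qed
  moreover have "\<tau> t = 0" if "t \<le> 0" for t unfolding \<tau> F_const0[OF that] by simp
  moreover have "\<tau> t = 1" if "1 \<le> t" for t unfolding \<tau> F_const1[OF that] using lt by simp
  ultimately show ?thesis by blast
qed

text \<open>Two shifted steps are subtracted: the first rises over \<open>[a - e, a]\<close>, the
  second over \<open>[b, b + e]\<close>. The difference is nonnegative because the step is
  monotone.\<close>

lemma plateau_exists:
  assumes "a \<le> b" "e > 0"
  shows "\<exists>f. sm f \<and> (\<forall>t. 0 \<le> f t \<and> f t \<le> 1) \<and> (\<forall>t\<in>{a..b}. f t = 1) \<and> (\<forall>t. t \<notin> {a - e..b + e} \<longrightarrow> f t = (0::real))"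
proof -
  obtain \<tau> where \<tau>: "sm \<tau>" "mono \<tau>" "\<And>t. t \<le> 0 \<Longrightarrow> \<tau> t = 0" "\<And>t. t \<ge> 1 \<Longrightarrow> \<tau> t = (1::real)"
    using smooth_step_exists by blast
  define f where "f t = 1 * \<tau> ((1 / e) * t + (1 - a / e)) + (-1) * \<tau> ((1 / e) * t + (- b / e))" for t
  have f: "f t = \<tau> ((t - a) / e + 1) - \<tau> ((t - b) / e)" for t
    by (simp add: f_def diff_divide_distrib algebra_simps)
  have r: "0 \<le> \<tau> t" "\<tau> t \<le> 1" for t
    using monoD[OF \<tau>(2), of "min t 0" t] monoD[OF \<tau>(2), of t "max t 1"] \<tau>(3)[of "min t 0"] \<tau>(4)[of "max t 1"] by auto
  have le: "(t - b) / e \<le> (t - a) / e + 1" for t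
    using divide_right_mono[of "t - b" "t - a" e] assms by auto
  have "sm f" unfolding f_def by (intro sm_add sm_affine \<tau>)
  moreover have "0 \<le> f t" for t unfolding f using monoD[OF \<tau>(2) le[of t]] by simp
  moreover have "f t \<le> 1" for t unfolding f using r[of "(t - a) / e + 1"] r[of "(t - b) / e"] by simp
  moreover have "f t = 1" if "t \<in> {a..b}" for t
    unfolding f using that assms by (simp add: \<tau> divide_le_0_iff)
  moreover have "f t = 0" if "t \<notin> {a - e..b + e}" for t
  proof (cases "t < a - e")
    case True
    then have "(t - a) / e + 1 \<le> 0" using assms by (simp add: field_simps)
    then show ?thesis using le[of t] by (simp add: f \<tau>)
  next
    case False
    then have "1 \<le> (t - b) / e" using that assms by (simp add: field_simps)
    then show ?thesis using le[of t] by (simp add: f \<tau>)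
  qed
  ultimately show ?thesis by blast
qed

lemma compact_support_rapid:
  fixes f :: "'a::euclidean_space \<Rightarrow> complex"
  assumes "continuous_on UNIV f" "compact K" "\<And>x. x \<notin> K \<Longrightarrow> f x = 0"
  shows "rapid f"
  unfolding rapid_def
proof
  fix N
  have "compact ((\<lambda>x. (1 + norm x) ^ N * cmod (f x)) ` K)"
    by (rule compact_continuous_image[OF continuous_on_subset[OF _ subset_UNIV] assms(2)])
      (intro continuous_intros assms(1))
  then have "bounded ((\<lambda>x. (1 + norm x) ^ N * cmod (f x)) ` K)" by (rule compact_imp_bounded)
  then obtain B where "\<forall>y\<in>(\<lambda>x. (1 + norm x) ^ N * cmod (f x)) ` K. norm y \<le> B"
    unfolding bounded_iff by blast
  then have B: "norm ((1 + norm x) ^ N * cmod (f x)) \<le> B" if "x \<in> K" for x using that by blast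
  have "(1 + norm x) ^ N * cmod (f x) \<le> \<bar>B\<bar>" for x
  proof (cases "x \<in> K")
    case True
    show ?thesis using B[OF True] by (simp add: abs_mult)
  next
    case False
    show ?thesis using assms(3)[OF False] by simp
  qed
  then show "\<exists>C. \<forall>x. (1 + norm x) ^ N * cmod (f x) \<le> C" by blast
qed

text \<open>Tensor products of smooth one-dimensional factors with bounded support form a class
  closed under \<open>pd\<close>, because a partial derivative affects one factor only. Rapid decay
  is then free, by compactness of the box.\<close>

lemma schwartz_prod:
  fixes K :: "'a::euclidean_space \<Rightarrow> real \<Rightarrow> real"
  assumes "\<And>i. i \<in> Basis \<Longrightarrow> sm (K i)" "\<And>i t. i \<in> Basis \<Longrightarrow> t \<notin> {l \<bullet> i..u \<bullet> i} \<Longrightarrow> K i t = 0"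
  shows "(\<lambda>x. of_real (\<Prod>i\<in>Basis. K i (x \<bullet> i))) \<in> schwartz"
proof -
  define good where "good K \<longleftrightarrow> (\<forall>i\<in>Basis. sm (K i) \<and> (\<forall>t. t \<notin> {l \<bullet> i..u \<bullet> i} \<longrightarrow> K i t = 0))"
    for K :: "'a \<Rightarrow> real \<Rightarrow> real"
  define P :: "('a \<Rightarrow> real \<Rightarrow> real) \<Rightarrow> 'a \<Rightarrow> complex" where "P K = (\<lambda>x. of_real (\<Prod>i\<in>Basis. K i (x \<bullet> i)))" for K
  have deriv: "\<exists>K'. (\<forall>x. (P K has_derivative (\<lambda>h. of_real (\<Sum>i\<in>Basis. (K' i (x \<bullet> i) * (h \<bullet> i)) * (\<Prod>j\<in>Basis - {i}. K j (x \<bullet> j))))) (at x)) \<and> good K'"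
    if g: "good K" for K
  proof -
    have "\<exists>f'. (\<forall>x. (K i has_real_derivative f' x) (at x)) \<and> sm f'" if "i \<in> Basis" for i
      using g that unfolding good_def by (meson smE)
    then obtain K' where K': "\<And>i x. i \<in> Basis \<Longrightarrow> (K i has_real_derivative K' i x) (at x)" "\<And>i. i \<in> Basis \<Longrightarrow> sm (K' i)"
      by metis
    have "K' i t = 0" if "i \<in> Basis" "t \<notin> {l \<bullet> i..u \<bullet> i}" for i t
    proof -
      \<comment> \<open>The complement of the closed interval is open, so the factor vanishes near
        \<open>t\<close> and its derivative vanishes at \<open>t\<close>.\<close>
      have "((\<lambda>t. 0) has_real_derivative 0) (at t)" by simp
      then have "(K i has_real_derivative 0) (at t)"
        by (rule has_field_derivative_transform_within_open[where S="- {l \<bullet> i..u \<bullet> i}"])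
          (use that g in \<open>auto simp: good_def\<close>)
      then show ?thesis using DERIV_unique K'(1)[OF that(1)] by blast
    qed
    then have "good K'" using K' by (auto simp: good_def)
    moreover have "(P K has_derivative (\<lambda>h. of_real (\<Sum>i\<in>Basis. (K' i (x \<bullet> i) * (h \<bullet> i)) * (\<Prod>j\<in>Basis - {i}. K j (x \<bullet> j))))) (at x)" for x
      unfolding P_def
    proof (intro bounded_linear.has_derivative[OF bounded_linear_of_real] has_derivative_prod)
      fix i :: 'a assume "i \<in> Basis"
      have "((\<lambda>x. x \<bullet> i) has_derivative (\<lambda>h. h \<bullet> i)) (at x)"
        by (intro bounded_linear_imp_has_derivative bounded_linear_inner_left)
      from has_derivative_compose[OF this K'(1)[OF \<open>i \<in> Basis\<close>, unfolded has_field_derivative_def]]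
      show "((\<lambda>x. K i (x \<bullet> i)) has_derivative (\<lambda>h. K' i (x \<bullet> i) * (h \<bullet> i))) (at x)" .
    qed
    ultimately show ?thesis by blast
  qed
  have "P K \<in> schwartz" if "good K" for K
  proof (rule schwartz_coinduct[where X="{P K | K. good K}"])
    show "P K \<in> {P K | K. good K}" using that by blast
  next
    show diff: "f differentiable (at x)" if "f \<in> {P K | K. good K}" for f x
      using that deriv differentiableI by blast
    show "rapid f" if "f \<in> {P K | K. good K}" for f
    proof (rule compact_support_rapid[of _ "cbox l u"])
      show "continuous_on UNIV f"
        using diff[OF that] by (simp add: continuous_at_imp_continuous_on differentiable_imp_continuous_within)
      show "f x = 0" if "x \<notin> cbox l u" for x
      proof -
        obtain K where K: "f = P K" "good K" using \<open>f \<in> _\<close> by blast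
        obtain i where "i \<in> Basis" "x \<bullet> i \<notin> {l \<bullet> i..u \<bullet> i}"
          using \<open>x \<notin> cbox l u\<close> unfolding mem_box atLeastAtMost_iff by blast
        then show ?thesis using K by (auto simp: P_def good_def intro!: prod_zero)
      qed
    qed simp
    show "pd b f \<in> {P K | K. good K}" if f: "f \<in> {P K | K. good K}" and b: "b \<in> Basis" for f b
    proof -
      obtain K where K: "f = P K" "good K" using f by blast
      obtain K' where K': "\<And>x. (P K has_derivative (\<lambda>h. of_real (\<Sum>i\<in>Basis. (K' i (x \<bullet> i) * (h \<bullet> i)) * (\<Prod>j\<in>Basis - {i}. K j (x \<bullet> j))))) (at x)" "good K'"
        using deriv[OF K(2)] by blast
      \<comment> \<open>In the direction of a basis vector \<open>b\<close> all inner products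
        \<open>b \<bullet> i\<close> with \<open>i \<noteq> b\<close> are zero, which leaves a
        single summand of the product rule.\<close>
      have "pd b f x = P (K(b := K' b)) x" for x
      proof -
        have "pd b f x = of_real (\<Sum>i\<in>Basis. (K' i (x \<bullet> i) * (b \<bullet> i)) * (\<Prod>j\<in>Basis - {i}. K j (x \<bullet> j)))"
          unfolding K(1) by (rule pd_eq[OF K'(1)])
        also have "(\<Sum>i\<in>Basis. (K' i (x \<bullet> i) * (b \<bullet> i)) * (\<Prod>j\<in>Basis - {i}. K j (x \<bullet> j))) =
            (\<Sum>i\<in>Basis. if i = b then K' b (x \<bullet> b) * (\<Prod>j\<in>Basis - {b}. K j (x \<bullet> j)) else 0)"
          by (rule sum.cong) (use b in \<open>auto simp: inner_Basis\<close>)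
        also have "\<dots> = K' b (x \<bullet> b) * (\<Prod>j\<in>Basis - {b}. K j (x \<bullet> j))" using b by simp
        also have "\<dots> = (\<Prod>i\<in>Basis. (K(b := K' b)) i (x \<bullet> i))"
          using b by (subst prod.remove[of Basis b]) auto
        finally show ?thesis by (simp add: P_def)
      qed
      moreover have "good (K(b := K' b))" using K(2) K'(2) b by (auto simp: good_def)
      ultimately show ?thesis by blast
    qed
  qed
  then show ?thesis using assms by (auto simp: P_def good_def)
qed

lemma bump_exists:
  fixes a b :: "'a::euclidean_space"
  assumes "\<And>i. i \<in> Basis \<Longrightarrow> a \<bullet> i \<le> b \<bullet> i" "e > 0"
  shows "\<exists>f. (\<lambda>x. complex_of_real (f x)) \<in> schwartz \<and> (\<forall>x. 0 \<le> f x \<and> f x \<le> 1) \<and> (\<forall>x\<in>cbox a b. f x = 1) \<and>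
    (\<forall>x. x \<notin> cbox (a - e *\<^sub>R One) (b + e *\<^sub>R One) \<longrightarrow> f x = 0)"
proof -
  have "\<forall>i\<in>Basis. \<exists>k. sm k \<and> (\<forall>t. 0 \<le> k t \<and> k t \<le> 1) \<and> (\<forall>t\<in>{a \<bullet> i..b \<bullet> i}. k t = 1) \<and> (\<forall>t. t \<notin> {a \<bullet> i - e..b \<bullet> i + e} \<longrightarrow> k t = (0::real))"
    using plateau_exists assms by blast
  then obtain K where K: "\<And>i. i \<in> Basis \<Longrightarrow> sm (K i)" "\<And>i t. i \<in> Basis \<Longrightarrow> 0 \<le> K i t \<and> K i t \<le> 1"
    "\<And>i t. i \<in> Basis \<Longrightarrow> t \<in> {a \<bullet> i..b \<bullet> i} \<Longrightarrow> K i t = 1" "\<And>i t. i \<in> Basis \<Longrightarrow> t \<notin> {a \<bullet> i - e..b \<bullet> i + e} \<Longrightarrow> K i t = (0::real)"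
    by metis
  define f where "f x = (\<Prod>i\<in>Basis. K i (x \<bullet> i))" for x :: 'a
  have "(\<lambda>x. complex_of_real (f x)) \<in> schwartz" unfolding f_def
    by (rule schwartz_prod[where l="a - e *\<^sub>R One" and u="b + e *\<^sub>R One"])
      (use K in \<open>auto simp: inner_simps\<close>)
  moreover have "0 \<le> f x \<and> f x \<le> 1" for x
    unfolding f_def using K(2) by (auto intro!: prod_nonneg prod_le_1)
  moreover have "f x = 1" if "x \<in> cbox a b" for x
    unfolding f_def by (rule prod.neutral) (use that K(3) in \<open>auto simp: mem_box\<close>)
  moreover have "f x = 0" if x: "x \<notin> cbox (a - e *\<^sub>R One) (b + e *\<^sub>R One)" for x
  proof -
    obtain i where i: "i \<in> Basis" "x \<bullet> i \<notin> {a \<bullet> i - e..b \<bullet> i + e}"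
      using x by (auto simp: mem_box inner_simps)
    then show ?thesis unfolding f_def using K(4) by (intro prod_zero) auto
  qed
  ultimately show ?thesis by blast
qed

section \<open>Fourier transforms of Schwartz functions\<close>

lemma lborel_prod_integrable:
  fixes f :: "'a::euclidean_space \<Rightarrow> real \<Rightarrow> 'b::{real_normed_field,banach,second_countable_topology}"
  assumes "\<And>b. b \<in> Basis \<Longrightarrow> integrable lborel (f b)"
  shows "integrable lborel (\<lambda>x::'a. \<Prod>b\<in>Basis. f b (x \<bullet> b))" (is ?I)
    and "(LINT x|lborel. (\<Prod>b\<in>Basis. f b ((x::'a) \<bullet> b))) = (\<Prod>b\<in>Basis. LINT t|lborel. f b t)" (is ?E)
proof -
  interpret product_sigma_finite "\<lambda>_::'a. lborel :: real measure" by standard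
  have [measurable]: "f b \<in> borel_measurable borel" if "b \<in> Basis" for b
    using borel_measurable_integrable[OF assms[OF that]] by simp
  have inner: "(\<Sum>c\<in>Basis. g c *\<^sub>R c) \<bullet> b = g b" if "b \<in> Basis" for b :: 'a and g
    using that by (simp add: inner_sum_left inner_Basis if_distrib cong: if_cong)
  have eq: "(\<Prod>b\<in>Basis. f b ((\<Sum>c\<in>Basis. g c *\<^sub>R c) \<bullet> b)) = (\<Prod>b\<in>Basis. f b (g b))" for g
    by (rule prod.cong) (simp_all add: inner)
  show ?I
    by (subst lborel_eq, subst integrable_distr_eq) (auto simp: eq intro!: product_integrable_prod assms)
  show ?E
    by (subst lborel_eq, subst integral_distr) (auto simp: eq intro!: product_integral_prod assms)
qed

lemma integrable_inverse_square: "integrable lborel (\<lambda>x::real. inverse (1 + x\<^sup>2))"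
  using integrable_inverse_1_plus_square by (simp add: set_integrable_def)

text \<open>The exponent allots \<open>(1 + norm x)^2\<close> to each coordinate, which dominates
  \<open>1 + (x \<bullet> b)^2\<close>; the majorant is thus a product of one-dimensional Cauchy
  densities, up to a constant.\<close>

lemma integrable_weight:
  "integrable lborel (\<lambda>x::'a::euclidean_space. 1 / (1 + norm x) ^ (2 * DIM('a)))"
proof (rule Bochner_Integration.integrable_bound)
  show "integrable lborel (\<lambda>x::'a. \<Prod>b\<in>Basis. inverse (1 + (x \<bullet> b)\<^sup>2))"
    by (rule lborel_prod_integrable) (rule integrable_inverse_square)
  have "1 / (1 + norm x) ^ (2 * DIM('a)) \<le> (\<Prod>b\<in>Basis. inverse (1 + (x \<bullet> b)\<^sup>2))" for x :: 'a
  proof -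
    have "(\<Prod>b\<in>(Basis::'a set). inverse ((1 + norm x)\<^sup>2)) \<le> (\<Prod>b\<in>Basis. inverse (1 + (x \<bullet> b)\<^sup>2))"
    proof (rule prod_mono, intro conjI)
      fix b :: 'a assume b: "b \<in> Basis"
      have "(x \<bullet> b)\<^sup>2 \<le> (norm x)\<^sup>2" using Basis_le_norm[OF b, of x] by (metis abs_ge_zero power2_abs power_mono)
      then have "1 + (x \<bullet> b)\<^sup>2 \<le> (1 + norm x)\<^sup>2" by (simp add: power2_sum add_increasing2)
      then show "inverse ((1 + norm x)\<^sup>2) \<le> inverse (1 + (x \<bullet> b)\<^sup>2)"
        by (intro le_imp_inverse_le) (auto intro: add_pos_nonneg)
    qed simp
    then show ?thesis by (simp add: power_mult power_inverse divide_inverse)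
  qed
  then show "AE x in lborel. norm (1 / (1 + norm x) ^ (2 * DIM('a))) \<le> norm (\<Prod>b\<in>Basis. inverse (1 + ((x::'a) \<bullet> b)\<^sup>2))"
    by (intro AE_I2) (auto simp: prod_nonneg)
qed simp

lemma rapid_integrable:
  fixes f :: "'a::euclidean_space \<Rightarrow> complex"
  assumes "rapid f" "f \<in> borel_measurable borel"
  shows "integrable lborel f"
proof -
  obtain C where C: "C > 0" "\<And>x. (1 + norm x) ^ (2 * DIM('a)) * cmod (f x) \<le> C" using rapidE[OF assms(1)] by metis
  show ?thesis
  proof (rule Bochner_Integration.integrable_bound)
    show "integrable lborel (\<lambda>x::'a. C * (1 / (1 + norm x) ^ (2 * DIM('a))))"
      by (intro integrable_mult_right integrable_weight)
    show "AE x in lborel. norm (f x) \<le> norm (C * (1 / (1 + norm x) ^ (2 * DIM('a))))"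
      using rapid_bound[OF C(2)] C(1) by (intro AE_I2) simp
  qed (use assms in simp)
qed

lemma schwartz_integrable: "f \<in> schwartz \<Longrightarrow> integrable lborel f"
  by (intro rapid_integrable schwartz_rapid schwartz_measurable)

lemma integrable_mult_cis:
  fixes f :: "'a::euclidean_space \<Rightarrow> complex"
  assumes "integrable lborel f" shows "integrable lborel (\<lambda>x. f x * cis (c * (x \<bullet> v)))"
  by (rule Bochner_Integration.integrable_bound[OF assms])
    (use borel_measurable_integrable[OF assms] in \<open>auto simp: norm_mult cis_conv_exp\<close>)

lemma norm_integral_mult_cis_le:
  fixes f :: "'a::euclidean_space \<Rightarrow> complex"
  assumes "integrable lborel f"
  shows "cmod (LINT x|lborel. f x * cis (c * (x \<bullet> v))) \<le> (LINT x|lborel. cmod (f x))"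
  using integral_norm_bound[of lborel "\<lambda>x. f x * cis (c * (x \<bullet> v))"] by (simp add: norm_mult)

lemma fourier_integrable: "f \<in> schwartz \<Longrightarrow> integrable lborel (\<lambda>x. f x * cis (- 2 * pi * (x \<bullet> \<xi>)))"
  by (rule integrable_mult_cis[OF schwartz_integrable])

lemma fourier_add:
  "f \<in> schwartz \<Longrightarrow> g \<in> schwartz \<Longrightarrow> fourier (\<lambda>x. f x + g x) = (\<lambda>\<xi>. fourier f \<xi> + fourier g \<xi>)"
  using Bochner_Integration.integral_add[OF fourier_integrable fourier_integrable, of f g]
  unfolding fourier_def distrib_right by blast

lemma fourier_cmult: "fourier (\<lambda>x. c * f x) = (\<lambda>\<xi>. c * fourier f \<xi>)"
  unfolding fourier_def mult.assoc by (simp only: integral_mult_right_zero)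

text \<open>With an explicit quadratic remainder, differentiation under an integral becomes an
  estimate and needs no limit theorem.\<close>

lemma has_derivative_quadratic:
  fixes f :: "'a::real_normed_vector \<Rightarrow> 'b::real_normed_vector"
  assumes "bounded_linear L" "\<And>h. norm (f (x + h) - f x - L h) \<le> C * (norm h)\<^sup>2"
  shows "(f has_derivative L) (at x)"
  unfolding has_derivative_at
proof (rule conjI[OF assms(1)], rule Lim_null_comparison)
  have "norm (norm (f (x + h) - f x - L h) / norm h) \<le> C * norm h" for h
  proof (cases "h = 0")
    case False
    then show ?thesis using assms(2)[of h] by (simp add: divide_le_eq power2_eq_square mult.assoc)
  qed simp
  then show "\<forall>\<^sub>F h in at 0. norm (norm (f (x + h) - f x - L h) / norm h) \<le> C * norm h" by simp
  show "((\<lambda>h::'a. C * norm h) \<longlongrightarrow> 0) (at 0)" by (auto intro!: tendsto_eq_intros)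
qed

lemma cis_taylor: "cmod (cis t - 1 - \<i> * of_real t) \<le> t\<^sup>2 / 2"
  using iexp_approx1[of t 1] by (simp add: cis_conv_exp algebra_simps power2_eq_square)

text \<open>The increment minus its linear part is the integral of \<open>\<psi>\<close> against the
  second-order Taylor remainder of the character. That remainder is at most
  \<open>2 * pi^2 * (norm x)^2 * (norm h)^2\<close>, and \<open>(norm x)^2 * \<psi> x\<close> is
  integrable.\<close>

lemma fourier_has_derivative:
  fixes \<psi> :: "'a::euclidean_space \<Rightarrow> complex"
  assumes "\<psi> \<in> schwartz"
  shows "(fourier \<psi> has_derivative (\<lambda>h. fourier (\<lambda>x. of_real (x \<bullet> h) * (- 2 * pi * \<i> * \<psi> x)) \<xi>)) (at \<xi>)"
proof (rule has_derivative_quadratic)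
  let ?L = "\<lambda>h. fourier (\<lambda>x. of_real (x \<bullet> h) * (- 2 * pi * \<i> * \<psi> x)) \<xi>"
  have S: "(\<lambda>x. of_real (x \<bullet> h) * (- 2 * pi * \<i> * \<psi> x)) \<in> schwartz" for h
    by (intro schwartz_coord schwartz_cmult assms)
  have lin: "linear ?L"
  proof (rule linearI)
    fix h k
    show "?L (h + k) = ?L h + ?L k"
      using fourier_add[OF S[of h] S[of k]] by (simp add: inner_add_right distrib_right fun_eq_iff)
    show "?L (r *\<^sub>R h) = r *\<^sub>R ?L h" for r
      using fourier_cmult[of "of_real r" "\<lambda>x. of_real (x \<bullet> h) * (- 2 * pi * \<i> * \<psi> x)"]
      by (simp add: mult.assoc scaleR_conv_of_real fun_eq_iff)
  qed
  then show "bounded_linear ?L" by (simp add: linear_conv_bounded_linear)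
  have slow: "slow (\<lambda>x::'a. complex_of_real ((norm x)\<^sup>2))"
    unfolding slow_def by (rule exI[of _ 2], rule exI[of _ 1]) (auto intro!: power_mono simp: norm_power)
  have [measurable]: "\<psi> \<in> borel_measurable borel" by (rule schwartz_measurable[OF assms])
  have "integrable lborel (\<lambda>x. complex_of_real ((norm x)\<^sup>2) * \<psi> x)"
    by (intro rapid_integrable rapid_slow_mult slow schwartz_rapid assms) measurable
  then have W: "integrable lborel (\<lambda>x. (norm x)\<^sup>2 * cmod (\<psi> x))"
    using integrable_norm by (fastforce simp: norm_mult norm_power)
  fix h
  let ?d = "\<lambda>x. \<psi> x * cis (- 2 * pi * (x \<bullet> \<xi>)) * (cis (- 2 * pi * (x \<bullet> h)) - 1 - \<i> * of_real (- 2 * pi * (x \<bullet> h)))"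
  have "fourier \<psi> (\<xi> + h) - fourier \<psi> \<xi> - ?L h =
      (LINT x|lborel. \<psi> x * cis (- 2 * pi * (x \<bullet> (\<xi> + h))) - \<psi> x * cis (- 2 * pi * (x \<bullet> \<xi>)) -
        of_real (x \<bullet> h) * (- 2 * pi * \<i> * \<psi> x) * cis (- 2 * pi * (x \<bullet> \<xi>)))"
    unfolding fourier_def
    using Bochner_Integration.integral_diff[OF Bochner_Integration.integrable_diff[OF
        fourier_integrable[OF assms] fourier_integrable[OF assms]] fourier_integrable[OF S], of "\<xi> + h" \<xi> h \<xi>]
      Bochner_Integration.integral_diff[OF fourier_integrable[OF assms] fourier_integrable[OF assms], of "\<xi> + h" \<xi>]
    by simp
  also have "\<dots> = (LINT x|lborel. ?d x)"
  proof (rule Bochner_Integration.integral_cong[OF refl])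
    fix x
    have "cis (- 2 * pi * (x \<bullet> (\<xi> + h))) = cis (- 2 * pi * (x \<bullet> \<xi>)) * cis (- 2 * pi * (x \<bullet> h))"
      by (simp add: cis_mult inner_add_right distrib_left)
    then show "\<psi> x * cis (- 2 * pi * (x \<bullet> (\<xi> + h))) - \<psi> x * cis (- 2 * pi * (x \<bullet> \<xi>)) -
        of_real (x \<bullet> h) * (- 2 * pi * \<i> * \<psi> x) * cis (- 2 * pi * (x \<bullet> \<xi>)) = ?d x"
      by (simp only:) (simp add: algebra_simps)
  qed
  finally have eq: "fourier \<psi> (\<xi> + h) - fourier \<psi> \<xi> - ?L h = (LINT x|lborel. ?d x)" .
  have "cmod (LINT x|lborel. ?d x) \<le> (LINT x|lborel. cmod (?d x))"
    by (rule integral_norm_bound)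
  also have "\<dots> \<le> (LINT x|lborel. (2 * pi\<^sup>2 * (norm h)\<^sup>2) * ((norm x)\<^sup>2 * cmod (\<psi> x)))"
  proof (rule integral_mono_AE')
    show "integrable lborel (\<lambda>x. (2 * pi\<^sup>2 * (norm h)\<^sup>2) * ((norm x)\<^sup>2 * cmod (\<psi> x)))"
      by (intro integrable_mult_right W)
    have "cmod (?d x) \<le> (2 * pi\<^sup>2 * (norm h)\<^sup>2) * ((norm x)\<^sup>2 * cmod (\<psi> x))" for x
    proof -
      have "(x \<bullet> h)\<^sup>2 \<le> (norm x * norm h)\<^sup>2"
        using power_mono[OF Cauchy_Schwarz_ineq2[of x h], of 2] by simp
      have "cmod (cis (- 2 * pi * (x \<bullet> h)) - 1 - \<i> * of_real (- 2 * pi * (x \<bullet> h))) \<le> (- 2 * pi * (x \<bullet> h))\<^sup>2 / 2"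
        by (rule cis_taylor)
      also have "\<dots> = 2 * pi\<^sup>2 * (x \<bullet> h)\<^sup>2" by (simp add: power2_eq_square)
      also have "\<dots> \<le> 2 * pi\<^sup>2 * (norm x * norm h)\<^sup>2" by (rule mult_left_mono[OF \<open>(x \<bullet> h)\<^sup>2 \<le> _\<close>]) simp
      finally have "cmod (cis (- 2 * pi * (x \<bullet> h)) - 1 - \<i> * of_real (- 2 * pi * (x \<bullet> h))) \<le> 2 * pi\<^sup>2 * (norm x * norm h)\<^sup>2" .
      then have "cmod (\<psi> x) * cmod (cis (- 2 * pi * (x \<bullet> h)) - 1 - \<i> * of_real (- 2 * pi * (x \<bullet> h))) \<le> cmod (\<psi> x) * (2 * pi\<^sup>2 * (norm x * norm h)\<^sup>2)"
        by (rule mult_left_mono) simp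
      then show ?thesis unfolding norm_mult norm_cis power_mult_distrib by (simp only: mult_ac mult_1)
    qed
    then show "AE x in lborel. cmod (?d x) \<le> (2 * pi\<^sup>2 * (norm h)\<^sup>2) * ((norm x)\<^sup>2 * cmod (\<psi> x))" by simp
  qed simp
  finally show "norm (fourier \<psi> (\<xi> + h) - fourier \<psi> \<xi> - ?L h) \<le> (2 * pi\<^sup>2 * (LINT x|lborel. (norm x)\<^sup>2 * cmod (\<psi> x))) * (norm h)\<^sup>2"
    unfolding eq integral_mult_right_zero by (simp only: mult_ac)
qed

lemma integral_translate:
  fixes f :: "'a::euclidean_space \<Rightarrow> 'b::{banach,second_countable_topology}"
  assumes "f \<in> borel_measurable borel"
  shows "(LINT x|lborel. f (x + a)) = (LINT x|lborel. f x)"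
proof -
  have "(LINT x|lborel. f x) = (LINT x|distr lborel borel ((+) a). f x)" by (simp add: lborel_distr_plus)
  also have "\<dots> = (LINT x|lborel. f (a + x))" by (rule integral_distr) (use assms in auto)
  finally show ?thesis by (simp add: add.commute)
qed

lemma integrable_translate:
  fixes f :: "'a::euclidean_space \<Rightarrow> 'b::{banach,second_countable_topology}"
  assumes "integrable lborel f"
  shows "integrable lborel (\<lambda>x. f (x + a))"
proof -
  have m: "f \<in> borel_measurable borel" using borel_measurable_integrable[OF assms] by simp
  have "integrable (distr lborel borel ((+) a)) f" using assms by (simp add: lborel_distr_plus)
  then have "integrable lborel (\<lambda>x. f (a + x))" using m by (subst (asm) integrable_distr_eq) auto
  then show ?thesis by (simp add: add.commute)
qed

lemma vector_derivative_quotient: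
  assumes "(g has_vector_derivative d) (at (0::real))"
  shows "(\<lambda>h. (g h - g 0) /\<^sub>R h) \<midarrow>0\<rightarrow> d"
proof -
  have "(\<lambda>h. norm (g (0 + h) - g 0 - h *\<^sub>R d) / norm h) \<midarrow>0\<rightarrow> 0"
    using assms unfolding has_vector_derivative_def has_derivative_at by blast
  moreover have "norm (g (0 + h) - g 0 - h *\<^sub>R d) / norm h = norm ((g h - g 0) /\<^sub>R h - d)" if "h \<noteq> 0" for h
  proof -
    have "(g h - g 0) /\<^sub>R h - d = (g (0 + h) - g 0 - h *\<^sub>R d) /\<^sub>R h" using that by (simp add: scaleR_diff_right)
    then show ?thesis by (simp add: divide_inverse mult.commute)
  qed
  ultimately have "(\<lambda>h. norm ((g h - g 0) /\<^sub>R h - d)) \<midarrow>0\<rightarrow> 0" by (simp cong: LIM_cong)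
  then show ?thesis by (simp add: tendsto_norm_zero_iff Lim_null[symmetric])
qed

text \<open>The difference quotients \<open>q n\<close> have integral 0 by translation invariance
  and converge to the derivative with an integrable majorant. Applied to products this is
  integration by parts without boundary terms.\<close>

lemma integral_pd_eq_0:
  fixes g :: "'a::euclidean_space \<Rightarrow> complex"
  assumes "g \<in> schwartz" "b \<in> Basis"
  shows "(LINT x|lborel. pd b g x) = 0"
proof -
  define q where "q n x = real (Suc n) *\<^sub>R (g (x + (1 / real (Suc n)) *\<^sub>R b) - g x)" for n x
  have [measurable]: "g \<in> borel_measurable borel" "pd b g \<in> borel_measurable borel"
    by (intro schwartz_measurable assms schwartz_pd)+
  let ?N = "2 * DIM('a)"
  obtain C where C: "C > 0" "\<And>x. (1 + norm x) ^ ?N * cmod (pd b g x) \<le> C"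
    using rapidE[OF schwartz_rapid[OF schwartz_pd[OF assms]]] by metis
  have hd: "((\<lambda>t. g (x + t *\<^sub>R b)) has_derivative (\<lambda>h. h *\<^sub>R pd b g (x + t *\<^sub>R b))) (at t)" for x t
  proof -
    have "((\<lambda>t. x + t *\<^sub>R b) has_derivative (\<lambda>h. h *\<^sub>R b)) (at t)" by (auto intro!: derivative_eq_intros)
    moreover have d: "(g has_derivative (\<lambda>h. pd h g (x + t *\<^sub>R b))) (at (x + t *\<^sub>R b))"
      by (rule has_derivative_pd[OF schwartz_differentiable[OF assms(1)]])
    ultimately have "((\<lambda>t. g (x + t *\<^sub>R b)) has_derivative (\<lambda>h. pd (h *\<^sub>R b) g (x + t *\<^sub>R b))) (at t)"
      by (rule has_derivative_compose)
    then show ?thesis by (simp add: linear_scale[OF has_derivative_linear[OF d]])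
  qed
  \<comment> \<open>By the mean value theorem the quotient is bounded by the derivative at a point
    at distance at most 1 from \<open>x\<close>; there \<open>1 + norm\<close> has dropped by a
    factor of at most 2, whence \<open>2 ^ ?N\<close>.\<close>
  have bound: "norm (q n x) \<le> (C * 2 ^ ?N) * (1 / (1 + norm x) ^ ?N)" for n x
  proof -
    define e where "e = 1 / real (Suc n)"
    have e: "0 < e" "e \<le> 1" by (auto simp: e_def)
    have "\<exists>s\<in>{0<..<e}. norm (g (x + e *\<^sub>R b) - g (x + 0 *\<^sub>R b)) \<le> norm ((e - 0) *\<^sub>R pd b g (x + s *\<^sub>R b))"
      by (rule mvt_general[OF e(1)]) (auto intro!: hd continuous_at_imp_continuous_on has_derivative_continuous[OF hd])
    then obtain s where s: "0 < s" "s < e" "norm (g (x + e *\<^sub>R b) - g x) \<le> e * cmod (pd b g (x + s *\<^sub>R b))"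
      using e by auto
    have "norm x \<le> norm (x + s *\<^sub>R b) + norm (s *\<^sub>R b)" by (metis add_diff_cancel norm_triangle_ineq4)
    also have "norm (s *\<^sub>R b) \<le> 1" using s e assms(2) by simp
    finally have "1 + norm x \<le> 2 * (1 + norm (x + s *\<^sub>R b))" by simp (smt (verit) norm_ge_zero)
    then have "(1 + norm x) ^ ?N \<le> (2 * (1 + norm (x + s *\<^sub>R b))) ^ ?N" by (intro power_mono) auto
    then have "(1 + norm x) ^ ?N * cmod (pd b g (x + s *\<^sub>R b)) \<le> 2 ^ ?N * ((1 + norm (x + s *\<^sub>R b)) ^ ?N * cmod (pd b g (x + s *\<^sub>R b)))"
      unfolding power_mult_distrib mult.assoc[symmetric] by (rule mult_right_mono) simp
    also have "\<dots> \<le> 2 ^ ?N * C" by (intro mult_left_mono C) simp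
    finally have "cmod (pd b g (x + s *\<^sub>R b)) \<le> 2 ^ ?N * C / (1 + norm x) ^ ?N" by (rule rapid_bound)
    then have "e * cmod (pd b g (x + s *\<^sub>R b)) \<le> e * (2 ^ ?N * C / (1 + norm x) ^ ?N)"
      using e by (intro mult_left_mono) auto
    with s(3) have "norm (g (x + e *\<^sub>R b) - g x) \<le> e * (2 ^ ?N * C / (1 + norm x) ^ ?N)" by linarith
    then have "norm (g (x + e *\<^sub>R b) - g x) / e \<le> 2 ^ ?N * C / (1 + norm x) ^ ?N"
      using e by (simp add: pos_divide_le_eq mult.commute)
    then show ?thesis by (simp add: q_def e_def mult_ac)
  qed
  have "(\<lambda>n. LINT x|lborel. q n x) \<longlonglongrightarrow> (LINT x|lborel. pd b g x)"
  proof (rule integral_dominated_convergence[where w="\<lambda>x::'a. (C * 2 ^ ?N) * (1 / (1 + norm x) ^ ?N)"])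
    show "integrable lborel (\<lambda>x::'a. (C * 2 ^ ?N) * (1 / (1 + norm x) ^ ?N))"
      by (intro integrable_mult_right integrable_weight)
    show "AE x in lborel. (\<lambda>n. q n x) \<longlonglongrightarrow> pd b g x"
    proof (rule AE_I2)
      fix x
      have "((\<lambda>t. g (x + t *\<^sub>R b)) has_vector_derivative pd b g x) (at 0)"
        using hd[of x 0] by (simp add: has_vector_derivative_def)
      from vector_derivative_quotient[OF this]
      have "(\<lambda>h. (g (x + h *\<^sub>R b) - g x) /\<^sub>R h) \<midarrow>0\<rightarrow> pd b g x" by simp
      moreover have "(\<lambda>n. 1 / real (Suc n)) \<longlonglongrightarrow> 0" by (rule LIMSEQ_Suc[OF lim_1_over_n])
      ultimately show "(\<lambda>n. q n x) \<longlonglongrightarrow> pd b g x"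
        unfolding tendsto_at_iff_sequentially
        by (elim allE[of _ "\<lambda>n. 1 / real (Suc n)"]) (simp add: q_def[abs_def] o_def divide_inverse)
    qed
    show "AE x in lborel. norm (q n x) \<le> (C * 2 ^ ?N) * (1 / (1 + norm x) ^ ?N)" for n
      using bound by simp
    show "q n \<in> borel_measurable lborel" for n unfolding q_def by measurable
  qed simp
  moreover have "(LINT x|lborel. q n x) = 0" for n
    unfolding q_def using integral_translate[of g "(1 / real (Suc n)) *\<^sub>R b"]
      integrable_translate[OF schwartz_integrable[OF assms(1)], of "(1 / real (Suc n)) *\<^sub>R b"]
      schwartz_integrable[OF assms(1)] by simp
  ultimately show ?thesis by (simp add: LIMSEQ_const_iff)
qed

text \<open>Obtained from \<open>integral_pd_eq_0\<close> for the product of \<open>\<psi>\<close>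
  with the character, whose derivative contributes the factor in \<open>\<xi>\<close>.\<close>

lemma fourier_pd:
  fixes \<psi> :: "'a::euclidean_space \<Rightarrow> complex"
  assumes "\<psi> \<in> schwartz" "b \<in> Basis"
  shows "fourier (pd b \<psi>) \<xi> = 2 * pi * \<i> * of_real (\<xi> \<bullet> b) * fourier \<psi> \<xi>"
proof -
  define v where "v = (- 2 * pi) *\<^sub>R \<xi>"
  have e: "cis (- 2 * pi * (x \<bullet> \<xi>)) = cis (x \<bullet> v)" for x by (simp add: v_def)
  have S: "(\<lambda>x. cis (x \<bullet> v) * \<psi> x) \<in> schwartz" by (rule schwartz_cis[OF assms(1)])
  have *: "pd b (\<lambda>x. cis (x \<bullet> v) * \<psi> x) x = of_real (b \<bullet> v) * \<i> * (\<psi> x * cis (x \<bullet> v)) + pd b \<psi> x * cis (x \<bullet> v)" for x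
    by (subst pd_mult) (auto intro!: differentiableI[OF has_derivative_cis_inner] schwartz_differentiable assms
        simp: pd_eq[OF has_derivative_cis_inner])
  have i: "integrable lborel (\<lambda>x. \<psi> x * cis (x \<bullet> v))" "integrable lborel (\<lambda>x. pd b \<psi> x * cis (x \<bullet> v))"
    using integrable_mult_cis[of \<psi> 1 v] integrable_mult_cis[of "pd b \<psi>" 1 v] schwartz_integrable schwartz_pd assms by auto
  have "0 = of_real (b \<bullet> v) * \<i> * (LINT x|lborel. \<psi> x * cis (x \<bullet> v)) + (LINT x|lborel. pd b \<psi> x * cis (x \<bullet> v))"
    using integral_pd_eq_0[OF S assms(2)] i unfolding * by simp
  then have "fourier (pd b \<psi>) \<xi> = - (of_real (b \<bullet> v) * \<i>) * fourier \<psi> \<xi>"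
    unfolding fourier_def e by (simp add: eq_neg_iff_add_eq_0 add.commute)
  then show ?thesis by (simp add: v_def inner_commute mult_ac)
qed

section \<open>Control of the Fourier transform by Schwartz seminorms\<close>

lemma finite_lists_Basis: "finite {bs \<in> lists (Basis::'a::euclidean_space set). length bs \<le> N}"
  using finite_lists_length_le[OF finite_Basis, of N] by (simp add: lists_eq_set)

text \<open>A real supremum bounds its members only if the set is bounded above. Here it is, because
  finitely many lists \<open>bs\<close> are involved and each has its own bound.\<close>

lemma schwartz_seminorm_upper:
  fixes \<psi> :: "'a::euclidean_space \<Rightarrow> complex"
  assumes "\<psi> \<in> schwartz" "bs \<in> lists Basis" "length bs \<le> N"
  shows "(1 + norm x) ^ N * cmod (iter_deriv bs \<psi> x) \<le> schwartz_seminorm N \<psi>"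
proof -
  let ?I = "{bs \<in> lists (Basis::'a set). length bs \<le> N}"
  have "\<exists>C. \<forall>x. (1 + norm x) ^ N * cmod (iter_deriv bs \<psi> x) \<le> C" if "bs \<in> ?I" for bs
    using schwartz_rapid_iter[OF assms(1), of bs] that unfolding rapid_def by blast
  then obtain C where C: "\<And>bs x. bs \<in> ?I \<Longrightarrow> (1 + norm x) ^ N * cmod (iter_deriv bs \<psi> x) \<le> C bs" by metis
  have "bdd_above ((\<lambda>(bs, x). (1 + norm x) ^ N * cmod (iter_deriv bs \<psi> x)) ` (?I \<times> UNIV))"
  proof (rule bdd_aboveI2[where M="\<Sum>bs\<in>?I. \<bar>C bs\<bar>"])
    fix p :: "'a list \<times> 'a" assume p: "p \<in> ?I \<times> UNIV"
    obtain bs x where px: "p = (bs, x)" by (cases p)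
    then have "bs \<in> ?I" using p by auto
    from C[OF this, of x] have "(1 + norm x) ^ N * cmod (iter_deriv bs \<psi> x) \<le> \<bar>C bs\<bar>" by linarith
    also have "\<dots> \<le> (\<Sum>bs\<in>?I. \<bar>C bs\<bar>)"
      by (rule member_le_sum[OF \<open>bs \<in> ?I\<close>]) (auto intro: finite_lists_Basis)
    finally show "(case p of (bs, x) \<Rightarrow> (1 + norm x) ^ N * cmod (iter_deriv bs \<psi> x)) \<le> (\<Sum>bs\<in>?I. \<bar>C bs\<bar>)"
      by (simp add: px)
  qed
  from cSUP_upper[OF _ this, of "(bs, x)"] show ?thesis
    unfolding schwartz_seminorm_def using assms by auto
qed

lemma schwartz_seminorm_least:
  fixes \<psi> :: "'a::euclidean_space \<Rightarrow> complex"
  assumes "\<And>bs x. bs \<in> lists Basis \<Longrightarrow> length bs \<le> N \<Longrightarrow> (1 + norm x) ^ N * cmod (iter_deriv bs \<psi> x) \<le> C"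
  shows "schwartz_seminorm N \<psi> \<le> C"
proof -
  have "([], 0) \<in> {bs \<in> lists (Basis :: 'a set). length bs \<le> N} \<times> (UNIV :: 'a set)" by simp
  then have "{bs \<in> lists (Basis :: 'a set). length bs \<le> N} \<times> (UNIV :: 'a set) \<noteq> {}" by blast
  then show ?thesis unfolding schwartz_seminorm_def using assms by (intro cSUP_least) auto
qed

lemma schwartz_iter_deriv: "\<psi> \<in> schwartz \<Longrightarrow> bs \<in> lists Basis \<Longrightarrow> iter_deriv bs \<psi> \<in> schwartz"
  by (induction bs) (auto simp: iter_deriv_Cons schwartz_pd)

lemma fourier_coord_power:
  assumes "\<psi> \<in> schwartz" "b \<in> Basis"
  shows "fourier (iter_deriv (replicate N b) \<psi>) \<xi> = (2 * pi * \<i> * of_real (\<xi> \<bullet> b)) ^ N * fourier \<psi> \<xi>"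
proof (induction N)
  case (Suc N)
  have "iter_deriv (replicate N b) \<psi> \<in> schwartz" using assms by (intro schwartz_iter_deriv) auto
  from fourier_pd[OF this assms(2)] Suc show ?case by (simp add: iter_deriv_Cons mult.assoc)
qed simp

text \<open>Both sides are compared with \<open>m\<close>, the maximum of 1 and the absolute
  coordinates. This converts control of the coordinate powers, which derivatives give, into decay in
  the norm.\<close>

lemma power_sum_Basis_bound:
  "(1 + norm (x::'a::euclidean_space)) ^ N \<le> (1 + DIM('a)) ^ N * (1 + (\<Sum>b\<in>Basis. \<bar>x \<bullet> b\<bar> ^ N))"
proof -
  define m where "m = Max (insert 1 ((\<lambda>b. \<bar>x \<bullet> b\<bar>) ` Basis))"
  have m1: "1 \<le> m" unfolding m_def by (rule Max_ge) auto
  have mb: "\<bar>x \<bullet> b\<bar> \<le> m" if "b \<in> Basis" for b unfolding m_def by (rule Max_ge) (use that in auto)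
  have "m \<in> insert 1 ((\<lambda>b. \<bar>x \<bullet> b\<bar>) ` Basis)" unfolding m_def by (rule Max_in) auto
  then have "m ^ N \<le> 1 + (\<Sum>b\<in>Basis. \<bar>x \<bullet> b\<bar> ^ N)"
  proof
    assume "m = 1" then show ?thesis by (simp add: sum_nonneg)
  next
    assume "m \<in> (\<lambda>b. \<bar>x \<bullet> b\<bar>) ` Basis"
    then obtain b where b: "b \<in> Basis" "m = \<bar>x \<bullet> b\<bar>" by blast
    have "m ^ N \<le> (\<Sum>b\<in>Basis. \<bar>x \<bullet> b\<bar> ^ N)"
      unfolding b(2) by (rule member_le_sum[OF b(1)]) auto
    then show ?thesis by simp
  qed
  have "norm x \<le> (\<Sum>b\<in>Basis. \<bar>x \<bullet> b\<bar>)" by (rule norm_le_l1)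
  also have "\<dots> \<le> DIM('a) * m" using sum_bounded_above[of Basis "\<lambda>b. \<bar>x \<bullet> b\<bar>" m] mb by simp
  finally have "1 + norm x \<le> (1 + DIM('a)) * m" using m1 by (simp add: distrib_right)
  then have "(1 + norm x) ^ N \<le> ((1 + DIM('a)) * m) ^ N" by (intro power_mono) auto
  also have "\<dots> = (1 + DIM('a)) ^ N * m ^ N" by (simp add: power_mult_distrib)
  also have "\<dots> \<le> (1 + DIM('a)) ^ N * (1 + (\<Sum>b\<in>Basis. \<bar>x \<bullet> b\<bar> ^ N))"
    by (rule mult_left_mono[OF \<open>m ^ N \<le> _\<close>]) simp
  finally show ?thesis by simp
qed

lemma schwartz_seminorm_nonneg:
  assumes "\<psi> \<in> schwartz" shows "0 \<le> schwartz_seminorm N \<psi>"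
  using order_trans[OF norm_ge_zero, of "\<psi> 0"] schwartz_seminorm_upper[OF assms, of "[]" N 0] by simp

lemma fourier_iter_bound:
  fixes \<psi> :: "'a::euclidean_space \<Rightarrow> complex"
  assumes "\<psi> \<in> schwartz" "bs \<in> lists Basis" "length bs \<le> M" "2 * DIM('a) \<le> M"
  shows "cmod (fourier (iter_deriv bs \<psi>) \<xi>) \<le>
    (LINT x|lborel. 1 / (1 + norm (x::'a)) ^ (2 * DIM('a))) * schwartz_seminorm M \<psi>"
proof -
  have S: "iter_deriv bs \<psi> \<in> schwartz" by (rule schwartz_iter_deriv[OF assms(1,2)])
  have "cmod (fourier (iter_deriv bs \<psi>) \<xi>) \<le> (LINT x|lborel. cmod (iter_deriv bs \<psi> x))"
    unfolding fourier_def by (rule norm_integral_mult_cis_le[OF schwartz_integrable[OF S]])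
  also have "\<dots> \<le> (LINT x|lborel. 1 / (1 + norm (x::'a)) ^ (2 * DIM('a)) * schwartz_seminorm M \<psi>)"
  proof (rule integral_mono_AE')
    show "integrable lborel (\<lambda>x::'a. 1 / (1 + norm x) ^ (2 * DIM('a)) * schwartz_seminorm M \<psi>)"
      by (intro integrable_mult_left integrable_weight)
    have "cmod (iter_deriv bs \<psi> x) \<le> 1 / (1 + norm x) ^ (2 * DIM('a)) * schwartz_seminorm M \<psi>" for x
    proof -
      have "(1 + norm x) ^ (2 * DIM('a)) * cmod (iter_deriv bs \<psi> x) \<le> (1 + norm x) ^ M * cmod (iter_deriv bs \<psi> x)"
        by (intro mult_right_mono power_increasing assms) auto
      also have "\<dots> \<le> schwartz_seminorm M \<psi>" by (rule schwartz_seminorm_upper[OF assms(1-3)])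
      finally show ?thesis using rapid_bound by fastforce
    qed
    then show "AE x in lborel. cmod (iter_deriv bs \<psi> x) \<le> 1 / (1 + norm x) ^ (2 * DIM('a)) * schwartz_seminorm M \<psi>" by simp
  qed (use schwartz_seminorm_nonneg[OF assms(1)] in simp)
  finally show ?thesis by (simp only: integral_mult_left_zero)
qed

text \<open>Continuity of the Fourier transform in quantitative form. The explicit dependence on a
  seminorm of \<open>\<psi>\<close> is what later shows that \<open>inv_fourier_distr\<close> is
  tempered.\<close>

lemma fourier_decay:
  "\<exists>M C. \<forall>\<psi>\<in>schwartz. \<forall>\<xi>::'a::euclidean_space. (1 + norm \<xi>) ^ N * cmod (fourier \<psi> \<xi>) \<le> C * schwartz_seminorm M \<psi>"
proof -
  \<comment> \<open>The seminorm has to admit \<open>N\<close> derivatives and also the decay of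
    order \<open>2 * DIM('a)\<close> that makes the integrals converge.\<close>
  define M where "M = max N (2 * DIM('a))"
  define W where "W = (LINT x|lborel. 1 / (1 + norm (x::'a)) ^ (2 * DIM('a)))"
  have W0: "W \<ge> 0" unfolding W_def by (intro integral_nonneg_AE AE_I2) simp
  have "(1 + norm \<xi>) ^ N * cmod (fourier \<psi> \<xi>) \<le> ((1 + DIM('a)) ^ N * ((1 + DIM('a)) * W)) * schwartz_seminorm M \<psi>"
    if "\<psi> \<in> schwartz" for \<psi> and \<xi> :: 'a
  proof -
    have 0: "cmod (fourier \<psi> \<xi>) \<le> W * schwartz_seminorm M \<psi>"
      using fourier_iter_bound[OF that, of "[]" M \<xi>] by (simp add: M_def W_def)
    have b: "\<bar>\<xi> \<bullet> b\<bar> ^ N * cmod (fourier \<psi> \<xi>) \<le> W * schwartz_seminorm M \<psi>" if b: "b \<in> Basis" for b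
    proof -
      have "cmod (fourier (iter_deriv (replicate N b) \<psi>) \<xi>) \<le> W * schwartz_seminorm M \<psi>"
        unfolding W_def by (rule fourier_iter_bound[OF \<open>\<psi> \<in> schwartz\<close>]) (use b in \<open>auto simp: M_def\<close>)
      then have "(2 * pi) ^ N * (\<bar>\<xi> \<bullet> b\<bar> ^ N * cmod (fourier \<psi> \<xi>)) \<le> W * schwartz_seminorm M \<psi>"
        unfolding fourier_coord_power[OF \<open>\<psi> \<in> schwartz\<close> b]
        by (simp add: norm_mult norm_power power_mult_distrib mult.assoc)
      moreover have "1 \<le> (2 * pi) ^ N" using pi_gt3 by (intro one_le_power) linarith
      ultimately show ?thesis
        using mult_right_mono[of 1 "(2 * pi) ^ N" "\<bar>\<xi> \<bullet> b\<bar> ^ N * cmod (fourier \<psi> \<xi>)"] by simp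
    qed
    have "(1 + norm \<xi>) ^ N * cmod (fourier \<psi> \<xi>) \<le>
        ((1 + DIM('a)) ^ N * (1 + (\<Sum>b\<in>Basis. \<bar>\<xi> \<bullet> b\<bar> ^ N))) * cmod (fourier \<psi> \<xi>)"
      by (intro mult_right_mono power_sum_Basis_bound) simp
    also have "\<dots> = (1 + DIM('a)) ^ N * (cmod (fourier \<psi> \<xi>) + (\<Sum>b\<in>Basis. \<bar>\<xi> \<bullet> b\<bar> ^ N * cmod (fourier \<psi> \<xi>)))"
      by (simp add: distrib_right sum_distrib_right mult.assoc)
    also have "\<dots> \<le> (1 + DIM('a)) ^ N * (W * schwartz_seminorm M \<psi> + (\<Sum>b\<in>(Basis::'a set). W * schwartz_seminorm M \<psi>))"
      by (intro mult_left_mono add_mono sum_mono 0 b) auto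
    finally show ?thesis by (simp add: algebra_simps)
  qed
  then show ?thesis by blast
qed

text \<open>The range of \<open>fourier\<close> on Schwartz functions is a coinductive class:
  differentiating a transform multiplies the original function by a coordinate.\<close>

lemma fourier_schwartz:
  fixes \<psi> :: "'a::euclidean_space \<Rightarrow> complex"
  assumes "\<psi> \<in> schwartz" shows "fourier \<psi> \<in> schwartz"
proof (rule schwartz_coinduct[where X="fourier ` schwartz"])
  show "fourier \<psi> \<in> fourier ` schwartz" using assms by blast
next
  fix f :: "'a \<Rightarrow> complex" assume "f \<in> fourier ` schwartz"
  then show "rapid f" unfolding rapid_def using fourier_decay by (metis imageE)
next
  fix f :: "'a \<Rightarrow> complex" and x assume "f \<in> fourier ` schwartz"
  then show "f differentiable (at x)" using differentiableI[OF fourier_has_derivative] by blast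
next
  fix f :: "'a \<Rightarrow> complex" and b :: 'a assume "f \<in> fourier ` schwartz"
  then obtain \<psi> where f: "f = fourier \<psi>" "\<psi> \<in> schwartz" by blast
  have "pd b f = fourier (\<lambda>x. of_real (x \<bullet> b) * (- 2 * pi * \<i> * \<psi> x))"
    unfolding f(1) by (rule ext, rule pd_eq[OF fourier_has_derivative[OF f(2)]])
  moreover have "(\<lambda>x. of_real (x \<bullet> b) * (- 2 * pi * \<i> * \<psi> x)) \<in> schwartz"
    by (intro schwartz_coord schwartz_cmult f)
  ultimately show "pd b f \<in> fourier ` schwartz" by blast
qed

section \<open>Fourier inversion\<close>

lemma integral_scale:
  fixes f :: "'a::euclidean_space \<Rightarrow> complex"
  assumes [measurable]: "f \<in> borel_measurable borel" and c: "c > 0"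
  shows "(LINT x|lborel. f x) = of_real (c ^ DIM('a)) * (LINT x|lborel. f (c *\<^sub>R x))"
proof -
  have "(LINT x|lborel. f x) = (LINT x|density (distr lborel borel (\<lambda>x. 0 + c *\<^sub>R x)) (\<lambda>_. ennreal (\<bar>c\<bar> ^ DIM('a))). f x)"
    using lborel_affine[of c "0::'a"] c by (simp add: ennreal_power)
  also have "\<dots> = (LINT x|distr lborel borel (\<lambda>x. 0 + c *\<^sub>R x). (\<bar>c\<bar> ^ DIM('a)) *\<^sub>R f x)"
    by (rule integral_density) auto
  also have "\<dots> = (LINT x|lborel. (\<bar>c\<bar> ^ DIM('a)) *\<^sub>R f (c *\<^sub>R x))"
    by (subst integral_distr) auto
  finally show ?thesis using c by (simp add: scaleR_conv_of_real)
qed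

text \<open>Up to the normalising constant this is the characteristic function of the standard
  normal distribution.\<close>

lemma gauss_real:
  "integrable lborel (\<lambda>t. exp (complex_of_real (- t\<^sup>2 / 2) + \<i> * of_real (c * t)))"
  "(LINT t|lborel. exp (complex_of_real (- t\<^sup>2 / 2) + \<i> * of_real (c * t))) = of_real (sqrt (2 * pi) * exp (- c\<^sup>2 / 2))"
proof -
  have eq: "std_normal_density t *\<^sub>R iexp (c * t) = of_real (1 / sqrt (2 * pi)) * exp (complex_of_real (- t\<^sup>2 / 2) + \<i> * of_real (c * t))" for t
    unfolding exp_add std_normal_density_def scaleR_conv_of_real of_real_mult exp_of_real by (simp only: mult.assoc)
  have "integrable lborel std_normal_density" by simp
  then have "integrable lborel (\<lambda>t. std_normal_density t *\<^sub>R iexp (c * t))"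
    by (rule Bochner_Integration.integrable_bound) auto
  then have "integrable lborel (\<lambda>t. of_real (sqrt (2 * pi)) * (of_real (1 / sqrt (2 * pi)) * exp (complex_of_real (- t\<^sup>2 / 2) + \<i> * of_real (c * t))))"
    unfolding eq by (rule integrable_mult_right)
  then show "integrable lborel (\<lambda>t. exp (complex_of_real (- t\<^sup>2 / 2) + \<i> * of_real (c * t)))"
    unfolding mult.assoc[symmetric] of_real_mult[symmetric] by simp
  have "of_real (exp (- c\<^sup>2 / 2)) = (CLINT t|density lborel std_normal_density. iexp (c * t))"
    using char_std_normal_distribution unfolding char_def fun_eq_iff by metis
  also have "\<dots> = (LINT t|lborel. std_normal_density t *\<^sub>R iexp (c * t))"
    by (rule integral_density) auto
  also have "\<dots> = of_real (1 / sqrt (2 * pi)) * (LINT t|lborel. exp (complex_of_real (- t\<^sup>2 / 2) + \<i> * of_real (c * t)))"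
    unfolding eq by (rule integral_mult_right_zero)
  finally have "complex_of_real (sqrt (2 * pi)) * of_real (exp (- c\<^sup>2 / 2)) = (of_real (sqrt (2 * pi)) * of_real (1 / sqrt (2 * pi))) *
      (LINT t|lborel. exp (complex_of_real (- t\<^sup>2 / 2) + \<i> * of_real (c * t)))" by simp
  then show "(LINT t|lborel. exp (complex_of_real (- t\<^sup>2 / 2) + \<i> * of_real (c * t))) = of_real (sqrt (2 * pi) * exp (- c\<^sup>2 / 2))"
    unfolding of_real_mult[symmetric] by simp
qed

lemma gauss_fourier:
  fixes v :: "'a::euclidean_space"
  shows "integrable lborel (\<lambda>x::'a. complex_of_real (exp (- (norm x)\<^sup>2 / 2)) * cis (x \<bullet> v))"
    and "(LINT x|lborel. complex_of_real (exp (- (norm (x::'a))\<^sup>2 / 2)) * cis (x \<bullet> v)) =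
      of_real (sqrt (2 * pi) ^ DIM('a) * exp (- (norm v)\<^sup>2 / 2))"
proof -
  define f where "f b t = exp (complex_of_real (- t\<^sup>2 / 2) + \<i> * of_real ((v \<bullet> b) * t))" for b :: 'a and t
  have n2: "(norm (x::'a))\<^sup>2 = (\<Sum>b\<in>Basis. (x \<bullet> b)\<^sup>2)" for x
    unfolding power2_norm_eq_inner by (subst euclidean_inner) (simp add: power2_eq_square)
  have eq: "(\<Prod>b\<in>Basis. f b (x \<bullet> b)) = complex_of_real (exp (- (norm x)\<^sup>2 / 2)) * cis (x \<bullet> v)" for x :: 'a
  proof -
    have "(\<Prod>b\<in>Basis. f b (x \<bullet> b)) = exp (\<Sum>b\<in>Basis. complex_of_real (- (x \<bullet> b)\<^sup>2 / 2) + \<i> * of_real ((v \<bullet> b) * (x \<bullet> b)))"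
      unfolding f_def by (rule exp_sum[symmetric]) simp
    also have "(\<Sum>b\<in>Basis. complex_of_real (- (x \<bullet> b)\<^sup>2 / 2) + \<i> * of_real ((v \<bullet> b) * (x \<bullet> b))) =
        of_real (\<Sum>b\<in>Basis. - (x \<bullet> b)\<^sup>2 / 2) + \<i> * of_real (\<Sum>b\<in>Basis. (v \<bullet> b) * (x \<bullet> b))"
      unfolding sum.distrib of_real_sum sum_distrib_left ..
    also have "(\<Sum>b\<in>Basis. - (x \<bullet> b)\<^sup>2 / 2) = - (norm x)\<^sup>2 / 2"
      unfolding n2 sum_divide_distrib[symmetric] sum_negf ..
    also have "(\<Sum>b\<in>Basis. (v \<bullet> b) * (x \<bullet> b)) = x \<bullet> v"
      by (subst euclidean_inner) (simp add: mult.commute)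
    finally show ?thesis unfolding exp_add exp_of_real cis_conv_exp .
  qed
  have i: "integrable lborel (f b)" for b
    unfolding f_def by (rule gauss_real)
  show "integrable lborel (\<lambda>x::'a. complex_of_real (exp (- (norm x)\<^sup>2 / 2)) * cis (x \<bullet> v))"
    using lborel_prod_integrable(1)[of f, OF i] unfolding eq .
  have "(LINT x|lborel. complex_of_real (exp (- (norm (x::'a))\<^sup>2 / 2)) * cis (x \<bullet> v)) = (\<Prod>b\<in>Basis. LINT t|lborel. f b t)"
    using lborel_prod_integrable(2)[of f, OF i] unfolding eq .
  also have "\<dots> = (\<Prod>b\<in>(Basis::'a set). of_real (sqrt (2 * pi) * exp (- (v \<bullet> b)\<^sup>2 / 2)))"
    unfolding f_def gauss_real ..
  also have "\<dots> = of_real (sqrt (2 * pi) ^ DIM('a) * (\<Prod>b\<in>(Basis::'a set). exp (- (v \<bullet> b)\<^sup>2 / 2)))"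
    by (simp add: prod.distrib)
  also have "(\<Prod>b\<in>(Basis::'a set). exp (- (v \<bullet> b)\<^sup>2 / 2)) = exp (- (norm v)\<^sup>2 / 2)"
    unfolding exp_sum[symmetric, OF finite_Basis] n2 by (simp add: sum_divide_distrib[symmetric] sum_negf)
  finally show "(LINT x|lborel. complex_of_real (exp (- (norm (x::'a))\<^sup>2 / 2)) * cis (x \<bullet> v)) =
      of_real (sqrt (2 * pi) ^ DIM('a) * exp (- (norm v)\<^sup>2 / 2))" .
qed

lemma integrable_product_bound:
  fixes f g :: "_ \<Rightarrow> real" and k :: "'a::euclidean_space \<times> 'b::euclidean_space \<Rightarrow> complex"
  assumes f: "integrable lborel f" and g: "integrable lborel g"
    and k: "k \<in> borel_measurable (lborel \<Otimes>\<^sub>M lborel)" "\<And>x y. cmod (k (x, y)) \<le> f x * g y"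
  shows "integrable (lborel \<Otimes>\<^sub>M lborel) k"
proof (rule Bochner_Integration.integrable_bound[OF _ k(1)])
  have [measurable]: "f \<in> borel_measurable borel" "g \<in> borel_measurable borel"
    using f g by auto
  show "integrable (lborel \<Otimes>\<^sub>M lborel) (\<lambda>(x, y). f x * g y)"
  proof (rule lborel_pair.Fubini_integrable)
    show "integrable lborel (\<lambda>x. LINT y|lborel. norm (case (x, y) of (x, y) \<Rightarrow> f x * g y))"
    proof -
      have "integrable lborel (\<lambda>x. norm (f x) * (LINT y|lborel. norm (g y)))"
        by (intro integrable_mult_left integrable_norm f)
      then show ?thesis by (simp add: abs_mult)
    qed
    show "AE x in lborel. integrable lborel (\<lambda>y. case (x, y) of (x, y) \<Rightarrow> f x * g y)"
      using g by (intro AE_I2) simp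
  qed measurable
  show "AE x in lborel \<Otimes>\<^sub>M lborel. norm (k x) \<le> norm (case x of (x, y) \<Rightarrow> f x * g y)"
    using k(2) by (intro AE_I2) (auto intro!: order_trans[OF k(2) abs_ge_self])
qed

text \<open>Gaussian regularisation: the transform is damped by
  \<open>E (e *\<^sub>R \<xi>)\<close>, Fubini's theorem moves the Gaussian over to
  \<open>\<psi>\<close>, and \<open>e\<close> tends to 0 on both sides.\<close>

lemma fourier_inversion_0:
  fixes \<psi> :: "'a::euclidean_space \<Rightarrow> complex"
  assumes \<psi>: "\<psi> \<in> schwartz"
  shows "(LINT \<xi>|lborel. fourier \<psi> \<xi>) = \<psi> 0"
proof -
  define E where "E x = exp (- (norm x)\<^sup>2 / 2)" for x :: 'a
  \<comment> \<open>The total mass of the Gaussian \<open>E\<close>. Its square is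
    \<open>(2 * pi) ^ DIM('a)\<close>, which makes the constants cancel in the end.\<close>
  define K where "K = sqrt (2 * pi) ^ DIM('a)"
  have [measurable]: "\<psi> \<in> borel_measurable borel" "fourier \<psi> \<in> borel_measurable borel"
    by (intro schwartz_measurable fourier_schwartz \<psi>)+
  have [measurable]: "E \<in> borel_measurable borel" unfolding E_def by measurable
  have [measurable]: "cis \<in> borel_measurable borel"
    by (intro borel_measurable_continuous_onI) (simp add: cis_conv_exp continuous_intros)
  have E01: "0 < E x" "E x \<le> 1" for x by (auto simp: E_def)
  have intE: "integrable lborel E" using gauss_fourier(1)[of "0::'a"] integrable_Re unfolding E_def by fastforce
  \<comment> \<open>The multiplication formula for the pair of \<open>\<psi>\<close> and the damping
    Gaussian, rescaled so that on the right \<open>e\<close> occurs in the argument of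
    \<open>\<psi>\<close> only; there the integrand tends to \<open>\<psi> 0 * E v\<close>.\<close>
  have key: "(LINT \<xi>|lborel. fourier \<psi> \<xi> * of_real (E (e *\<^sub>R \<xi>))) =
      of_real (K / (2 * pi) ^ DIM('a)) * (LINT v|lborel. \<psi> ((e / (2 * pi)) *\<^sub>R v) * of_real (E v))" if e: "e > 0" for e
  proof -
    have inner: "(LINT \<xi>|lborel. of_real (E (e *\<^sub>R \<xi>)) * cis (- 2 * pi * (y \<bullet> \<xi>))) = of_real (K / e ^ DIM('a) * E ((2 * pi / e) *\<^sub>R y))" for y
    proof -
      have "(LINT \<eta>|lborel. complex_of_real (E \<eta>) * cis (\<eta> \<bullet> ((- 2 * pi / e) *\<^sub>R y))) =
          of_real (e ^ DIM('a)) * (LINT \<xi>|lborel. of_real (E (e *\<^sub>R \<xi>)) * cis ((e *\<^sub>R \<xi>) \<bullet> ((- 2 * pi / e) *\<^sub>R y)))"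
        by (rule integral_scale) (use e in measurable)
      also have "(e *\<^sub>R \<xi>) \<bullet> ((- 2 * pi / e) *\<^sub>R y) = - 2 * pi * (y \<bullet> \<xi>)" for \<xi>
        using e by (simp add: inner_commute)
      then have "(\<lambda>\<xi>. complex_of_real (E (e *\<^sub>R \<xi>)) * cis ((e *\<^sub>R \<xi>) \<bullet> ((- 2 * pi / e) *\<^sub>R y))) =
          (\<lambda>\<xi>. of_real (E (e *\<^sub>R \<xi>)) * cis (- 2 * pi * (y \<bullet> \<xi>)))"
        by presburger
      finally have "of_real (e ^ DIM('a)) * (LINT \<xi>|lborel. of_real (E (e *\<^sub>R \<xi>)) * cis (- 2 * pi * (y \<bullet> \<xi>))) =
          complex_of_real (K * E ((- 2 * pi / e) *\<^sub>R y))"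
        unfolding E_def gauss_fourier(2) K_def by simp
      moreover have "E ((- 2 * pi / e) *\<^sub>R y) = E ((2 * pi / e) *\<^sub>R y)" by (simp add: E_def)
      moreover have "complex_of_real (e ^ DIM('a)) \<noteq> 0" using e by simp
      ultimately show ?thesis by (simp add: field_simps)
    qed
    have intEe: "integrable lborel (\<lambda>\<xi>. E (e *\<^sub>R \<xi>))"
    proof -
      have "integrable (distr lborel borel (\<lambda>x. 0 + e *\<^sub>R x)) E"
      proof -
        have "integrable (density (distr lborel borel (\<lambda>x. 0 + e *\<^sub>R x)) (\<lambda>_. ennreal (\<bar>e\<bar> ^ DIM('a)))) E"
          using lborel_affine[of e "0::'a"] e intE by (simp add: ennreal_power)
        then have "integrable (distr lborel borel (\<lambda>x. 0 + e *\<^sub>R x)) (\<lambda>x. (\<bar>e\<bar> ^ DIM('a)) *\<^sub>R E x)"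
          by (subst (asm) integrable_density) auto
        then show ?thesis using e by simp
      qed
      then show ?thesis by (subst (asm) integrable_distr_eq) auto
    qed
    have "(LINT \<xi>|lborel. fourier \<psi> \<xi> * of_real (E (e *\<^sub>R \<xi>))) =
        (LINT \<xi>|lborel. LINT y|lborel. of_real (E (e *\<^sub>R \<xi>)) * (\<psi> y * cis (- 2 * pi * (y \<bullet> \<xi>))))"
      unfolding fourier_def by (simp only: integral_mult_right_zero mult.commute)
    also have "\<dots> = (LINT y|lborel. LINT \<xi>|lborel. of_real (E (e *\<^sub>R \<xi>)) * (\<psi> y * cis (- 2 * pi * (y \<bullet> \<xi>))))"
    proof (rule lborel_pair.Fubini_integral[symmetric])
      show "integrable (lborel \<Otimes>\<^sub>M lborel) (\<lambda>(\<xi>, y). complex_of_real (E (e *\<^sub>R \<xi>)) * (\<psi> y * cis (- 2 * pi * (y \<bullet> \<xi>))))"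
        by (rule integrable_product_bound[OF intEe integrable_norm[OF schwartz_integrable[OF \<psi>]]])
          (measurable, use E01 in \<open>auto simp: norm_mult less_imp_le\<close>)
    qed
    also have "\<dots> = (LINT y|lborel. \<psi> y * (LINT \<xi>|lborel. of_real (E (e *\<^sub>R \<xi>)) * cis (- 2 * pi * (y \<bullet> \<xi>))))"
      unfolding integral_mult_right_zero[symmetric] by (simp only: mult_ac)
    also have "\<dots> = (LINT y|lborel. of_real (K / e ^ DIM('a)) * (\<psi> y * of_real (E ((2 * pi / e) *\<^sub>R y))))"
      unfolding inner by (simp only: of_real_mult mult_ac)
    also have "\<dots> = of_real (K / e ^ DIM('a)) * (LINT y|lborel. \<psi> y * of_real (E ((2 * pi / e) *\<^sub>R y)))"
      by (rule integral_mult_right_zero)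
    also have "(LINT y|lborel. \<psi> y * of_real (E ((2 * pi / e) *\<^sub>R y))) = of_real ((e / (2 * pi)) ^ DIM('a)) *
        (LINT v|lborel. \<psi> ((e / (2 * pi)) *\<^sub>R v) * of_real (E ((2 * pi / e) *\<^sub>R ((e / (2 * pi)) *\<^sub>R v))))"
      by (rule integral_scale) (use e in \<open>measurable, simp\<close>)
    also have "(\<lambda>v. \<psi> ((e / (2 * pi)) *\<^sub>R v) * complex_of_real (E ((2 * pi / e) *\<^sub>R ((e / (2 * pi)) *\<^sub>R v)))) = (\<lambda>v. \<psi> ((e / (2 * pi)) *\<^sub>R v) * of_real (E v))"
      using e by simp
    also have "complex_of_real (K / e ^ DIM('a)) * (of_real ((e / (2 * pi)) ^ DIM('a)) * X) = of_real (K / (2 * pi) ^ DIM('a)) * X" for X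
      unfolding mult.assoc[symmetric] of_real_mult[symmetric] using e by (simp add: power_divide)
    finally show ?thesis .
  qed
  define e where "e n = 1 / real (Suc n)" for n
  have e: "e n > 0" for n by (simp add: e_def)
  have e0: "e \<longlonglongrightarrow> 0" unfolding e_def by (rule LIMSEQ_Suc[OF lim_1_over_n])
  have contE: "isCont E x" for x unfolding E_def by (intro continuous_intros) auto
  have cont\<psi>: "isCont \<psi> x" for x using schwartz_continuous[OF \<psi>] by (simp add: continuous_on_eq_continuous_at)
  have lim: "(\<lambda>n. LINT \<xi>|lborel. fourier \<psi> \<xi> * of_real (E (e n *\<^sub>R \<xi>))) \<longlonglongrightarrow> (LINT \<xi>|lborel. fourier \<psi> \<xi>)"
  proof (rule integral_dominated_convergence[where w="\<lambda>\<xi>. norm (fourier \<psi> \<xi>)"])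
    show "integrable lborel (\<lambda>\<xi>. norm (fourier \<psi> \<xi>))"
      by (intro integrable_norm schwartz_integrable fourier_schwartz \<psi>)
    show "AE x in lborel. (\<lambda>n. fourier \<psi> x * of_real (E (e n *\<^sub>R x))) \<longlonglongrightarrow> fourier \<psi> x"
    proof (rule AE_I2)
      fix x
      have "(\<lambda>n. fourier \<psi> x * of_real (E (e n *\<^sub>R x))) \<longlonglongrightarrow> fourier \<psi> x * of_real (E (0 *\<^sub>R x))"
        by (intro tendsto_mult tendsto_const tendsto_of_real isCont_tendsto_compose[OF contE] tendsto_scaleR e0)
      then show "(\<lambda>n. fourier \<psi> x * of_real (E (e n *\<^sub>R x))) \<longlonglongrightarrow> fourier \<psi> x" by (simp add: E_def)
    qed
    show "AE x in lborel. norm (fourier \<psi> x * of_real (E (e n *\<^sub>R x))) \<le> norm (fourier \<psi> x)" for n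
      using E01 by (intro AE_I2) (simp add: norm_mult less_imp_le mult_left_le)
  qed measurable
  have lim2: "(\<lambda>n. LINT v|lborel. \<psi> ((e n / (2 * pi)) *\<^sub>R v) * of_real (E v)) \<longlonglongrightarrow> (LINT v|lborel. \<psi> 0 * of_real (E v))"
  proof -
    obtain C where C: "C > 0" "\<And>x. (1 + norm x) ^ 0 * cmod (\<psi> x) \<le> C" using rapidE[OF schwartz_rapid[OF \<psi>]] by metis
    show ?thesis
    proof (rule integral_dominated_convergence[where w="\<lambda>v. C * E v"])
      show "integrable lborel (\<lambda>v. C * E v)" by (intro integrable_mult_right intE)
      show "AE x in lborel. (\<lambda>n. \<psi> ((e n / (2 * pi)) *\<^sub>R x) * of_real (E x)) \<longlonglongrightarrow> \<psi> 0 * of_real (E x)"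
      proof (rule AE_I2)
        fix x :: 'a
        have "(\<lambda>n. (e n / (2 * pi)) *\<^sub>R x) \<longlonglongrightarrow> (0 / (2 * pi)) *\<^sub>R x"
          by (intro tendsto_scaleR tendsto_divide tendsto_const e0) simp
        then show "(\<lambda>n. \<psi> ((e n / (2 * pi)) *\<^sub>R x) * of_real (E x)) \<longlonglongrightarrow> \<psi> 0 * of_real (E x)"
          by (intro tendsto_mult tendsto_const isCont_tendsto_compose[OF cont\<psi>]) simp
      qed
      show "AE x in lborel. norm (\<psi> ((e n / (2 * pi)) *\<^sub>R x) * of_real (E x)) \<le> C * E x" for n
        using C E01 by (intro AE_I2) (simp add: norm_mult less_imp_le mult_right_mono)
    qed measurable
  qed
  have EK: "(LINT v|lborel. \<psi> 0 * complex_of_real (E v)) = \<psi> 0 * of_real K"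
    using gauss_fourier(2)[of "0::'a"] unfolding E_def K_def integral_mult_right_zero by simp
  have "K / (2 * pi) ^ DIM('a) * K = 1"
  proof -
    have "K * K = (sqrt (2 * pi) * sqrt (2 * pi)) ^ DIM('a)"
      unfolding K_def by (rule power_mult_distrib[symmetric])
    then have "K * K = (2 * pi) ^ DIM('a)" by simp
    then show ?thesis using pi_gt_zero by (metis divide_self mult_eq_0_iff power_not_zero times_divide_eq_left zero_neq_numeral less_irrefl)
  qed
  then have "complex_of_real (K / (2 * pi) ^ DIM('a)) * of_real K = 1"
    by (simp only: of_real_mult[symmetric] of_real_1)
  then have 1: "complex_of_real (K / (2 * pi) ^ DIM('a)) * (\<psi> 0 * of_real K) = \<psi> 0"
    by (simp only: mult.left_commute[of _ "\<psi> 0"] mult_1_right)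
  have "(\<lambda>n. LINT \<xi>|lborel. fourier \<psi> \<xi> * of_real (E (e n *\<^sub>R \<xi>))) \<longlonglongrightarrow> \<psi> 0"
    unfolding key[OF e] using tendsto_mult_left[OF lim2, of "complex_of_real (K / (2 * pi) ^ DIM('a))"] unfolding EK 1 .
  with lim show ?thesis by (rule LIMSEQ_unique)
qed

text \<open>Translating \<open>\<psi>\<close> moves the point of evaluation to the origin and
  multiplies the transform by the character that the outer integral contains.\<close>

lemma fourier_fourier:
  fixes \<psi> :: "'a::euclidean_space \<Rightarrow> complex"
  assumes \<psi>: "\<psi> \<in> schwartz"
  shows "fourier (fourier \<psi>) x = \<psi> (- x)"
proof -
  have [measurable]: "\<psi> \<in> borel_measurable borel" by (rule schwartz_measurable[OF \<psi>])
  have [measurable]: "cis \<in> borel_measurable borel"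
    by (intro borel_measurable_continuous_onI) (simp add: cis_conv_exp continuous_intros)
  have "fourier (\<lambda>y. \<psi> (y + - x)) \<xi> = fourier \<psi> \<xi> * cis (- 2 * pi * (\<xi> \<bullet> x))" for \<xi>
  proof -
    have "(LINT y|lborel. \<psi> (y + - x) * cis (- 2 * pi * ((y + - x) \<bullet> \<xi>))) = fourier \<psi> \<xi>"
      unfolding fourier_def by (intro integral_translate[of "\<lambda>y. \<psi> y * cis (- 2 * pi * (y \<bullet> \<xi>))"]) measurable
    moreover have "(LINT y|lborel. \<psi> (y + - x) * cis (- 2 * pi * (y \<bullet> \<xi>))) =
        (LINT y|lborel. \<psi> (y + - x) * cis (- 2 * pi * ((y + - x) \<bullet> \<xi>)) * cis (- 2 * pi * (\<xi> \<bullet> x)))"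
      by (simp only: mult.assoc cis_mult) (simp add: inner_diff_left inner_commute algebra_simps)
    ultimately show ?thesis unfolding fourier_def by simp
  qed
  then have "fourier (fourier \<psi>) x = (LINT \<xi>|lborel. fourier (\<lambda>y. \<psi> (y + - x)) \<xi>)"
    by (simp add: fourier_def[of "fourier \<psi>"])
  also have "\<dots> = \<psi> (- x)"
    using fourier_inversion_0[OF schwartz_translate[OF \<psi>, of "- x"]] by simp
  finally show ?thesis .
qed

lemma fourier_reflect:
  fixes \<psi> :: "'a::euclidean_space \<Rightarrow> complex"
  assumes "\<psi> \<in> borel_measurable borel"
  shows "fourier (\<lambda>x. \<psi> (- x)) \<xi> = fourier \<psi> (- \<xi>)"
proof -
  have [measurable]: "\<psi> \<in> borel_measurable borel" by fact
  have [measurable]: "cis \<in> borel_measurable borel"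
    by (intro borel_measurable_continuous_onI) (simp add: cis_conv_exp continuous_intros)
  have "lborel = distr lborel borel (\<lambda>x::'a. - x)"
    using lborel_affine[of "-1" "0::'a"] by (simp add: density_1)
  then have "fourier \<psi> (- \<xi>) = (LINT x|distr lborel borel (\<lambda>x. - x). \<psi> x * cis (- 2 * pi * (x \<bullet> - \<xi>)))"
    unfolding fourier_def by simp
  also have "\<dots> = (LINT x|lborel. \<psi> (- x) * cis (- 2 * pi * (- x \<bullet> - \<xi>)))"
    by (rule integral_distr) measurable
  finally show ?thesis unfolding fourier_def by simp
qed

lemma fourier_surj:
  fixes \<psi> :: "'a::euclidean_space \<Rightarrow> complex"
  assumes \<psi>: "\<psi> \<in> schwartz"
  shows "fourier (\<lambda>x. fourier \<psi> (- x)) = \<psi>"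
  by (rule ext, subst fourier_reflect) (auto simp: fourier_fourier[OF \<psi>] intro!: schwartz_measurable fourier_schwartz \<psi>)

section \<open>Distributions whose Fourier transform is a function\<close>

lemma AE_box_eq_cbox: "AE x in lborel. indicator (box a b) x = (indicator (cbox a b) x :: real)"
proof -
  have "AE x in lborel. x \<notin> cbox a b - box a b"
    by (rule AE_not_in[OF null_sets_cbox_Diff_box])
  then show ?thesis by eventually_elim (use box_subset_cbox[of a b] in \<open>auto simp: indicator_def\<close>)
qed

text \<open>The positive and the negative part of \<open>h\<close> are densities of two measures
  that agree on boxes, an intersection-stable generator of the Borel sets; hence the densities agree
  almost everywhere.\<close>

lemma AE_eq_0_of_boxes:
  fixes h :: "'a::euclidean_space \<Rightarrow> real"
  assumes int: "integrable lborel h" and box: "\<And>a b. (LINT x|lborel. h x * indicator (box a b) x) = 0"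
  shows "AE x in lborel. h x = 0"
proof -
  have [measurable]: "h \<in> borel_measurable borel" using int by auto
  let ?p = "\<lambda>x. ennreal (h x)" and ?m = "\<lambda>x. ennreal (- h x)"
  \<comment> \<open>\<open>ennreal\<close> truncates negative numbers to 0, so \<open>?p\<close> and
    \<open>?m\<close> are the positive and the negative part of \<open>h\<close>.\<close>
  have ennreal_max_0: "ennreal (max 0 r) = ennreal r" for r
    by (cases "r \<ge> 0") (simp_all add: max_def ennreal_neg)
  have em: "emeasure (density lborel (\<lambda>x. ennreal (k x))) B = ennreal (LINT x|lborel. max 0 (k x) * indicator B x)"
    if "integrable lborel k" "B \<in> sets borel" for k B
  proof -
    have [measurable]: "k \<in> borel_measurable borel" "B \<in> sets borel" using that by auto
    have i: "integrable lborel (\<lambda>x. max 0 (k x) * indicator B x)"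
      using integrable_real_mult_indicator[OF _ Bochner_Integration.integrable_max[OF integrable_zero that(1)], of B] by simp
    have "emeasure (density lborel (\<lambda>x. ennreal (k x))) B = (\<integral>\<^sup>+x. ennreal (k x) * indicator B x \<partial>lborel)"
      by (rule emeasure_density) auto
    also have "\<dots> = (\<integral>\<^sup>+x. ennreal (max 0 (k x) * indicator B x) \<partial>lborel)"
      by (intro nn_integral_cong) (simp add: indicator_def ennreal_max_0)
    also have "\<dots> = ennreal (LINT x|lborel. max 0 (k x) * indicator B x)"
      by (rule nn_integral_eq_integral[OF i]) auto
    finally show ?thesis .
  qed
  have "density lborel ?p = density lborel ?m"
  proof (rule measure_eqI_generator_eq)
    let ?E = "range (\<lambda>(a, b). box a b::'a set)"
    show "Int_stable ?E" by (auto simp: Int_stable_def box_Int_box)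
    show "?E \<subseteq> Pow UNIV" "sets (density lborel ?p) = sigma_sets UNIV ?E" "sets (density lborel ?m) = sigma_sets UNIV ?E"
      by (simp_all add: borel_eq_box)
    let ?A = "\<lambda>n::nat. box (- (real n *\<^sub>R One)) (real n *\<^sub>R One) :: 'a set"
    show "range ?A \<subseteq> ?E" "(\<Union>i. ?A i) = UNIV"
      unfolding UN_box_eq_UNIV by auto
    show "emeasure (density lborel ?p) (?A i) \<noteq> \<infinity>" for i
      by (subst em[OF int]) auto
    fix X assume "X \<in> ?E"
    then obtain a b where X: "X = box a b" by auto
    have i: "integrable lborel (\<lambda>x. max 0 (h x) * indicator X x)" "integrable lborel (\<lambda>x. max 0 (- h x) * indicator X x)"
      using integrable_real_mult_indicator[OF _ Bochner_Integration.integrable_max[OF integrable_zero int], of X]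
        integrable_real_mult_indicator[OF _ Bochner_Integration.integrable_max[OF integrable_zero integrable_minus[OF int]], of X]
      by (simp_all add: X)
    have "0 = (LINT x|lborel. max 0 (h x) * indicator X x - max 0 (- h x) * indicator X x)"
      unfolding X by (subst box[symmetric, of a b], rule Bochner_Integration.integral_cong) (auto simp: max_def indicator_def)
    also have "\<dots> = (LINT x|lborel. max 0 (h x) * indicator X x) - (LINT x|lborel. max 0 (- h x) * indicator X x)"
      by (rule Bochner_Integration.integral_diff[OF i])
    finally show "emeasure (density lborel ?p) X = emeasure (density lborel ?m) X"
      using em[OF int, of X] em[OF integrable_minus[OF int], of X] X by simp
  qed
  then have "AE x in lborel. ?p x = ?m x" by (subst (asm) sigma_finite_measure.density_unique_iff[OF sigma_finite_lborel]) auto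
  then show ?thesis by eventually_elim (smt (verit) ennreal_eq_0_iff)
qed

text \<open>Bumps decreasing to the indicator of a box carry the hypothesis over from test functions
  to boxes; the real and imaginary parts are then covered by
  \<open>AE_eq_0_of_boxes\<close>.\<close>

lemma AE_eq_0_of_schwartz:
  fixes g :: "'a::euclidean_space \<Rightarrow> complex"
  assumes m: "g \<in> borel_measurable borel" and int: "\<And>\<psi>. \<psi> \<in> schwartz \<Longrightarrow> integrable lborel (\<lambda>x. g x * \<psi> x)"
    and 0: "\<And>\<psi>. \<psi> \<in> schwartz \<Longrightarrow> (LINT x|lborel. g x * \<psi> x) = 0"
  shows "AE x in lborel. g x = 0"
proof -
  have cbox: "integrable lborel (\<lambda>x. g x * indicator (cbox a b) x)" "(LINT x|lborel. g x * indicator (cbox a b) x) = 0" for a b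
  proof -
    have "integrable lborel (\<lambda>x. g x * indicator (cbox a b) x) \<and> (LINT x|lborel. g x * indicator (cbox a b) x) = 0"
    proof (cases "cbox a b = {}")
      case False
      then have ab: "\<And>i. i \<in> Basis \<Longrightarrow> a \<bullet> i \<le> b \<bullet> i" by (simp add: box_ne_empty)
      have "\<exists>f. \<forall>n. (\<lambda>x. complex_of_real (f n x)) \<in> schwartz \<and> (\<forall>x. 0 \<le> f n x \<and> f n x \<le> 1) \<and> (\<forall>x\<in>cbox a b. f n x = 1) \<and>
        (\<forall>x. x \<notin> cbox (a - (1 / real (Suc n)) *\<^sub>R One) (b + (1 / real (Suc n)) *\<^sub>R One) \<longrightarrow> f n x = 0)"
        using bump_exists[OF ab] by (intro choice allI) simp
      then obtain f where f: "\<And>n. (\<lambda>x. complex_of_real (f n x)) \<in> schwartz" "\<And>n x. 0 \<le> f n x \<and> f n x \<le> 1"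
        "\<And>n x. x \<in> cbox a b \<Longrightarrow> f n x = 1"
        "\<And>n x. x \<notin> cbox (a - (1 / real (Suc n)) *\<^sub>R One) (b + (1 / real (Suc n)) *\<^sub>R One) \<Longrightarrow> f n x = 0"
        by blast
      \<comment> \<open>All bumps \<open>f n\<close> live in the box enlarged by 1, since
        \<open>1 / Suc n \<le> 1\<close>. The single bump \<open>F\<close> therefore dominates them,
        and \<open>g * F\<close> is integrable by hypothesis.\<close>
      have "\<And>i. i \<in> Basis \<Longrightarrow> (a - One) \<bullet> i \<le> (b + One) \<bullet> i" using ab by (fastforce simp: inner_simps)
      from bump_exists[OF this, of 1]
      obtain F where F: "(\<lambda>x. complex_of_real (F x)) \<in> schwartz" "\<And>x. 0 \<le> F x"  "\<And>x. x \<in> cbox (a - One) (b + One) \<Longrightarrow> F x = 1"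
        by auto
      have fF: "f n x \<le> F x" for n x
      proof (cases "x \<in> cbox (a - One) (b + One)")
        case True then show ?thesis using F(3) f(2) by simp
      next
        case False
        have "cbox (a - (1 / real (Suc n)) *\<^sub>R One) (b + (1 / real (Suc n)) *\<^sub>R One) \<subseteq> cbox (a - One) (b + One)"
          by (rule subset_box_imp) (auto simp: inner_simps)
        then have "f n x = 0" using f(4) False by blast
        then show ?thesis using F(2) by simp
      qed
      have lim: "(\<lambda>n. f n x) \<longlonglongrightarrow> indicator (cbox a b) x" for x
      proof (cases "x \<in> cbox a b")
        case True then show ?thesis using f(3) by simp
      next
        case False
        then obtain i where i: "i \<in> Basis" "x \<bullet> i < a \<bullet> i \<or> b \<bullet> i < x \<bullet> i" unfolding mem_box by force
        define d where "d = max (a \<bullet> i - x \<bullet> i) (x \<bullet> i - b \<bullet> i)"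
        have "d > 0" using i by (auto simp: d_def)
        then obtain N where N: "N > 0" "1 / real N < d" by (metis real_arch_inverse inverse_eq_divide gr0I of_nat_0_less_iff)
        have "f n x = 0" if "n \<ge> N" for n
        proof (rule f(4))
          have "1 / real (Suc n) \<le> 1 / real N" using that N by (intro divide_left_mono) auto
          then have "1 / real (Suc n) < d" using N by linarith
          then show "x \<notin> cbox (a - (1 / real (Suc n)) *\<^sub>R One) (b + (1 / real (Suc n)) *\<^sub>R One)"
            using i unfolding mem_box d_def by (auto intro!: bexI[of _ i] simp: inner_simps max_def split: if_splits)
        qed
        then have "eventually (\<lambda>n. f n x = 0) sequentially" unfolding eventually_sequentially by blast
        then show ?thesis using False by (simp add: tendsto_eventually)
      qed
      have gF: "integrable lborel (\<lambda>x. norm (g x * of_real (F x)))" by (intro integrable_norm int F)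
      have [measurable]: "g \<in> borel_measurable borel" by fact
      have [measurable]: "(\<lambda>x. complex_of_real (f n x)) \<in> borel_measurable borel" for n by (rule schwartz_measurable[OF f(1)])
      have L: "AE x in lborel. (\<lambda>n. g x * complex_of_real (f n x)) \<longlonglongrightarrow> g x * indicator (cbox a b) x"
      proof (rule AE_I2)
        fix x
        have "(\<lambda>n. g x * of_real (f n x)) \<longlonglongrightarrow> g x * of_real (indicator (cbox a b) x)"
          by (intro tendsto_mult tendsto_const tendsto_of_real lim)
        then show "(\<lambda>n. g x * of_real (f n x)) \<longlonglongrightarrow> g x * indicator (cbox a b) x" by (simp add: of_real_indicator)
      qed
      have B: "AE x in lborel. norm (g x * complex_of_real (f n x)) \<le> norm (g x * of_real (F x))" for n
        using fF f(2) F(2) by (intro AE_I2) (simp add: norm_mult mult_left_mono)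
      have "integrable lborel (\<lambda>x. g x * indicator (cbox a b) x)"
        by (rule integrable_dominated_convergence[OF _ _ gF L B]) measurable
      moreover have "(\<lambda>n. LINT x|lborel. g x * of_real (f n x)) \<longlonglongrightarrow> (LINT x|lborel. g x * indicator (cbox a b) x)"
        by (rule integral_dominated_convergence[OF _ _ gF L B]) measurable
      then have "(LINT x|lborel. g x * indicator (cbox a b) x) = 0"
        unfolding 0[OF f(1)] by (simp add: LIMSEQ_const_iff)
      ultimately show ?thesis by blast
    qed simp
    then show "integrable lborel (\<lambda>x. g x * indicator (cbox a b) x)" "(LINT x|lborel. g x * indicator (cbox a b) x) = 0" by auto
  qed
  \<comment> \<open>As \<open>g\<close> is known to be integrable on bounded boxes only, it is cut
    off at \<open>cbox c d\<close>. Integrals over further boxes then concern intersections, which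
    are closed boxes up to null sets.\<close>
  have part: "AE x in lborel. P (g x * indicator (cbox c d) x) = 0" if P: "bounded_linear P" for P :: "complex \<Rightarrow> real" and c d
  proof (rule AE_eq_0_of_boxes)
    interpret P: bounded_linear P by fact
    show "integrable lborel (\<lambda>x. P (g x * indicator (cbox c d) x))" by (rule integrable_bounded_linear[OF P cbox(1)])
    fix a b
    obtain l u where lu: "cbox c d \<inter> cbox a b = cbox l (u::'a)" using Int_interval[of c d a b] by blast
    have [measurable]: "g \<in> borel_measurable borel" by fact
    have [measurable]: "P \<in> borel_measurable borel"
      by (intro borel_measurable_continuous_onI linear_continuous_on P)
    have "(LINT x|lborel. P (g x * indicator (cbox c d) x) * indicator (box a b) x) =
        (LINT x|lborel. P (g x * indicator (cbox c d) x) * indicator (cbox a b) x)"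
    proof (rule integral_cong_AE)
      show "AE x in lborel. P (g x * indicator (cbox c d) x) * indicator (box a b) x = P (g x * indicator (cbox c d) x) * indicator (cbox a b) x"
        using AE_box_eq_cbox[of a b] by eventually_elim simp
    qed measurable
    also have "\<dots> = (LINT x|lborel. P (g x * indicator (cbox l u) x))"
      by (rule Bochner_Integration.integral_cong) (auto simp: indicator_def lu[symmetric] P.zero)
    also have "\<dots> = P (LINT x|lborel. g x * indicator (cbox l u) x)"
      by (rule integral_bounded_linear[OF P cbox(1)])
    finally show "(LINT x|lborel. P (g x * indicator (cbox c d) x) * indicator (box a b) x) = 0"
      by (simp add: cbox(2) P.zero)
  qed
  have "AE x in lborel. g x * indicator (cbox c d) x = 0" for c d
    using part[OF bounded_linear_Re, of c d] part[OF bounded_linear_Im, of c d]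
    by eventually_elim (simp add: complex_eq_iff)
  then have "AE x in lborel. \<forall>n::nat. g x * indicator (cbox (- (real n *\<^sub>R One)) (real n *\<^sub>R One)) x = 0"
    unfolding AE_all_countable by blast
  then show ?thesis
  proof eventually_elim
    case (elim x)
    have "x \<in> (\<Union>n::nat. box (- (real n *\<^sub>R One)) (real n *\<^sub>R One))" unfolding UN_box_eq_UNIV by simp
    then obtain n where "x \<in> box (- (real n *\<^sub>R One)) (real n *\<^sub>R One)" by blast
    then have "x \<in> cbox (- (real n *\<^sub>R One)) (real n *\<^sub>R One)" using box_subset_cbox by blast
    moreover have "g x * indicator (cbox (- (real n *\<^sub>R One)) (real n *\<^sub>R One)) x = 0" using elim by blast
    ultimately show ?case by simp
  qed
qed

lemma represents_unique:
  fixes g h :: "'a::euclidean_space \<Rightarrow> complex"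
  assumes "represents g T" "represents h T" shows "AE x in lborel. g x = h x"
proof -
  have "AE x in lborel. g x - h x = 0"
  proof (rule AE_eq_0_of_schwartz)
    fix \<psi> :: "'a \<Rightarrow> complex" assume "\<psi> \<in> schwartz"
    then have i: "integrable lborel (\<lambda>x. g x * \<psi> x)" "integrable lborel (\<lambda>x. h x * \<psi> x)"
      "(LINT x|lborel. g x * \<psi> x) = (LINT x|lborel. h x * \<psi> x)"
      using assms unfolding represents_def by metis+
    show "integrable lborel (\<lambda>x. (g x - h x) * \<psi> x)" "(LINT x|lborel. (g x - h x) * \<psi> x) = 0"
      unfolding left_diff_distrib using i by simp_all
  qed (use assms in \<open>auto simp: represents_def\<close>)
  then show ?thesis by simp
qed

lemma represents_cong_AE:
  assumes "represents g T" "h \<in> borel_measurable lborel" "AE x in lborel. g x = h x"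
  shows "represents h T"
  unfolding represents_def
proof (intro conjI assms(2) ballI)
  fix \<psi> :: "'a \<Rightarrow> complex" assume \<psi>: "\<psi> \<in> schwartz"
  have [measurable]: "g \<in> borel_measurable lborel" "h \<in> borel_measurable lborel" "\<psi> \<in> borel_measurable lborel"
    using assms schwartz_measurable[OF \<psi>] by (auto simp: represents_def)
  have ae: "AE x in lborel. g x * \<psi> x = h x * \<psi> x" using assms(3) by eventually_elim simp
  have "integrable lborel (\<lambda>x. g x * \<psi> x)" "T \<psi> = (LINT x|lborel. g x * \<psi> x)"
    using assms(1) \<psi> by (auto simp: represents_def)
  then show "integrable lborel (\<lambda>x. h x * \<psi> x)" "T \<psi> = (LINT x|lborel. h x * \<psi> x)"
    using integrable_cong_AE[OF _ _ ae] integral_cong_AE[OF _ _ ae] by simp_all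
qed

lemma fhat_represents:
  assumes "\<exists>g. represents g (fourier_distr T)"
  shows "represents (fhat T) (fourier_distr T)"
    and "(\<exists>h. continuous_on UNIV h \<and> represents h (fourier_distr T)) \<Longrightarrow> continuous_on UNIV (fhat T)"
proof -
  let ?P = "\<lambda>g. represents g (fourier_distr T) \<and>
     ((\<exists>h. continuous_on UNIV h \<and> represents h (fourier_distr T)) \<longrightarrow> continuous_on UNIV g)"
  \<comment> \<open>A continuous representative is a witness if there is one; otherwise the
    implication is vacuous and any representative will do.\<close>
  have "\<exists>g. ?P g" using assms by blast
  then have "?P (fhat T)" unfolding fhat_def by (rule someI_ex)
  then show "represents (fhat T) (fourier_distr T)"
    "(\<exists>h. continuous_on UNIV h \<and> represents h (fourier_distr T)) \<Longrightarrow> continuous_on UNIV (fhat T)" by auto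
qed

lemma fhat_AE_eq:
  assumes "represents g (fourier_distr T)" shows "AE x in lborel. fhat T x = g x"
  using represents_unique fhat_represents(1) assms by blast

lemma fhat_measurable:
  assumes "represents g (fourier_distr T)" shows "fhat T \<in> borel_measurable borel"
  using fhat_represents(1)[of T] assms unfolding represents_def by auto

text \<open>The set where the functions agree is closed and has full measure, hence is the whole
  space.\<close>

lemma continuous_AE_eq:
  fixes f g :: "'a::euclidean_space \<Rightarrow> complex"
  assumes "continuous_on UNIV f" "continuous_on UNIV g" "AE x in lborel. f x = g x"
  shows "f = g"
proof
  fix x
  have "closed {x. f x = g x}" by (rule closed_Collect_eq[OF assms(1,2)])
  moreover have "AE x in lebesgue. x \<in> {x. f x = g x}" using AE_completion[OF assms(3)] by simp
  ultimately show "f x = g x" using mem_closed_if_AE_lebesgue by blast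
qed

lemma fhat_eq_continuous:
  assumes "represents g (fourier_distr T)" "continuous_on UNIV g"
  shows "fhat T = g"
  using assms fhat_represents(2)[of T] fhat_AE_eq[OF assms(1)] by (intro continuous_AE_eq) auto

text \<open>Every Schwartz function is a Fourier transform by \<open>fourier_surj\<close>, so a
  distribution is determined by its transform; outside the Schwartz space both functionals are
  0.\<close>

lemma fourier_distr_inj:
  fixes T T' :: "'a::euclidean_space distr"
  assumes "\<And>\<psi>. \<psi> \<notin> schwartz \<Longrightarrow> T \<psi> = 0" "\<And>\<psi>. \<psi> \<notin> schwartz \<Longrightarrow> T' \<psi> = 0"
    and "represents g (fourier_distr T)" "represents g' (fourier_distr T')" "AE x in lborel. g x = g' x"
  shows "T = T'"
proof
  fix \<psi> :: "'a \<Rightarrow> complex"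
  show "T \<psi> = T' \<psi>"
  proof (cases "\<psi> \<in> schwartz")
    case True
    define \<eta> where "\<eta> = (\<lambda>x. fourier \<psi> (- x))"
    have \<eta>: "\<eta> \<in> schwartz" "fourier \<eta> = \<psi>"
      unfolding \<eta>_def using fourier_surj[OF True] by (auto intro!: schwartz_reflect fourier_schwartz True)
    have "g' \<in> borel_measurable lborel" using assms(4) by (simp add: represents_def)
    from represents_cong_AE[OF assms(3) this assms(5)]
    have "fourier_distr T \<eta> = fourier_distr T' \<eta>"
      using assms(4) \<eta>(1) unfolding represents_def by metis
    then show ?thesis using \<eta> by (simp add: fourier_distr_def)
  qed (use assms in simp)
qed

section \<open>Sobolev spaces\<close>

lemma measurable_cis [measurable]: "cis \<in> borel_measurable borel"
  by (intro borel_measurable_continuous_onI) (simp add: cis_conv_exp continuous_intros)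

abbreviation weight :: "real \<Rightarrow> 'a::real_normed_vector \<Rightarrow> real" where
  "weight t x \<equiv> (1 + (norm x)\<^sup>2) powr t"

text \<open>The case of exponent 1 of Peetre's inequality.\<close>

lemma weight_le: "1 + (norm x)\<^sup>2 \<le> 2 * (1 + (norm y)\<^sup>2) * (1 + (norm (x - y))\<^sup>2)"
proof -
  have "norm x \<le> norm y + norm (x - y)" by (metis add.commute diff_add_cancel norm_triangle_ineq)
  then have "(norm x)\<^sup>2 \<le> (norm y + norm (x - y))\<^sup>2" by (intro power_mono) auto
  also have "\<dots> \<le> 2 * (norm y)\<^sup>2 + 2 * (norm (x - y))\<^sup>2"
    using sum_squares_bound[of "norm y" "norm (x - y)"] by (simp add: power2_sum)
  finally have 1: "(norm x)\<^sup>2 \<le> 2 * (norm y)\<^sup>2 + 2 * (norm (x - y))\<^sup>2" .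
  have "0 \<le> (norm y)\<^sup>2 * (norm (x - y))\<^sup>2" by simp
  moreover have "2 * (1 + (norm y)\<^sup>2) * (1 + (norm (x - y))\<^sup>2) = 2 + 2 * (norm y)\<^sup>2 + 2 * (norm (x - y))\<^sup>2 + 2 * ((norm y)\<^sup>2 * (norm (x - y))\<^sup>2)"
    by (simp add: algebra_simps)
  ultimately show ?thesis using 1 by linarith
qed

text \<open>Peetre's inequality. For a negative exponent the inequality for \<open>- t\<close> is
  used with \<open>x\<close> and \<open>y\<close> interchanged, and is then divided by the
  weights.\<close>

lemma weight_powr_le:
  "weight t x \<le> 2 powr \<bar>t\<bar> * weight t y * weight (\<bar>t\<bar>) (x - y)"
proof (cases "t \<ge> 0")
  case True
  have "weight t x \<le> (2 * (1 + (norm y)\<^sup>2) * (1 + (norm (x - y))\<^sup>2)) powr t"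
    by (rule powr_mono2[OF True _ weight_le]) simp
  then show ?thesis using True by (simp only: powr_mult abs_of_nonneg)
next
  case False
  then have t: "\<bar>t\<bar> = - t" by simp
  have pos: "0 < 1 + (norm z)\<^sup>2" for z :: 'a by (simp add: add_pos_nonneg)
  have "weight (- t) y \<le> (2 * (1 + (norm x)\<^sup>2) * (1 + (norm (y - x))\<^sup>2)) powr (- t)"
    by (rule powr_mono2[OF _ _ weight_le]) (use False in auto)
  then have *: "weight (- t) y \<le> 2 powr (- t) * weight (- t) x * weight (- t) (x - y)"
    by (simp only: powr_mult norm_minus_commute)
  have "weight t x = weight t x * weight t y * weight (- t) y"
    using pos[of y] by (simp add: powr_minus)
  also have "\<dots> \<le> weight t x * weight t y * (2 powr (- t) * weight (- t) x * weight (- t) (x - y))"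
    by (rule mult_left_mono[OF *]) simp
  also have "\<dots> = (weight t x * weight (- t) x) * (2 powr (- t) * weight t y * weight (- t) (x - y))"
    by (simp only: mult_ac)
  also have "weight t x * weight (- t) x = 1"
    using pos[of x] by (simp add: powr_minus)
  finally show ?thesis unfolding t by simp
qed

lemma weight_powr_poly: "weight t x \<le> (1 + norm x) ^ (2 * nat \<lceil>\<bar>t\<bar>\<rceil>)"
proof -
  have "weight t x \<le> (1 + (norm x)\<^sup>2) powr real (nat \<lceil>\<bar>t\<bar>\<rceil>)"
  proof (rule powr_mono)
    have "t \<le> real_of_int \<lceil>\<bar>t\<bar>\<rceil>" using le_of_int_ceiling[of "\<bar>t\<bar>"] abs_ge_self[of t] by linarith
    then show "t \<le> real (nat \<lceil>\<bar>t\<bar>\<rceil>)" by simp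
  qed simp
  also have "\<dots> = (1 + (norm x)\<^sup>2) ^ nat \<lceil>\<bar>t\<bar>\<rceil>" by (rule powr_realpow) (simp add: add_pos_nonneg)
  also have "\<dots> \<le> ((1 + norm x)\<^sup>2) ^ nat \<lceil>\<bar>t\<bar>\<rceil>" by (rule power_mono) (auto simp: power2_sum)
  finally show ?thesis by (simp add: power_mult)
qed

lemma norm_shift_le: "1 + norm x \<le> (1 + norm (x - y)) * (1 + norm y)"
  using norm_triangle_ineq[of "x - y" y] by (simp add: algebra_simps) (smt (verit) norm_ge_zero mult_nonneg_nonneg)

text \<open>With \<open>k\<close> at least \<open>|t|\<close>, the inverse weight is at most
  \<open>(1 + norm \<xi>) ^ (2 * k)\<close>. The quotient is then at most a product
  \<open>a * b\<close>, where \<open>a^2\<close> is the given integrand and \<open>b^2\<close> is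
  the function of \<open>integrable_weight\<close>; finally
  \<open>a * b \<le> a^2 + b^2\<close>.\<close>

lemma weighted_L2_decay:
  fixes g :: "'a::euclidean_space \<Rightarrow> complex"
  assumes m: "g \<in> borel_measurable borel" and i: "integrable lborel (\<lambda>\<xi>. (cmod (g \<xi>))\<^sup>2 * weight t \<xi>)"
  shows "\<exists>N. integrable lborel (\<lambda>\<xi>. cmod (g \<xi>) / (1 + norm \<xi>) ^ N)"
proof -
  define k where "k = nat \<lceil>\<bar>t\<bar>\<rceil>"
  have [measurable]: "g \<in> borel_measurable borel" by fact
  have "integrable lborel (\<lambda>\<xi>. cmod (g \<xi>) / (1 + norm \<xi>) ^ (k + DIM('a)))"
  proof (rule Bochner_Integration.integrable_bound)
    show "integrable lborel (\<lambda>\<xi>. (cmod (g \<xi>))\<^sup>2 * weight t \<xi> + 1 / (1 + norm \<xi>) ^ (2 * DIM('a)))"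
      by (intro Bochner_Integration.integrable_add i integrable_weight)
    have "cmod (g \<xi>) / (1 + norm \<xi>) ^ (k + DIM('a)) \<le> (cmod (g \<xi>))\<^sup>2 * weight t \<xi> + 1 / (1 + norm \<xi>) ^ (2 * DIM('a))" for \<xi>
    proof -
      define W where "W = weight t \<xi>"
      define P where "P = 1 + norm \<xi>"
      have pos: "W > 0" "P > 0" 
        using add_pos_nonneg[of 1 "(norm \<xi>)\<^sup>2"] add_pos_nonneg[of 1 "norm \<xi>"] by (auto simp: W_def P_def)
      have "W * P ^ (2 * k) \<ge> 1"
      proof -
        have "weight (- t) \<xi> \<le> P ^ (2 * k)" using weight_powr_poly[of \<xi> "- t"] by (simp add: P_def k_def)
        then have "inverse W \<le> P ^ (2 * k)" by (simp add: W_def powr_minus)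
        then show ?thesis using pos by (simp add: field_simps)
      qed
      define a where "a = cmod (g \<xi>) * sqrt W" 
      define b where "b = 1 / P ^ DIM('a)"
      have "1 / P ^ k \<le> sqrt W"
      proof -
        have "sqrt (1 / P ^ (2 * k)) \<le> sqrt W" using \<open>W * P ^ (2 * k) \<ge> 1\<close> pos by (intro real_sqrt_le_mono) (simp add: field_simps)
        then show ?thesis using pos by (simp add: power_even_eq real_sqrt_divide)
      qed
      then have "cmod (g \<xi>) / P ^ (k + DIM('a)) \<le> a * b"
        using mult_left_mono[of "1 / P ^ k" "sqrt W" "cmod (g \<xi>) / P ^ DIM('a)"] pos
        by (simp add: a_def b_def power_add mult_ac)
      also have "a * b \<le> a\<^sup>2 + b\<^sup>2" using sum_squares_bound[of a b] zero_le_power2[of a] zero_le_power2[of b] by linarith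
      also have "a\<^sup>2 = (cmod (g \<xi>))\<^sup>2 * W" using pos by (simp add: a_def power_mult_distrib)
      also have "b\<^sup>2 = 1 / P ^ (2 * DIM('a))" by (simp add: b_def power_divide power_mult[symmetric] mult.commute)
      finally show ?thesis unfolding P_def W_def .
    qed
    then show "AE x in lborel. norm (cmod (g x) / (1 + norm x) ^ (k + DIM('a))) \<le>
        norm ((cmod (g x))\<^sup>2 * weight t x + 1 / (1 + norm x) ^ (2 * DIM('a)))"
      by (intro AE_I2) (simp add: order_trans[OF _ abs_ge_self])
  qed measurable
  then show ?thesis by blast
qed

text \<open>The second bound is linear in \<open>C\<close>. With a multiple of a Schwartz seminorm
  for \<open>C\<close> it becomes the continuity estimate of a tempered distribution.\<close>

lemma decay_rapid_integrable:
  fixes g \<psi> :: "'a::euclidean_space \<Rightarrow> complex"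
  assumes m: "g \<in> borel_measurable borel" and i: "integrable lborel (\<lambda>\<xi>. cmod (g \<xi>) / (1 + norm \<xi>) ^ N)"
    and \<psi>: "\<psi> \<in> borel_measurable borel" and C: "\<And>x. (1 + norm x) ^ N * cmod (\<psi> x) \<le> C"
  shows "integrable lborel (\<lambda>\<xi>. g \<xi> * \<psi> \<xi>)"
    and "cmod (LINT \<xi>|lborel. g \<xi> * \<psi> \<xi>) \<le> (LINT \<xi>|lborel. cmod (g \<xi>) / (1 + norm \<xi>) ^ N) * C"
proof -
  have b: "cmod (g x * \<psi> x) \<le> cmod (g x) / (1 + norm x) ^ N * C" for x
    using mult_left_mono[OF rapid_bound[OF C[of x]] norm_ge_zero[of "g x"]] by (simp add: norm_mult)
  show int: "integrable lborel (\<lambda>\<xi>. g \<xi> * \<psi> \<xi>)"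
    by (rule Bochner_Integration.integrable_bound[OF integrable_mult_left[OF i, of C]])
      (use m \<psi> order_trans[OF b abs_ge_self] in \<open>simp_all only: measurable_lborel1 borel_measurable_times real_norm_def, auto\<close>)
  have "cmod (LINT \<xi>|lborel. g \<xi> * \<psi> \<xi>) \<le> (LINT \<xi>|lborel. cmod (g \<xi> * \<psi> \<xi>))" by (rule integral_norm_bound)
  also have "\<dots> \<le> (LINT \<xi>|lborel. cmod (g \<xi>) / (1 + norm \<xi>) ^ N * C)"
    by (intro integral_mono integrable_norm int integrable_mult_left i b)
  finally show "cmod (LINT \<xi>|lborel. g \<xi> * \<psi> \<xi>) \<le> (LINT \<xi>|lborel. cmod (g \<xi>) / (1 + norm \<xi>) ^ N) * C"
    by (simp only: integral_mult_left_zero)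
qed

text \<open>The distribution whose transform is \<open>g\<close>: since
  \<open>fourier \<psi> (- \<xi>)\<close> is the inverse transform of \<open>\<psi>\<close>, this is
  integration of \<open>g\<close> against inverse transforms.\<close>

definition inv_fourier_distr :: "('a::euclidean_space \<Rightarrow> complex) \<Rightarrow> 'a distr" where
  "inv_fourier_distr g \<psi> = (if \<psi> \<in> schwartz then LINT \<xi>|lborel. g \<xi> * fourier \<psi> (- \<xi>) else 0)"

lemma inv_fourier_distr_represents:
  fixes g :: "'a::euclidean_space \<Rightarrow> complex"
  assumes m: "g \<in> borel_measurable borel" and i: "integrable lborel (\<lambda>\<xi>. cmod (g \<xi>) / (1 + norm \<xi>) ^ N)"
  shows "represents g (fourier_distr (inv_fourier_distr g))" (is ?R)
    and "inv_fourier_distr g \<in> tempered" (is ?T)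
proof -
  have int: "integrable lborel (\<lambda>\<xi>. g \<xi> * \<psi> \<xi>)" if "\<psi> \<in> schwartz" for \<psi>
    using decay_rapid_integrable(1)[OF m i schwartz_measurable[OF that]] schwartz_rapid[OF that] unfolding rapid_def by blast
  show ?R
    unfolding represents_def using m int
    by (auto simp: fourier_distr_def inv_fourier_distr_def fourier_schwartz fourier_fourier)
  have refl: "(\<lambda>\<xi>. fourier \<psi> (- \<xi>)) \<in> schwartz" if "\<psi> \<in> schwartz" for \<psi> :: "'a \<Rightarrow> complex"
    by (intro schwartz_reflect fourier_schwartz that)
  obtain M C where MC: "\<And>\<psi> \<xi>. \<psi> \<in> schwartz \<Longrightarrow> (1 + norm (\<xi>::'a)) ^ N * cmod (fourier \<psi> \<xi>) \<le> C * schwartz_seminorm M \<psi>"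
    using fourier_decay by metis
  have bound: "cmod (inv_fourier_distr g \<psi>) \<le> ((LINT \<xi>|lborel. cmod (g \<xi>) / (1 + norm \<xi>) ^ N) * C) * schwartz_seminorm M \<psi>" if "\<psi> \<in> schwartz" for \<psi>
  proof -
    have "(1 + norm \<xi>) ^ N * cmod (fourier \<psi> (- \<xi>)) \<le> C * schwartz_seminorm M \<psi>" for \<xi>
      using MC[OF that, of "- \<xi>"] by simp
    from decay_rapid_integrable(2)[OF m i schwartz_measurable[OF refl[OF that]] this] show ?thesis
      using that by (simp add: inv_fourier_distr_def mult.assoc)
  qed
  show ?T
    unfolding tempered_def mem_Collect_eq
  proof (intro conjI allI ballI impI)
    show "inv_fourier_distr g \<psi> = 0" if "\<psi> \<notin> schwartz" for \<psi> using that by (simp add: inv_fourier_distr_def)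
    show "inv_fourier_distr g (\<lambda>x. \<psi> x + \<eta> x) = inv_fourier_distr g \<psi> + inv_fourier_distr g \<eta>" if "\<psi> \<in> schwartz" "\<eta> \<in> schwartz" for \<psi> \<eta>
      using that int[OF refl] by (simp add: inv_fourier_distr_def schwartz_add fourier_add distrib_left)
    show "inv_fourier_distr g (\<lambda>x. c * \<psi> x) = c * inv_fourier_distr g \<psi>" if "\<psi> \<in> schwartz" for c \<psi>
      using that by (simp add: inv_fourier_distr_def schwartz_cmult fourier_cmult mult.left_commute)
    show "\<exists>N C. \<forall>\<psi>\<in>schwartz. cmod (inv_fourier_distr g \<psi>) \<le> C * schwartz_seminorm N \<psi>" using bound by blast
  qed
qed

lemma sobolevD:
  assumes "f \<in> sobolev t"
  shows "f \<in> tempered" "represents (fhat f) (fourier_distr f)" "fhat f \<in> borel_measurable borel"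
    "integrable lborel (\<lambda>\<xi>. (cmod (fhat f \<xi>))\<^sup>2 * weight t \<xi>)"
  using assms fhat_represents(1) fhat_measurable unfolding sobolev_def by auto

lemma sobolevI:
  assumes "T \<in> tempered" "represents g (fourier_distr T)" "integrable lborel (\<lambda>\<xi>. (cmod (g \<xi>))\<^sup>2 * weight t \<xi>)"
  shows "T \<in> sobolev t"
proof -
  have [measurable]: "fhat T \<in> borel_measurable borel" "g \<in> borel_measurable borel"
    using fhat_measurable[OF assms(2)] assms(2) by (auto simp: represents_def)
  have "AE \<xi> in lborel. (cmod (g \<xi>))\<^sup>2 * weight t \<xi> = (cmod (fhat T \<xi>))\<^sup>2 * weight t \<xi>"
    using fhat_AE_eq[OF assms(2)] by eventually_elim simp
  then have "integrable lborel (\<lambda>\<xi>. (cmod (fhat T \<xi>))\<^sup>2 * weight t \<xi>)"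
    using assms(3) by (subst (asm) integrable_cong_AE) auto
  then show ?thesis using assms unfolding sobolev_def by blast
qed

lemma sobolev_exists:
  fixes g :: "'a::euclidean_space \<Rightarrow> complex"
  assumes m: "g \<in> borel_measurable borel" and i: "integrable lborel (\<lambda>\<xi>. (cmod (g \<xi>))\<^sup>2 * weight t \<xi>)"
  shows "inv_fourier_distr g \<in> sobolev t" "represents g (fourier_distr (inv_fourier_distr g))"
proof -
  obtain N where N: "integrable lborel (\<lambda>\<xi>. cmod (g \<xi>) / (1 + norm \<xi>) ^ N)" using weighted_L2_decay[OF m i] by blast
  show "represents g (fourier_distr (inv_fourier_distr g))" by (rule inv_fourier_distr_represents(1)[OF m N])
  then show "inv_fourier_distr g \<in> sobolev t" by (rule sobolevI[OF inv_fourier_distr_represents(2)[OF m N] _ i])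
qed

section \<open>Tempered distributions and their supports\<close>

lemma temperedD:
  assumes "T \<in> tempered"
  shows "\<psi> \<notin> schwartz \<Longrightarrow> T \<psi> = 0"
    and "\<psi> \<in> schwartz \<Longrightarrow> \<eta> \<in> schwartz \<Longrightarrow> T (\<lambda>x. \<psi> x + \<eta> x) = T \<psi> + T \<eta>"
    and "\<psi> \<in> schwartz \<Longrightarrow> T (\<lambda>x. c * \<psi> x) = c * T \<psi>"
  using assms unfolding tempered_def by auto

lemma tempered_diff:
  assumes "T \<in> tempered" "\<psi> \<in> schwartz" "\<eta> \<in> schwartz"
  shows "T (\<lambda>x. \<psi> x - \<eta> x) = T \<psi> - T \<eta>"
  using temperedD(2)[OF assms(1,2) schwartz_cmult[OF assms(3), of "-1"]] temperedD(3)[OF assms(1,3), of "-1"] by simp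

lemma local_bump:
  fixes U :: "'a::euclidean_space set"
  assumes "open U" "x \<in> U"
  shows "\<exists>V \<eta>. open V \<and> x \<in> V \<and> \<eta> \<in> schwartz \<and> (\<forall>y\<in>V. \<eta> y = (1::complex)) \<and>
    (\<exists>K. compact K \<and> K \<subseteq> U \<and> (\<forall>y. y \<notin> K \<longrightarrow> \<eta> y = 0))"
proof -
  obtain e where e: "e > 0" "ball x e \<subseteq> U" using assms open_contains_ball by blast
  \<comment> \<open>The outer box reaches \<open>2 * d\<close> in every coordinate, hence has
    l1-radius \<open>e / 2\<close>, and so fits into the ball.\<close>
  define d where "d = e / (4 * DIM('a))"
  have d: "d > 0" using e by (simp add: d_def)
  have "\<And>i. i \<in> Basis \<Longrightarrow> (x - d *\<^sub>R One) \<bullet> i \<le> (x + d *\<^sub>R One) \<bullet> i" using d by (simp add: inner_simps)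
  from bump_exists[OF this d] obtain f where f: "(\<lambda>x. complex_of_real (f x)) \<in> schwartz"
    "\<And>y. y \<in> cbox (x - d *\<^sub>R One) (x + d *\<^sub>R One) \<Longrightarrow> f y = 1"
    "\<And>y. y \<notin> cbox (x - d *\<^sub>R One - d *\<^sub>R One) (x + d *\<^sub>R One + d *\<^sub>R One) \<Longrightarrow> f y = 0" by blast
  have "cbox (x - d *\<^sub>R One - d *\<^sub>R One) (x + d *\<^sub>R One + d *\<^sub>R One) \<subseteq> ball x e"
  proof
    fix y assume y: "y \<in> cbox (x - d *\<^sub>R One - d *\<^sub>R One) (x + d *\<^sub>R One + d *\<^sub>R One)"
    have "\<bar>(x - y) \<bullet> i\<bar> \<le> 2 * d" if "i \<in> Basis" for i
      using y that unfolding mem_box by (drule_tac bspec[OF _ that]) (simp add: inner_simps abs_le_iff)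
    then have "(\<Sum>i\<in>Basis. \<bar>(x - y) \<bullet> i\<bar>) \<le> DIM('a) * (2 * d)"
      using sum_bounded_above[of Basis "\<lambda>i. \<bar>(x - y) \<bullet> i\<bar>" "2 * d"] by simp
    then have "norm (x - y) \<le> e / 2" using norm_le_l1[of "x - y"] by (simp add: d_def)
    then show "y \<in> ball x e" using e by (simp add: dist_norm)
  qed
  then have 1: "\<exists>K. compact K \<and> K \<subseteq> U \<and> (\<forall>y. y \<notin> K \<longrightarrow> complex_of_real (f y) = 0)"
    using e f(3) by (intro exI[of _ "cbox (x - d *\<^sub>R One - d *\<^sub>R One) (x + d *\<^sub>R One + d *\<^sub>R One)"]) auto
  have 2: "x \<in> box (x - d *\<^sub>R One) (x + d *\<^sub>R One)" using d by (auto simp: mem_box inner_simps)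
  have 3: "\<forall>y\<in>box (x - d *\<^sub>R One) (x + d *\<^sub>R One). complex_of_real (f y) = 1"
  proof
    fix y assume "y \<in> box (x - d *\<^sub>R One) (x + d *\<^sub>R One)"
    then have "y \<in> cbox (x - d *\<^sub>R One) (x + d *\<^sub>R One)" using box_subset_cbox by blast
    then show "complex_of_real (f y) = 1" by (simp add: f(2))
  qed
  show ?thesis
  proof -
    define V where "V = box (x - d *\<^sub>R One) (x + d *\<^sub>R One)"
    define \<eta> where "\<eta> = (\<lambda>y. complex_of_real (f y))"
    have "open V" "x \<in> V" using 2 by (simp_all add: V_def open_box)
    moreover have "\<eta> \<in> schwartz" unfolding \<eta>_def by (rule f(1))
    moreover have "\<forall>y\<in>V. \<eta> y = 1" unfolding V_def \<eta>_def by (rule 3)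
    moreover have "\<exists>K. compact K \<and> K \<subseteq> U \<and> (\<forall>y. y \<notin> K \<longrightarrow> \<eta> y = 0)" unfolding \<eta>_def by (rule 1)
    ultimately show ?thesis by blast
  qed
qed

lemma compact_closure_support:
  fixes f :: "'a::euclidean_space \<Rightarrow> complex"
  assumes "compact K" "\<And>y. y \<notin> K \<Longrightarrow> f y = 0"
  shows "compact (closure {x. f x \<noteq> 0})" "closure {x. f x \<noteq> 0} \<subseteq> K"
proof -
  have "{x. f x \<noteq> 0} \<subseteq> K" using assms(2) by blast
  then show "closure {x. f x \<noteq> 0} \<subseteq> K" by (rule closure_minimal) (use assms compact_imp_closed in auto)
  then show "compact (closure {x. f x \<noteq> 0})"
    using bounded_subset[OF compact_imp_bounded[OF assms(1)]] by (simp add: compact_eq_bounded_closed)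
qed

text \<open>Off the support, \<open>T\<close> vanishes locally by definition. Passing to a test
  function that meets several of the open sets requires compactness and a localisation by
  bumps.\<close>

lemma vanishes_off_support:
  fixes T :: "'a::euclidean_space distr"
  assumes T: "T \<in> tempered" and \<psi>: "\<psi> \<in> schwartz"
    and K: "compact (closure {x. \<psi> x \<noteq> 0})" "closure {x. \<psi> x \<noteq> 0} \<inter> distr_support T = {}"
  shows "T \<psi> = 0"
proof -
  let ?S = "closure {x. \<psi> x \<noteq> 0}"
  define Q where "Q x V \<eta> \<longleftrightarrow> open V \<and> x \<in> V \<and> \<eta> \<in> schwartz \<and> (\<forall>y\<in>V. \<eta> y = 1) \<and> (\<forall>\<psi>\<in>schwartz. T (\<lambda>y. \<eta> y * \<psi> y) = 0)"
    for x :: 'a and V \<eta>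
  have "\<exists>V \<eta>. Q x V \<eta>"
    if "x \<in> ?S" for x
  proof -
    obtain U where U: "open U" "vanishes_on T U" "x \<in> U" using K(2) \<open>x \<in> ?S\<close> unfolding distr_support_def by blast
    obtain V \<eta> L where V: "open V" "x \<in> V" "\<eta> \<in> schwartz" "\<forall>y\<in>V. \<eta> y = 1"
      and L: "compact L" "L \<subseteq> U" "\<And>y. y \<notin> L \<Longrightarrow> \<eta> y = 0" using local_bump[OF U(1,3)] by blast
    have "T (\<lambda>y. \<eta> y * \<psi> y) = 0" if "\<psi> \<in> schwartz" for \<psi>
    proof -
      have "compact (closure {x. \<eta> x * \<psi> x \<noteq> 0})"
        by (rule compact_closure_support(1)[OF L(1)]) (simp add: L(3))
      moreover have "closure {x. \<eta> x * \<psi> x \<noteq> 0} \<subseteq> L"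
        by (rule compact_closure_support(2)[OF L(1)]) (simp add: L(3))
      ultimately have "compact (closure {x. \<eta> x * \<psi> x \<noteq> 0}) \<and> closure {x. \<eta> x * \<psi> x \<noteq> 0} \<subseteq> U"
        using L(2) by blast
      then show ?thesis
        by (rule mp[OF bspec[OF U(2)[unfolded vanishes_on_def] schwartz_mult[OF V(3) \<open>\<psi> \<in> schwartz\<close>]]])
    qed
    then show ?thesis using V unfolding Q_def by blast
  qed
  then have "\<forall>x\<in>?S. \<exists>V \<eta>. Q x V \<eta>" by blast
  then obtain V where "\<forall>x\<in>?S. \<exists>\<eta>. Q x (V x) \<eta>" using bchoice[of ?S "\<lambda>x V. \<exists>\<eta>. Q x V \<eta>"] by blast
  then obtain \<eta> where "\<forall>x\<in>?S. Q x (V x) (\<eta> x)" using bchoice[of ?S "\<lambda>x \<eta>. Q x (V x) \<eta>"] by blast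
  then have V: "\<And>x. x \<in> ?S \<Longrightarrow> open (V x)" "\<And>x. x \<in> ?S \<Longrightarrow> x \<in> V x"
    and \<eta>: "\<And>x. x \<in> ?S \<Longrightarrow> \<eta> x \<in> schwartz" "\<And>x y. x \<in> ?S \<Longrightarrow> y \<in> V x \<Longrightarrow> \<eta> x y = 1"
    "\<And>x \<psi>. x \<in> ?S \<Longrightarrow> \<psi> \<in> schwartz \<Longrightarrow> T (\<lambda>y. \<eta> x y * \<psi> y) = 0" unfolding Q_def by simp_all
  obtain I where I: "I \<subseteq> ?S" "finite I" "?S \<subseteq> (\<Union>x\<in>I. V x)"
    using compactE_image[OF K(1), of ?S V] V by blast
  \<comment> \<open>In place of a normalised partition of unity, \<open>\<psi>\<close> is multiplied
    by the factors \<open>1 - \<eta> x\<close> one after the other. No factor changes the value of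
    \<open>T\<close>, because \<open>T\<close> annihilates multiples of \<open>\<eta> x\<close>, and
    the full product vanishes wherever \<open>\<psi>\<close> does not.\<close>
  have "(\<lambda>y. \<psi> y * (\<Prod>x\<in>J. 1 - \<eta> x y)) \<in> schwartz \<and> T (\<lambda>y. \<psi> y * (\<Prod>x\<in>J. 1 - \<eta> x y)) = T \<psi>"
    if "finite J" "J \<subseteq> ?S" for J
    using that
  proof (induction J rule: finite_induct)
    case empty
    then show ?case using \<psi> by simp
  next
    case (insert z J)
    let ?f = "\<lambda>y. \<psi> y * (\<Prod>x\<in>J. 1 - \<eta> x y)"
    have f: "?f \<in> schwartz" "T ?f = T \<psi>" using insert by auto
    have z: "z \<in> ?S" using insert by auto
    have eq: "(\<lambda>y. \<psi> y * (\<Prod>x\<in>insert z J. 1 - \<eta> x y)) = (\<lambda>y. ?f y - \<eta> z y * ?f y)"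
      using insert(1,2) by (simp add: algebra_simps)
    have "(\<lambda>y. \<eta> z y * ?f y) \<in> schwartz" by (rule schwartz_mult[OF \<eta>(1)[OF z] f(1)])
    then show ?case unfolding eq
      using schwartz_diff[OF f(1)] tempered_diff[OF T f(1)] \<eta>(3)[OF z f(1)] f(2) by simp
  qed
  then have "T (\<lambda>y. \<psi> y * (\<Prod>x\<in>I. 1 - \<eta> x y)) = T \<psi>" using I by blast
  moreover have "\<psi> y * (\<Prod>x\<in>I. 1 - \<eta> x y) = 0" for y
  proof (cases "\<psi> y = 0")
    case False
    then have "y \<in> ?S" by (intro subsetD[OF closure_subset]) simp
    then obtain x where x: "x \<in> I" "y \<in> V x" using I(3) by blast
    then have "1 - \<eta> x y = 0" using I(1) \<eta>(2)[of x y] by auto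
    then have "(\<Prod>x\<in>I. 1 - \<eta> x y) = 0" using x(1) by (intro prod_zero[OF I(2)] bexI[of _ x])
    then show ?thesis by simp
  qed simp
  then have "(\<lambda>y. \<psi> y * (\<Prod>x\<in>I. 1 - \<eta> x y)) = (\<lambda>y. 0 * \<psi> y)" by (intro ext) (simp only: mult_zero_left)
  ultimately show ?thesis using temperedD(3)[OF T \<psi>, of 0] by simp
qed

section \<open>Compactly supported distributions\<close>

lemma iter_deriv_lin:
  assumes "f \<in> schwartz" "g \<in> schwartz" "bs \<in> lists Basis"
  shows "iter_deriv bs (\<lambda>x. c * f x + g x) = (\<lambda>x. c * iter_deriv bs f x + iter_deriv bs g x)"
  using assms(3)
proof (induction bs)
  case (Cons b bs)
  then have S: "iter_deriv bs f \<in> schwartz" "iter_deriv bs g \<in> schwartz"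
    using schwartz_iter_deriv assms by auto
  have "pd b (\<lambda>x. c * iter_deriv bs f x + iter_deriv bs g x) x = c * pd b (iter_deriv bs f) x + pd b (iter_deriv bs g) x" for x
    by (subst pd_add) (auto intro!: schwartz_differentiable schwartz_cmult S simp: pd_cmult[OF schwartz_differentiable[OF S(1)]])
  note pd = this
  have IH: "iter_deriv bs (\<lambda>x. c * f x + g x) = (\<lambda>x. c * iter_deriv bs f x + iter_deriv bs g x)"
    using Cons by auto
  show ?case unfolding iter_deriv_Cons IH by (rule ext) (rule pd)
qed simp

lemma schwartz_dilate:
  fixes f :: "'a::euclidean_space \<Rightarrow> complex"
  assumes "f \<in> schwartz" "r > 0" shows "(\<lambda>x. f (r *\<^sub>R x)) \<in> schwartz"
  by (rule schwartz_compose_linear[where c="1 / r"]) (use assms in \<open>auto simp: linear_iff algebra_simps\<close>)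

lemma pd_dilate:
  assumes "f \<in> schwartz"
  shows "pd b (\<lambda>x. f (r *\<^sub>R x)) x = of_real r * pd b f (r *\<^sub>R x)"
proof -
  have d: "(f has_derivative (\<lambda>h. pd h f (r *\<^sub>R x))) (at (r *\<^sub>R x))"
    by (rule has_derivative_pd[OF schwartz_differentiable[OF assms]])
  have "((\<lambda>x. r *\<^sub>R x) has_derivative (\<lambda>h. r *\<^sub>R h)) (at x)" by (auto intro!: derivative_eq_intros)
  from has_derivative_compose[OF this d]
  have "((\<lambda>x. f (r *\<^sub>R x)) has_derivative (\<lambda>h. pd (r *\<^sub>R h) f (r *\<^sub>R x))) (at x)" .
  from pd_eq[OF this] show ?thesis
    by (simp add: linear_scale[OF has_derivative_linear[OF d]] scaleR_conv_of_real)
qed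

text \<open>Multiplying by \<open>c + \<zeta>(x / n)\<close>, which vanishes on the cube of radius \<open>n\<close>, costs a factor
  \<open>1 / n\<close> in every Schwartz seminorm: either the derivative hits the dilate, or the decay of \<open>\<psi>\<close> helps.\<close>

lemma cutoff_remainder_bound:
  fixes \<psi> \<zeta> :: "'a::euclidean_space \<Rightarrow> complex"
  assumes "bs \<in> lists Basis" "\<psi> \<in> schwartz" "\<zeta> \<in> schwartz" "\<And>x. x \<in> box (- One) One \<Longrightarrow> c + \<zeta> x = 0"
  shows "\<exists>C. \<forall>n. \<forall>x. (1 + norm x) ^ N * cmod (iter_deriv bs (\<lambda>x. (c + \<zeta> ((1 / real (Suc n)) *\<^sub>R x)) * \<psi> x) x) \<le> C / real (Suc n)"
  using assms
\<comment> \<open>The first derivative splits the product into one with \<open>pd b \<zeta>\<close>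
  and constant 0, with the factor \<open>1 / Suc n\<close>, and one with \<open>pd b \<psi>\<close>.
  All of \<open>\<psi>\<close>, \<open>\<zeta>\<close> and \<open>c\<close> therefore change in the
  induction.\<close>
proof (induction bs arbitrary: \<psi> \<zeta> c rule: rev_induct)
  case Nil
  obtain B where B: "B > 0" "\<And>x. (1 + norm x) ^ 0 * cmod (\<zeta> x) \<le> B" using rapidE[OF schwartz_rapid[OF Nil(3)]] by metis
  \<comment> \<open>The surplus power of decay pays for the denominator: outside the dilated cube
    \<open>1 + norm x\<close> is at least \<open>Suc n\<close>.\<close>
  obtain D where D: "D > 0" "\<And>x. (1 + norm x) ^ (Suc N) * cmod (\<psi> x) \<le> D" using rapidE[OF schwartz_rapid[OF Nil(2)]] by metis
  have "(1 + norm x) ^ N * cmod ((c + \<zeta> ((1 / real (Suc n)) *\<^sub>R x)) * \<psi> x) \<le> ((cmod c + B) * D) / real (Suc n)" for n x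
  proof (cases "(1 / real (Suc n)) *\<^sub>R x \<in> box (- One) One")
    case True
    then show ?thesis using Nil(4) B D by simp
  next
    case False
    then obtain i where i: "i \<in> Basis" "\<not> (- 1 < (x \<bullet> i) / real (Suc n) \<and> (x \<bullet> i) / real (Suc n) < 1)"
      unfolding mem_box by (auto simp: inner_simps)
    then have "1 \<le> \<bar>(x \<bullet> i) / real (Suc n)\<bar>" by linarith
    then have "real (Suc n) \<le> \<bar>x \<bullet> i\<bar>" by (simp add: abs_divide pos_le_divide_eq)
    then have n: "real (Suc n) \<le> 1 + norm x" using Basis_le_norm[OF i(1), of x] by linarith
    have "cmod (c + \<zeta> ((1 / real (Suc n)) *\<^sub>R x)) \<le> cmod c + B"
      using norm_triangle_ineq[of c "\<zeta> ((1 / real (Suc n)) *\<^sub>R x)"] B(2)[of "(1 / real (Suc n)) *\<^sub>R x"] by simp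
    moreover have "(1 + norm x) ^ N * cmod (\<psi> x) \<le> D / real (Suc n)"
    proof -
      have "real (Suc n) * ((1 + norm x) ^ N * cmod (\<psi> x)) \<le> (1 + norm x) * ((1 + norm x) ^ N * cmod (\<psi> x))"
        by (rule mult_right_mono[OF n]) simp
      also have "\<dots> \<le> D" using D(2)[of x] by (simp add: mult.assoc)
      finally show ?thesis by (simp add: pos_le_divide_eq mult.commute)
    qed
    ultimately have "cmod (c + \<zeta> ((1 / real (Suc n)) *\<^sub>R x)) * ((1 + norm x) ^ N * cmod (\<psi> x)) \<le> (cmod c + B) * (D / real (Suc n))"
      by (rule mult_mono) (use B in auto)
    then show ?thesis by (simp add: norm_mult mult_ac)
  qed
  then show ?case by (auto simp del: of_nat_Suc)
next
  case (snoc b bs)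
  then have b: "b \<in> Basis" and bs: "bs \<in> lists Basis" by auto
  have S: "pd b \<psi> \<in> schwartz" "pd b \<zeta> \<in> schwartz" using schwartz_pd b snoc.prems by auto
  have "0 + pd b \<zeta> x = 0" if "x \<in> box (- One) One" for x
  proof -
    have "((\<lambda>y. - c) has_derivative (\<lambda>h. 0)) (at x)" by simp
    then have "(\<zeta> has_derivative (\<lambda>h. 0)) (at x)"
      by (rule has_derivative_transform_within_open[OF _ open_box that])
        (use snoc.prems(4) in \<open>simp add: neg_eq_iff_add_eq_0\<close>)
    then show ?thesis by (simp add: pd_eq)
  qed
  from snoc.IH[OF bs snoc.prems(2) S(2) this]
  obtain C1 where C1: "\<And>n x. (1 + norm x) ^ N * cmod (iter_deriv bs (\<lambda>x. (0 + pd b \<zeta> ((1 / real (Suc n)) *\<^sub>R x)) * \<psi> x) x) \<le> C1 / real (Suc n)" by blast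
  from snoc.IH[OF bs S(1) snoc.prems(3,4)]
  obtain C2 where C2: "\<And>n x. (1 + norm x) ^ N * cmod (iter_deriv bs (\<lambda>x. (c + \<zeta> ((1 / real (Suc n)) *\<^sub>R x)) * pd b \<psi> x) x) \<le> C2 / real (Suc n)" by blast
  have "(1 + norm x) ^ N * cmod (iter_deriv (bs @ [b]) (\<lambda>x. (c + \<zeta> ((1 / real (Suc n)) *\<^sub>R x)) * \<psi> x) x) \<le> (C1 + C2) / real (Suc n)" for n x
  proof -
    define r where "r = 1 / real (Suc n)"
    have r: "r > 0" "r \<le> 1" by (auto simp: r_def)
    let ?f = "\<lambda>x. (0 + pd b \<zeta> (r *\<^sub>R x)) * \<psi> x" and ?g = "\<lambda>x. (c + \<zeta> (r *\<^sub>R x)) * pd b \<psi> x"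
    have f: "?f \<in> schwartz" using schwartz_mult[OF schwartz_dilate[OF S(2) r(1)] snoc.prems(2)] by simp
    have "(\<lambda>x. c * pd b \<psi> x + \<zeta> (r *\<^sub>R x) * pd b \<psi> x) \<in> schwartz"
      by (intro schwartz_add schwartz_cmult schwartz_mult schwartz_dilate S snoc.prems r)
    then have g: "?g \<in> schwartz" by (simp add: distrib_right)
    have dz: "(\<lambda>x. \<zeta> (r *\<^sub>R x)) differentiable (at x)" for x
      by (rule schwartz_differentiable[OF schwartz_dilate[OF snoc.prems(3) r(1)]])
    have "pd b (\<lambda>x. (c + \<zeta> (r *\<^sub>R x)) * \<psi> x) = (\<lambda>x. of_real r * ?f x + ?g x)"
    proof
      fix x
      have "pd b (\<lambda>x. c + \<zeta> (r *\<^sub>R x)) x = of_real r * pd b \<zeta> (r *\<^sub>R x)"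
        using pd_add[of "\<lambda>_. c" x "\<lambda>x. \<zeta> (r *\<^sub>R x)" b] dz[of x] pd_eq[of "\<lambda>_. c" "\<lambda>_. 0" x b]
        by (simp add: pd_dilate[OF snoc.prems(3)])
      moreover have "(\<lambda>x. c + \<zeta> (r *\<^sub>R x)) differentiable (at x)"
        by (intro differentiable_add differentiable_const dz)
      ultimately show "pd b (\<lambda>x. (c + \<zeta> (r *\<^sub>R x)) * \<psi> x) x = of_real r * ?f x + ?g x"
        by (simp add: pd_mult schwartz_differentiable[OF snoc.prems(2)])
    qed
    then have eq: "iter_deriv (bs @ [b]) (\<lambda>x. (c + \<zeta> (r *\<^sub>R x)) * \<psi> x) x = of_real r * iter_deriv bs ?f x + iter_deriv bs ?g x"
      unfolding iter_deriv_snoc using iter_deriv_lin[OF f g bs] by simp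
    have "cmod (of_real r * iter_deriv bs ?f x + iter_deriv bs ?g x) \<le> r * cmod (iter_deriv bs ?f x) + cmod (iter_deriv bs ?g x)"
      using norm_triangle_ineq[of "of_real r * iter_deriv bs ?f x" "iter_deriv bs ?g x"] r by (simp add: norm_mult)
    also have "\<dots> \<le> cmod (iter_deriv bs ?f x) + cmod (iter_deriv bs ?g x)"
      using mult_right_mono[OF r(2), of "cmod (iter_deriv bs ?f x)"] by simp
    finally have "(1 + norm x) ^ N * cmod (iter_deriv (bs @ [b]) (\<lambda>x. (c + \<zeta> (r *\<^sub>R x)) * \<psi> x) x) \<le>
        (1 + norm x) ^ N * cmod (iter_deriv bs ?f x) + (1 + norm x) ^ N * cmod (iter_deriv bs ?g x)"
      unfolding eq distrib_left[symmetric] by (rule mult_left_mono) simp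
    also have "\<dots> \<le> C1 / real (Suc n) + C2 / real (Suc n)"
      unfolding r_def by (intro add_mono C1 C2)
    finally show ?thesis unfolding r_def by (simp only: add_divide_distrib)
  qed
  then show ?case by blast
qed

text \<open>For \<open>\<kappa>\<close> equal to 1 on a box around the support,
  \<open>\<psi> - \<kappa> * \<psi>\<close> vanishes near the support, but it need not have compact
  support, as \<open>vanishes_off_support\<close> demands. The gap is closed by dilated cutoffs and
  the continuity of \<open>T\<close> in a seminorm.\<close>

lemma cutoff_near_support:
  fixes T :: "'a::euclidean_space distr"
  assumes T: "T \<in> tempered" and K: "compact (distr_support T)"
  shows "\<exists>\<kappa>\<in>schwartz. \<forall>\<psi>\<in>schwartz. T \<psi> = T (\<lambda>x. \<kappa> x * \<psi> x)"
proof -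
  obtain R where R: "R > 0" "distr_support T \<subseteq> box (- R *\<^sub>R One) (R *\<^sub>R One)"
  proof -
    obtain a where a: "distr_support T \<subseteq> box (- a) a" using bounded_subset_box_symmetric[OF compact_imp_bounded[OF K]] by blast
    define R where "R = 1 + (\<Sum>i\<in>Basis. \<bar>a \<bullet> i\<bar>)"
    have Ri: "\<bar>a \<bullet> i\<bar> < R" if "i \<in> Basis" for i
      using member_le_sum[OF that, of "\<lambda>i. \<bar>a \<bullet> i\<bar>"] by (simp add: R_def)
    have "box (- a) a \<subseteq> box (- R *\<^sub>R One) (R *\<^sub>R One)"
      by (rule subset_box_imp) (use Ri in \<open>fastforce simp: inner_simps abs_if split: if_splits\<close>)
    moreover have "R > 0" by (simp add: R_def add_pos_nonneg sum_nonneg)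
    ultimately show thesis using a that by blast
  qed
  have le: "(- r *\<^sub>R One) \<bullet> i \<le> (r *\<^sub>R One) \<bullet> i" if "r > 0" "i \<in> Basis" for r and i :: 'a
    using that by (simp add: inner_simps)
  define P where "P r f L \<longleftrightarrow> (\<lambda>x. complex_of_real (f x)) \<in> schwartz \<and> (\<forall>x\<in>cbox (- r *\<^sub>R One) (r *\<^sub>R One). f x = 1) \<and> compact L \<and> (\<forall>x. x \<notin> L \<longrightarrow> f x = 0)"
    for r and f :: "'a \<Rightarrow> real" and L
  have ex: "\<exists>f L. P r f L" if r: "r > 0" for r
  proof -
    have "\<exists>f. (\<lambda>x. complex_of_real (f x)) \<in> schwartz \<and> (\<forall>x. 0 \<le> f x \<and> f x \<le> 1) \<and> (\<forall>x\<in>cbox (- r *\<^sub>R One) (r *\<^sub>R One). f x = 1) \<and>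
      (\<forall>x::'a. x \<notin> cbox (- r *\<^sub>R One - 1 *\<^sub>R One) (r *\<^sub>R One + 1 *\<^sub>R One) \<longrightarrow> f x = 0)"
      by (rule bump_exists) (use le[OF r] in auto)
    then show ?thesis unfolding P_def using compact_cbox by blast
  qed
  obtain \<kappa> L' where "P R \<kappa> L'" using ex[OF R(1)] by blast
  then have \<kappa>: "(\<lambda>x. complex_of_real (\<kappa> x)) \<in> schwartz" "\<And>x. x \<in> cbox (- R *\<^sub>R One) (R *\<^sub>R One) \<Longrightarrow> \<kappa> x = 1"
    unfolding P_def by auto
  obtain \<rho> L where "P 1 \<rho> L" using ex[OF zero_less_one] by blast
  then have \<rho>: "(\<lambda>x. complex_of_real (\<rho> x)) \<in> schwartz" "\<And>x. x \<in> cbox (- 1 *\<^sub>R One) (1 *\<^sub>R One) \<Longrightarrow> \<rho> x = 1"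
    and L: "compact L" "\<And>x. x \<notin> L \<Longrightarrow> \<rho> x = 0"
    unfolding P_def by auto
  have "T \<psi> = T (\<lambda>x. of_real (\<kappa> x) * \<psi> x)" if \<psi>: "\<psi> \<in> schwartz" for \<psi>
  proof -
    define \<phi> where "\<phi> = (\<lambda>x. \<psi> x - of_real (\<kappa> x) * \<psi> x)"
    have S: "(\<lambda>x. of_real (\<kappa> x) * \<psi> x) \<in> schwartz" by (rule schwartz_mult[OF \<kappa>(1) \<psi>])
    have \<phi>: "\<phi> \<in> schwartz" unfolding \<phi>_def by (rule schwartz_diff[OF \<psi> S])
    \<comment> \<open>The truncation of \<open>\<phi>\<close> at scale \<open>Suc n\<close>.
      \<open>T\<close> annihilates it, and what is cut away has seminorm of order
      \<open>1 / Suc n\<close>.\<close>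
    define p where "p n = (\<lambda>x. of_real (\<rho> ((1 / real (Suc n)) *\<^sub>R x)) * \<phi> x)" for n
    have p: "p n \<in> schwartz" for n unfolding p_def by (intro schwartz_mult \<phi> schwartz_dilate[OF \<rho>(1)]) simp
    have p0: "T (p n) = 0" for n
    proof (rule vanishes_off_support[OF T p])
      have "compact ((\<lambda>x. real (Suc n) *\<^sub>R x) ` L)" by (intro compact_scaling L)
      moreover have "p n y = 0" if y: "y \<notin> (\<lambda>x. real (Suc n) *\<^sub>R x) ` L" for y
      proof -
        have "y = real (Suc n) *\<^sub>R ((1 / real (Suc n)) *\<^sub>R y)" by simp
        then have "(1 / real (Suc n)) *\<^sub>R y \<notin> L" using y by blast
        then show ?thesis by (simp add: p_def L(2))
      qed
      ultimately show "compact (closure {x. p n x \<noteq> 0})" by (rule compact_closure_support(1))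
      \<comment> \<open>The support of \<open>T\<close> lies in the open box, while
        \<open>\<kappa>\<close> is 1 on the closed one. Hence \<open>p n\<close> vanishes on the
        open box, and taking the closure adds no point of it.\<close>
      have "closure {x. p n x \<noteq> 0} \<subseteq> - box (- R *\<^sub>R One) (R *\<^sub>R One)"
      proof (rule closure_minimal)
        show "{x. p n x \<noteq> 0} \<subseteq> - box (- R *\<^sub>R One) (R *\<^sub>R One)"
        proof (rule subsetI, rule ccontr)
          fix x assume x: "x \<in> {x. p n x \<noteq> 0}" "x \<notin> - box (- R *\<^sub>R One) (R *\<^sub>R One)"
          then have "x \<in> cbox (- R *\<^sub>R One) (R *\<^sub>R One)" using box_subset_cbox by blast
          then have "p n x = 0" by (simp add: p_def \<phi>_def \<kappa>(2))
          then show False using x by simp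
        qed
      qed (simp add: closed_Compl open_box)
      then show "closure {x. p n x \<noteq> 0} \<inter> distr_support T = {}" using R(2) by blast
    qed
    obtain N C where NC: "\<And>\<psi>. \<psi> \<in> schwartz \<Longrightarrow> cmod (T \<psi>) \<le> C * schwartz_seminorm N \<psi>"
      using T unfolding tempered_def by blast
    have m\<rho>: "(\<lambda>x. - complex_of_real (\<rho> x)) \<in> schwartz" using schwartz_cmult[OF \<rho>(1), of "-1"] by simp
    have one: "1 + - complex_of_real (\<rho> x) = 0" if "x \<in> box (- One) One" for x
      using \<rho>(2)[of x] that box_subset_cbox by auto
    have "\<exists>D. \<forall>bs\<in>{bs \<in> lists Basis. length bs \<le> N}. \<forall>n x. (1 + norm x) ^ N * cmod (iter_deriv bs (\<lambda>x. (1 + - of_real (\<rho> ((1 / real (Suc n)) *\<^sub>R x))) * \<phi> x) x) \<le> D bs / real (Suc n)"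
      using cutoff_remainder_bound[OF _ \<phi> m\<rho> one, of _ N] by (intro bchoice) blast
    then obtain D where D: "\<And>bs n x. bs \<in> lists Basis \<Longrightarrow> length bs \<le> N \<Longrightarrow>
        (1 + norm x) ^ N * cmod (iter_deriv bs (\<lambda>x. (1 + - of_real (\<rho> ((1 / real (Suc n)) *\<^sub>R x))) * \<phi> x) x) \<le> D bs / real (Suc n)" by blast
    define E where "E = (\<Sum>bs\<in>{bs \<in> lists (Basis::'a set). length bs \<le> N}. \<bar>D bs\<bar>)"
    have eq: "(\<lambda>x. (1 + - of_real (\<rho> ((1 / real (Suc n)) *\<^sub>R x))) * \<phi> x) = (\<lambda>x. \<phi> x - p n x)" for n
      by (simp add: p_def fun_eq_iff algebra_simps)
    have sem: "schwartz_seminorm N (\<lambda>x. \<phi> x - p n x) \<le> E / real (Suc n)" for n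
    proof (rule schwartz_seminorm_least)
      fix bs and x :: 'a assume bs: "bs \<in> lists (Basis::'a set)" "length bs \<le> N"
      have "D bs \<le> \<bar>D bs\<bar>" by simp
      also have "\<dots> \<le> E" unfolding E_def
        by (rule member_le_sum) (use bs finite_lists_Basis in auto)
      finally have "D bs / real (Suc n) \<le> E / real (Suc n)" by (rule divide_right_mono) simp
      with D[OF bs, of x n] show "(1 + norm x) ^ N * cmod (iter_deriv bs (\<lambda>x. \<phi> x - p n x) x) \<le> E / real (Suc n)"
        unfolding eq by linarith
    qed
    have "cmod (T \<phi>) \<le> \<bar>C\<bar> * E * (1 / real (Suc n))" for n
    proof -
      have d: "(\<lambda>x. \<phi> x - p n x) \<in> schwartz" by (rule schwartz_diff[OF \<phi> p])
      have "T \<phi> = T (\<lambda>x. \<phi> x - p n x)" using tempered_diff[OF T \<phi> p] p0 by simp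
      then have "cmod (T \<phi>) \<le> C * schwartz_seminorm N (\<lambda>x. \<phi> x - p n x)" using NC[OF d] by simp
      also have "\<dots> \<le> \<bar>C\<bar> * schwartz_seminorm N (\<lambda>x. \<phi> x - p n x)"
        by (intro mult_right_mono schwartz_seminorm_nonneg d) simp
      also have "\<dots> \<le> \<bar>C\<bar> * (E / real (Suc n))" by (intro mult_left_mono sem) simp
      finally show ?thesis by simp
    qed
    moreover have "(\<lambda>n. \<bar>C\<bar> * E * (1 / real (Suc n))) \<longlonglongrightarrow> \<bar>C\<bar> * E * 0"
      by (intro tendsto_mult tendsto_const LIMSEQ_Suc[OF lim_1_over_n])
    ultimately have "cmod (T \<phi>) \<le> \<bar>C\<bar> * E * 0" by (intro LIMSEQ_le_const) auto
    then have "T \<phi> = 0" by simp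
    then show ?thesis using tempered_diff[OF T \<psi> S] by (simp add: \<phi>_def)
  qed
  then show ?thesis by (intro bexI[OF _ \<kappa>(1)] ballI)
qed

text \<open>As \<open>T\<close> equals \<open>\<kappa>\<close> times \<open>T\<close>, its transform
  is the convolution of itself with the transform of \<open>\<kappa>\<close>. The convolution
  \<open>G\<close> is continuous and represents the same distribution, so it is the version that
  \<open>fhat\<close> selects.\<close>

lemma fhat_reproducing:
  fixes T :: "'a::euclidean_space distr"
  assumes T: "T \<in> sobolev t" and K: "compact (distr_support T)"
  shows "\<exists>\<theta>\<in>schwartz. \<forall>\<eta>. integrable lborel (\<lambda>\<xi>. fhat T \<xi> * \<theta> (\<xi> - \<eta>)) \<and> fhat T \<eta> = (LINT \<xi>|lborel. fhat T \<xi> * \<theta> (\<xi> - \<eta>))"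
    and "continuous_on UNIV (fhat T)"
proof -
  obtain \<kappa> where \<kappa>: "\<kappa> \<in> schwartz" "\<And>\<psi>. \<psi> \<in> schwartz \<Longrightarrow> T \<psi> = T (\<lambda>x. \<kappa> x * \<psi> x)"
    using cutoff_near_support[OF sobolevD(1)[OF T] K] by blast
  define g where "g = fhat T"
  have g: "represents g (fourier_distr T)" and gm [measurable]: "g \<in> borel_measurable borel"
    unfolding g_def using sobolevD[OF T] by auto
  obtain N where N: "integrable lborel (\<lambda>\<xi>. cmod (g \<xi>) / (1 + norm \<xi>) ^ N)"
    using weighted_L2_decay[OF gm, of t] sobolevD(4)[OF T] unfolding g_def by blast
  \<comment> \<open>The reflection makes \<open>\<theta> (\<xi> - \<eta>)\<close> the transform of
    \<open>\<kappa>\<close> at \<open>\<eta> - \<xi>\<close>, as a convolution requires.\<close>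
  define \<theta> where "\<theta> = (\<lambda>\<xi>. fourier \<kappa> (- \<xi>))"
  have \<theta>: "\<theta> \<in> schwartz" unfolding \<theta>_def by (intro schwartz_reflect fourier_schwartz \<kappa>)
  have [measurable]: "\<theta> \<in> borel_measurable borel" "\<kappa> \<in> borel_measurable borel" by (intro schwartz_measurable \<theta> \<kappa>)+
  obtain C where C: "C > 0" "\<And>x. (1 + norm x) ^ N * cmod (\<theta> x) \<le> C" using rapidE[OF schwartz_rapid[OF \<theta>]] by metis
  have \<theta>b: "cmod (\<theta> (\<xi> - \<eta>)) \<le> C * (1 + norm \<eta>) ^ N / (1 + norm \<xi>) ^ N" for \<xi> \<eta>
  proof (rule rapid_bound)
    have "(1 + norm \<xi>) ^ N \<le> ((1 + norm (\<xi> - \<eta>)) * (1 + norm \<eta>)) ^ N" by (intro power_mono norm_shift_le) simp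
    then have "(1 + norm \<xi>) ^ N * cmod (\<theta> (\<xi> - \<eta>)) \<le> ((1 + norm (\<xi> - \<eta>)) ^ N * (1 + norm \<eta>) ^ N) * cmod (\<theta> (\<xi> - \<eta>))"
      unfolding power_mult_distrib by (rule mult_right_mono) simp
    also have "\<dots> = ((1 + norm (\<xi> - \<eta>)) ^ N * cmod (\<theta> (\<xi> - \<eta>))) * (1 + norm \<eta>) ^ N" by (simp only: mult_ac)
    also have "\<dots> \<le> C * (1 + norm \<eta>) ^ N" by (intro mult_right_mono C) simp
    finally show "(1 + norm \<xi>) ^ N * cmod (\<theta> (\<xi> - \<eta>)) \<le> C * (1 + norm \<eta>) ^ N" .
  qed
  have gb: "cmod (g \<xi> * \<theta> (\<xi> - \<eta>)) \<le> cmod (g \<xi>) / (1 + norm \<xi>) ^ N * (C * (1 + norm \<eta>) ^ N)" for \<xi> \<eta>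
    using mult_left_mono[OF \<theta>b norm_ge_zero[of "g \<xi>"]] by (simp add: norm_mult)
  define G where "G \<eta> = (LINT \<xi>|lborel. g \<xi> * \<theta> (\<xi> - \<eta>))" for \<eta>
  have int: "integrable lborel (\<lambda>\<xi>. g \<xi> * \<theta> (\<xi> - \<eta>))" for \<eta>
    by (rule Bochner_Integration.integrable_bound[OF integrable_mult_left[OF N, of "C * (1 + norm \<eta>) ^ N"]])
      (measurable, use order_trans[OF gb abs_ge_self] in \<open>simp only: real_norm_def AE_I2\<close>)
  have contG: "continuous_on UNIV G"
    unfolding continuous_on_sequentially
  proof (intro allI ballI impI, elim conjE)
    fix u :: "nat \<Rightarrow> 'a" and \<eta> assume u: "u \<longlonglongrightarrow> \<eta>"
    then have "Bseq u" using convergentI convergent_imp_Bseq by blast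
    then obtain R where R: "R > 0" "\<And>n. norm (u n) \<le> R" by (auto elim: BseqE)
    have "(\<lambda>n. LINT \<xi>|lborel. g \<xi> * \<theta> (\<xi> - u n)) \<longlonglongrightarrow> (LINT \<xi>|lborel. g \<xi> * \<theta> (\<xi> - \<eta>))"
    proof (rule integral_dominated_convergence[where w="\<lambda>\<xi>. cmod (g \<xi>) / (1 + norm \<xi>) ^ N * (C * (1 + R) ^ N)"])
      show "integrable lborel (\<lambda>\<xi>. cmod (g \<xi>) / (1 + norm \<xi>) ^ N * (C * (1 + R) ^ N))" by (rule integrable_mult_left[OF N])
      have "isCont \<theta> x" for x using schwartz_continuous[OF \<theta>] by (simp add: continuous_on_eq_continuous_at)
      then have "(\<lambda>n. \<theta> (x - u n)) \<longlonglongrightarrow> \<theta> (x - \<eta>)" for x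
        by (rule isCont_tendsto_compose) (intro tendsto_diff tendsto_const u)
      then show "AE x in lborel. (\<lambda>n. g x * \<theta> (x - u n)) \<longlonglongrightarrow> g x * \<theta> (x - \<eta>)"
        by (intro AE_I2 tendsto_mult_left)
      have "cmod (g x * \<theta> (x - u n)) \<le> cmod (g x) / (1 + norm x) ^ N * (C * (1 + R) ^ N)" for x n
        by (rule order_trans[OF gb], intro mult_left_mono power_mono add_left_mono R(2)) (use C in auto)
      then show "AE x in lborel. norm (g x * \<theta> (x - u n)) \<le> cmod (g x) / (1 + norm x) ^ N * (C * (1 + R) ^ N)" for n by simp
    qed measurable
    then show "(G \<circ> u) \<longlonglongrightarrow> G \<eta>" by (simp add: G_def[abs_def] o_def)
  qed
  then have [measurable]: "G \<in> borel_measurable borel" by (rule borel_measurable_continuous_onI)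
  have "represents G (fourier_distr T)"
    unfolding represents_def
  proof (intro conjI ballI)
    fix \<psi> :: "'a \<Rightarrow> complex" assume \<psi>: "\<psi> \<in> schwartz"
    have [measurable]: "\<psi> \<in> borel_measurable borel" by (rule schwartz_measurable[OF \<psi>])
    \<comment> \<open>\<open>w\<close> is the test function with transform \<open>\<kappa>\<close>
      times \<open>fourier \<psi>\<close>. Hence \<open>T (fourier \<psi>)\<close> can be evaluated
      as \<open>fourier_distr T w\<close>, and Fubini's theorem moves the convolution from
      \<open>\<psi>\<close> to \<open>g\<close>.\<close>
    define w where "w = (\<lambda>\<xi>. fourier (\<lambda>x. \<kappa> x * fourier \<psi> x) (- \<xi>))"
    have S: "(\<lambda>x. \<kappa> x * fourier \<psi> x) \<in> schwartz" by (intro schwartz_mult \<kappa> fourier_schwartz \<psi>)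
    have w: "w \<in> schwartz" "fourier w = (\<lambda>x. \<kappa> x * fourier \<psi> x)"
      unfolding w_def using fourier_surj[OF S] by (auto intro!: schwartz_reflect fourier_schwartz S)
    have w_eq: "w \<xi> = (LINT y|lborel. \<psi> y * \<theta> (\<xi> - y))" for \<xi>
    proof -
      have "w \<xi> = (LINT x|lborel. \<kappa> x * (LINT y|lborel. \<psi> y * cis (- 2 * pi * (y \<bullet> x))) * cis (- 2 * pi * (x \<bullet> - \<xi>)))"
        unfolding w_def fourier_def ..
      also have "\<dots> = (LINT x|lborel. LINT y|lborel. \<kappa> x * (\<psi> y * cis (- 2 * pi * (y \<bullet> x))) * cis (- 2 * pi * (x \<bullet> - \<xi>)))"
        unfolding integral_mult_right_zero integral_mult_left_zero ..
      also have "\<dots> = (LINT y|lborel. LINT x|lborel. \<kappa> x * (\<psi> y * cis (- 2 * pi * (y \<bullet> x))) * cis (- 2 * pi * (x \<bullet> - \<xi>)))"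
      proof (rule lborel_pair.Fubini_integral[symmetric])
        show "integrable (lborel \<Otimes>\<^sub>M lborel) (\<lambda>(x, y). \<kappa> x * (\<psi> y * cis (- 2 * pi * (y \<bullet> x))) * cis (- 2 * pi * (x \<bullet> - \<xi>)))"
          by (rule integrable_product_bound[OF integrable_norm[OF schwartz_integrable[OF \<kappa>(1)]] integrable_norm[OF schwartz_integrable[OF \<psi>]]])
            (measurable, simp add: norm_mult)
      qed
      also have "\<dots> = (LINT y|lborel. LINT x|lborel. \<psi> y * (\<kappa> x * cis (- 2 * pi * (x \<bullet> - (\<xi> - y)))))"
      proof (intro Bochner_Integration.integral_cong refl)
        fix x y
        have "cis (- 2 * pi * (y \<bullet> x)) * cis (- 2 * pi * (x \<bullet> - \<xi>)) = cis (- 2 * pi * (x \<bullet> - (\<xi> - y)))"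
          unfolding cis_mult by (simp add: inner_diff_right inner_commute algebra_simps)
        then show "\<kappa> x * (\<psi> y * cis (- 2 * pi * (y \<bullet> x))) * cis (- 2 * pi * (x \<bullet> - \<xi>)) = \<psi> y * (\<kappa> x * cis (- 2 * pi * (x \<bullet> - (\<xi> - y))))"
          by (metis mult.assoc mult.commute)
      qed
      also have "\<dots> = (LINT y|lborel. \<psi> y * \<theta> (\<xi> - y))"
        unfolding \<theta>_def fourier_def by (simp only: integral_mult_right_zero)
      finally show ?thesis .
    qed
    have prod: "integrable (lborel \<Otimes>\<^sub>M lborel) (\<lambda>(\<xi>, y). g \<xi> * (\<psi> y * \<theta> (\<xi> - y)))"
    proof (rule integrable_product_bound[OF N])
      have "slow (\<lambda>y::'a. complex_of_real (C * (1 + norm y) ^ N))"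
        unfolding slow_def by (rule exI[of _ N], rule exI[of _ C]) (use C in \<open>simp only: norm_of_real, simp\<close>)
      then have "integrable lborel (\<lambda>y. complex_of_real (C * (1 + norm y) ^ N) * \<psi> y)"
        by (intro rapid_integrable rapid_slow_mult schwartz_rapid \<psi>) measurable
      then have "integrable lborel (\<lambda>y. norm (complex_of_real (C * (1 + norm y) ^ N) * \<psi> y))" by (rule integrable_norm)
      then show "integrable lborel (\<lambda>y. (C * (1 + norm y) ^ N) * cmod (\<psi> y))"
        unfolding norm_mult norm_of_real using C(1) by simp
      show "cmod (case (\<xi>, y) of (\<xi>, y) \<Rightarrow> g \<xi> * (\<psi> y * \<theta> (\<xi> - y))) \<le> cmod (g \<xi>) / (1 + norm \<xi>) ^ N * ((C * (1 + norm y) ^ N) * cmod (\<psi> y))" for \<xi> y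
        using mult_right_mono[OF gb[of \<xi> y] norm_ge_zero[of "\<psi> y"]] by (simp add: norm_mult mult_ac)
    qed measurable
    have eqG: "(LINT \<xi>|lborel. g \<xi> * (\<psi> y * \<theta> (\<xi> - y))) = G y * \<psi> y" for y
      unfolding G_def integral_mult_left_zero[symmetric] by (simp only: mult_ac)
    from lborel_pair.integrable_snd[OF prod] show "integrable lborel (\<lambda>\<xi>. G \<xi> * \<psi> \<xi>)" unfolding eqG .
    have "fourier_distr T \<psi> = T (fourier \<psi>)" using \<psi> by (simp add: fourier_distr_def)
    also have "\<dots> = T (fourier w)" unfolding w(2) by (rule \<kappa>(2)[OF fourier_schwartz[OF \<psi>]])
    also have "\<dots> = fourier_distr T w" using w(1) by (simp add: fourier_distr_def)
    also have "\<dots> = (LINT \<xi>|lborel. g \<xi> * w \<xi>)" using g w(1) unfolding represents_def by blast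
    also have "\<dots> = (LINT \<xi>|lborel. LINT y|lborel. g \<xi> * (\<psi> y * \<theta> (\<xi> - y)))"
      unfolding w_eq integral_mult_right_zero ..
    also have "\<dots> = (LINT y|lborel. LINT \<xi>|lborel. g \<xi> * (\<psi> y * \<theta> (\<xi> - y)))"
      by (rule lborel_pair.Fubini_integral[OF prod, symmetric])
    finally show "fourier_distr T \<psi> = (LINT \<xi>|lborel. G \<xi> * \<psi> \<xi>)" unfolding eqG .
  qed measurable
  then have "fhat T = G" by (rule fhat_eq_continuous[OF _ contG])
  then show "continuous_on UNIV (fhat T)" using contG by simp
  have "integrable lborel (\<lambda>\<xi>. fhat T \<xi> * \<theta> (\<xi> - \<eta>)) \<and> fhat T \<eta> = (LINT \<xi>|lborel. fhat T \<xi> * \<theta> (\<xi> - \<eta>))" for \<eta>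
    using int[of \<eta>] \<open>fhat T = G\<close> unfolding g_def[symmetric] G_def by metis
  then show "\<exists>\<theta>\<in>schwartz. \<forall>\<eta>. integrable lborel (\<lambda>\<xi>. fhat T \<xi> * \<theta> (\<xi> - \<eta>)) \<and> fhat T \<eta> = (LINT \<xi>|lborel. fhat T \<xi> * \<theta> (\<xi> - \<eta>))"
    using \<theta> by blast
qed

section \<open>Linear changes of variables\<close>

text \<open>The library knows the Jacobian of linear maps only for index types of class \<open>wellorder\<close>.
  The type \<open>'a wo\<close> is a well-ordered copy of a finite index type, through which the result is transported.\<close>

typedef 'a wo = "UNIV :: 'a set" morphisms un_wo mk_wo ..

lemma bij_mk_wo: "bij mk_wo"
  by (rule o_bij[of un_wo]) (simp_all add: fun_eq_iff mk_wo_inverse un_wo_inverse)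

lemma bij_un_wo: "bij un_wo"
  by (rule o_bij[of mk_wo]) (simp_all add: fun_eq_iff mk_wo_inverse un_wo_inverse)

instance wo :: (finite) finite
proof
  have "finite (range (mk_wo :: 'a \<Rightarrow> 'a wo))" by (rule finite_imageI) (rule finite)
  then show "finite (UNIV :: 'a wo set)" unfolding bij_is_surj[OF bij_mk_wo] .
qed

instantiation wo :: (finite) wellorder
begin

definition less_eq_wo :: "'a wo \<Rightarrow> 'a wo \<Rightarrow> bool" where "less_eq_wo x y \<longleftrightarrow> to_nat (un_wo x) \<le> to_nat (un_wo y)"
definition less_wo :: "'a wo \<Rightarrow> 'a wo \<Rightarrow> bool" where "less_wo x y \<longleftrightarrow> to_nat (un_wo x) < to_nat (un_wo y)"

instance
proof
  fix x y z :: "'a wo"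
  show "(x < y) = (x \<le> y \<and> \<not> y \<le> x)" by (auto simp: less_wo_def less_eq_wo_def)
  show "x \<le> x" by (simp add: less_eq_wo_def)
  show "x \<le> y \<Longrightarrow> y \<le> z \<Longrightarrow> x \<le> z" by (simp add: less_eq_wo_def)
  show "x \<le> y \<Longrightarrow> y \<le> x \<Longrightarrow> x = y" by (simp add: less_eq_wo_def un_wo_inject)
  show "x \<le> y \<or> y \<le> x" by (auto simp: less_eq_wo_def)
next
  fix P and a :: "'a wo"
  assume *: "\<And>x :: 'a wo. (\<And>y. y < x \<Longrightarrow> P y) \<Longrightarrow> P x"
  show "P a"
  proof (induction "to_nat (un_wo a)" arbitrary: a rule: less_induct)
    case less
    then show ?case using * by (simp add: less_wo_def)
  qed
qed

end

definition wo_vec :: "'a^'d \<Rightarrow> 'a^'d wo" where "wo_vec x = (\<chi> i. x $ un_wo i)"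
definition unwo_vec :: "'a^'d wo \<Rightarrow> 'a^'d" where "unwo_vec x = (\<chi> i. x $ mk_wo i)"
definition wo_mat :: "'a^'d^'d \<Rightarrow> 'a^'d wo^'d wo" where "wo_mat A = (\<chi> i j. A $ un_wo i $ un_wo j)"

lemma unwo_wo [simp]: "unwo_vec (wo_vec x) = x" "wo_vec (unwo_vec y) = y"
  by (simp_all add: vec_eq_iff wo_vec_def unwo_vec_def mk_wo_inverse un_wo_inverse)

lemma linear_wo_vec: "linear (wo_vec :: real^'d::finite \<Rightarrow> real^'d wo)"
  by (rule linearI) (simp_all add: vec_eq_iff wo_vec_def)

lemma linear_unwo_vec: "linear (unwo_vec :: real^'d::finite wo \<Rightarrow> real^'d)"
  by (rule linearI) (simp_all add: vec_eq_iff unwo_vec_def)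

lemma wo_mat_vec: "wo_mat A *v wo_vec x = wo_vec (A *v x)" for A :: "real^'d::finite^'d"
  by (simp add: vec_eq_iff wo_mat_def wo_vec_def matrix_vector_mult_def)
    (intro allI sum.reindex_bij_betw[OF bij_un_wo, symmetric, THEN sym])

text \<open>\<open>map_permutation\<close> matches the permutations of the two index types and
  preserves signs and the products of entries, so the Leibniz sums agree term by term.\<close>

lemma det_wo_mat: "det (wo_mat A) = det A" for A :: "real^'d::finite^'d"
proof -
  let ?m = "map_permutation (UNIV :: 'd set) mk_wo"
  have inj: "inj_on mk_wo (UNIV :: 'd set)" by (rule bij_is_inj[OF bij_mk_wo])
  have b: "bij_betw ?m {p. p permutes UNIV} {p. p permutes UNIV}"
  proof (rule bij_betwI)
    show "?m \<in> {p. p permutes UNIV} \<rightarrow> {p. p permutes UNIV}"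
      using map_permutation_permutes[OF bij_mk_wo] by auto
    show "map_permutation UNIV un_wo \<in> {p. p permutes UNIV} \<rightarrow> {p. p permutes (UNIV :: 'd set)}"
      using map_permutation_permutes[OF bij_un_wo] by auto
    show "map_permutation UNIV un_wo (?m p) = p" if "p \<in> {p. p permutes UNIV}" for p
      by (rule map_permutation_compose_inv[OF bij_mk_wo]) (use that in \<open>auto simp: mk_wo_inverse\<close>)
    show "?m (map_permutation UNIV un_wo p) = p" if "p \<in> {p. p permutes UNIV}" for p
      by (rule map_permutation_compose_inv[OF bij_un_wo]) (use that in \<open>auto simp: un_wo_inverse\<close>)
  qed
  have "det (wo_mat A) = (\<Sum>p | p permutes (UNIV :: 'd set). of_int (sign (?m p)) * (\<Prod>i\<in>UNIV. wo_mat A $ i $ ?m p i))"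
    unfolding det_def by (rule sum.reindex_bij_betw[OF b, symmetric])
  also have "\<dots> = (\<Sum>p | p permutes (UNIV :: 'd set). of_int (sign p) * (\<Prod>i\<in>UNIV. A $ i $ p i))"
  proof (rule sum.cong[OF refl])
    fix p assume "p \<in> {p. p permutes (UNIV :: 'd set)}"
    then have p: "p permutes (UNIV :: 'd set)" by simp
    have "(\<Prod>i\<in>UNIV. wo_mat A $ i $ ?m p i) = (\<Prod>i\<in>UNIV. wo_mat A $ mk_wo i $ ?m p (mk_wo i))"
      by (rule prod.reindex_bij_betw[OF bij_mk_wo, symmetric])
    also have "\<dots> = (\<Prod>i\<in>UNIV. A $ i $ p i)"
      by (simp add: map_permutation_apply[OF inj] wo_mat_def mk_wo_inverse)
    finally show "of_int (sign (?m p)) * (\<Prod>i\<in>UNIV. wo_mat A $ i $ ?m p i) = of_int (sign p) * (\<Prod>i\<in>UNIV. A $ i $ p i)"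
      using sign_map_permutation[OF inj p] by simp
  qed
  finally show ?thesis unfolding det_def .
qed

lemma prod_Basis_vec: "(\<Prod>b\<in>(Basis :: (real^'d) set). f b) = (\<Prod>i\<in>UNIV. f (axis i 1))"
  by (rule prod.reindex_bij_betw[symmetric]) (auto simp: bij_betw_def inj_on_def axis_eq_axis Basis_vec_def)

lemma lborel_wo_vec: "distr lborel borel (wo_vec :: real^'d::finite \<Rightarrow> real^'d wo) = lborel"
proof (rule lborel_eqI[symmetric])
  have [measurable]: "(wo_vec :: real^'d \<Rightarrow> real^'d wo) \<in> borel_measurable borel"
    by (intro borel_measurable_continuous_onI linear_continuous_on linear_conv_bounded_linear[THEN iffD1] linear_wo_vec)
  fix l u :: "real^'d wo" assume le: "\<And>b. b \<in> Basis \<Longrightarrow> l \<bullet> b \<le> u \<bullet> b"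
  have "wo_vec -` box l u = box (unwo_vec l) (unwo_vec u)"
  proof -
    have inv: "un_wo (mk_wo a) = a" "mk_wo (un_wo b) = b" for a :: 'd and b
      by (simp_all add: mk_wo_inverse un_wo_inverse)
    show ?thesis
      by (auto simp: mem_box_cart wo_vec_def unwo_vec_def) (metis inv)+
  qed
  then have "emeasure (distr lborel borel wo_vec) (box l u) = emeasure lborel (box (unwo_vec l) (unwo_vec u))"
    by (subst emeasure_distr) auto
  also have "\<dots> = (\<Prod>b\<in>Basis. (unwo_vec u - unwo_vec l) \<bullet> b)"
  proof (rule emeasure_lborel_box)
    fix b :: "real^'d" assume "b \<in> Basis"
    then obtain i where "b = axis i 1" by (auto simp: Basis_vec_def)
    then show "unwo_vec l \<bullet> b \<le> unwo_vec u \<bullet> b"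
      using le[of "axis (mk_wo i) 1"] by (simp add: inner_axis unwo_vec_def axis_in_Basis_iff)
  qed
  also have "(\<Prod>b\<in>Basis. (unwo_vec u - unwo_vec l) \<bullet> b) = (\<Prod>b\<in>Basis. (u - l) \<bullet> b)"
    unfolding prod_Basis_vec
    by (simp add: inner_axis unwo_vec_def) (rule prod.reindex_bij_betw[OF bij_mk_wo])
  finally show "emeasure (distr lborel borel wo_vec) (box l u) = (\<Prod>b\<in>Basis. (u - l) \<bullet> b)" .
qed simp

section \<open>The Jacobian of an invertible matrix\<close>

lemma matrix_inv_mult:
  assumes "invertible A" shows "A ** matrix_inv A = mat 1" "matrix_inv A ** A = mat 1"
proof -
  have "\<exists>A'. A ** A' = mat 1 \<and> A' ** A = mat 1" using assms unfolding invertible_def .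
  then have "A ** matrix_inv A = mat 1 \<and> matrix_inv A ** A = mat 1" unfolding matrix_inv_def by (rule someI_ex)
  then show "A ** matrix_inv A = mat 1" "matrix_inv A ** A = mat 1" by auto
qed

lemma emeasure_linear_image_box:
  fixes A :: "real^'n::{finite,wellorder}^'n::_"
  assumes "det A \<noteq> 0"
  shows "emeasure lborel ((*v) A ` box l u) = ennreal \<bar>det A\<bar> * emeasure lborel (box l u)"
proof -
  have lin: "linear ((*v) A)" by (rule matrix_vector_mul_linear)
  have m: "(*v) A ` box l u \<in> lmeasurable"
    by (rule measurable_linear_image[OF lin lmeasurable_box])
  have inv: "invertible A" using assms by (simp add: invertible_det_nz)
  \<comment> \<open>Being open, the image is a Borel set; this permits the passage between
    \<open>lborel\<close> and \<open>lebesgue\<close>.\<close>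
  have "open ((*v) A ` box l u)"
    by (rule open_surjective_linear_image[OF open_box lin]) (rule surjI[of _ "(*v) (matrix_inv A)"], simp add: matrix_vector_mul_assoc matrix_inv_mult[OF inv])
  then have b: "(*v) A ` box l u \<in> sets borel" by simp
  have "emeasure lborel ((*v) A ` box l u) = emeasure lebesgue ((*v) A ` box l u)"
    using b by (simp add: emeasure_completion)
  also have "\<dots> = ennreal (measure lebesgue ((*v) A ` box l u))"
    using m by (simp add: emeasure_eq_measure2)
  also have "\<dots> = ennreal (\<bar>det (matrix ((*v) A))\<bar> * measure lebesgue (box l u))"
    using measure_linear_image[OF lin lmeasurable_box] by simp
  also have "\<dots> = ennreal \<bar>det A\<bar> * ennreal (measure lebesgue (box l u))"
    by (simp add: ennreal_mult)
  also have "ennreal (measure lebesgue (box l u)) = emeasure lebesgue (box l u)"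
    using lmeasurable_box[of l u] by (simp add: emeasure_eq_measure2)
  also have "emeasure lebesgue (box l u) = emeasure lborel (box l u)" by simp
  finally show ?thesis .
qed

text \<open>Preimages of boxes under \<open>A\<close> are images under its inverse \<open>B\<close>,
  and the two determinants are reciprocal. So both measures give each box its volume, which
  determines \<open>lborel\<close>.\<close>

lemma distr_lborel_matrix_wellorder:
  fixes A :: "real^'n::{finite,wellorder}^'n::_"
  assumes "det A \<noteq> 0"
  shows "lborel = density (distr lborel borel ((*v) A)) (\<lambda>_. ennreal \<bar>det A\<bar>)"
proof (rule lborel_eqI)
  have [measurable]: "(*v) A \<in> borel_measurable borel"
    by (intro borel_measurable_continuous_onI linear_continuous_on matrix_vector_mul_bounded_linear)
  fix l u :: "real^'n::_" assume le: "\<And>b. b \<in> Basis \<Longrightarrow> l \<bullet> b \<le> u \<bullet> b"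
  define B where "B = matrix_inv A"
  have inv: "invertible A" using assms by (simp add: invertible_det_nz)
  have AB: "A ** B = mat 1" "B ** A = mat 1" unfolding B_def using matrix_inv_mult[OF inv] by auto
  have detB: "\<bar>det A\<bar> * \<bar>det B\<bar> = 1" using arg_cong[OF AB(1), of det] by (simp add: det_mul abs_mult[symmetric])
  have "(*v) A -` box l u = (*v) B ` box l u"
  proof safe
    fix x assume "A *v x \<in> box l u"
    moreover have "x = B *v (A *v x)" by (simp add: matrix_vector_mul_assoc AB)
    ultimately show "x \<in> (*v) B ` box l u" by blast
  qed (simp add: matrix_vector_mul_assoc AB)
  then have "emeasure (density (distr lborel borel ((*v) A)) (\<lambda>_. ennreal \<bar>det A\<bar>)) (box l u) = ennreal \<bar>det A\<bar> * emeasure lborel ((*v) B ` box l u)"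
    by (subst emeasure_density) (auto simp: nn_integral_cmult emeasure_distr)
  also have "\<dots> = ennreal \<bar>det A\<bar> * (ennreal \<bar>det B\<bar> * emeasure lborel (box l u))"
    by (subst emeasure_linear_image_box) (use detB in auto)
  also have "\<dots> = emeasure lborel (box l u)"
    using detB by (simp add: mult.assoc[symmetric] ennreal_mult[symmetric])
  also have "\<dots> = (\<Prod>b\<in>Basis. (u - l) \<bullet> b)" by (rule emeasure_lborel_box[OF le])
  finally show "emeasure (density (distr lborel borel ((*v) A)) (\<lambda>_. ennreal \<bar>det A\<bar>)) (box l u) = (\<Prod>b\<in>Basis. (u - l) \<bullet> b)" .
qed simp

text \<open>\<open>wo_vec\<close> preserves Lebesgue measure and intertwines \<open>A\<close> with
  \<open>wo_mat A\<close>, which carries the formula over from the well-ordered index type.\<close>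

lemma nn_integral_matrix:
  fixes A :: "real^'d::finite^'d" and f :: "real^'d \<Rightarrow> ennreal"
  assumes "det A \<noteq> 0" and [measurable]: "f \<in> borel_measurable borel"
  shows "(\<integral>\<^sup>+x. f x \<partial>lborel) = ennreal \<bar>det A\<bar> * (\<integral>\<^sup>+x. f (A *v x) \<partial>lborel)"
proof -
  have [measurable]: "(wo_vec :: real^'d \<Rightarrow> real^'d wo) \<in> borel_measurable borel" "(unwo_vec :: real^'d wo \<Rightarrow> real^'d) \<in> borel_measurable borel"
    by (intro borel_measurable_continuous_onI linear_continuous_on linear_conv_bounded_linear[THEN iffD1] linear_wo_vec linear_unwo_vec)+
  have [measurable]: "(*v) (wo_mat A) \<in> borel_measurable borel" "(*v) A \<in> borel_measurable borel"
    by (intro borel_measurable_continuous_onI linear_continuous_on matrix_vector_mul_bounded_linear)+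
  have wo: "(\<integral>\<^sup>+x. g (wo_vec x) \<partial>lborel) = (\<integral>\<^sup>+y. g y \<partial>lborel)" if [measurable]: "g \<in> borel_measurable borel" for g :: "real^'d wo \<Rightarrow> ennreal"
    by (subst lborel_wo_vec[symmetric], subst nn_integral_distr) auto
  have "(\<integral>\<^sup>+x. f x \<partial>lborel) = (\<integral>\<^sup>+y. f (unwo_vec y) \<partial>lborel)"
    using wo[of "\<lambda>y. f (unwo_vec y)"] by simp
  also have "\<dots> = (\<integral>\<^sup>+y. f (unwo_vec y) \<partial>density (distr lborel borel ((*v) (wo_mat A))) (\<lambda>_. ennreal \<bar>det A\<bar>))"
    using distr_lborel_matrix_wellorder[of "wo_mat A"] assms by (simp add: det_wo_mat)
  also have "\<dots> = ennreal \<bar>det A\<bar> * (\<integral>\<^sup>+y. f (unwo_vec (wo_mat A *v y)) \<partial>lborel)"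
    by (simp add: nn_integral_density nn_integral_distr nn_integral_cmult)
  also have "(\<integral>\<^sup>+y. f (unwo_vec (wo_mat A *v y)) \<partial>lborel) = (\<integral>\<^sup>+x. f (A *v x) \<partial>lborel)"
    using wo[of "\<lambda>y. f (unwo_vec (wo_mat A *v y))"] by (simp add: wo_mat_vec)
  finally show ?thesis .
qed

lemma lborel_matrix:
  fixes A :: "real^'d::finite^'d"
  assumes "det A \<noteq> 0"
  shows "lborel = density (distr lborel borel ((*v) A)) (\<lambda>_. ennreal \<bar>det A\<bar>)"
proof (rule measure_eqI)
  have [measurable]: "(*v) A \<in> borel_measurable borel"
    by (intro borel_measurable_continuous_onI linear_continuous_on matrix_vector_mul_bounded_linear)
  fix X :: "(real^'d) set" assume "X \<in> sets lborel"
  then have [measurable]: "X \<in> sets borel" by simp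
  have "emeasure lborel X = (\<integral>\<^sup>+x. indicator X x \<partial>lborel)" by simp
  also have "\<dots> = ennreal \<bar>det A\<bar> * (\<integral>\<^sup>+x. indicator X (A *v x) \<partial>lborel)"
    by (rule nn_integral_matrix[OF assms]) simp
  also have "\<dots> = emeasure (density (distr lborel borel ((*v) A)) (\<lambda>_. ennreal \<bar>det A\<bar>)) X"
  proof -
    have "emeasure (density (distr lborel borel ((*v) A)) (\<lambda>_. ennreal \<bar>det A\<bar>)) X =
        (\<integral>\<^sup>+x. ennreal \<bar>det A\<bar> * indicator X x \<partial>distr lborel borel ((*v) A))"
      by (rule emeasure_density) auto
    also have "\<dots> = ennreal \<bar>det A\<bar> * (\<integral>\<^sup>+x. indicator X x \<partial>distr lborel borel ((*v) A))"
      by (rule nn_integral_cmult) auto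
    also have "(\<integral>\<^sup>+x. indicator X x \<partial>distr lborel borel ((*v) A)) = (\<integral>\<^sup>+x. indicator X (A *v x) \<partial>lborel)"
      by (rule nn_integral_distr) auto
    finally show ?thesis by (rule sym)
  qed
  finally show "emeasure lborel X = emeasure (density (distr lborel borel ((*v) A)) (\<lambda>_. ennreal \<bar>det A\<bar>)) X" .
qed simp

lemma integrable_matrix:
  fixes A :: "real^'d::finite^'d" and f :: "real^'d \<Rightarrow> 'b::{banach,second_countable_topology}"
  assumes "det A \<noteq> 0" and [measurable]: "f \<in> borel_measurable borel"
  shows "integrable lborel (\<lambda>x. f (A *v x)) \<longleftrightarrow> integrable lborel f"
proof -
  have [measurable]: "(*v) A \<in> borel_measurable borel"
    by (intro borel_measurable_continuous_onI linear_continuous_on matrix_vector_mul_bounded_linear)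
  have "integrable lborel f \<longleftrightarrow> integrable (density (distr lborel borel ((*v) A)) (\<lambda>_. ennreal \<bar>det A\<bar>)) f"
    using lborel_matrix[OF assms(1)] by simp
  also have "\<dots> \<longleftrightarrow> integrable (distr lborel borel ((*v) A)) (\<lambda>x. \<bar>det A\<bar> *\<^sub>R f x)"
    by (rule integrable_density) auto
  also have "\<dots> \<longleftrightarrow> integrable lborel (\<lambda>x. \<bar>det A\<bar> *\<^sub>R f (A *v x))"
    by (rule integrable_distr_eq) auto
  also have "\<dots> \<longleftrightarrow> integrable lborel (\<lambda>x. f (A *v x))"
  proof
    assume "integrable lborel (\<lambda>x. \<bar>det A\<bar> *\<^sub>R f (A *v x))"
    then have "integrable lborel (\<lambda>x. inverse \<bar>det A\<bar> *\<^sub>R (\<bar>det A\<bar> *\<^sub>R f (A *v x)))"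
      by (rule integrable_scaleR_right)
    then show "integrable lborel (\<lambda>x. f (A *v x))" using assms(1) by simp
  qed simp
  finally show ?thesis by simp
qed

lemma integral_matrix:
  fixes A :: "real^'d::finite^'d" and f :: "real^'d \<Rightarrow> 'b::{banach,second_countable_topology}"
  assumes "det A \<noteq> 0" and [measurable]: "f \<in> borel_measurable borel"
  shows "(LINT x|lborel. f x) = \<bar>det A\<bar> *\<^sub>R (LINT x|lborel. f (A *v x))"
proof -
  have [measurable]: "(*v) A \<in> borel_measurable borel"
    by (intro borel_measurable_continuous_onI linear_continuous_on matrix_vector_mul_bounded_linear)
  have "(LINT x|lborel. f x) = (LINT x|density (distr lborel borel ((*v) A)) (\<lambda>_. ennreal \<bar>det A\<bar>). f x)"
    using lborel_matrix[OF assms(1)] by simp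
  also have "\<dots> = (LINT x|distr lborel borel ((*v) A). \<bar>det A\<bar> *\<^sub>R f x)"
    by (rule integral_density) auto
  also have "\<dots> = (LINT x|lborel. \<bar>det A\<bar> *\<^sub>R f (A *v x))"
    by (rule integral_distr) auto
  finally show ?thesis by simp
qed

section \<open>The integer lattice and its fundamental cube\<close>

text \<open>The cube is half-open so that its integer translates partition the space. The measure
  has total mass 1, so integrating a constant over the cube returns it.\<close>

definition cube_measure :: "(real^'d) measure" where
  "cube_measure = restrict_space lborel unit_cube"

lemma unit_cube_sets [measurable]: "unit_cube \<in> sets (borel :: (real^'d) measure)"
  unfolding unit_cube_def by measurable

lemma real_vec_add: "real_vec (k + l) = real_vec k + real_vec l"
  and real_vec_minus: "real_vec (- k) = - real_vec k"
  and real_vec_0 [simp]: "real_vec 0 = 0"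
  by (simp_all add: real_vec_def vec_eq_iff)

lemma real_vec_inj: "real_vec k = real_vec l \<longleftrightarrow> k = l"
  by (simp add: real_vec_def vec_eq_iff)

lemma cube_cover: "\<exists>k. x - real_vec k \<in> unit_cube"
proof
  show "x - real_vec (\<chi> i. \<lfloor>x $ i + 1/2\<rfloor>) \<in> unit_cube"
    unfolding unit_cube_def by (auto simp: real_vec_def) linarith+
qed

lemma cube_translate_unique:
  assumes "x - real_vec k \<in> unit_cube" "x - real_vec l \<in> unit_cube" shows "k = l"
proof -
  have "k $ i = l $ i" for i
  proof -
    have "- 1/2 \<le> x $ i - real_of_int (k $ i)" "x $ i - real_of_int (k $ i) < 1/2"
      "- 1/2 \<le> x $ i - real_of_int (l $ i)" "x $ i - real_of_int (l $ i) < 1/2"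
      using assms by (auto simp: unit_cube_def real_vec_def)
    then have "\<bar>real_of_int (k $ i - l $ i)\<bar> < 1" by auto
    then show ?thesis by linarith
  qed
  then show ?thesis by (simp add: vec_eq_iff)
qed

lemma space_cube_measure [simp]: "space cube_measure = unit_cube"
  by (simp add: cube_measure_def space_restrict_space)

lemma emeasure_unit_cube: "emeasure lborel (unit_cube :: (real^'d) set) = 1"
proof -
  let ?h = "(\<chi> i. 1/2) :: real^'d"
  have sub: "box (- ?h) ?h \<subseteq> unit_cube" "unit_cube \<subseteq> cbox (- ?h) ?h"
    by (auto simp: unit_cube_def mem_box_cart less_imp_le)
  have le: "(- ?h) \<bullet> b \<le> ?h \<bullet> b" if "b \<in> Basis" for b
    using that by (auto simp: Basis_vec_def inner_axis)
  have one: "(\<Prod>b\<in>Basis. (?h - - ?h) \<bullet> b) = 1"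
    unfolding prod_Basis_vec by (simp add: inner_axis)
  have "emeasure lborel (box (- ?h) ?h) = 1" "emeasure lborel (cbox (- ?h) ?h) = 1"
    using emeasure_lborel_box[OF le] emeasure_lborel_cbox[OF le] one by simp_all
  moreover have "emeasure lborel (box (- ?h) ?h) \<le> emeasure lborel (unit_cube :: (real^'d) set)"
    by (rule emeasure_mono[OF sub(1)]) simp
  moreover have "emeasure lborel (unit_cube :: (real^'d) set) \<le> emeasure lborel (cbox (- ?h) ?h)"
    by (rule emeasure_mono[OF sub(2)]) simp
  ultimately show ?thesis by simp
qed

lemma emeasure_cube_measure: "A \<subseteq> unit_cube \<Longrightarrow> emeasure cube_measure A = emeasure lborel A"
  unfolding cube_measure_def by (rule emeasure_restrict_space) simp_all

lemma prob_space_cube_measure: "prob_space (cube_measure :: (real^'d) measure)"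
  by (rule prob_spaceI) (simp add: emeasure_cube_measure emeasure_unit_cube)

interpretation cube: prob_space "cube_measure :: (real^'d) measure"
  by (rule prob_space_cube_measure)

interpretation lattice: sigma_finite_measure "count_space (UNIV :: (int^'d) set)"
  by (rule sigma_finite_measure_count_space_countable) simp

interpretation lattice_cube: pair_sigma_finite "count_space (UNIV :: (int^'d) set)" "cube_measure :: (real^'d) measure" ..

lemma measurable_id_cube: "(\<lambda>x. x) \<in> cube_measure \<rightarrow>\<^sub>M borel"
  unfolding cube_measure_def by (rule measurable_restrict_space1) simp

lemma borel_measurable_cube: "f \<in> borel \<rightarrow>\<^sub>M N \<Longrightarrow> f \<in> cube_measure \<rightarrow>\<^sub>M N"
  by (rule measurable_compose[OF measurable_id_cube, of f])

lemma measurable_lattice_shift [measurable]: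
  "(\<lambda>(k, u). u + real_vec k) \<in> count_space (UNIV :: (int^'d) set) \<Otimes>\<^sub>M (cube_measure :: (real^'d) measure) \<rightarrow>\<^sub>M borel"
  by (rule measurable_pair_measure_countable1) (auto intro!: borel_measurable_cube)

text \<open>Each point is uniquely a cube point plus a lattice point. Stated as an image of a
  product measure, this lets Tonelli and Fubini exchange integrals over the space with sums over
  cosets.\<close>

lemma lborel_lattice_cube:
  "lborel = distr (count_space (UNIV :: (int^'d) set) \<Otimes>\<^sub>M (cube_measure :: (real^'d) measure)) borel (\<lambda>(k, u). u + real_vec k)"
proof (rule measure_eqI)
  fix X :: "(real^'d) set" assume "X \<in> sets lborel"
  then have X [measurable]: "X \<in> sets borel" by simp
  define Y where "Y k = {x \<in> X. x - real_vec k \<in> unit_cube}" for k :: "int^'d"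
  have Y [measurable]: "Y k \<in> sets borel" for k unfolding Y_def by measurable
  have "emeasure (distr (count_space (UNIV :: (int^'d) set) \<Otimes>\<^sub>M (cube_measure :: (real^'d) measure)) borel (\<lambda>(k, u). u + real_vec k)) X =
      emeasure (count_space UNIV \<Otimes>\<^sub>M cube_measure) ((\<lambda>(k, u). u + real_vec k) -` X \<inter> space (count_space UNIV \<Otimes>\<^sub>M cube_measure))"
    by (rule emeasure_distr) auto
  also have "\<dots> = (\<integral>\<^sup>+k. emeasure cube_measure (Pair k -` ((\<lambda>(k, u). u + real_vec k) -` X \<inter> space (count_space UNIV \<Otimes>\<^sub>M cube_measure))) \<partial>count_space UNIV)"
    by (rule cube.emeasure_pair_measure_alt) measurable
  also have "\<dots> = (\<integral>\<^sup>+k. emeasure lborel (Y k) \<partial>count_space UNIV)"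
  proof (rule nn_integral_cong)
    fix k :: "int^'d"
    have "Pair k -` ((\<lambda>(k, u). u + real_vec k) -` X \<inter> space (count_space UNIV \<Otimes>\<^sub>M cube_measure)) = {u \<in> unit_cube. u + real_vec k \<in> X}"
      by (auto simp: space_pair_measure)
    moreover have "emeasure cube_measure {u \<in> unit_cube. u + real_vec k \<in> X} = emeasure lborel {u \<in> unit_cube. u + real_vec k \<in> X}"
      by (rule emeasure_cube_measure) auto
    moreover have "emeasure lborel {u \<in> unit_cube. u + real_vec k \<in> X} = emeasure (distr lborel borel ((+) (real_vec k))) (Y k)"
      by (subst emeasure_distr) (auto simp: Y_def vimage_def add.commute conj_commute)
    ultimately show "emeasure cube_measure (Pair k -` ((\<lambda>(k, u). u + real_vec k) -` X \<inter> space (count_space UNIV \<Otimes>\<^sub>M cube_measure))) = emeasure lborel (Y k)"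
      by (simp add: lborel_distr_plus)
  qed
  also have "\<dots> = emeasure lborel (\<Union>k. Y k)"
  proof (rule emeasure_UN_countable[symmetric])
    show "disjoint_family_on Y UNIV" unfolding disjoint_family_on_def Y_def using cube_translate_unique by blast
  qed auto
  also have "(\<Union>k. Y k) = X" unfolding Y_def using cube_cover by blast
  finally show "emeasure lborel X = emeasure (distr (count_space (UNIV :: (int^'d) set) \<Otimes>\<^sub>M (cube_measure :: (real^'d) measure)) borel (\<lambda>(k, u). u + real_vec k)) X" by simp
qed simp

lemma nn_integral_lattice_cube:
  fixes f :: "real^'d \<Rightarrow> ennreal"
  assumes [measurable]: "f \<in> borel_measurable borel"
  shows "(\<integral>\<^sup>+x. f x \<partial>lborel) = (\<integral>\<^sup>+u. (\<integral>\<^sup>+k. f (u + real_vec k) \<partial>count_space UNIV) \<partial>cube_measure)"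
proof -
  have "(\<integral>\<^sup>+x. f x \<partial>lborel) = (\<integral>\<^sup>+p. f ((\<lambda>(k, u). u + real_vec k) p) \<partial>(count_space UNIV \<Otimes>\<^sub>M cube_measure))"
    by (subst lborel_lattice_cube, rule nn_integral_distr) auto
  also have "\<dots> = (\<integral>\<^sup>+u. (\<integral>\<^sup>+k. f ((\<lambda>(k, u). u + real_vec k) (k, u)) \<partial>count_space UNIV) \<partial>cube_measure)"
    by (rule lattice_cube.nn_integral_snd[symmetric]) measurable
  finally show ?thesis by simp
qed

lemma integral_lattice_cube:
  fixes f :: "real^'d \<Rightarrow> complex"
  assumes f: "integrable lborel f"
  shows "AE u in cube_measure. integrable (count_space UNIV) (\<lambda>k. f (u + real_vec k))"
    and "integrable cube_measure (\<lambda>u. LINT k|count_space UNIV. f (u + real_vec k))"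
    and "(LINT x|lborel. f x) = (LINT u|cube_measure. LINT k|count_space UNIV. f (u + real_vec k))"
proof -
  have [measurable]: "f \<in> borel_measurable borel" using f by auto
  have i: "integrable (count_space (UNIV :: (int^'d) set) \<Otimes>\<^sub>M cube_measure) (case_prod (\<lambda>k u. f (u + real_vec k)))"
    using f by (subst (asm) lborel_lattice_cube, subst (asm) integrable_distr_eq) (auto simp: case_prod_unfold)
  show "AE u in cube_measure. integrable (count_space UNIV) (\<lambda>k. f (u + real_vec k))"
    by (rule lattice_cube.AE_integrable_snd[OF i])
  show "integrable cube_measure (\<lambda>u. LINT k|count_space UNIV. f (u + real_vec k))"
    by (rule lattice_cube.integrable_snd[OF i])
  have "(LINT x|lborel. f x) = (LINT p|(count_space UNIV \<Otimes>\<^sub>M cube_measure). f ((\<lambda>(k, u). u + real_vec k) p))"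
    by (subst lborel_lattice_cube, rule integral_distr) auto
  also have "\<dots> = (LINT p|(count_space UNIV \<Otimes>\<^sub>M cube_measure). (case_prod (\<lambda>k u. f (u + real_vec k))) p)"
    by (simp add: case_prod_unfold)
  also have "\<dots> = (LINT u|cube_measure. LINT k|count_space UNIV. f (u + real_vec k))"
    by (rule lattice_cube.integral_snd[OF i, symmetric])
  finally show "(LINT x|lborel. f x) = (LINT u|cube_measure. LINT k|count_space UNIV. f (u + real_vec k))" .
qed

section \<open>Lattice sums bounded uniformly in the shift\<close>

lemma cube_norm_le:
  assumes "u \<in> unit_cube" shows "norm (u :: real^'d) \<le> DIM(real^'d)"
proof -
  have "norm u \<le> (\<Sum>i\<in>UNIV. \<bar>u $ i\<bar>)" by (rule norm_le_l1_cart)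
  also have "\<dots> \<le> (\<Sum>i\<in>(UNIV::'d set). 1)"
  proof (rule sum_mono)
    fix i
    have "- 1/2 \<le> u $ i" "u $ i < 1/2" using assms by (auto simp: unit_cube_def)
    then show "\<bar>u $ i\<bar> \<le> 1" by linarith
  qed
  finally show ?thesis by simp
qed

text \<open>Shifting the argument by a cube point changes \<open>W\<close> by at most the factor
  \<open>c\<close>. Averaging over the cube therefore bounds the lattice sum by an integral over the
  whole space, which does not depend on \<open>x\<close>.\<close>

lemma lattice_sum_bound:
  "\<exists>B. \<forall>x::real^'d. (\<integral>\<^sup>+k. ennreal (1 / (1 + norm (x + real_vec k)) ^ (2 * DIM(real^'d))) \<partial>count_space UNIV) \<le> ennreal B"
proof -
  let ?D = "DIM(real^'d)"
  define W where "W y = 1 / (1 + norm y) ^ (2 * ?D)" for y :: "real^'d"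
  have [measurable]: "W \<in> borel_measurable borel" unfolding W_def by measurable
  have W0: "W y \<ge> 0" for y by (simp add: W_def)
  define c where "c = (1 + real ?D) ^ (2 * ?D)"
  have c: "c > 0" unfolding c_def by (intro zero_less_power add_pos_nonneg) auto
  have le: "W y \<le> c * W (y + u)" if u: "u \<in> unit_cube" for y u
  proof -
    have pos: "1 + norm z > 0" for z :: "real^'d" by (simp add: add_pos_nonneg)
    have "1 + norm (y + u) \<le> (1 + norm u) * (1 + norm y)"
      using norm_shift_le[of "y + u" y] by simp
    also have "\<dots> \<le> (1 + real ?D) * (1 + norm y)"
      by (intro mult_right_mono add_left_mono cube_norm_le u) simp
    finally have "(1 + norm (y + u)) ^ (2 * ?D) \<le> ((1 + real ?D) * (1 + norm y)) ^ (2 * ?D)"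
      by (intro power_mono) auto
    then have 1: "(1 + norm (y + u)) ^ (2 * ?D) \<le> c * (1 + norm y) ^ (2 * ?D)"
      unfolding c_def power_mult_distrib .
    have p1: "(1 + norm y) ^ (2 * ?D) > 0" "(1 + norm (y + u)) ^ (2 * ?D) > 0" using pos by simp_all
    show ?thesis unfolding W_def using 1 p1 by (simp only: times_divide_eq_right mult_1_right) (simp only: divide_le_eq le_divide_eq, simp add: field_simps)
  qed
  have "(\<integral>\<^sup>+k. ennreal (W (x + real_vec k)) \<partial>count_space UNIV) \<le> ennreal c * (\<integral>\<^sup>+y. ennreal (W y) \<partial>lborel)" for x
  proof -
    have "(\<integral>\<^sup>+k. ennreal (W (x + real_vec k)) \<partial>count_space UNIV) = (\<integral>\<^sup>+(u::real^'d). (\<integral>\<^sup>+k. ennreal (W (x + real_vec k)) \<partial>count_space UNIV) \<partial>cube_measure)"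
      by (simp add: emeasure_cube_measure emeasure_unit_cube)
    also have "\<dots> \<le> (\<integral>\<^sup>+u. (\<integral>\<^sup>+k. ennreal c * ennreal (W (x + (u + real_vec k))) \<partial>count_space UNIV) \<partial>cube_measure)"
    proof (intro nn_integral_mono)
      fix u :: "real^'d" and k assume "u \<in> space cube_measure"
      then have "W (x + real_vec k) \<le> c * W (x + real_vec k + u)" by (intro le) simp
      then have "ennreal (W (x + real_vec k)) \<le> ennreal (c * W (x + (u + real_vec k)))"
        by (intro ennreal_leI) (simp add: ac_simps)
      then show "ennreal (W (x + real_vec k)) \<le> ennreal c * ennreal (W (x + (u + real_vec k)))"
        using c W0 by (simp add: ennreal_mult)
    qed
    also have "\<dots> = (\<integral>\<^sup>+y. ennreal c * ennreal (W (x + y)) \<partial>lborel)"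
      by (rule nn_integral_lattice_cube[symmetric]) measurable
    also have "\<dots> = ennreal c * (\<integral>\<^sup>+y. ennreal (W (x + y)) \<partial>lborel)"
      by (rule nn_integral_cmult) measurable
    also have "(\<integral>\<^sup>+y. ennreal (W (x + y)) \<partial>lborel) = (\<integral>\<^sup>+y. ennreal (W y) \<partial>distr lborel borel ((+) x))"
      by (rule nn_integral_distr[symmetric]) auto
    also have "distr lborel borel ((+) x) = lborel" by (rule lborel_distr_plus)
    finally show ?thesis .
  qed
  moreover have "(\<integral>\<^sup>+y. ennreal (W y) \<partial>lborel) = ennreal (LINT y|lborel. W y)"
    by (rule nn_integral_eq_integral) (use W0 integrable_weight[where 'a="real^'d"] in \<open>auto simp: W_def\<close>)
  ultimately have "(\<integral>\<^sup>+k. ennreal (W (x + real_vec k)) \<partial>count_space UNIV) \<le> ennreal (c * (LINT y|lborel. W y))" for x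
    using c by (simp add: ennreal_mult')
  then show ?thesis unfolding W_def by blast
qed

text \<open>The reproducing formula bounds the square of a point value by a weighted average of the
  square over the space. Summing along a coset affects the kernel of the average only, and
  \<open>lattice_sum_bound\<close> controls that sum uniformly.\<close>

lemma fhat_lattice_bound:
  fixes T :: "(real^'d) distr"
  assumes T: "T \<in> sobolev t" and K: "compact (distr_support T)"
  shows "\<exists>B\<ge>0. \<forall>\<eta>. (\<integral>\<^sup>+k. ennreal ((cmod (fhat T (\<eta> + real_vec k)))\<^sup>2 * weight t (\<eta> + real_vec k)) \<partial>count_space UNIV) \<le> ennreal B"
proof -
  let ?D = "DIM(real^'d)"
  obtain \<theta> where \<theta>: "\<theta> \<in> schwartz" and rep: "\<And>\<eta>. integrable lborel (\<lambda>\<xi>. fhat T \<xi> * \<theta> (\<xi> - \<eta>))"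
    "\<And>\<eta>. fhat T \<eta> = (LINT \<xi>|lborel. fhat T \<xi> * \<theta> (\<xi> - \<eta>))"
    using fhat_reproducing(1)[OF T K] by blast
  define g where "g = fhat T"
  have [measurable]: "g \<in> borel_measurable borel" "\<theta> \<in> borel_measurable borel"
    unfolding g_def using sobolevD(3)[OF T] schwartz_measurable[OF \<theta>] by auto
  define w where "w x = weight t x" for x :: "real^'d"
  have [measurable]: "w \<in> borel_measurable borel" unfolding w_def by measurable
  have w0: "w x \<ge> 0" for x by (simp add: w_def)
  define W where "W y = 1 / (1 + norm y) ^ (2 * ?D)" for y :: "real^'d"
  have [measurable]: "W \<in> borel_measurable borel" unfolding W_def by measurable
  have W0: "W y \<ge> 0" for y by (simp add: W_def)
  obtain B0 where B0: "\<And>x. (\<integral>\<^sup>+k. ennreal (W (x + real_vec k)) \<partial>count_space UNIV) \<le> ennreal B0"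
    using lattice_sum_bound unfolding W_def by blast
  define k where "k = nat \<lceil>\<bar>\<bar>t\<bar>\<bar>\<rceil>"
  \<comment> \<open>The \<open>2 * k\<close> orders of decay absorb the weight with exponent
    \<open>|t|\<close> from Peetre's inequality; the other \<open>2 * ?D\<close> make the lattice
    sum converge.\<close>
  obtain C where C: "C > 0" "\<And>x. (1 + norm x) ^ (2 * k + 2 * ?D) * cmod (\<theta> x) \<le> C" using rapidE[OF schwartz_rapid[OF \<theta>]] by metis
  have \<theta>W: "cmod (\<theta> z) * weight (\<bar>t\<bar>) z \<le> C * W z" for z
  proof -
    have "weight (\<bar>t\<bar>) z \<le> (1 + norm z) ^ (2 * k)" using weight_powr_poly[of z "\<bar>t\<bar>"] by (simp add: k_def)
    then have "(1 + norm z) ^ (2 * ?D) * (cmod (\<theta> z) * weight (\<bar>t\<bar>) z) \<le> (1 + norm z) ^ (2 * ?D) * (cmod (\<theta> z) * (1 + norm z) ^ (2 * k))"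
      by (intro mult_left_mono) auto
    also have "\<dots> \<le> C" using C(2)[of z] by (simp add: power_add mult_ac)
    finally show ?thesis unfolding W_def using rapid_bound by fastforce
  qed
  define \<Theta> where "\<Theta> = (LINT z|lborel. cmod (\<theta> z))"
  have \<Theta>0: "\<Theta> \<ge> 0" unfolding \<Theta>_def by simp
  define c where "c = 2 powr \<bar>t\<bar> * C * \<Theta>"
  have c0: "c \<ge> 0" using C \<Theta>0 by (simp add: c_def)
  have nn\<Theta>: "(\<integral>\<^sup>+\<xi>. ennreal (cmod (\<theta> (\<xi> - \<eta>))) \<partial>lborel) = ennreal \<Theta>" for \<eta>
  proof -
    have "(\<integral>\<^sup>+\<xi>. ennreal (cmod (\<theta> (\<xi> - \<eta>))) \<partial>lborel) = (\<integral>\<^sup>+\<xi>. ennreal (cmod (\<theta> (- \<eta> + \<xi>))) \<partial>lborel)" by simp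
    also have "\<dots> = (\<integral>\<^sup>+\<xi>. ennreal (cmod (\<theta> \<xi>)) \<partial>distr lborel borel ((+) (- \<eta>)))"
      by (rule nn_integral_distr[symmetric]) auto
    also have "\<dots> = ennreal \<Theta>"
      unfolding lborel_distr_plus \<Theta>_def by (rule nn_integral_eq_integral[OF integrable_norm[OF schwartz_integrable[OF \<theta>]]]) simp
    finally show ?thesis .
  qed
  \<comment> \<open>Cauchy-Schwarz with the modulus of \<open>\<theta>\<close> split into two square
    roots, one of which accompanies \<open>g\<close>. Peetre's inequality then moves the weight from
    \<open>\<eta>\<close> to \<open>\<xi>\<close>, and its extra factor is swallowed by
    \<open>\<theta>\<close>.\<close>
  have pw: "ennreal ((cmod (g \<eta>))\<^sup>2 * w \<eta>) \<le> ennreal c * (\<integral>\<^sup>+\<xi>. ennreal ((cmod (g \<xi>))\<^sup>2 * w \<xi> * W (\<eta> - \<xi>)) \<partial>lborel)" for \<eta>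
  proof -
    have "ennreal (cmod (g \<eta>)) \<le> (\<integral>\<^sup>+\<xi>. ennreal (cmod (g \<xi> * \<theta> (\<xi> - \<eta>))) \<partial>lborel)"
    proof -
      have "ennreal (cmod (g \<eta>)) \<le> ennreal (LINT \<xi>|lborel. cmod (g \<xi> * \<theta> (\<xi> - \<eta>)))"
        unfolding g_def by (subst rep(2)) (intro ennreal_leI integral_norm_bound)
      also have "\<dots> = (\<integral>\<^sup>+\<xi>. ennreal (cmod (g \<xi> * \<theta> (\<xi> - \<eta>))) \<partial>lborel)"
        by (rule nn_integral_eq_integral[symmetric]) (use rep(1)[of \<eta>] in \<open>auto simp: g_def intro!: integrable_norm\<close>)
      finally show ?thesis .
    qed
    also have "\<dots> = (\<integral>\<^sup>+\<xi>. ennreal (cmod (g \<xi>) * sqrt (cmod (\<theta> (\<xi> - \<eta>)))) * ennreal (sqrt (cmod (\<theta> (\<xi> - \<eta>)))) \<partial>lborel)"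
      by (intro nn_integral_cong) (simp add: ennreal_mult[symmetric] norm_mult mult.assoc)
    finally have "ennreal (cmod (g \<eta>)) ^ 2 \<le> (\<integral>\<^sup>+\<xi>. ennreal (cmod (g \<xi>) * sqrt (cmod (\<theta> (\<xi> - \<eta>)))) * ennreal (sqrt (cmod (\<theta> (\<xi> - \<eta>)))) \<partial>lborel) ^ 2"
      by (intro power_mono) auto
    also have "\<dots> \<le> (\<integral>\<^sup>+\<xi>. ennreal (cmod (g \<xi>) * sqrt (cmod (\<theta> (\<xi> - \<eta>)))) ^ 2 \<partial>lborel) * (\<integral>\<^sup>+\<xi>. ennreal (sqrt (cmod (\<theta> (\<xi> - \<eta>)))) ^ 2 \<partial>lborel)"
      by (rule Cauchy_Schwarz_nn_integral) measurable
    also have "(\<integral>\<^sup>+\<xi>. ennreal (sqrt (cmod (\<theta> (\<xi> - \<eta>)))) ^ 2 \<partial>lborel) = ennreal \<Theta>"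
      unfolding nn\<Theta>[of \<eta>, symmetric] by (intro nn_integral_cong) (simp add: ennreal_power)
    also have "(\<integral>\<^sup>+\<xi>. ennreal (cmod (g \<xi>) * sqrt (cmod (\<theta> (\<xi> - \<eta>)))) ^ 2 \<partial>lborel) = (\<integral>\<^sup>+\<xi>. ennreal ((cmod (g \<xi>))\<^sup>2 * cmod (\<theta> (\<xi> - \<eta>))) \<partial>lborel)"
      by (intro nn_integral_cong) (simp add: ennreal_power power_mult_distrib)
    finally have 1: "ennreal ((cmod (g \<eta>))\<^sup>2) \<le> (\<integral>\<^sup>+\<xi>. ennreal ((cmod (g \<xi>))\<^sup>2 * cmod (\<theta> (\<xi> - \<eta>))) \<partial>lborel) * ennreal \<Theta>"
      by (simp add: ennreal_power)
    have "ennreal ((cmod (g \<eta>))\<^sup>2 * w \<eta>) = ennreal ((cmod (g \<eta>))\<^sup>2) * ennreal (w \<eta>)"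
      using w0 by (simp add: ennreal_mult)
    also have "\<dots> \<le> ((\<integral>\<^sup>+\<xi>. ennreal ((cmod (g \<xi>))\<^sup>2 * cmod (\<theta> (\<xi> - \<eta>))) \<partial>lborel) * ennreal \<Theta>) * ennreal (w \<eta>)"
      by (rule mult_right_mono[OF 1]) simp
    also have "\<dots> = ennreal \<Theta> * (\<integral>\<^sup>+\<xi>. ennreal (w \<eta>) * ennreal ((cmod (g \<xi>))\<^sup>2 * cmod (\<theta> (\<xi> - \<eta>))) \<partial>lborel)"
      by (subst nn_integral_cmult) (simp_all add: mult_ac)
    also have "\<dots> \<le> ennreal \<Theta> * (\<integral>\<^sup>+\<xi>. ennreal (2 powr \<bar>t\<bar> * C) * ennreal ((cmod (g \<xi>))\<^sup>2 * w \<xi> * W (\<eta> - \<xi>)) \<partial>lborel)"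
    proof (intro mult_left_mono nn_integral_mono)
      fix \<xi> :: "real^'d"
      have "w \<eta> * ((cmod (g \<xi>))\<^sup>2 * cmod (\<theta> (\<xi> - \<eta>))) \<le> (2 powr \<bar>t\<bar> * w \<xi> * weight (\<bar>t\<bar>) (\<eta> - \<xi>)) * ((cmod (g \<xi>))\<^sup>2 * cmod (\<theta> (\<xi> - \<eta>)))"
        unfolding w_def by (rule mult_right_mono[OF weight_powr_le]) simp
      also have "\<dots> = (2 powr \<bar>t\<bar> * w \<xi> * (cmod (g \<xi>))\<^sup>2) * (cmod (\<theta> (\<xi> - \<eta>)) * weight (\<bar>t\<bar>) (\<xi> - \<eta>))"
        by (simp add: mult_ac norm_minus_commute)
      also have "\<dots> \<le> (2 powr \<bar>t\<bar> * w \<xi> * (cmod (g \<xi>))\<^sup>2) * (C * W (\<xi> - \<eta>))"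
        by (intro mult_left_mono \<theta>W mult_nonneg_nonneg w0) auto
      also have "\<dots> = (2 powr \<bar>t\<bar> * C) * ((cmod (g \<xi>))\<^sup>2 * w \<xi> * W (\<eta> - \<xi>))"
        by (simp add: mult_ac W_def norm_minus_commute)
      finally show "ennreal (w \<eta>) * ennreal ((cmod (g \<xi>))\<^sup>2 * cmod (\<theta> (\<xi> - \<eta>))) \<le> ennreal (2 powr \<bar>t\<bar> * C) * ennreal ((cmod (g \<xi>))\<^sup>2 * w \<xi> * W (\<eta> - \<xi>))"
        using w0 W0 C by (simp add: ennreal_mult[symmetric] ennreal_leI)
    qed simp
    also have "\<dots> = ennreal c * (\<integral>\<^sup>+\<xi>. ennreal ((cmod (g \<xi>))\<^sup>2 * w \<xi> * W (\<eta> - \<xi>)) \<partial>lborel)"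
    proof -
      have "ennreal \<Theta> * ennreal (2 powr \<bar>t\<bar> * C) = ennreal c"
        using C \<Theta>0 by (subst ennreal_mult[symmetric]) (simp_all add: c_def mult.commute)
      moreover have "(\<integral>\<^sup>+\<xi>. ennreal (2 powr \<bar>t\<bar> * C) * ennreal ((cmod (g \<xi>))\<^sup>2 * w \<xi> * W (\<eta> - \<xi>)) \<partial>lborel) =
          ennreal (2 powr \<bar>t\<bar> * C) * (\<integral>\<^sup>+\<xi>. ennreal ((cmod (g \<xi>))\<^sup>2 * w \<xi> * W (\<eta> - \<xi>)) \<partial>lborel)"
        by (rule nn_integral_cmult) measurable
      ultimately show ?thesis by (simp only: mult.assoc[symmetric])
    qed
    finally show ?thesis .
  qed
  define I where "I = (LINT \<xi>|lborel. (cmod (g \<xi>))\<^sup>2 * w \<xi>)"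
  have I: "(\<integral>\<^sup>+\<xi>. ennreal ((cmod (g \<xi>))\<^sup>2 * w \<xi>) \<partial>lborel) = ennreal I"
    unfolding I_def by (rule nn_integral_eq_integral) (use sobolevD(4)[OF T] w0 in \<open>auto simp: g_def w_def\<close>)
  have I0: "I \<ge> 0" unfolding I_def by (intro integral_nonneg_AE AE_I2) (simp add: w0)
  have "(\<integral>\<^sup>+k. ennreal ((cmod (g (\<eta> + real_vec k)))\<^sup>2 * w (\<eta> + real_vec k)) \<partial>count_space UNIV) \<le> ennreal (c * (I * max 0 B0))" for \<eta>
  proof -
    interpret LL: pair_sigma_finite "count_space (UNIV :: (int^'d) set)" "lborel :: (real^'d) measure" ..
    have "(\<integral>\<^sup>+k. ennreal ((cmod (g (\<eta> + real_vec k)))\<^sup>2 * w (\<eta> + real_vec k)) \<partial>count_space UNIV) \<le>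
        (\<integral>\<^sup>+k. ennreal c * (\<integral>\<^sup>+\<xi>. ennreal ((cmod (g \<xi>))\<^sup>2 * w \<xi> * W (\<eta> + real_vec k - \<xi>)) \<partial>lborel) \<partial>count_space UNIV)"
      by (intro nn_integral_mono pw)
    also have "\<dots> = ennreal c * (\<integral>\<^sup>+k. (\<integral>\<^sup>+\<xi>. ennreal ((cmod (g \<xi>))\<^sup>2 * w \<xi> * W (\<eta> + real_vec k - \<xi>)) \<partial>lborel) \<partial>count_space UNIV)"
      by (rule nn_integral_cmult) simp
    also have "(\<integral>\<^sup>+k. (\<integral>\<^sup>+\<xi>. ennreal ((cmod (g \<xi>))\<^sup>2 * w \<xi> * W (\<eta> + real_vec k - \<xi>)) \<partial>lborel) \<partial>count_space UNIV) =
        (\<integral>\<^sup>+\<xi>. (\<integral>\<^sup>+k. ennreal ((cmod (g \<xi>))\<^sup>2 * w \<xi> * W (\<eta> + real_vec k - \<xi>)) \<partial>count_space UNIV) \<partial>lborel)"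
      by (rule LL.Fubini'[symmetric]) measurable
    also have "\<dots> = (\<integral>\<^sup>+\<xi>. ennreal ((cmod (g \<xi>))\<^sup>2 * w \<xi>) * (\<integral>\<^sup>+k. ennreal (W ((\<eta> - \<xi>) + real_vec k)) \<partial>count_space UNIV) \<partial>lborel)"
    proof (rule nn_integral_cong)
      fix \<xi>
      have "(\<integral>\<^sup>+k. ennreal ((cmod (g \<xi>))\<^sup>2 * w \<xi> * W (\<eta> + real_vec k - \<xi>)) \<partial>count_space UNIV) = (\<integral>\<^sup>+k. ennreal ((cmod (g \<xi>))\<^sup>2 * w \<xi>) * ennreal (W ((\<eta> - \<xi>) + real_vec k)) \<partial>count_space UNIV)"
        by (intro nn_integral_cong) (simp add: ennreal_mult w0 W0 algebra_simps)
      also have "\<dots> = ennreal ((cmod (g \<xi>))\<^sup>2 * w \<xi>) * (\<integral>\<^sup>+k. ennreal (W ((\<eta> - \<xi>) + real_vec k)) \<partial>count_space UNIV)"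
        by (rule nn_integral_cmult) simp
      finally show "(\<integral>\<^sup>+k. ennreal ((cmod (g \<xi>))\<^sup>2 * w \<xi> * W (\<eta> + real_vec k - \<xi>)) \<partial>count_space UNIV) = ennreal ((cmod (g \<xi>))\<^sup>2 * w \<xi>) * (\<integral>\<^sup>+k. ennreal (W ((\<eta> - \<xi>) + real_vec k)) \<partial>count_space UNIV)" .
    qed
    also have "\<dots> \<le> (\<integral>\<^sup>+\<xi>. ennreal ((cmod (g \<xi>))\<^sup>2 * w \<xi>) * ennreal (max 0 B0) \<partial>lborel)"
      by (intro nn_integral_mono mult_left_mono order_trans[OF B0] ennreal_leI) auto
    also have "\<dots> = ennreal I * ennreal (max 0 B0)"
      unfolding I[symmetric] by (rule nn_integral_multc) measurable
    finally show ?thesis using c0 I0 by (simp add: ennreal_mult mult_left_mono)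
  qed
  then show ?thesis unfolding g_def w_def using c0 I0 by (intro exI[of _ "c * (I * max 0 B0)"]) auto
qed

section \<open>Fourier series\<close>

text \<open>The character with the positive sign, which is what the shift \<open>x + k\<close>
  produces on the Fourier side.\<close>

definition tchar :: "int^'d \<Rightarrow> real^'d \<Rightarrow> complex" where
  "tchar k u = cis (2 * pi * (real_vec k \<bullet> u))"

lemma tchar_add: "tchar (k + l) u = tchar k u * tchar l u"
  by (simp add: tchar_def real_vec_add inner_add_left distrib_left cis_mult)

lemma tchar_minus: "tchar (- k) u = cnj (tchar k u)"
  by (simp add: tchar_def real_vec_minus cis_cnj)

lemma tchar_0 [simp]: "tchar 0 u = 1" by (simp add: tchar_def)

lemma norm_tchar [simp]: "cmod (tchar k u) = 1" by (simp add: tchar_def)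

lemma tchar_cnj_mult: "tchar k u * cnj (tchar l u) = tchar (k - l) u"
  using tchar_add[of k "- l" u] by (simp add: tchar_minus)

lemma tchar_shift: "tchar k (u + real_vec l) = tchar k u"
proof -
  have "real_vec k \<bullet> real_vec l = real_of_int (\<Sum>i\<in>UNIV. k $ i * l $ i)"
    by (simp add: inner_vec_def real_vec_def)
  then have "real_vec k \<bullet> real_vec l \<in> \<int>" by (simp only: Ints_of_int)
  then have "cis (2 * pi * (real_vec k \<bullet> real_vec l)) = 1" by (rule cis_multiple_2pi)
  then show ?thesis by (simp add: tchar_def inner_add_right distrib_left cis_mult[symmetric])
qed

lemma continuous_tchar: "continuous_on UNIV (tchar k)"
  unfolding tchar_def cis_conv_exp by (intro continuous_intros)

lemma measurable_tchar [measurable]: "tchar k \<in> borel_measurable borel"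
  by (rule borel_measurable_continuous_onI[OF continuous_tchar])

lemma measurable_tchar_cube [measurable]: "tchar k \<in> borel_measurable cube_measure"
  by (rule borel_measurable_cube) simp

lemma prod_cis: "finite I \<Longrightarrow> (\<Prod>i\<in>I. cis (f i)) = cis (sum f I)"
  by (induction I rule: finite_induct) (simp_all add: cis_mult)

text \<open>The missing end point is a null set, so the integral can be taken over the closed
  interval; there an antiderivative has equal values at both ends unless
  \<open>m = 0\<close>.\<close>

lemma integral_cis_period:
  "(LINT t|lborel. indicator {- 1/2..<1/2} t *\<^sub>R cis (2 * pi * (real_of_int m) * t)) = (if m = 0 then 1 else 0)"
  "integrable lborel (\<lambda>t. indicator {- 1/2..<1/2} t *\<^sub>R cis (2 * pi * (real_of_int m) * t))"
proof -
  define c where "c = 2 * pi * real_of_int m"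
  have ae: "AE t in lborel. indicator {- 1/2..1/2} t *\<^sub>R cis (c * t) = indicator {- 1/2..<1/2} t *\<^sub>R cis (c * t)"
    using AE_lborel_singleton[of "1/2::real"] by eventually_elim (auto simp: indicator_def)
  have "integrable lborel (\<lambda>t::real. indicator {- 1/2..<1/2} t :: real)" by simp
  then show "integrable lborel (\<lambda>t. indicator {- 1/2..<1/2} t *\<^sub>R cis (2 * pi * (real_of_int m) * t))"
  proof (rule Bochner_Integration.integrable_bound)
    have "(\<lambda>t. cis (2 * pi * (real_of_int m) * t)) \<in> borel_measurable borel" by measurable
    then show "(\<lambda>t. indicator {- 1/2..<1/2} t *\<^sub>R cis (2 * pi * (real_of_int m) * t)) \<in> borel_measurable lborel"
      by (intro borel_measurable_scaleR borel_measurable_indicator) simp_all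
  qed (intro AE_I2, simp add: indicator_def)
  have "(LINT t|lborel. indicator {- 1/2..<1/2} t *\<^sub>R cis (c * t)) = (LINT t|lborel. indicator {- 1/2..1/2} t *\<^sub>R cis (c * t))"
    by (rule integral_cong_AE) (measurable, use ae in \<open>auto elim: AE_mp\<close>)
  also have "\<dots> = (if m = 0 then 1 else 0)"
  proof (cases "m = 0")
    case True
    then show ?thesis by (simp add: c_def)
  next
    case False
    then have c: "c \<noteq> 0" by (simp add: c_def)
    have "(LINT t|lborel. indicator {- 1/2..1/2} t *\<^sub>R cis (c * t)) =
        exp (\<i> * of_real c * of_real (1/2)) / (\<i> * of_real c) - exp (\<i> * of_real c * of_real (- 1/2)) / (\<i> * of_real c)"
    proof (rule integral_FTC_atLeastAtMost)
      fix x :: real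
      have "((\<lambda>t. exp (\<i> * of_real c * t) / (\<i> * of_real c)) has_field_derivative exp (\<i> * of_real c * of_real x)) (at (of_real x))"
        using c by (auto intro!: derivative_eq_intros)
      from has_vector_derivative_real_field[OF this]
      have "((\<lambda>t. exp (\<i> * of_real c * complex_of_real t) / (\<i> * of_real c)) has_vector_derivative cis (c * x)) (at x within {- 1/2..1/2})"
        by (simp add: cis_conv_exp mult.assoc)
      then show "((\<lambda>t. exp (\<i> * of_real c * complex_of_real t) / (\<i> * of_real c)) has_vector_derivative cis (c * x)) (at x within {- 1/2..1/2})" .
    next
      show "continuous_on {- 1/2..1/2} (\<lambda>t. cis (c * t))" unfolding cis_conv_exp by (intro continuous_intros)
    qed simp
    also have "\<i> * of_real c * of_real (1/2) = \<i> * complex_of_real (pi * real_of_int m)" by (simp add: c_def)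
    also have "\<i> * of_real c * of_real (- 1/2) = \<i> * complex_of_real (- (pi * real_of_int m))" by (simp add: c_def)
    also have "exp (\<i> * complex_of_real (- (pi * real_of_int m))) = exp (\<i> * complex_of_real (pi * real_of_int m))"
    proof -
      have "pi * real_of_int m = - (pi * real_of_int m) + 2 * pi * real_of_int m" by (simp add: algebra_simps)
      then have "cis (pi * real_of_int m) = cis (- (pi * real_of_int m)) * cis (2 * pi * real_of_int m)"
        by (simp only: cis_mult)
      also have "cis (2 * pi * real_of_int m) = 1" by (rule cis_multiple_2pi) simp
      finally show ?thesis unfolding cis_conv_exp mult_1_right by (rule sym)
    qed
    finally show ?thesis using False by simp
  qed
  finally show "(LINT t|lborel. indicator {- 1/2..<1/2} t *\<^sub>R cis (2 * pi * (real_of_int m) * t)) = (if m = 0 then 1 else 0)"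
    unfolding c_def .
qed

lemma integral_tchar:
  fixes k :: "int^'d"
  shows "(LINT u|cube_measure. tchar k u) = (if k = 0 then 1 else 0)"
proof -
  define f where "f b t = indicator {- 1/2..<1/2} t *\<^sub>R cis (2 * pi * (real_vec k \<bullet> b) * t)" for b :: "real^'d" and t
  have kb: "\<exists>m. real_vec k \<bullet> b = real_of_int m" if "b \<in> Basis" for b
    using that by (auto simp: Basis_vec_def inner_axis real_vec_def)
  have fi: "integrable lborel (f b)" if b: "b \<in> Basis" for b
  proof -
    obtain m where "real_vec k \<bullet> b = real_of_int m" using kb[OF b] by blast
    then show ?thesis unfolding f_def using integral_cis_period(2)[of m] by simp
  qed
  have eq: "indicator unit_cube u *\<^sub>R tchar k u = (\<Prod>b\<in>Basis. f b (u \<bullet> b))" for u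
  proof -
    have "(\<Prod>b\<in>Basis. f b (u \<bullet> b)) = (\<Prod>b\<in>Basis. of_real (indicator {- 1/2..<1/2} (u \<bullet> b)) * cis (2 * pi * (real_vec k \<bullet> b) * (u \<bullet> b)))"
      by (simp add: f_def scaleR_conv_of_real)
    also have "\<dots> = of_real (\<Prod>b\<in>Basis. indicator {- 1/2..<1/2} (u \<bullet> b)) * cis (\<Sum>b\<in>Basis. 2 * pi * (real_vec k \<bullet> b) * (u \<bullet> b))"
      by (simp add: prod.distrib prod_cis)
    also have "(\<Sum>b\<in>Basis. 2 * pi * (real_vec k \<bullet> b) * (u \<bullet> b)) = 2 * pi * (real_vec k \<bullet> u)"
      by (subst euclidean_inner) (simp add: sum_distrib_left mult.assoc)
    also have "(\<Prod>b\<in>Basis. indicator {- 1/2..<1/2} (u \<bullet> b)) = (indicator unit_cube u :: real)"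
    proof (cases "u \<in> unit_cube")
      case True
      then show ?thesis unfolding prod_Basis_vec by (auto simp: inner_axis unit_cube_def intro!: prod.neutral)
    next
      case False
      then obtain i where "\<not> (- 1/2 \<le> u $ i \<and> u $ i < 1/2)" by (auto simp: unit_cube_def)
      then have "\<exists>i\<in>UNIV. indicator {- 1/2..<1/2} (u \<bullet> axis i 1) = (0::real)" by (intro bexI[of _ i]) (auto simp: inner_axis)
      then have "(\<Prod>i\<in>UNIV. indicator {- 1/2..<1/2} (u \<bullet> axis i 1) :: real) = 0" by (intro prod_zero) simp_all
      then show ?thesis unfolding prod_Basis_vec using False by simp
    qed
    finally show ?thesis by (simp add: tchar_def scaleR_conv_of_real)
  qed
  have "(LINT u|cube_measure. tchar k u) = (LINT u|lborel. indicator unit_cube u *\<^sub>R tchar k u)"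
    unfolding cube_measure_def by (rule integral_restrict_space) simp
  also have "\<dots> = (\<Prod>b\<in>Basis. LINT t|lborel. f b t)"
    unfolding eq by (rule lborel_prod_integrable(2)[OF fi])
  also have "\<dots> = (\<Prod>i\<in>UNIV. if k $ i = 0 then 1 else 0)"
    unfolding prod_Basis_vec f_def by (rule prod.cong[OF refl], subst integral_cis_period(1)[symmetric]) (simp add: inner_axis real_vec_def)
  also have "\<dots> = (if k = 0 then 1 else 0)"
    by (auto simp: vec_eq_iff intro!: prod_zero)
  finally show ?thesis .
qed

section \<open>Square-integrable functions on the cube and best approximation\<close>

lemma integrable_cube_bounded:
  fixes f g :: "real^'d \<Rightarrow> complex"
  assumes "integrable cube_measure f" "g \<in> borel_measurable borel" "\<And>u. cmod (g u) \<le> C"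
  shows "integrable cube_measure (\<lambda>u. f u * g u)"
proof (rule Bochner_Integration.integrable_bound)
  show "integrable cube_measure (\<lambda>u. C * cmod (f u))" using assms(1) by simp
  show "(\<lambda>u. f u * g u) \<in> borel_measurable cube_measure"
    using borel_measurable_cube[OF assms(2)] assms(1) by simp
  show "AE u in cube_measure. norm (f u * g u) \<le> norm (C * cmod (f u))"
  proof (rule AE_I2)
    fix u
    have "C \<ge> 0" using order_trans[OF norm_ge_zero assms(3)] .
    then show "norm (f u * g u) \<le> norm (C * cmod (f u))"
      using mult_right_mono[OF assms(3)[of u] norm_ge_zero[of "f u"]] by (simp add: norm_mult abs_mult mult.commute)
  qed
qed

lemma square_integrable_imp_integrable:
  fixes f :: "real^'d \<Rightarrow> complex"
  assumes [measurable]: "f \<in> borel_measurable cube_measure" and "integrable cube_measure (\<lambda>u. (cmod (f u))\<^sup>2)"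
  shows "integrable cube_measure f"
proof (rule Bochner_Integration.integrable_bound)
  show "integrable cube_measure (\<lambda>u. 1 + (cmod (f u))\<^sup>2)" using assms(2) by simp
  have "cmod (f u) \<le> 1 + (cmod (f u))\<^sup>2" for u
    using sum_squares_bound[of 1 "cmod (f u)"] zero_le_power2[of "cmod (f u)"] by (simp; linarith)
  then show "AE u in cube_measure. norm (f u) \<le> norm (1 + (cmod (f u))\<^sup>2)" by (intro AE_I2) simp
qed simp

lemma sum_tchar_bound: "cmod (\<Sum>k\<in>F. a k * tchar k u) \<le> (\<Sum>k\<in>F. cmod (a k))"
  by (rule order_trans[OF norm_sum]) (simp add: norm_mult)

lemma cmod_power2_add_le: "(cmod (a + b))\<^sup>2 \<le> 2 * (cmod a)\<^sup>2 + 2 * (cmod b)\<^sup>2"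
proof -
  have "(cmod (a + b))\<^sup>2 \<le> (cmod a + cmod b)\<^sup>2" by (intro power_mono norm_triangle_ineq) simp
  also have "\<dots> \<le> 2 * (cmod a)\<^sup>2 + 2 * (cmod b)\<^sup>2"
    using sum_squares_bound[of "cmod a" "cmod b"] by (simp add: power2_sum)
  finally show ?thesis .
qed

lemma square_integrable_add:
  fixes f g :: "'a \<Rightarrow> complex"
  assumes [measurable]: "f \<in> borel_measurable M" "g \<in> borel_measurable M"
    and "integrable M (\<lambda>u. (cmod (f u))\<^sup>2)" "integrable M (\<lambda>u. (cmod (g u))\<^sup>2)"
  shows "integrable M (\<lambda>u. (cmod (f u + g u))\<^sup>2)"
    and "(LINT u|M. (cmod (f u + g u))\<^sup>2) \<le> 2 * (LINT u|M. (cmod (f u))\<^sup>2) + 2 * (LINT u|M. (cmod (g u))\<^sup>2)"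
proof -
  have i: "integrable M (\<lambda>u. 2 * (cmod (f u))\<^sup>2 + 2 * (cmod (g u))\<^sup>2)" using assms by simp
  show 1: "integrable M (\<lambda>u. (cmod (f u + g u))\<^sup>2)"
    by (rule Bochner_Integration.integrable_bound[OF i]) (measurable, use cmod_power2_add_le order_trans[OF _ abs_ge_self] in \<open>simp\<close>)
  have "(LINT u|M. (cmod (f u + g u))\<^sup>2) \<le> (LINT u|M. 2 * (cmod (f u))\<^sup>2 + 2 * (cmod (g u))\<^sup>2)"
    by (rule integral_mono[OF 1 i]) (rule cmod_power2_add_le)
  then show "(LINT u|M. (cmod (f u + g u))\<^sup>2) \<le> 2 * (LINT u|M. (cmod (f u))\<^sup>2) + 2 * (LINT u|M. (cmod (g u))\<^sup>2)"
    using assms by simp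
qed

definition fcoeff :: "(real^'d \<Rightarrow> complex) \<Rightarrow> int^'d \<Rightarrow> complex" where
  "fcoeff P k = (LINT u|cube_measure. P u * cnj (tchar k u))"

lemma square_integrable_sum_tchar: "integrable cube_measure (\<lambda>u. (cmod (\<Sum>k\<in>F. a k * tchar k u))\<^sup>2)"
proof (rule cube.integrable_const_bound[where B="(\<Sum>k\<in>F. cmod (a k))\<^sup>2"])
  show "AE u in cube_measure. norm ((cmod (\<Sum>k\<in>F. a k * tchar k u))\<^sup>2) \<le> (\<Sum>k\<in>F. cmod (a k))\<^sup>2"
    by (intro AE_I2) (simp add: power_mono sum_tchar_bound)
qed measurable

text \<open>The partial sum is an orthogonal projection: \<open>P - S\<close> is orthogonal to each
  character in \<open>F\<close>, and any competitor differs from \<open>S\<close> by an element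
  \<open>E\<close> of their span, so the cross term vanishes.\<close>

lemma fcoeff_best_approx:
  fixes P :: "real^'d \<Rightarrow> complex"
  assumes [measurable]: "P \<in> borel_measurable cube_measure" and P2: "integrable cube_measure (\<lambda>u. (cmod (P u))\<^sup>2)" and F: "finite F"
  shows "(LINT u|cube_measure. (cmod (P u - (\<Sum>k\<in>F. fcoeff P k * tchar k u)))\<^sup>2) \<le> (LINT u|cube_measure. (cmod (P u - (\<Sum>k\<in>F. a k * tchar k u)))\<^sup>2)"
proof -
  define S where "S u = (\<Sum>k\<in>F. fcoeff P k * tchar k u)" for u
  define d where "d k = fcoeff P k - a k" for k
  define E where "E u = (\<Sum>k\<in>F. d k * tchar k u)" for u
  have [measurable]: "S \<in> borel_measurable borel" "E \<in> borel_measurable borel" unfolding S_def E_def by measurable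
  have [measurable]: "S \<in> borel_measurable cube_measure" "E \<in> borel_measurable cube_measure" by (rule borel_measurable_cube, simp)+
  have Pi: "integrable cube_measure P" by (rule square_integrable_imp_integrable[OF _ P2]) simp
  have S2: "integrable cube_measure (\<lambda>u. (cmod (S u))\<^sup>2)" "integrable cube_measure (\<lambda>u. (cmod (E u))\<^sup>2)"
    unfolding S_def E_def by (rule square_integrable_sum_tchar)+
  have Si: "integrable cube_measure S" by (rule square_integrable_imp_integrable[OF _ S2(1)]) simp
  have D2: "integrable cube_measure (\<lambda>u. (cmod (P u - S u))\<^sup>2)"
    using square_integrable_add(1)[of P cube_measure "\<lambda>u. - S u"] P2 S2 by simp
  have Di: "integrable cube_measure (\<lambda>u. P u - S u)" using Pi Si by simp
  have "S u - (\<Sum>k\<in>F. a k * tchar k u) = E u" for u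
    by (simp add: S_def E_def d_def left_diff_distrib sum_subtractf)
  then have decomp: "P u - (\<Sum>k\<in>F. a k * tchar k u) = (P u - S u) + E u" for u by (simp add: algebra_simps)
  have expand: "(cmod ((P u - S u) + E u))\<^sup>2 = (cmod (P u - S u))\<^sup>2 + (cmod (E u))\<^sup>2 + 2 * Re ((P u - S u) * cnj (E u))" for u
    by (simp only: cmod_power2) (simp add: power2_eq_square algebra_simps)
  have iDk: "integrable cube_measure (\<lambda>u. (P u - S u) * cnj (tchar k u))" for k
    by (rule integrable_cube_bounded[OF Di, where C=1]) (auto intro!: borel_measurable_continuous_onI continuous_on_cnj continuous_tchar)
  have orth: "(LINT u|cube_measure. (P u - S u) * cnj (tchar k u)) = 0" if k: "k \<in> F" for k
  proof -
    have iP: "integrable cube_measure (\<lambda>u. P u * cnj (tchar k u))"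
      by (rule integrable_cube_bounded[OF Pi, where C=1]) (auto intro!: borel_measurable_continuous_onI continuous_on_cnj continuous_tchar)
    have it: "integrable cube_measure (tchar l)" for l :: "int^'d"
      by (rule cube.integrable_const_bound[where B=1]) auto
    have "(LINT u|cube_measure. S u * cnj (tchar k u)) = (LINT u|cube_measure. (\<Sum>l\<in>F. fcoeff P l * tchar (l - k) u))"
      unfolding S_def sum_distrib_right mult.assoc tchar_cnj_mult ..
    also have "\<dots> = (\<Sum>l\<in>F. fcoeff P l * (LINT u|cube_measure. tchar (l - k) u))"
      by (simp add: it)
    also have "\<dots> = (\<Sum>l\<in>F. if l = k then fcoeff P k else 0)"
      unfolding integral_tchar by (rule sum.cong) auto
    also have "\<dots> = fcoeff P k" using k F by simp
    finally have "(LINT u|cube_measure. S u * cnj (tchar k u)) = fcoeff P k" .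
    moreover have "integrable cube_measure (\<lambda>u. S u * cnj (tchar k u))"
      by (rule integrable_cube_bounded[OF Si, where C=1]) (auto intro!: borel_measurable_continuous_onI continuous_on_cnj continuous_tchar)
    ultimately show ?thesis using iP by (simp add: left_diff_distrib fcoeff_def)
  qed
  have DE: "(P u - S u) * cnj (E u) = (\<Sum>k\<in>F. cnj (d k) * ((P u - S u) * cnj (tchar k u)))" for u
    unfolding E_def cnj_sum sum_distrib_left by (simp add: mult_ac)
  have iDE: "integrable cube_measure (\<lambda>u. (P u - S u) * cnj (E u))"
    unfolding DE by (intro Bochner_Integration.integrable_sum integrable_mult_right iDk)
  have "(LINT u|cube_measure. (P u - S u) * cnj (E u)) = (\<Sum>k\<in>F. cnj (d k) * (LINT u|cube_measure. (P u - S u) * cnj (tchar k u)))"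
    unfolding DE by (subst Bochner_Integration.integral_sum) (auto intro!: integrable_mult_right iDk)
  also have "\<dots> = 0" by (simp add: orth)
  finally have 0: "(LINT u|cube_measure. Re ((P u - S u) * cnj (E u))) = 0"
    using integral_Re[OF iDE] by simp
  have "(LINT u|cube_measure. (cmod (P u - (\<Sum>k\<in>F. a k * tchar k u)))\<^sup>2) =
      (LINT u|cube_measure. (cmod (P u - S u))\<^sup>2 + (cmod (E u))\<^sup>2 + 2 * Re ((P u - S u) * cnj (E u)))"
    unfolding decomp expand ..
  also have "\<dots> = (LINT u|cube_measure. (cmod (P u - S u))\<^sup>2) + (LINT u|cube_measure. (cmod (E u))\<^sup>2) + 2 * (LINT u|cube_measure. Re ((P u - S u) * cnj (E u)))"
  proof -
    have i: "integrable cube_measure (\<lambda>u. 2 * Re ((P u - S u) * cnj (E u)))" by (intro integrable_mult_right integrable_Re iDE)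
    show ?thesis
      unfolding Bochner_Integration.integral_add[OF Bochner_Integration.integrable_add[OF D2 S2(2)] i]
        Bochner_Integration.integral_add[OF D2 S2(2)] integral_mult_right_zero ..
  qed
  also have "\<dots> \<ge> (LINT u|cube_measure. (cmod (P u - S u))\<^sup>2)" unfolding 0 by simp
  finally show ?thesis unfolding S_def .
qed

section \<open>Density of the trigonometric polynomials\<close>

inductive_set trig :: "(real^'d \<Rightarrow> complex) set" where
  single: "(\<lambda>u. a * tchar k u) \<in> trig"
| add: "f \<in> trig \<Longrightarrow> g \<in> trig \<Longrightarrow> (\<lambda>u. f u + g u) \<in> trig"

lemma trig_sum: "f \<in> trig \<Longrightarrow> \<exists>F a. finite F \<and> (\<forall>k. k \<notin> F \<longrightarrow> a k = 0) \<and> f = (\<lambda>u. \<Sum>k\<in>F. a k * tchar k u)"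
proof (induction rule: trig.induct)
  case (single a k)
  show ?case by (rule exI[of _ "{k}"], rule exI[of _ "\<lambda>l. if l = k then a else 0"]) simp
next
  case (add f g)
  then obtain F a G b where F: "finite F" "\<forall>k. k \<notin> F \<longrightarrow> a k = 0" "f = (\<lambda>u. \<Sum>k\<in>F. a k * tchar k u)"
    and G: "finite G" "\<forall>k. k \<notin> G \<longrightarrow> b k = 0" "g = (\<lambda>u. \<Sum>k\<in>G. b k * tchar k u)" by blast
  have "f u = (\<Sum>k\<in>F \<union> G. a k * tchar k u)" for u
    unfolding F(3) by (rule sum.mono_neutral_left) (use F G in auto)
  moreover have "g u = (\<Sum>k\<in>F \<union> G. b k * tchar k u)" for u
    unfolding G(3) by (rule sum.mono_neutral_left) (use F G in auto)
  ultimately have "(\<lambda>u. f u + g u) = (\<lambda>u. \<Sum>k\<in>F \<union> G. (a k + b k) * tchar k u)"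
    by (simp add: fun_eq_iff sum.distrib distrib_right)
  then show ?case using F G by (intro exI[of _ "F \<union> G"] exI[of _ "\<lambda>k. a k + b k"]) auto
qed

lemma trig_mult: "f \<in> trig \<Longrightarrow> g \<in> trig \<Longrightarrow> (\<lambda>u. f u * g u) \<in> trig"
proof (induction rule: trig.induct)
  case (single a k)
  from single show ?case
  proof (induction rule: trig.induct)
    case (single b l)
    have "(\<lambda>u. a * tchar k u * (b * tchar l u)) = (\<lambda>u. (a * b) * tchar (k + l) u)"
      by (simp add: tchar_add fun_eq_iff mult_ac)
    then show ?case by (simp only: trig.single)
  next
    case (add f g)
    then show ?case using trig.add by (fastforce simp: distrib_left)
  qed
next
  case (add f g)
  then show ?case using trig.add by (fastforce simp: distrib_right)
qed

lemma trig_const: "(\<lambda>u. c) \<in> trig"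
  using trig.single[of c 0] by simp

text \<open>Opposite faces of the cube must be identified before continuous functions can be
  approximated uniformly by trigonometric polynomials. This compact subset of
  \<open>complex^'d\<close> is the quotient, with \<open>torus_map\<close> as projection and
  \<open>torus_arg\<close> as a section.\<close>

definition torus :: "(complex^'d) set" where "torus = {z. \<forall>i. cmod (z $ i) = 1}"

definition torus_map :: "real^'d \<Rightarrow> complex^'d" where "torus_map u = (\<chi> i. cis (2 * pi * u $ i))"

definition torus_arg :: "complex^'d \<Rightarrow> real^'d" where "torus_arg z = (\<chi> i. Arg (z $ i) / (2 * pi))"

definition open_cube :: "(real^'d) set" where "open_cube = {u. \<forall>i. - 1/2 < u $ i \<and> u $ i < 1/2}"

lemma open_cube_eq_box: "open_cube = box (- (\<chi> i. 1/2)) ((\<chi> i. 1/2) :: real^'d)"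
  by (auto simp: open_cube_def mem_box_cart)

lemma open_open_cube: "open open_cube"
  unfolding open_cube_eq_box by (rule open_box)

lemma compact_torus: "compact (torus :: (complex^'d) set)"
proof -
  have "norm z \<le> CARD('d)" if "z \<in> torus" for z :: "complex^'d"
  proof -
    have "norm z \<le> (\<Sum>i\<in>UNIV. norm (z $ i))" unfolding norm_vec_def by (rule L2_set_le_sum) simp
    also have "\<dots> = CARD('d)" using that by (simp add: torus_def)
    finally show ?thesis .
  qed
  then have "bounded (torus :: (complex^'d) set)" unfolding bounded_iff by blast
  moreover have "closed (torus :: (complex^'d) set)"
    unfolding torus_def by (intro closed_Collect_all closed_Collect_eq continuous_intros)
  ultimately show ?thesis by (simp add: compact_eq_bounded_closed)
qed

lemma torus_map_in_torus: "torus_map u \<in> torus"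
  by (simp add: torus_def torus_map_def)

lemma torus_map_arg: "z \<in> torus \<Longrightarrow> torus_map (torus_arg z) = z"
proof -
  assume z: "z \<in> torus"
  have "cis (Arg (z $ i)) = z $ i" for i
  proof -
    have "cmod (z $ i) = 1" using z by (simp add: torus_def)
    then have "z $ i \<noteq> 0" by auto
    from Arg_eq[OF this] show ?thesis unfolding \<open>cmod (z $ i) = 1\<close> of_real_1 mult_1 cis_conv_exp by (rule sym)
  qed
  then show ?thesis by (simp add: torus_map_def torus_arg_def vec_eq_iff)
qed

lemma Arg_cis_eq: "- pi < x \<Longrightarrow> x \<le> pi \<Longrightarrow> Arg (cis x) = x"
  by (rule Arg_unique[of 1]) (simp_all add: cis_conv_exp)

lemma torus_arg_map:
  assumes "u \<in> open_cube" shows "torus_arg (torus_map u) = u"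
proof -
  have "Arg (cis (2 * pi * u $ i)) = 2 * pi * u $ i" for i
  proof (rule Arg_cis_eq)
    have "- 1/2 < u $ i" "u $ i < 1/2" using assms by (auto simp: open_cube_def)
    then have "2 * pi * (- 1/2) < 2 * pi * u $ i" "2 * pi * u $ i < 2 * pi * (1/2)"
      by (intro mult_strict_left_mono; simp)+
    then show "- pi < 2 * pi * u $ i" "2 * pi * u $ i \<le> pi" by simp_all
  qed
  then show ?thesis by (simp add: torus_arg_def torus_map_def vec_eq_iff)
qed

lemma continuous_torus_map: "continuous_on S torus_map"
  unfolding torus_map_def cis_conv_exp by (intro continuous_intros)

lemma trig_coordinate:
  fixes i :: "'d::finite"
  shows "(\<lambda>u::real^'d. complex_of_real (Re (torus_map u $ i))) \<in> trig"
    and "(\<lambda>u::real^'d. complex_of_real (Im (torus_map u $ i))) \<in> trig"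
proof -
  define k :: "int^'d" where "k = axis i 1"
  have "real_vec k = axis i 1" by (simp add: k_def real_vec_def vec_eq_iff axis_def)
  then have t: "tchar k u = cis (2 * pi * u $ i)" for u
    by (simp add: tchar_def inner_axis')
  have "complex_of_real (Re (torus_map u $ i)) = 1/2 * tchar k u + 1/2 * tchar (- k) u" for u
    unfolding tchar_minus t torus_map_def by (simp add: complex_eq_iff)
  moreover have "(\<lambda>u. 1/2 * tchar k u + 1/2 * tchar (- k) u) \<in> trig" by (intro trig.intros)
  ultimately show "(\<lambda>u::real^'d. complex_of_real (Re (torus_map u $ i))) \<in> trig" by simp
  have "complex_of_real (Im (torus_map u $ i)) = (- \<i>/2) * tchar k u + (\<i>/2) * tchar (- k) u" for u
    unfolding tchar_minus t torus_map_def by (simp add: complex_eq_iff)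
  moreover have "(\<lambda>u. (- \<i>/2) * tchar k u + (\<i>/2) * tchar (- k) u) \<in> trig" by (intro trig.intros)
  ultimately show "(\<lambda>u::real^'d. complex_of_real (Im (torus_map u $ i))) \<in> trig" by simp
qed

text \<open>Compact support inside the open cube lets \<open>g\<close> descend to a continuous
  function \<open>G\<close> on the torus, although \<open>torus_arg\<close> jumps along the faces.
  The rest is the Stone-Weierstrass theorem.\<close>

lemma trig_approx_real:
  fixes g :: "real^'d \<Rightarrow> real"
  assumes g: "continuous_on UNIV g" and K: "compact K" "K \<subseteq> open_cube" "\<And>u. u \<notin> K \<Longrightarrow> g u = 0" and e: "e > 0"
  shows "\<exists>t\<in>trig. \<forall>u\<in>unit_cube. cmod (of_real (g u) - t u) < e"
proof -
  \<comment> \<open>Membership is defined through the pullback to the cube, so the approximating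
    element of the algebra is a trigonometric polynomial by definition. The real and imaginary parts
    of the coordinates separate points.\<close>
  define R where "R = {f :: complex^'d \<Rightarrow> real. continuous_on torus f \<and> (\<lambda>u. complex_of_real (f (torus_map u))) \<in> trig}"
  interpret function_ring_on R torus
  proof
    show "compact (torus :: (complex^'d) set)" by (rule compact_torus)
    show "continuous_on torus f" if "f \<in> R" for f using that by (simp add: R_def)
    show "(\<lambda>x. f x + g x) \<in> R" if "f \<in> R" "g \<in> R" for f g
      using that trig.add unfolding R_def by (fastforce intro: continuous_on_add)
    show "(\<lambda>x. f x * g x) \<in> R" if "f \<in> R" "g \<in> R" for f g
      using that trig_mult unfolding R_def by (fastforce intro: continuous_on_mult)
    show "(\<lambda>_. c) \<in> R" for c by (simp add: R_def trig_const)
    show "\<exists>f\<in>R. f x \<noteq> f y" if "x \<in> torus" "y \<in> torus" "x \<noteq> y" for x y :: "complex^'d"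
    proof -
      obtain i where i: "x $ i \<noteq> y $ i" using \<open>x \<noteq> y\<close> by (auto simp: vec_eq_iff)
      have "(\<lambda>z. Re (z $ i)) \<in> R" "(\<lambda>z. Im (z $ i)) \<in> R"
        unfolding R_def using trig_coordinate[of i] by (auto intro!: continuous_intros)
      moreover have "Re (x $ i) \<noteq> Re (y $ i) \<or> Im (x $ i) \<noteq> Im (y $ i)" using i by (simp add: complex_eq_iff)
      ultimately show ?thesis by (metis (no_types, lifting))
    qed
  qed
  define C where "C = torus_map ` K"
  have "closed C" unfolding C_def by (intro compact_imp_closed compact_continuous_image continuous_torus_map K)
  define G where "G z = g (torus_arg z)" for z
  have contG: "continuous_on torus G"
    unfolding continuous_on_def
  proof
    fix z :: "complex^'d" assume z: "z \<in> torus"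
    show "(G \<longlongrightarrow> G z) (at z within torus)"
    proof (cases "z \<in> C")
      case True
      then obtain k where k: "k \<in> K" "z = torus_map k" by (auto simp: C_def)
      have "((\<lambda>w. torus_arg w) \<longlongrightarrow> torus_arg z) (at z within torus)"
        unfolding torus_arg_def
      proof (intro tendsto_vec_lambda tendsto_divide tendsto_const)
        fix i
        \<comment> \<open>\<open>Arg\<close> is discontinuous on the negative axis only, which
          corresponds to a coordinate 1/2; points of \<open>C\<close> come from the open cube and
          avoid it.\<close>
        have "z $ i \<notin> \<real>\<^sub>\<le>\<^sub>0"
        proof
          assume "z $ i \<in> \<real>\<^sub>\<le>\<^sub>0"
          moreover have "z $ i \<noteq> 0" using z by (auto simp: torus_def dest!: spec[of _ i])
          ultimately have "Arg (z $ i) = pi"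
            by (auto simp: Arg_eq_pi complex_nonpos_Reals_iff complex_is_Real_iff complex_eq_iff)
          then have "torus_arg z $ i = 1/2" by (simp add: torus_arg_def)
          moreover have "torus_arg z = k" using k K(2) torus_arg_map by blast
          moreover have "k $ i < 1/2" using subsetD[OF K(2) k(1)] by (simp add: open_cube_def)
          ultimately show False by simp
        qed
        then have "isCont Arg (z $ i)" by (rule continuous_at_Arg)
        then show "((\<lambda>w. Arg (w $ i)) \<longlongrightarrow> Arg (z $ i)) (at z within torus)"
          by (rule isCont_tendsto_compose) (intro tendsto_intros)
      qed simp
      moreover have "isCont g (torus_arg z)" using g by (simp add: continuous_on_eq_continuous_at)
      ultimately show ?thesis unfolding G_def by (rule isCont_tendsto_compose[rotated])
    next
      case False
      have zero: "G w = 0" if "w \<in> torus" "w \<notin> C" for w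
        unfolding G_def using that torus_map_arg[OF that(1)] K(3) unfolding C_def by force
      have "open (- C)" using \<open>closed C\<close> by (rule open_Compl)
      then have "eventually (\<lambda>w. w \<in> - C) (at z within torus)"
        using False by (intro eventually_at_topological[THEN iffD2] exI[of _ "- C"]) auto
      moreover have "eventually (\<lambda>w. w \<in> torus) (at z within torus)" by (simp add: eventually_at_filter)
      ultimately have "eventually (\<lambda>w. G w = 0) (at z within torus)"
        by eventually_elim (simp add: zero)
      then show ?thesis using zero[OF z False] by (simp add: tendsto_eventually)
    qed
  qed
  obtain h where h: "h \<in> R" "\<And>z. z \<in> torus \<Longrightarrow> \<bar>G z - h z\<bar> < e"
    using Stone_Weierstrass_basic[OF contG e] by blast
  \<comment> \<open>On a face with coordinate \<open>- 1/2\<close> the section returns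
    \<open>1/2\<close>, so it does not undo the projection there; but then both points lie outside
    the open cube and both values are 0.\<close>
  have GE: "G (torus_map u) = g u" if u: "u \<in> unit_cube" for u
  proof (cases "u \<in> open_cube")
    case True
    then show ?thesis by (simp add: G_def torus_arg_map)
  next
    case False
    then have "g u = 0" using K by blast
    obtain i where "\<not> (- 1/2 < u $ i \<and> u $ i < 1/2)" using False by (auto simp: open_cube_def)
    moreover have "- 1/2 \<le> u $ i \<and> u $ i < 1/2" using u by (simp add: unit_cube_def)
    ultimately have "u $ i = - 1/2" by linarith
    then have "torus_map u $ i = cis (- pi)" by (simp add: torus_map_def)
    also have "cis (- pi) = cis pi" by (simp add: complex_eq_iff)
    finally have "torus_arg (torus_map u) $ i = 1/2"
      using Arg_cis_eq[of pi] by (simp add: torus_arg_def)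
    then have "torus_arg (torus_map u) \<notin> open_cube"
      unfolding open_cube_def mem_Collect_eq by (metis less_irrefl)
    then show ?thesis using K \<open>g u = 0\<close> by (auto simp: G_def)
  qed
  show ?thesis
  proof (intro bexI ballI)
    show "(\<lambda>u. complex_of_real (h (torus_map u))) \<in> trig" using h by (simp add: R_def)
    fix u :: "real^'d" assume "u \<in> unit_cube"
    then have "\<bar>g u - h (torus_map u)\<bar> < e" using h(2)[OF torus_map_in_torus, of u] GE by simp
    then show "cmod (of_real (g u) - of_real (h (torus_map u))) < e"
      unfolding of_real_diff[symmetric] norm_of_real .
  qed
qed

lemma trig_approx_continuous:
  fixes g :: "real^'d \<Rightarrow> complex"
  assumes g: "continuous_on UNIV g" and K: "compact K" "K \<subseteq> open_cube" "\<And>u. u \<notin> K \<Longrightarrow> g u = 0" and e: "e > 0"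
  shows "\<exists>t\<in>trig. \<forall>u\<in>unit_cube. cmod (g u - t u) < e"
proof -
  have e2: "e / 2 > 0" using e by simp
  obtain t1 where t1: "t1 \<in> trig" "\<And>u. u \<in> unit_cube \<Longrightarrow> cmod (of_real (Re (g u)) - t1 u) < e / 2"
    using trig_approx_real[OF continuous_on_Re[OF g] K(1,2) _ e2] K(3) by force
  obtain t2 where t2: "t2 \<in> trig" "\<And>u. u \<in> unit_cube \<Longrightarrow> cmod (of_real (Im (g u)) - t2 u) < e / 2"
    using trig_approx_real[OF continuous_on_Im[OF g] K(1,2) _ e2] K(3) by force
  have "(\<lambda>u. t1 u + \<i> * t2 u) \<in> trig"
    by (intro trig.add t1 trig_mult[OF trig_const] t2)
  moreover have "cmod (g u - (t1 u + \<i> * t2 u)) < e" if "u \<in> unit_cube" for u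
  proof -
    have eq: "g u - (t1 u + \<i> * t2 u) = (of_real (Re (g u)) - t1 u) + \<i> * (of_real (Im (g u)) - t2 u)"
      using complex_eq[of "g u"] by (simp add: algebra_simps)
    have "cmod (g u - (t1 u + \<i> * t2 u)) \<le> cmod (of_real (Re (g u)) - t1 u) + cmod (\<i> * (of_real (Im (g u)) - t2 u))"
      unfolding eq by (rule norm_triangle_ineq)
    moreover have "cmod (\<i> * (of_real (Im (g u)) - t2 u)) = cmod (of_real (Im (g u)) - t2 u)"
      by (simp only: norm_mult norm_ii mult_1)
    ultimately have "cmod (g u - (t1 u + \<i> * t2 u)) \<le> cmod (of_real (Re (g u)) - t1 u) + cmod (of_real (Im (g u)) - t2 u)" by simp
    then show ?thesis using t1(2)[OF that] t2(2)[OF that] by linarith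
  qed
  ultimately show ?thesis by (intro bexI[of _ "\<lambda>u. t1 u + \<i> * t2 u"]) auto
qed

lemma AE_cube_measureI: "AE u in lborel. P u \<Longrightarrow> AE u in cube_measure. P u"
  unfolding cube_measure_def by (subst AE_restrict_space_iff) (auto elim: AE_mp)

lemma AE_cube_open: "AE u in cube_measure. u \<in> open_cube"
proof -
  let ?h = "(\<chi> i. 1/2) :: real^'d"
  have "AE u in lborel. u \<notin> cbox (- ?h) ?h - box (- ?h) ?h"
    by (rule AE_not_in[OF null_sets_cbox_Diff_box])
  then have "AE u in cube_measure. u \<notin> cbox (- ?h) ?h - box (- ?h) ?h" by (rule AE_cube_measureI)
  then show ?thesis
  proof (rule AE_mp, intro AE_I2 impI)
    fix u :: "real^'d" assume "u \<in> space cube_measure" "u \<notin> cbox (- ?h) ?h - box (- ?h) ?h"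
    then show "u \<in> open_cube" by (auto simp: unit_cube_def open_cube_def mem_box_cart less_imp_le)
  qed
qed

text \<open>A measurable function is almost everywhere a limit of continuous ones. These are clipped
  at \<open>N\<close> for dominated convergence and cut off near the faces so that
  \<open>trig_approx_continuous\<close> applies.\<close>

lemma trig_dense_bounded:
  fixes f :: "real^'d \<Rightarrow> complex"
  assumes f [measurable]: "f \<in> borel_measurable borel" and b: "\<And>u. cmod (f u) \<le> N" and e: "e > 0"
  shows "\<exists>t\<in>trig. (LINT u|cube_measure. (cmod (f u - t u))\<^sup>2) < e"
proof -
  have N0: "N \<ge> 0" using order_trans[OF norm_ge_zero b] .
  have "f measurable_on UNIV"
    by (rule lebesgue_measurable_imp_measurable_on) (auto intro: measurable_completion)
  then obtain Z g where Z: "negligible Z" "\<And>n. continuous_on UNIV (g n)" "\<And>x. x \<notin> Z \<Longrightarrow> (\<lambda>n. g n x) \<longlonglongrightarrow> f x"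
    unfolding measurable_on_def by auto
  \<comment> \<open>The nearest-point projection onto the disc of radius \<open>N\<close> is
    continuous, bounds the approximants and fixes the values of \<open>f\<close>.\<close>
  define clip where "clip = closest_point (cball (0::complex) N)"
  have clip: "continuous_on UNIV clip" "\<And>z. cmod (clip z) \<le> N" "\<And>z. cmod z \<le> N \<Longrightarrow> clip z = z"
  proof -
    have ne: "cball (0::complex) N \<noteq> {}" using N0 by simp
    show "continuous_on UNIV clip" unfolding clip_def by (rule continuous_on_closest_point) (use ne in auto)
    show "cmod (clip z) \<le> N" for z
      using closest_point_in_set[of "cball (0::complex) N" z] ne by (simp add: clip_def)
    show "clip z = z" if "cmod z \<le> N" for z unfolding clip_def by (rule closest_point_self) (use that in simp)
  qed
  \<comment> \<open>The cutoff in \<open>h n\<close> vanishes where \<open>n * \<delta> < 1\<close>,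
    so its support is compact inside the open cube; at each point of the open cube it equals 1 for
    all large \<open>n\<close>.\<close>
  define \<delta> where "\<delta> u = infdist u (- open_cube)" for u :: "real^'d"
  note open_cube = open_open_cube
  have "2 *\<^sub>R (\<chi> i. 1) \<in> - (open_cube :: (real^'d) set)" by (simp add: open_cube_def)
  then have nee: "- (open_cube :: (real^'d) set) \<noteq> {}" by blast
  have \<delta>: "\<delta> u > 0 \<longleftrightarrow> u \<in> open_cube" for u
    using in_closed_iff_infdist_zero[of "- open_cube" u] open_cube nee infdist_nonneg[of u "- open_cube"]
    unfolding \<delta>_def by (auto simp: closed_def less_le)
  have cont\<delta>: "continuous_on UNIV \<delta>" unfolding \<delta>_def by (intro continuous_intros)
  define h where "h n u = max 0 (min 1 (real n * \<delta> u - 1)) *\<^sub>R clip (g n u)" for n u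
  have hcont: "continuous_on UNIV (h n)" for n
    unfolding h_def by (intro continuous_intros cont\<delta> continuous_on_compose2[OF clip(1) Z(2)]) auto
  have [measurable]: "h n \<in> borel_measurable borel" for n by (rule borel_measurable_continuous_onI[OF hcont])
  have hb: "cmod (h n u) \<le> N" for n u
  proof -
    have "cmod (h n u) = max 0 (min 1 (real n * \<delta> u - 1)) * cmod (clip (g n u))" by (simp add: h_def)
    also have "\<dots> \<le> 1 * N" by (intro mult_mono clip) auto
    finally show ?thesis by simp
  qed
  have hK: "\<exists>K. compact K \<and> K \<subseteq> open_cube \<and> (\<forall>u. u \<notin> K \<longrightarrow> h n u = 0)" for n
  proof (intro exI[of _ "{u. 1 \<le> real n * \<delta> u}"] conjI allI impI)
    show sub: "{u. 1 \<le> real n * \<delta> u} \<subseteq> open_cube"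
    proof
      fix u assume "u \<in> {u. 1 \<le> real n * \<delta> u}"
      then have "\<delta> u > 0" using infdist_nonneg[of u "- open_cube"] unfolding \<delta>_def[symmetric]
        by (cases "\<delta> u = 0") auto
      then show "u \<in> open_cube" by (simp add: \<delta>)
    qed
    let ?h = "(\<chi> i. 1/2) :: real^'d"
    have "(open_cube :: (real^'d) set) \<subseteq> cbox (- ?h) ?h" by (auto simp: open_cube_def mem_box_cart less_imp_le)
    then have "bounded {u. 1 \<le> real n * \<delta> u}" using sub bounded_cbox bounded_subset by blast
    moreover have "closed {u. 1 \<le> real n * \<delta> u}"
      by (intro closed_Collect_le continuous_intros cont\<delta>)
    ultimately show "compact {u. 1 \<le> real n * \<delta> u}" by (simp add: compact_eq_bounded_closed)
    show "h n u = 0" if "u \<notin> {u. 1 \<le> real n * \<delta> u}" for u using that by (simp add: h_def)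
  qed
  have lim: "(\<lambda>n. h n u) \<longlonglongrightarrow> f u" if "u \<notin> Z" "u \<in> open_cube" for u
  proof -
    have "(\<lambda>n. clip (g n u)) \<longlonglongrightarrow> clip (f u)"
      using clip(1) by (intro isCont_tendsto_compose[OF _ Z(3)[OF that(1)]]) (simp add: continuous_on_eq_continuous_at)
    moreover have "eventually (\<lambda>n. max 0 (min 1 (real n * \<delta> u - 1)) = 1) sequentially"
    proof -
      have d: "\<delta> u > 0" using that \<delta> by simp
      obtain m :: nat where m: "2 / \<delta> u < real m" using reals_Archimedean2 by blast
      have "max 0 (min 1 (real n * \<delta> u - 1)) = 1" if "n \<ge> m" for n
      proof -
        have "2 / \<delta> u \<le> real n" using m that by linarith
        then have "2 \<le> real n * \<delta> u" using d by (simp add: pos_divide_le_eq)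
        then show ?thesis by simp
      qed
      then show ?thesis unfolding eventually_sequentially by blast
    qed
    then have "(\<lambda>n. max 0 (min 1 (real n * \<delta> u - 1))) \<longlonglongrightarrow> 1" by (rule tendsto_eventually)
    ultimately have "(\<lambda>n. h n u) \<longlonglongrightarrow> 1 *\<^sub>R clip (f u)" unfolding h_def by (rule tendsto_scaleR[rotated])
    then show ?thesis using clip(3)[OF b] by simp
  qed
  have "AE u in lborel. u \<notin> Z"
  proof -
    have "AE u in lebesgue. u \<notin> Z" using Z(1) by (intro AE_not_in) (simp add: negligible_iff_null_sets)
    then show ?thesis by (simp add: AE_completion_iff)
  qed
  then have aeZ: "AE u in cube_measure. u \<notin> Z" by (rule AE_cube_measureI)
  have [measurable]: "f \<in> borel_measurable cube_measure" "h n \<in> borel_measurable cube_measure" for n by (rule borel_measurable_cube, simp)+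
  have "(\<lambda>n. LINT u|cube_measure. (cmod (f u - h n u))\<^sup>2) \<longlonglongrightarrow> (LINT u|(cube_measure :: (real^'d) measure). 0)"
  proof (rule integral_dominated_convergence[where w="\<lambda>_. (2 * N)\<^sup>2"])
    show "AE u in cube_measure. (\<lambda>n. (cmod (f u - h n u))\<^sup>2) \<longlonglongrightarrow> 0"
      using aeZ AE_cube_open
    proof eventually_elim
      case (elim u)
      have "(\<lambda>n. (cmod (f u - h n u))\<^sup>2) \<longlonglongrightarrow> (cmod (f u - f u))\<^sup>2"
        by (intro tendsto_power tendsto_norm tendsto_diff tendsto_const lim elim)
      then show ?case by simp
    qed
    have "(cmod (f u - h n u))\<^sup>2 \<le> (2 * N)\<^sup>2" for n u
      by (rule power_mono) (use norm_triangle_ineq4[of "f u" "h n u"] b[of u] hb[of n u] in linarith, simp)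
    then show "AE u in cube_measure. norm ((cmod (f u - h n u))\<^sup>2) \<le> (2 * N)\<^sup>2" for n by simp
  qed simp_all
  then have "(\<lambda>n. LINT u|cube_measure. (cmod (f u - h n u))\<^sup>2) \<longlonglongrightarrow> 0" by simp
  \<comment> \<open>Both squared errors stay within \<open>e / 8\<close>, and the factor 2 of
    \<open>square_integrable_add\<close> leaves less than \<open>e\<close>.\<close>
  moreover have "e / 8 > 0" using e by simp
  ultimately have "eventually (\<lambda>n. (LINT u|cube_measure. (cmod (f u - h n u))\<^sup>2) < e / 8) sequentially" by (rule order_tendstoD(2))
  then obtain n where n: "(LINT u|cube_measure. (cmod (f u - h n u))\<^sup>2) < e / 8" unfolding eventually_sequentially by blast
  obtain K where K: "compact K" "K \<subseteq> open_cube" "\<And>u. u \<notin> K \<Longrightarrow> h n u = 0" using hK by blast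
  have "sqrt (e / 8) > 0" using e by simp
  from trig_approx_continuous[OF hcont K this]
  obtain t where t: "t \<in> trig" "\<And>u. u \<in> unit_cube \<Longrightarrow> cmod (h n u - t u) < sqrt (e / 8)" by blast
  have tb: "(cmod (h n u - t u))\<^sup>2 \<le> e / 8" if "u \<in> unit_cube" for u
    using power_mono[of "cmod (h n u - t u)" "sqrt (e / 8)" 2] t(2)[OF that] e by simp
  have [measurable]: "t \<in> borel_measurable borel" using trig_sum[OF t(1)] by auto
  have [measurable]: "t \<in> borel_measurable cube_measure" by (rule borel_measurable_cube) simp
  have i2: "integrable cube_measure (\<lambda>u. (cmod (h n u - t u))\<^sup>2)"
  proof (rule cube.integrable_const_bound[where B="e / 8"])
    have "norm ((cmod (h n u - t u))\<^sup>2) \<le> e / 8" if "u \<in> unit_cube" for u using tb[OF that] by simp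
    then show "AE u in cube_measure. norm ((cmod (h n u - t u))\<^sup>2) \<le> e / 8"
      by (intro AE_I2) (simp only: space_cube_measure)
  qed simp
  have i1: "integrable cube_measure (\<lambda>u. (cmod (f u - h n u))\<^sup>2)"
  proof (rule cube.integrable_const_bound[where B="(2 * N)\<^sup>2"])
    have "(cmod (f u - h n u))\<^sup>2 \<le> (2 * N)\<^sup>2" for u
      by (rule power_mono) (use norm_triangle_ineq4[of "f u" "h n u"] b[of u] hb[of n u] in linarith, simp)
    then show "AE u in cube_measure. norm ((cmod (f u - h n u))\<^sup>2) \<le> (2 * N)\<^sup>2" by simp
  qed simp
  have "(LINT u|cube_measure. (cmod (h n u - t u))\<^sup>2) \<le> (LINT u|(cube_measure :: (real^'d) measure). e / 8)"
  proof (rule integral_mono_AE[OF i2])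
    show "AE u in cube_measure. (cmod (h n u - t u))\<^sup>2 \<le> e / 8"
      by (rule AE_I2) (simp only: space_cube_measure tb)
  qed simp
  also have "\<dots> = e / 8" by (simp add: cube.prob_space[unfolded space_cube_measure])
  finally have "(LINT u|cube_measure. (cmod (h n u - t u))\<^sup>2) \<le> e / 8" .
  moreover have "(LINT u|cube_measure. (cmod ((f u - h n u) + (h n u - t u)))\<^sup>2) \<le>
      2 * (LINT u|cube_measure. (cmod (f u - h n u))\<^sup>2) + 2 * (LINT u|cube_measure. (cmod (h n u - t u))\<^sup>2)"
    by (rule square_integrable_add(2)[OF _ _ i1 i2]) auto
  ultimately have "(LINT u|cube_measure. (cmod (f u - t u))\<^sup>2) < e" using n e by simp
  then show ?thesis using t(1) by blast
qed

text \<open>Reduction to the bounded case by truncating \<open>P\<close> at height \<open>n\<close>;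
  the truncation error is dominated by the square of \<open>P\<close> itself.\<close>

lemma trig_dense:
  fixes P :: "real^'d \<Rightarrow> complex"
  assumes P [measurable]: "P \<in> borel_measurable borel" and P2: "integrable cube_measure (\<lambda>u. (cmod (P u))\<^sup>2)" and e: "e > 0"
  shows "\<exists>t\<in>trig. (LINT u|cube_measure. (cmod (P u - t u))\<^sup>2) < e"
proof -
  define f where "f n u = (if cmod (P u) \<le> real n then P u else 0)" for n u
  have fm [measurable]: "f n \<in> borel_measurable borel" for n unfolding f_def by measurable
  have [measurable]: "P \<in> borel_measurable cube_measure" "f n \<in> borel_measurable cube_measure" for n by (rule borel_measurable_cube, simp)+
  have le: "(cmod (P u - f n u))\<^sup>2 \<le> (cmod (P u))\<^sup>2" for n u by (simp add: f_def)
  have "(\<lambda>n. LINT u|cube_measure. (cmod (P u - f n u))\<^sup>2) \<longlonglongrightarrow> (LINT u|(cube_measure :: (real^'d) measure). 0)"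
  proof (rule integral_dominated_convergence[OF _ _ P2])
    show "AE u in cube_measure. (\<lambda>n. (cmod (P u - f n u))\<^sup>2) \<longlonglongrightarrow> 0"
    proof (rule AE_I2, rule tendsto_eventually)
      fix u
      obtain m :: nat where "cmod (P u) < real m" using reals_Archimedean2 by blast
      then have "(cmod (P u - f n u))\<^sup>2 = 0" if "n \<ge> m" for n using that by (simp add: f_def)
      then show "eventually (\<lambda>n. (cmod (P u - f n u))\<^sup>2 = 0) sequentially" unfolding eventually_sequentially by blast
    qed
    show "AE u in cube_measure. norm ((cmod (P u - f n u))\<^sup>2) \<le> (cmod (P u))\<^sup>2" for n using le by simp
  qed simp_all
  then have "(\<lambda>n. LINT u|cube_measure. (cmod (P u - f n u))\<^sup>2) \<longlonglongrightarrow> 0" by simp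
  moreover have e4: "e / 4 > 0" using e by simp
  ultimately have "eventually (\<lambda>n. (LINT u|cube_measure. (cmod (P u - f n u))\<^sup>2) < e / 4) sequentially" by (rule order_tendstoD(2))
  then obtain n where n: "(LINT u|cube_measure. (cmod (P u - f n u))\<^sup>2) < e / 4" unfolding eventually_sequentially by blast
  have fb: "cmod (f n u) \<le> real n" for u by (simp add: f_def)
  obtain t where t: "t \<in> trig" "(LINT u|cube_measure. (cmod (f n u - t u))\<^sup>2) < e / 4"
    using trig_dense_bounded[OF fm fb e4] by blast
  obtain F a where Fa: "t = (\<lambda>u. \<Sum>k\<in>F. a k * tchar k u)" using trig_sum[OF t(1)] by blast
  have [measurable]: "t \<in> borel_measurable cube_measure" unfolding Fa by (rule borel_measurable_cube) simp
  have i1: "integrable cube_measure (\<lambda>u. (cmod (P u - f n u))\<^sup>2)"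
    by (rule Bochner_Integration.integrable_bound[OF P2]) (use le in auto)
  have i0: "integrable cube_measure (\<lambda>u. (cmod (f n u))\<^sup>2)"
    by (rule Bochner_Integration.integrable_bound[OF P2]) (auto simp: f_def)
  have i2: "integrable cube_measure (\<lambda>u. (cmod (f n u - t u))\<^sup>2)"
    using square_integrable_add(1)[of "f n" cube_measure "\<lambda>u. - t u"] i0 square_integrable_sum_tchar[where F=F and a=a] by (simp add: Fa)
  have "(LINT u|cube_measure. (cmod ((P u - f n u) + (f n u - t u)))\<^sup>2) \<le>
      2 * (LINT u|cube_measure. (cmod (P u - f n u))\<^sup>2) + 2 * (LINT u|cube_measure. (cmod (f n u - t u))\<^sup>2)"
    by (rule square_integrable_add(2)[OF _ _ i1 i2]) auto
  then have "(LINT u|cube_measure. (cmod (P u - t u))\<^sup>2) < e" using n t(2) by simp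
  then show ?thesis using t(1) by blast
qed

text \<open>As soon as \<open>F\<close> contains the frequencies \<open>F0\<close> of a good
  polynomial, best approximation makes the partial sum over \<open>F\<close> at least as good. This
  is convergence along the net of finite sets, that is, unconditional convergence.\<close>

lemma fourier_series_L2:
  fixes P :: "real^'d \<Rightarrow> complex"
  assumes P [measurable]: "P \<in> borel_measurable borel" and P2: "integrable cube_measure (\<lambda>u. (cmod (P u))\<^sup>2)"
  shows "((\<lambda>F. LINT u|cube_measure. (cmod (P u - (\<Sum>k\<in>F. fcoeff P k * tchar k u)))\<^sup>2) \<longlongrightarrow> 0) (finite_subsets_at_top UNIV)"
proof (rule tendstoI)
  fix e :: real assume e: "e > 0"
  obtain t where t: "t \<in> trig" "(LINT u|cube_measure. (cmod (P u - t u))\<^sup>2) < e" using trig_dense[OF P P2 e] by blast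
  obtain F0 a where F0: "finite F0" "\<forall>k. k \<notin> F0 \<longrightarrow> a k = 0" "t = (\<lambda>u. \<Sum>k\<in>F0. a k * tchar k u)" using trig_sum[OF t(1)] by blast
  show "\<forall>\<^sub>F F in finite_subsets_at_top UNIV. dist (LINT u|cube_measure. (cmod (P u - (\<Sum>k\<in>F. fcoeff P k * tchar k u)))\<^sup>2) 0 < e"
    unfolding eventually_finite_subsets_at_top
  proof (intro exI[of _ F0] conjI allI impI F0(1) subset_UNIV)
    fix F assume F: "finite F \<and> F0 \<subseteq> F \<and> F \<subseteq> UNIV"
    have "t = (\<lambda>u. \<Sum>k\<in>F. a k * tchar k u)"
      unfolding F0(3) by (rule ext, rule sum.mono_neutral_left) (use F F0(2) in auto)
    then have "(LINT u|cube_measure. (cmod (P u - (\<Sum>k\<in>F. fcoeff P k * tchar k u)))\<^sup>2) < e"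
      using fcoeff_best_approx[OF borel_measurable_cube[OF P] P2, of F a] F t(2) by simp
    then show "dist (LINT u|cube_measure. (cmod (P u - (\<Sum>k\<in>F. fcoeff P k * tchar k u)))\<^sup>2) 0 < e"
      by (simp add: dist_real_def)
  qed
qed

section \<open>Dilations and shifts of distributions\<close>

lemma det_real_mat: "det (real_mat M) = real_of_int (det M)"
  by (simp add: det_def real_mat_def map_matrix_def)

text \<open>A kernel vector would be an eigenvector for the eigenvalue 0, which is not larger than 1
  in modulus.\<close>

lemma dilation_matrix_det_nonzero:
  fixes M :: "int^'d^'d"
  assumes "dilation_matrix M" shows "det (real_mat M) \<noteq> 0"
proof
  assume "det (real_mat M) = 0"
  then have "\<not> invertible (real_mat M)" by (simp add: invertible_det_nz)
  then have "\<not> (\<forall>x. real_mat M *v x = 0 \<longrightarrow> x = 0)"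
    using matrix_left_invertible_ker[of "real_mat M"] invertible_left_inverse by blast
  then obtain x where x: "real_mat M *v x = 0" "x \<noteq> 0" by blast
  define v :: "complex^'d" where "v = (\<chi> i. of_real (x $ i))"
  have "v \<noteq> 0" using x(2) by (auto simp: v_def vec_eq_iff)
  moreover have "map_matrix of_int M *v v = 0 *s v"
  proof -
    have "(map_matrix of_int M *v v) $ i = of_real ((real_mat M *v x) $ i)" for i
      by (simp add: matrix_vector_mult_def map_matrix_def v_def real_mat_def)
    then show ?thesis using x(1) by (simp add: vec_eq_iff)
  qed
  ultimately have "cmod 0 > 1" using assms unfolding dilation_matrix_def by blast
  then show False by simp
qed

section \<open>Integer powers of a matrix\<close>

lemma matrix_inv_unique:
  fixes A :: "real^'d^'d"
  assumes "A ** B = mat 1" "B ** A = mat 1" shows "matrix_inv A = B"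
proof -
  have "invertible A" using assms unfolding invertible_def by blast
  then have "matrix_inv A ** A = mat 1" by (rule matrix_inv_mult)
  then have "matrix_inv A ** (A ** B) = B" by (simp add: matrix_mul_assoc)
  then show ?thesis by (simp add: assms)
qed

abbreviation mpow :: "real^'d^'d \<Rightarrow> nat \<Rightarrow> real^'d^'d" where "mpow A n \<equiv> (((**) A) ^^ n) (mat 1)"

lemma mpow_commute: "mpow A n ** A = A ** mpow A n"
  by (induction n) (simp_all add: matrix_mul_assoc[symmetric])

lemma det_mpow: "det (mpow A n) = det A ^ n"
  by (induction n) (simp_all add: det_mul)

lemma transpose_mpow: "transpose (mpow A n) = mpow (transpose A) n"
proof (induction n)
  case (Suc n)
  then show ?case by (simp add: matrix_transpose_mul mpow_commute)
qed (simp add: transpose_mat)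

lemma mpow_inverse:
  assumes "A ** B = mat 1" shows "mpow A n ** mpow B n = mat 1"
proof (induction n)
  case (Suc n)
  have "mpow A (Suc n) ** mpow B (Suc n) = (mpow A n ** A) ** (B ** mpow B n)" by (simp add: mpow_commute)
  also have "\<dots> = mpow A n ** ((A ** B) ** mpow B n)" by (simp add: matrix_mul_assoc)
  also have "\<dots> = mat 1" using Suc assms by simp
  finally show ?case .
qed simp

lemma matrix_inv_det:
  fixes A :: "real^'d^'d"
  assumes "det A \<noteq> 0" shows "A ** matrix_inv A = mat 1" "matrix_inv A ** A = mat 1"
  using assms by (auto intro: matrix_inv_mult simp: invertible_det_nz)

lemma det_matrix_inv:
  fixes A :: "real^'d^'d"
  assumes "det A \<noteq> 0" shows "det (matrix_inv A) = 1 / det A"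
proof -
  have "A ** matrix_inv A = mat 1" by (rule matrix_inv_det[OF assms])
  then have "det A * det (matrix_inv A) = 1" by (metis det_I det_mul)
  then show ?thesis using assms by (simp add: field_simps)
qed

lemma det_mat_powi:
  assumes "det A \<noteq> 0" shows "\<bar>det (mat_powi A j)\<bar> = \<bar>det A\<bar> powr (real_of_int j)"
proof (cases "j \<ge> 0")
  case True
  then have "\<bar>det (mat_powi A j)\<bar> = \<bar>det A\<bar> ^ nat j" by (simp add: mat_powi_def det_mpow power_abs)
  also have "\<dots> = \<bar>det A\<bar> powr (real (nat j))" using assms by (simp add: powr_realpow)
  finally show ?thesis using True by simp
next
  case False
  then have "\<bar>det (mat_powi A j)\<bar> = (1 / \<bar>det A\<bar>) ^ nat (- j)"
    using assms by (simp add: mat_powi_def det_mpow power_abs det_matrix_inv)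
  also have "\<dots> = inverse (\<bar>det A\<bar> ^ nat (- j))" by (simp add: power_divide inverse_eq_divide)
  also have "\<dots> = inverse (\<bar>det A\<bar> powr (real (nat (- j))))" using assms by (simp add: powr_realpow)
  also have "\<dots> = \<bar>det A\<bar> powr (- real (nat (- j)))" by (simp add: powr_minus)
  finally show ?thesis using False by simp
qed

lemma matrix_inv_transpose:
  fixes A :: "real^'d^'d"
  assumes "det A \<noteq> 0" shows "matrix_inv (transpose A) = transpose (matrix_inv A)"
proof (rule matrix_inv_unique)
  have inv: "A ** matrix_inv A = mat 1" "matrix_inv A ** A = mat 1" by (rule matrix_inv_det[OF assms])+
  show "transpose A ** transpose (matrix_inv A) = mat 1" "transpose (matrix_inv A) ** transpose A = mat 1"
    unfolding matrix_transpose_mul[symmetric] inv by (rule transpose_mat)+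
qed

lemma transpose_mat_powi:
  assumes "det A \<noteq> 0" shows "mat_powi (transpose A) j = transpose (mat_powi A j)"
  by (simp add: mat_powi_def transpose_mpow matrix_inv_transpose[OF assms])

lemma mat_powi_neg:
  fixes A :: "real^'d^'d"
  assumes "det A \<noteq> 0" shows "mat_powi A (- j) = matrix_inv (mat_powi A j)"
proof -
  have inv: "A ** matrix_inv A = mat 1" "matrix_inv A ** A = mat 1" by (rule matrix_inv_det[OF assms])+
  note inv_pow = mpow_inverse[OF inv(1)] mpow_inverse[OF inv(2)]
  show ?thesis
  proof (cases j "0 :: int" rule: linorder_cases)
    case less
    then show ?thesis using matrix_inv_unique[OF inv_pow(2,1)] by (simp add: mat_powi_def)
  next
    case equal
    have "matrix_inv (mat 1) = (mat 1 :: real^'d^'d)" by (rule matrix_inv_unique) simp_all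
    then show ?thesis using equal by (simp add: mat_powi_def)
  next
    case greater
    then show ?thesis using matrix_inv_unique[OF inv_pow] by (simp add: mat_powi_def)
  qed
qed

section \<open>Fourier transforms of affine substitutions\<close>

lemma inner_transpose: "(transpose A *v x) \<bullet> y = x \<bullet> (A *v y)" for A :: "real^'d^'d"
  by (simp add: dot_lmul_matrix)

lemma measurable_matrix [measurable]: "(\<lambda>x. (A :: real^'d^'d) *v x) \<in> borel_measurable borel"
  by (intro borel_measurable_continuous_onI linear_continuous_on matrix_vector_mul_bounded_linear)

lemma schwartz_matrix:
  fixes A :: "real^'d^'d"
  assumes "\<psi> \<in> schwartz" "det A \<noteq> 0" shows "(\<lambda>u. \<psi> (A *v u)) \<in> schwartz"
proof (rule schwartz_compose_linear[OF assms(1) matrix_vector_mul_linear])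
  fix x :: "real^'d"
  have "x = matrix_inv A *v (A *v x)"
    using assms(2) by (simp add: matrix_vector_mul_assoc matrix_inv_mult invertible_det_nz)
  then have "norm x = norm (matrix_inv A *v (A *v x))" by simp
  also have "\<dots> \<le> onorm ((*v) (matrix_inv A)) * norm (A *v x)"
    by (rule onorm[OF matrix_vector_mul_bounded_linear])
  finally show "norm x \<le> onorm ((*v) (matrix_inv A)) * norm (A *v x)" .
qed

text \<open>For a function this is the substitution \<open>y = A x + b\<close> in the Fourier
  integral; for a distribution the same substitution is carried out on the test function.\<close>

lemma affine_distr_represents:
  fixes A :: "real^'d^'d" and T :: "(real^'d) distr"
  assumes A: "det A \<noteq> 0" and T: "T \<in> tempered" and g: "represents g (fourier_distr T)"
  shows "represents (\<lambda>\<xi>. of_real (1 / \<bar>det A\<bar>) * (cis (2 * pi * (b \<bullet> (matrix_inv (transpose A) *v \<xi>))) * g (matrix_inv (transpose A) *v \<xi>)))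
    (fourier_distr (affine_distr A b T))"
proof -
  define B where "B = transpose A"
  define Bi where "Bi = matrix_inv B"
  have B: "det B \<noteq> 0" "\<bar>det B\<bar> = \<bar>det A\<bar>" using A by (simp_all add: B_def)
  have BBi: "Bi *v (B *v u) = u" for u
    using B by (simp add: Bi_def matrix_vector_mul_assoc matrix_inv_mult invertible_det_nz)
  have AAi: "A *v (matrix_inv A *v y) = y" for y
    using A by (simp add: matrix_vector_mul_assoc matrix_inv_mult invertible_det_nz)
  have [measurable]: "g \<in> borel_measurable borel" using g by (simp add: represents_def)
  define G where "G \<xi> = of_real (1 / \<bar>det A\<bar>) * (cis (2 * pi * (b \<bullet> (Bi *v \<xi>))) * g (Bi *v \<xi>))" for \<xi>
  have [measurable]: "G \<in> borel_measurable borel" unfolding G_def by measurable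
  have "represents G (fourier_distr (affine_distr A b T))"
    unfolding represents_def
  proof (intro conjI ballI)
    fix \<psi> :: "real^'d \<Rightarrow> complex" assume \<psi>: "\<psi> \<in> schwartz"
    have [measurable]: "\<psi> \<in> borel_measurable borel" by (rule schwartz_measurable[OF \<psi>])
    \<comment> \<open>Substituting \<open>B u\<close> in the transform of \<open>\<psi>\<close> at
      the point \<open>matrix_inv A *v (y - b)\<close> gives the modulus of the determinant times
      the transform of \<open>\<eta>\<close> at \<open>y\<close>.\<close>
    define \<eta> where "\<eta> u = cis (u \<bullet> ((2 * pi) *\<^sub>R b)) * \<psi> (B *v u)" for u
    have \<eta>: "\<eta> \<in> schwartz" unfolding \<eta>_def by (intro schwartz_cis schwartz_matrix \<psi> B)
    have 1: "fourier \<psi> (matrix_inv A *v (y - b)) = of_real \<bar>det A\<bar> * fourier \<eta> y" for y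
    proof -
      have "fourier \<psi> (matrix_inv A *v (y - b)) = \<bar>det B\<bar> *\<^sub>R (LINT u|lborel. \<psi> (B *v u) * cis (- 2 * pi * ((B *v u) \<bullet> (matrix_inv A *v (y - b)))))"
        unfolding fourier_def by (rule integral_matrix[OF B(1)]) measurable
      also have "(\<lambda>u. \<psi> (B *v u) * cis (- 2 * pi * ((B *v u) \<bullet> (matrix_inv A *v (y - b))))) = (\<lambda>u. \<eta> u * cis (- 2 * pi * (u \<bullet> y)))"
      proof
        fix u
        have "(B *v u) \<bullet> (matrix_inv A *v (y - b)) = u \<bullet> (y - b)" unfolding B_def inner_transpose AAi ..
        moreover have "cis (- 2 * pi * (u \<bullet> (y - b))) = cis (u \<bullet> ((2 * pi) *\<^sub>R b)) * cis (- 2 * pi * (u \<bullet> y))"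
          by (simp add: cis_mult inner_diff_right algebra_simps)
        ultimately show "\<psi> (B *v u) * cis (- 2 * pi * ((B *v u) \<bullet> (matrix_inv A *v (y - b)))) = \<eta> u * cis (- 2 * pi * (u \<bullet> y))"
          unfolding \<eta>_def by (simp only: mult_ac)
      qed
      finally show ?thesis unfolding fourier_def B(2) by (simp add: scaleR_conv_of_real)
    qed
    have i: "integrable lborel (\<lambda>u. g u * \<eta> u)" and "fourier_distr T \<eta> = (LINT u|lborel. g u * \<eta> u)"
      using g \<eta> by (auto simp: represents_def)
    have h: "G (B *v u) * \<psi> (B *v u) = of_real (1 / \<bar>det A\<bar>) * (g u * \<eta> u)" for u
      unfolding G_def BBi \<eta>_def by (simp add: inner_commute)
    have "integrable lborel (\<lambda>u. G (B *v u) * \<psi> (B *v u))"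
      unfolding h by (intro integrable_mult_right i)
    then show "integrable lborel (\<lambda>\<xi>. G \<xi> * \<psi> \<xi>)"
      using integrable_matrix[OF B(1), of "\<lambda>\<xi>. G \<xi> * \<psi> \<xi>"] by simp
    have "(LINT \<xi>|lborel. G \<xi> * \<psi> \<xi>) = \<bar>det B\<bar> *\<^sub>R (LINT u|lborel. G (B *v u) * \<psi> (B *v u))"
      by (rule integral_matrix[OF B(1)]) measurable
    also have "\<dots> = (LINT u|lborel. g u * \<eta> u)"
      unfolding h integral_mult_right_zero B(2) using A by (simp add: scaleR_conv_of_real)
    finally have 2: "(LINT \<xi>|lborel. G \<xi> * \<psi> \<xi>) = (LINT u|lborel. g u * \<eta> u)" .
    have "fourier_distr (affine_distr A b T) \<psi> = T (\<lambda>y. of_real \<bar>det A\<bar> * fourier \<eta> y) / of_real \<bar>det A\<bar>"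
      using \<psi> fourier_schwartz[OF \<psi>] by (simp add: fourier_distr_def affine_distr_def 1)
    also have "\<dots> = T (fourier \<eta>)"
      using temperedD(3)[OF T fourier_schwartz[OF \<eta>]] A by simp
    also have "\<dots> = fourier_distr T \<eta>" using \<eta> by (simp add: fourier_distr_def)
    finally show "fourier_distr (affine_distr A b T) \<psi> = (LINT \<xi>|lborel. G \<xi> * \<psi> \<xi>)"
      unfolding 2 using \<open>fourier_distr T \<eta> = _\<close> by simp
  qed simp
  then show ?thesis unfolding G_def Bi_def B_def .
qed

lemma represents_cmult:
  assumes "represents g (fourier_distr T)" shows "represents (\<lambda>\<xi>. c * g \<xi>) (fourier_distr (\<lambda>\<psi>. c * T \<psi>))"
  using assms unfolding represents_def fourier_distr_def by (auto simp: mult.assoc)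

lemma represents_diff:
  assumes "represents g (fourier_distr T)" "represents h (fourier_distr U)"
  shows "represents (\<lambda>\<xi>. g \<xi> - h \<xi>) (fourier_distr (\<lambda>\<psi>. T \<psi> - U \<psi>))"
  using assms unfolding represents_def fourier_distr_def by (auto simp: left_diff_distrib)

lemma represents_sum:
  fixes g :: "'a \<Rightarrow> 'b::euclidean_space \<Rightarrow> complex"
  assumes "\<And>k. k \<in> F \<Longrightarrow> represents (g k) (fourier_distr (T k))"
  shows "represents (\<lambda>\<xi>. \<Sum>k\<in>F. g k \<xi>) (fourier_distr (\<lambda>\<psi>. \<Sum>k\<in>F. T k \<psi>))"
  unfolding represents_def
proof (intro conjI ballI)
  show "(\<lambda>\<xi>. \<Sum>k\<in>F. g k \<xi>) \<in> borel_measurable lborel"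
    using assms by (intro borel_measurable_sum) (simp add: represents_def)
  fix \<psi> :: "'b \<Rightarrow> complex" assume \<psi>: "\<psi> \<in> schwartz"
  have i: "integrable lborel (\<lambda>\<xi>. g k \<xi> * \<psi> \<xi>)" and e: "T k (fourier \<psi>) = (LINT \<xi>|lborel. g k \<xi> * \<psi> \<xi>)" if "k \<in> F" for k
    using assms[OF that] \<psi> by (auto simp: represents_def fourier_distr_def)
  show "integrable lborel (\<lambda>\<xi>. (\<Sum>k\<in>F. g k \<xi>) * \<psi> \<xi>)"
    unfolding sum_distrib_right by (intro Bochner_Integration.integrable_sum i)
  show "fourier_distr (\<lambda>\<psi>. \<Sum>k\<in>F. T k \<psi>) \<psi> = (LINT \<xi>|lborel. (\<Sum>k\<in>F. g k \<xi>) * \<psi> \<xi>)"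
    using \<psi> by (simp add: sum_distrib_right Bochner_Integration.integral_sum i e fourier_distr_def)
qed

text \<open>The normalisation \<open>m^(j/2)\<close> is the square root of the modulus of the
  determinant and meets its reciprocal from the substitution, which leaves the factor with
  \<open>sqrt\<close> below the fraction.\<close>

lemma dil_shift_represents:
  fixes M :: "int^'d^'d" and T :: "(real^'d) distr" and j :: int
  assumes M: "dilation_matrix M" and T: "T \<in> tempered" and g: "represents g (fourier_distr T)"
  defines "B \<equiv> mat_powi (transpose (real_mat M)) j"
  shows "represents (\<lambda>\<xi>. of_real (1 / sqrt \<bar>det B\<bar>) * (tchar k (matrix_inv B *v \<xi>) * g (matrix_inv B *v \<xi>))) (fourier_distr (dil_shift M j k T))"
    and "det B \<noteq> 0"
proof -
  define A where "A = mat_powi (real_mat M) j"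
  have M0: "det (real_mat M) \<noteq> 0" by (rule dilation_matrix_det_nonzero[OF M])
  have B: "B = transpose A" unfolding B_def A_def by (rule transpose_mat_powi[OF M0])
  have dA: "\<bar>det A\<bar> = \<bar>real_of_int (det M)\<bar> powr real_of_int j"
    unfolding A_def det_mat_powi[OF M0] by (simp add: det_real_mat)
  have M0': "\<bar>real_of_int (det M)\<bar> > 0" using M0 by (simp add: det_real_mat)
  have dA0: "\<bar>det A\<bar> > 0" unfolding dA using M0' by simp
  then have A0: "det A \<noteq> 0" by simp
  then show "det B \<noteq> 0" by (simp add: B)
  have sq: "\<bar>real_of_int (det M)\<bar> powr (real_of_int j / 2) = sqrt \<bar>det A\<bar>"
    unfolding dA by (simp add: powr_half_sqrt[symmetric] powr_powr)
  have "represents (\<lambda>\<xi>. of_real (sqrt \<bar>det A\<bar>) * (of_real (1 / \<bar>det A\<bar>) * (cis (2 * pi * (real_vec k \<bullet> (matrix_inv (transpose A) *v \<xi>))) * g (matrix_inv (transpose A) *v \<xi>))))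
      (fourier_distr (\<lambda>\<psi>. of_real (sqrt \<bar>det A\<bar>) * affine_distr A (real_vec k) T \<psi>))"
    by (intro represents_cmult affine_distr_represents A0 T g)
  moreover have "dil_shift M j k T = (\<lambda>\<psi>. of_real (sqrt \<bar>det A\<bar>) * affine_distr A (real_vec k) T \<psi>)"
    unfolding dil_shift_def A_def[symmetric] sq ..
  moreover have "complex_of_real (sqrt \<bar>det A\<bar>) * (of_real (1 / \<bar>det A\<bar>) * z) = of_real (1 / sqrt \<bar>det B\<bar>) * z" for z
  proof -
    have "sqrt \<bar>det A\<bar> * (1 / \<bar>det A\<bar>) = 1 / sqrt \<bar>det B\<bar>"
      using dA0 by (simp add: B real_div_sqrt field_simps)
    then show ?thesis by (metis mult.assoc of_real_mult)
  qed
  ultimately show "represents (\<lambda>\<xi>. of_real (1 / sqrt \<bar>det B\<bar>) * (tchar k (matrix_inv B *v \<xi>) * g (matrix_inv B *v \<xi>))) (fourier_distr (dil_shift M j k T))"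
    by (simp only: tchar_def B)
qed

section \<open>Symbols with bounded lattice sums\<close>

lemma measurable_cnj [measurable]: "cnj \<in> borel_measurable borel"
  by (intro borel_measurable_continuous_onI continuous_intros)

lemma ennreal_integral_le:
  fixes f g :: "'a \<Rightarrow> real"
  assumes [measurable]: "f \<in> borel_measurable M" and f0: "\<And>x. f x \<ge> 0" and C: "C \<ge> 0"
    and "(\<integral>\<^sup>+x. ennreal (f x) \<partial>M) \<le> ennreal C"
  shows "integrable M f" "(LINT x|M. f x) \<le> C"
proof -
  show i: "integrable M f"
    using assms(4) f0 by (intro integrableI_nonneg) (auto simp: le_less_trans ennreal_less_top)
  have "ennreal (LINT x|M. f x) \<le> ennreal C"
    using nn_integral_eq_integral[OF i] f0 assms(4) by simp
  then show "(LINT x|M. f x) \<le> C" using C by simp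
qed

text \<open>To be used with the transforms of \<open>\<phi>\<close> and \<open>\<phi>'\<close> as
  \<open>p\<close> and \<open>q\<close>. The opposite exponents are the two sides of the duality
  between the Sobolev spaces of orders \<open>s\<close> and \<open>- s\<close>.\<close>

locale symbol_pair =
  fixes p q :: "real^'d \<Rightarrow> complex" and s b :: real
  assumes p_measurable [measurable]: "p \<in> borel_measurable borel"
    and q_measurable [measurable]: "q \<in> borel_measurable borel"
    and b_nonneg: "b \<ge> 0"
    and p_bound: "(\<integral>\<^sup>+k. ennreal ((cmod (p (u + real_vec k)))\<^sup>2 * weight s (u + real_vec k)) \<partial>count_space UNIV) \<le> ennreal b"
    and q_bound: "(\<integral>\<^sup>+k. ennreal ((cmod (q (u + real_vec k)))\<^sup>2 * weight (- s) (u + real_vec k)) \<partial>count_space UNIV) \<le> ennreal b"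
begin

text \<open>The bracket product of \<open>F\<close> and \<open>q\<close>. As a Bochner integral over
  counting measure it is an absolutely convergent sum, and it has the default value 0 where absolute
  convergence fails.\<close>

definition per :: "(real^'d \<Rightarrow> complex) \<Rightarrow> real^'d \<Rightarrow> complex" where
  "per F u = (LINT l|count_space UNIV. F (u + real_vec l) * cnj (q (u + real_vec l)))"

lemma per_periodic: "per F (u + real_vec k) = per F u"
proof -
  have "per F (u + real_vec k) = (LINT l|count_space UNIV. F (u + real_vec (k + l)) * cnj (q (u + real_vec (k + l))))"
    by (simp add: per_def real_vec_add add.assoc)
  also have "\<dots> = per F u"
    unfolding per_def by (rule integral_bij_count_space[of "(+) k" UNIV UNIV "\<lambda>l. F (u + real_vec l) * cnj (q (u + real_vec l))"])
      (auto intro: bij_betw_byWitness[where f'="(+) (- k)"])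
  finally show ?thesis .
qed

lemma per_measurable [measurable]:
  assumes [measurable]: "F \<in> borel_measurable borel" shows "per F \<in> borel_measurable borel"
proof -
  have "(\<lambda>(u, l). F (u + real_vec l) * cnj (q (u + real_vec l))) \<in> borel_measurable (borel \<Otimes>\<^sub>M count_space (UNIV :: (int^'d) set))"
  proof (subst measurable_cong)
    have "(\<lambda>(l, u). F (u + real_vec l) * cnj (q (u + real_vec l))) \<in> borel_measurable (count_space (UNIV :: (int^'d) set) \<Otimes>\<^sub>M borel)"
      by (rule measurable_pair_measure_countable1) auto
    from measurable_compose[OF measurable_pair_swap' this]
    show "(\<lambda>p. (\<lambda>(l, u). F (u + real_vec l) * cnj (q (u + real_vec l))) ((\<lambda>(x, y). (y, x)) p)) \<in> borel_measurable (borel \<Otimes>\<^sub>M count_space (UNIV :: (int^'d) set))" .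
  qed auto
  from lattice.borel_measurable_lebesgue_integral[OF this] show ?thesis unfolding per_def .
qed

lemma weight_square: "(weight (s / 2) x)\<^sup>2 = weight s x"
  "(weight (- s / 2) x)\<^sup>2 = weight (- s) x"
  "weight (s / 2) x * weight (- s / 2) x = 1"
proof -
  have "1 + (norm x)\<^sup>2 \<noteq> 0" using zero_le_power2[of "norm x"] by linarith
  then show "(weight (s / 2) x)\<^sup>2 = weight s x"
    "(weight (- s / 2) x)\<^sup>2 = weight (- s) x"
    "weight (s / 2) x * weight (- s / 2) x = 1"
    by (simp_all add: power2_eq_square powr_add[symmetric])
qed

text \<open>Factors with exponents \<open>s / 2\<close> and \<open>- s / 2\<close>, whose product is
  1, are inserted before the Cauchy-Schwarz inequality; the sum with \<open>q\<close> is then at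
  most \<open>b\<close>.\<close>

lemma lattice_Cauchy_Schwarz:
  "(\<integral>\<^sup>+l. ennreal (cmod (F (u + real_vec l)) * cmod (q (u + real_vec l))) \<partial>count_space A)\<^sup>2 \<le> ennreal b * (\<integral>\<^sup>+l. ennreal ((cmod (F (u + real_vec l)))\<^sup>2 * weight s (u + real_vec l)) \<partial>count_space A)"
    (is "?L \<le> _ * ?R")
proof -
  define v where "v x = weight (s / 2) x" for x :: "real^'d"
  define v' where "v' x = weight (- s / 2) x" for x :: "real^'d"
  have v0: "v x \<ge> 0" "v' x \<ge> 0" for x by (simp_all add: v_def v'_def)
  have vv: "v x * v' x = 1" for x unfolding v_def v'_def by (rule weight_square(3))
  have eq: "cmod (F x) * cmod (q x) = (cmod (F x) * v x) * (cmod (q x) * v' x)" for x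
  proof -
    have "(cmod (F x) * v x) * (cmod (q x) * v' x) = cmod (F x) * cmod (q x) * (v x * v' x)" by (simp only: mult_ac)
    then show ?thesis using vv by simp
  qed
  have "(\<integral>\<^sup>+l. ennreal (cmod (F (u + real_vec l)) * cmod (q (u + real_vec l))) \<partial>count_space A)\<^sup>2 =
      (\<integral>\<^sup>+l. ennreal (cmod (F (u + real_vec l)) * v (u + real_vec l)) * ennreal (cmod (q (u + real_vec l)) * v' (u + real_vec l)) \<partial>count_space A)\<^sup>2"
    unfolding eq using v0 by (simp add: ennreal_mult)
  also have "\<dots> \<le> (\<integral>\<^sup>+l. (ennreal (cmod (F (u + real_vec l)) * v (u + real_vec l)))\<^sup>2 \<partial>count_space A) * (\<integral>\<^sup>+l. (ennreal (cmod (q (u + real_vec l)) * v' (u + real_vec l)))\<^sup>2 \<partial>count_space A)"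
    by (rule Cauchy_Schwarz_nn_integral) auto
  also have "(\<integral>\<^sup>+l. (ennreal (cmod (F (u + real_vec l)) * v (u + real_vec l)))\<^sup>2 \<partial>count_space A) = (\<integral>\<^sup>+l. ennreal ((cmod (F (u + real_vec l)))\<^sup>2 * weight s (u + real_vec l)) \<partial>count_space A)"
    using v0 by (intro nn_integral_cong) (simp add: ennreal_power power_mult_distrib v_def weight_square(1))
  also have "(\<integral>\<^sup>+l. (ennreal (cmod (q (u + real_vec l)) * v' (u + real_vec l)))\<^sup>2 \<partial>count_space A) = (\<integral>\<^sup>+l. ennreal ((cmod (q (u + real_vec l)))\<^sup>2 * weight (- s) (u + real_vec l)) \<partial>count_space A)"
    using v0 by (intro nn_integral_cong) (simp add: ennreal_power power_mult_distrib v'_def weight_square(2)[unfolded minus_divide_left[symmetric]])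
  finally have "?L \<le> ?R * (\<integral>\<^sup>+l. ennreal ((cmod (q (u + real_vec l)))\<^sup>2 * weight (- s) (u + real_vec l)) \<partial>count_space A)" .
  also have "\<dots> \<le> ?R * (\<integral>\<^sup>+l. ennreal ((cmod (q (u + real_vec l)))\<^sup>2 * weight (- s) (u + real_vec l)) \<partial>count_space UNIV)"
    by (intro mult_left_mono, subst nn_integral_count_space_indicator) (auto intro!: nn_integral_mono simp: indicator_def)
  also have "\<dots> \<le> ?R * ennreal b" by (intro mult_left_mono q_bound) simp
  finally show ?thesis by (simp only: mult.commute)
qed

lemma per_bound:
  "ennreal ((cmod (per F u))\<^sup>2) \<le> ennreal b * (\<integral>\<^sup>+l. ennreal ((cmod (F (u + real_vec l)))\<^sup>2 * weight s (u + real_vec l)) \<partial>count_space UNIV)"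
proof -
  have "ennreal (cmod (per F u)) \<le> (\<integral>\<^sup>+l. ennreal (cmod (F (u + real_vec l)) * cmod (q (u + real_vec l))) \<partial>count_space UNIV)"
  proof (cases "integrable (count_space UNIV) (\<lambda>l. F (u + real_vec l) * cnj (q (u + real_vec l)))")
    case True
    from integral_norm_bound_ennreal[OF this] show ?thesis unfolding per_def by (simp add: norm_mult)
  next
    case False
    then show ?thesis by (simp add: per_def not_integrable_integral_eq)
  qed
  then have "(ennreal (cmod (per F u)))\<^sup>2 \<le> (\<integral>\<^sup>+l. ennreal (cmod (F (u + real_vec l)) * cmod (q (u + real_vec l))) \<partial>count_space UNIV)\<^sup>2"
    by (intro power_mono) auto
  also note lattice_Cauchy_Schwarz
  finally show ?thesis by (simp add: ennreal_power)
qed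

text \<open>Integrating \<open>per_bound\<close> over the cube reassembles the coset sums into one
  weighted integral over the space.\<close>

lemma per_square_integrable:
  assumes [measurable]: "F \<in> borel_measurable borel" and i: "integrable lborel (\<lambda>u. (cmod (F u))\<^sup>2 * weight s u)"
  shows "integrable cube_measure (\<lambda>u. (cmod (per F u))\<^sup>2)"
proof (rule ennreal_integral_le(1))
  show "(\<lambda>u. (cmod (per F u))\<^sup>2) \<in> borel_measurable cube_measure" by (rule borel_measurable_cube) measurable
  have "(\<integral>\<^sup>+u. ennreal ((cmod (per F u))\<^sup>2) \<partial>cube_measure) \<le>
      (\<integral>\<^sup>+u. ennreal b * (\<integral>\<^sup>+l. ennreal ((cmod (F (u + real_vec l)))\<^sup>2 * weight s (u + real_vec l)) \<partial>count_space UNIV) \<partial>cube_measure)"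
    by (intro nn_integral_mono per_bound)
  also have "\<dots> = (\<integral>\<^sup>+u. (\<integral>\<^sup>+l. ennreal b * ennreal ((cmod (F (u + real_vec l)))\<^sup>2 * weight s (u + real_vec l)) \<partial>count_space UNIV) \<partial>cube_measure)"
    by (simp add: nn_integral_cmult)
  also have "\<dots> = (\<integral>\<^sup>+u. ennreal b * ennreal ((cmod (F u))\<^sup>2 * weight s u) \<partial>lborel)"
    by (rule nn_integral_lattice_cube[symmetric]) measurable
  also have "\<dots> = ennreal b * (\<integral>\<^sup>+u. ennreal ((cmod (F u))\<^sup>2 * weight s u) \<partial>lborel)"
    by (rule nn_integral_cmult) measurable
  also have "\<dots> = ennreal (b * (LINT u|lborel. (cmod (F u))\<^sup>2 * weight s u))"
    using nn_integral_eq_integral[OF i] b_nonneg by (simp add: ennreal_mult')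
  finally show "(\<integral>\<^sup>+u. ennreal ((cmod (per F u))\<^sup>2) \<partial>cube_measure) \<le> ennreal (b * (LINT u|lborel. (cmod (F u))\<^sup>2 * weight s u))" .
  show "b * (LINT u|lborel. (cmod (F u))\<^sup>2 * weight s u) \<ge> 0"
    using b_nonneg by (intro mult_nonneg_nonneg integral_nonneg_AE AE_I2) auto
qed simp

lemma product_integrable:
  assumes [measurable]: "F \<in> borel_measurable borel" and i: "integrable lborel (\<lambda>u. (cmod (F u))\<^sup>2 * weight s u)"
  shows "integrable lborel (\<lambda>u. F u * cnj (q u))"
proof (rule Bochner_Integration.integrable_bound)
  have "integrable lborel (\<lambda>u. (cmod (q u))\<^sup>2 * weight (- s) u)"
  proof (rule ennreal_integral_le(1))
    have "(\<integral>\<^sup>+u. ennreal ((cmod (q u))\<^sup>2 * weight (- s) u) \<partial>lborel) =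
        (\<integral>\<^sup>+u. (\<integral>\<^sup>+k. ennreal ((cmod (q (u + real_vec k)))\<^sup>2 * weight (- s) (u + real_vec k)) \<partial>count_space UNIV) \<partial>cube_measure)"
      by (rule nn_integral_lattice_cube) measurable
    also have "\<dots> \<le> (\<integral>\<^sup>+u. ennreal b \<partial>(cube_measure :: (real^'d) measure))" by (intro nn_integral_mono q_bound)
    also have "\<dots> = ennreal b" by (simp add: emeasure_cube_measure emeasure_unit_cube)
    finally show "(\<integral>\<^sup>+u. ennreal ((cmod (q u))\<^sup>2 * weight (- s) u) \<partial>lborel) \<le> ennreal b" .
  qed (auto simp: b_nonneg)
  with i show "integrable lborel (\<lambda>u. (cmod (F u))\<^sup>2 * weight s u + (cmod (q u))\<^sup>2 * weight (- s) u)"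
    by (rule Bochner_Integration.integrable_add)
  have "cmod (F u * cnj (q u)) \<le> (cmod (F u))\<^sup>2 * weight s u + (cmod (q u))\<^sup>2 * weight (- s) u" for u
  proof -
    define x where "x = cmod (F u) * weight (s / 2) u"
    define y where "y = cmod (q u) * weight (- s / 2) u"
    have "x * y = cmod (F u) * cmod (q u) * (weight (s / 2) u * weight (- s / 2) u)"
      unfolding x_def y_def by (simp only: mult_ac)
    then have "cmod (F u * cnj (q u)) = x * y" unfolding weight_square(3) by (simp add: norm_mult)
    also have "\<dots> \<le> x\<^sup>2 + y\<^sup>2" using sum_squares_bound[of x y] zero_le_power2[of x] zero_le_power2[of y] by linarith
    finally show ?thesis unfolding x_def y_def power_mult_distrib weight_square .
  qed
  then show "AE u in lborel. norm (F u * cnj (q u)) \<le> norm ((cmod (F u))\<^sup>2 * weight s u + (cmod (q u))\<^sup>2 * weight (- s) u)"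
    by (intro AE_I2) (metis abs_ge_self order_trans real_norm_def)
qed measurable

text \<open>Unfolding: the characters are invariant under lattice shifts, so the integral over the
  cube of the coset sum is an integral over the space.\<close>

lemma fcoeff_per:
  assumes [measurable]: "F \<in> borel_measurable borel" and i: "integrable lborel (\<lambda>u. (cmod (F u))\<^sup>2 * weight s u)"
  shows "fcoeff (per F) k = (LINT u|lborel. F u * cnj (q u) * cnj (tchar k u))"
proof -
  have "integrable lborel (\<lambda>u. F u * cnj (q u) * cnj (tchar k u))"
    by (rule Bochner_Integration.integrable_bound[OF product_integrable[OF assms]])
      (measurable, simp add: norm_mult)
  from integral_lattice_cube(3)[OF this]
  have "(LINT u|lborel. F u * cnj (q u) * cnj (tchar k u)) =
      (LINT u|cube_measure. LINT l|count_space UNIV. F (u + real_vec l) * cnj (q (u + real_vec l)) * cnj (tchar k u))"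
    unfolding tchar_shift .
  then show ?thesis unfolding fcoeff_def per_def by (simp only: integral_mult_left_zero)
qed

text \<open>A periodic factor is constant along each coset and comes out of the lattice sum, where
  \<open>p_bound\<close> controls what is left. This is the stability of the shifts of
  \<open>\<phi>\<close> from above.\<close>

lemma periodic_times_symbol:
  assumes [measurable]: "S \<in> borel_measurable borel" and per: "\<And>u k. S (u + real_vec k) = S u"
    and i: "integrable cube_measure (\<lambda>u. (cmod (S u))\<^sup>2)"
  shows "integrable lborel (\<lambda>u. (cmod (S u * p u))\<^sup>2 * weight s u)"
    and "(LINT u|lborel. (cmod (S u * p u))\<^sup>2 * weight s u) \<le> b * (LINT u|cube_measure. (cmod (S u))\<^sup>2)"
proof -
  have "(\<integral>\<^sup>+u. ennreal ((cmod (S u * p u))\<^sup>2 * weight s u) \<partial>lborel) =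
      (\<integral>\<^sup>+u. (\<integral>\<^sup>+k. ennreal ((cmod (S u))\<^sup>2) * ennreal ((cmod (p (u + real_vec k)))\<^sup>2 * weight s (u + real_vec k)) \<partial>count_space UNIV) \<partial>cube_measure)"
    by (subst nn_integral_lattice_cube) (simp_all add: per norm_mult power_mult_distrib ennreal_mult[symmetric] mult.assoc)
  also have "\<dots> = (\<integral>\<^sup>+u. ennreal ((cmod (S u))\<^sup>2) * (\<integral>\<^sup>+k. ennreal ((cmod (p (u + real_vec k)))\<^sup>2 * weight s (u + real_vec k)) \<partial>count_space UNIV) \<partial>cube_measure)"
    by (simp add: nn_integral_cmult)
  also have "\<dots> \<le> (\<integral>\<^sup>+u. ennreal ((cmod (S u))\<^sup>2) * ennreal b \<partial>cube_measure)"
    by (intro nn_integral_mono mult_left_mono p_bound) simp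
  also have "\<dots> = (\<integral>\<^sup>+u. ennreal ((cmod (S u))\<^sup>2) \<partial>cube_measure) * ennreal b"
    using i by (intro nn_integral_multc) simp
  also have "\<dots> = ennreal (b * (LINT u|cube_measure. (cmod (S u))\<^sup>2))"
    using nn_integral_eq_integral[OF i] b_nonneg by (simp add: ennreal_mult' mult.commute)
  finally have le: "(\<integral>\<^sup>+u. ennreal ((cmod (S u * p u))\<^sup>2 * weight s u) \<partial>lborel) \<le> ennreal (b * (LINT u|cube_measure. (cmod (S u))\<^sup>2))" .
  have C: "b * (LINT u|cube_measure. (cmod (S u))\<^sup>2) \<ge> 0" using b_nonneg by simp
  show "integrable lborel (\<lambda>u. (cmod (S u * p u))\<^sup>2 * weight s u)"
    by (rule ennreal_integral_le(1)[OF _ _ C le]) auto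
  show "(LINT u|lborel. (cmod (S u * p u))\<^sup>2 * weight s u) \<le> b * (LINT u|cube_measure. (cmod (S u))\<^sup>2)"
    by (rule ennreal_integral_le(2)[OF _ _ C le]) auto
qed

text \<open>The remainder of the Fourier series of \<open>per F\<close> is periodic, so its product
  with \<open>p\<close> is as small in the weighted norm as the remainder itself is on the
  cube.\<close>

lemma symbol_series_tendsto:
  assumes F [measurable]: "F \<in> borel_measurable borel" and i: "integrable lborel (\<lambda>u. (cmod (F u))\<^sup>2 * weight s u)"
  defines "E \<equiv> \<lambda>A u. per F u - (\<Sum>k\<in>A. fcoeff (per F) k * tchar k u)"
  shows "integrable lborel (\<lambda>u. (cmod (E A u * p u))\<^sup>2 * weight s u)"
    and "((\<lambda>A. LINT u|lborel. (cmod (E A u * p u))\<^sup>2 * weight s u) \<longlongrightarrow> 0) (finite_subsets_at_top UNIV)"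
proof -
  have [measurable]: "E A \<in> borel_measurable borel" for A unfolding E_def by measurable
  have [measurable]: "per F \<in> borel_measurable cube_measure" by (rule borel_measurable_cube) measurable
  have [measurable]: "(\<lambda>u. \<Sum>k\<in>A. fcoeff (per F) k * tchar k u) \<in> borel_measurable cube_measure" for A by (rule borel_measurable_cube) measurable
  have E_per: "E A (u + real_vec k) = E A u" for A u k
    unfolding E_def by (simp add: per_periodic tchar_shift)
  have P2: "integrable cube_measure (\<lambda>u. (cmod (per F u))\<^sup>2)" by (rule per_square_integrable[OF F i])
  have E2: "integrable cube_measure (\<lambda>u. (cmod (E A u))\<^sup>2)" for A
    using square_integrable_add(1)[of "per F" cube_measure "\<lambda>u. - (\<Sum>k\<in>A. fcoeff (per F) k * tchar k u)"] P2
      square_integrable_sum_tchar[of "fcoeff (per F)" A] by (simp add: E_def)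
  have main: "integrable lborel (\<lambda>u. (cmod (E A u * p u))\<^sup>2 * weight s u)"
    "(LINT u|lborel. (cmod (E A u * p u))\<^sup>2 * weight s u) \<le> b * (LINT u|cube_measure. (cmod (E A u))\<^sup>2)" for A
    using periodic_times_symbol[OF _ E_per E2, of A] by simp_all
  show "integrable lborel (\<lambda>u. (cmod (E A u * p u))\<^sup>2 * weight s u)" by (rule main(1))
  have "((\<lambda>A. LINT u|cube_measure. (cmod (E A u))\<^sup>2) \<longlongrightarrow> 0) (finite_subsets_at_top UNIV)"
    unfolding E_def by (rule fourier_series_L2[OF _ P2]) measurable
  from tendsto_mult_left[OF this, of b]
  have "((\<lambda>A. b * (LINT u|cube_measure. (cmod (E A u))\<^sup>2)) \<longlongrightarrow> 0) (finite_subsets_at_top UNIV)" by simp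
  then show "((\<lambda>A. LINT u|lborel. (cmod (E A u * p u))\<^sup>2 * weight s u) \<longlongrightarrow> 0) (finite_subsets_at_top UNIV)"
    by (rule Lim_null_comparison[rotated]) (auto intro!: always_eventually main(2) simp: abs_of_nonneg)
qed

end

section \<open>Quasi-projections in the Fourier domain\<close>

lemma symbol_pair_exists:
  fixes \<phi> \<phi>' :: "(real^'d) distr"
  assumes "\<phi> \<in> sobolev s" "\<phi>' \<in> sobolev (- s)" "compact (distr_support \<phi>)" "compact (distr_support \<phi>')"
  shows "\<exists>b. symbol_pair (fhat \<phi>) (fhat \<phi>') s b"
proof -
  obtain b1 where b1: "b1 \<ge> 0" "\<And>\<eta>. (\<integral>\<^sup>+k. ennreal ((cmod (fhat \<phi> (\<eta> + real_vec k)))\<^sup>2 * weight s (\<eta> + real_vec k)) \<partial>count_space UNIV) \<le> ennreal b1"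
    using fhat_lattice_bound[OF assms(1,3)] by auto
  obtain b2 where b2: "b2 \<ge> 0" "\<And>\<eta>. (\<integral>\<^sup>+k. ennreal ((cmod (fhat \<phi>' (\<eta> + real_vec k)))\<^sup>2 * weight (- s) (\<eta> + real_vec k)) \<partial>count_space UNIV) \<le> ennreal b2"
    using fhat_lattice_bound[OF assms(2,4)] by auto
  have le: "ennreal b1 \<le> ennreal (max b1 b2)" "ennreal b2 \<le> ennreal (max b1 b2)" by (simp_all add: ennreal_leI)
  have "symbol_pair (fhat \<phi>) (fhat \<phi>') s (max b1 b2)"
  proof
    show "fhat \<phi> \<in> borel_measurable borel" "fhat \<phi>' \<in> borel_measurable borel"
      using sobolevD(3)[OF assms(1)] sobolevD(3)[OF assms(2)] .
    show "0 \<le> max b1 b2" using b1(1) by simp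
  qed (rule order_trans[OF b1(2) le(1)], rule order_trans[OF b2(2) le(2)])
  then show ?thesis ..
qed

lemma sobolev_mono:
  assumes "f \<in> sobolev t" "s \<le> t" shows "f \<in> sobolev s"
proof (rule sobolevI[OF sobolevD(1,2)[OF assms(1)]], rule Bochner_Integration.integrable_bound[OF sobolevD(4)[OF assms(1)]])
  have [measurable]: "fhat f \<in> borel_measurable borel" by (rule sobolevD(3)[OF assms(1)])
  show "(\<lambda>\<xi>. (cmod (fhat f \<xi>))\<^sup>2 * weight s \<xi>) \<in> borel_measurable lborel" by simp
  show "AE \<xi> in lborel. norm ((cmod (fhat f \<xi>))\<^sup>2 * weight s \<xi>) \<le> norm ((cmod (fhat f \<xi>))\<^sup>2 * weight t \<xi>)"
    using assms(2) by (intro AE_I2) (auto intro!: mult_left_mono powr_mono simp: abs_mult)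
qed

section \<open>Norms computed from any representative of the transform\<close>

lemma sobolev_norm_represents:
  assumes "represents h (fourier_distr T)"
  shows "sobolev_norm t T = sqrt (LINT \<xi>|lborel. (cmod (h \<xi>))\<^sup>2 * weight t \<xi>)"
proof -
  have [measurable]: "fhat T \<in> borel_measurable borel" "h \<in> borel_measurable borel"
    using fhat_measurable[OF assms] assms by (auto simp: represents_def)
  have "AE \<xi> in lborel. (cmod (fhat T \<xi>))\<^sup>2 * weight t \<xi> = (cmod (h \<xi>))\<^sup>2 * weight t \<xi>"
    using fhat_AE_eq[OF assms] by eventually_elim simp
  then have "(LINT \<xi>|lborel. (cmod (fhat T \<xi>))\<^sup>2 * weight t \<xi>) = (LINT \<xi>|lborel. (cmod (h \<xi>))\<^sup>2 * weight t \<xi>)"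
    by (intro integral_cong_AE) simp_all
  then show ?thesis by (simp add: sobolev_norm_def)
qed

lemma sobolev_seminorm_represents:
  assumes "represents h (fourier_distr T)"
  shows "sobolev_seminorm t T = sqrt (LINT \<xi>|lborel. norm \<xi> powr (2 * t) * (cmod (h \<xi>))\<^sup>2)"
proof -
  have [measurable]: "fhat T \<in> borel_measurable borel" "h \<in> borel_measurable borel"
    using fhat_measurable[OF assms] assms by (auto simp: represents_def)
  have "AE \<xi> in lborel. norm \<xi> powr (2 * t) * (cmod (fhat T \<xi>))\<^sup>2 = norm \<xi> powr (2 * t) * (cmod (h \<xi>))\<^sup>2"
    using fhat_AE_eq[OF assms] by eventually_elim simp
  then have "(LINT \<xi>|lborel. norm \<xi> powr (2 * t) * (cmod (fhat T \<xi>))\<^sup>2) = (LINT \<xi>|lborel. norm \<xi> powr (2 * t) * (cmod (h \<xi>))\<^sup>2)"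
    by (intro integral_cong_AE) simp_all
  then show ?thesis by (simp add: sobolev_seminorm_def)
qed

section \<open>Weighted integrals under a change of variables\<close>

lemma norm_matrix_le: "norm (A *v x) \<le> op_norm A * norm x" for A :: "real^'d^'d"
  unfolding op_norm_def by (rule onorm[OF matrix_vector_mul_bounded_linear])

lemma op_norm_nonneg: "op_norm (A :: real^'d^'d) \<ge> 0"
  unfolding op_norm_def by (rule onorm_pos_le[OF matrix_vector_mul_bounded_linear])

lemma matrix_inv_cancel:
  fixes A :: "real^'d^'d"
  assumes "det A \<noteq> 0" shows "matrix_inv A *v (A *v x) = x" "A *v (matrix_inv A *v x) = x"
  by (simp_all add: matrix_vector_mul_assoc matrix_inv_det[OF assms])

lemma weight_matrix_le:
  fixes A :: "real^'d^'d"
  assumes "s \<ge> 0"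
  shows "weight s (A *v x) \<le> (1 + (op_norm A)\<^sup>2) powr s * weight s x"
proof -
  have "(norm (A *v x))\<^sup>2 \<le> (op_norm A * norm x)\<^sup>2" by (intro power_mono norm_matrix_le) simp
  then have "1 + (norm (A *v x))\<^sup>2 \<le> (1 + (op_norm A)\<^sup>2) * (1 + (norm x)\<^sup>2)"
    by (simp add: power_mult_distrib distrib_left distrib_right add_increasing)
  then have "weight s (A *v x) \<le> ((1 + (op_norm A)\<^sup>2) * (1 + (norm x)\<^sup>2)) powr s"
    using assms by (intro powr_mono2) auto
  then show ?thesis by (simp add: powr_mult)
qed

text \<open>The weight at \<open>x\<close> is at most a constant times the weight at
  \<open>A *v x\<close>, because \<open>x\<close> is recovered by the inverse matrix. The dilation
  thus preserves weighted integrability, with a bound good enough for limits.\<close>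

lemma weighted_integral_matrix:
  fixes A :: "real^'d^'d" and g :: "real^'d \<Rightarrow> complex"
  assumes A: "det A \<noteq> 0" and s: "s \<ge> 0" and [measurable]: "g \<in> borel_measurable borel"
    and i: "integrable lborel (\<lambda>x. (cmod (g x))\<^sup>2 * weight s x)"
  shows "integrable lborel (\<lambda>x. (cmod (g (A *v x)))\<^sup>2 * weight s x)"
    and "(LINT x|lborel. (cmod (g (A *v x)))\<^sup>2 * weight s x) \<le>
      (1 + (op_norm (matrix_inv A))\<^sup>2) powr s / \<bar>det A\<bar> * (LINT x|lborel. (cmod (g x))\<^sup>2 * weight s x)"
proof -
  define c where "c = (1 + (op_norm (matrix_inv A))\<^sup>2) powr s"
  define h where "h x = (cmod (g x))\<^sup>2 * weight s x" for x
  have [measurable]: "h \<in> borel_measurable borel" unfolding h_def by measurable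
  have ih: "integrable lborel (\<lambda>x. c * h (A *v x))"
    using integrable_matrix[OF A, of h] i by (simp add: h_def[abs_def])
  have le: "(cmod (g (A *v x)))\<^sup>2 * weight s x \<le> c * h (A *v x)" for x
  proof -
    have "weight s x \<le> c * weight s (A *v x)"
      using weight_matrix_le[OF s, of "matrix_inv A" "A *v x"] unfolding matrix_inv_cancel[OF A] c_def .
    then have "(cmod (g (A *v x)))\<^sup>2 * weight s x \<le> (cmod (g (A *v x)))\<^sup>2 * (c * weight s (A *v x))"
      by (rule mult_left_mono) simp
    then show ?thesis by (simp add: h_def mult.left_commute)
  qed
  show i': "integrable lborel (\<lambda>x. (cmod (g (A *v x)))\<^sup>2 * weight s x)"
    by (rule Bochner_Integration.integrable_bound[OF ih]) (simp, intro AE_I2, use order_trans[OF le abs_ge_self] in \<open>simp add: abs_mult\<close>)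
  have "(LINT x|lborel. (cmod (g (A *v x)))\<^sup>2 * weight s x) \<le> (LINT x|lborel. c * h (A *v x))"
    by (rule integral_mono[OF i' ih le])
  also have "\<dots> = c / \<bar>det A\<bar> * (LINT x|lborel. h x)"
    using integral_matrix[OF A, of h] A by simp
  finally show "(LINT x|lborel. (cmod (g (A *v x)))\<^sup>2 * weight s x) \<le>
      (1 + (op_norm (matrix_inv A))\<^sup>2) powr s / \<bar>det A\<bar> * (LINT x|lborel. (cmod (g x))\<^sup>2 * weight s x)"
    unfolding c_def h_def .
qed

text \<open>Multiplication by the square root \<open>w\<close> of the weight reduces the claim to
  \<open>square_integrable_add\<close>.\<close>

lemma weighted_square_triangle:
  fixes f g h :: "'a::euclidean_space \<Rightarrow> complex"
  assumes [measurable]: "f \<in> borel_measurable borel" "g \<in> borel_measurable borel" "h \<in> borel_measurable borel"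
    and i: "integrable lborel (\<lambda>x. (cmod (f x - h x))\<^sup>2 * weight s x)"
      "integrable lborel (\<lambda>x. (cmod (g x - h x))\<^sup>2 * weight s x)"
  shows "integrable lborel (\<lambda>x. (cmod (f x - g x))\<^sup>2 * weight s x)"
    and "(LINT x|lborel. (cmod (f x - g x))\<^sup>2 * weight s x) \<le>
      2 * (LINT x|lborel. (cmod (f x - h x))\<^sup>2 * weight s x) + 2 * (LINT x|lborel. (cmod (g x - h x))\<^sup>2 * weight s x)"
proof -
  define w where "w x = complex_of_real (weight (s / 2) x)" for x :: 'a
  have [measurable]: "w \<in> borel_measurable borel" unfolding w_def by measurable
  have w: "(cmod (z * w x))\<^sup>2 = (cmod z)\<^sup>2 * weight s x" for z x
  proof -
    have "1 + (norm x)\<^sup>2 \<noteq> 0" using zero_le_power2[of "norm x"] by linarith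
    then have "(weight (s / 2) x)\<^sup>2 = weight s x"
      by (simp add: power2_eq_square powr_add[symmetric])
    then show ?thesis by (simp add: w_def norm_mult power_mult_distrib)
  qed
  have d: "(f x - h x) * w x + (h x - g x) * w x = (f x - g x) * w x" for x by (simp add: algebra_simps)
  note sq = square_integrable_add[of "\<lambda>x. (f x - h x) * w x" lborel "\<lambda>x. (h x - g x) * w x", unfolded w d norm_minus_commute[of "h _" "g _"], OF _ _ i]
  show "integrable lborel (\<lambda>x. (cmod (f x - g x))\<^sup>2 * weight s x)" by (rule sq(1)) measurable
  show "(LINT x|lborel. (cmod (f x - g x))\<^sup>2 * weight s x) \<le>
      2 * (LINT x|lborel. (cmod (f x - h x))\<^sup>2 * weight s x) + 2 * (LINT x|lborel. (cmod (g x - h x))\<^sup>2 * weight s x)"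
    by (rule sq(2)) measurable
qed

text \<open>The partial sums have transforms \<open>S A\<close> times the symbol in the variable
  \<open>u\<close>, and \<open>S A\<close> is a partial Fourier sum of \<open>per F\<close>.
  Convergence of that series provides the limit; uniqueness is checked separately so that the
  definite description can be evaluated.\<close>

lemma quasi_proj_represents:
  fixes M :: "int^'d^'d" and \<phi> \<phi>' f :: "(real^'d) distr" and j :: int
  assumes M: "dilation_matrix M" and \<phi>: "\<phi> \<in> sobolev s" and \<phi>': "\<phi>' \<in> sobolev (- s)"
    and sp: "symbol_pair (fhat \<phi>) (fhat \<phi>') s b" and s: "s \<ge> 0"
    and g: "represents g (fourier_distr f)" and ig: "integrable lborel (\<lambda>\<xi>. (cmod (g \<xi>))\<^sup>2 * weight s \<xi>)"
  defines "B \<equiv> mat_powi (transpose (real_mat M)) j"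
  shows "represents (\<lambda>\<xi>. symbol_pair.per (fhat \<phi>') (\<lambda>u. g (B *v u)) (matrix_inv B *v \<xi>) * fhat \<phi> (matrix_inv B *v \<xi>))
    (fourier_distr (quasi_proj s M \<phi> \<phi>' j f))"
proof -
  interpret symbol_pair "fhat \<phi>" "fhat \<phi>'" s b by (rule sp)
  note dil = dil_shift_represents(1)[OF M sobolevD(1,2)[OF \<phi>], of j, folded B_def]
  note dil' = dil_shift_represents(1)[OF M sobolevD(1,2)[OF \<phi>'], of j, folded B_def]
  have B: "det B \<noteq> 0" unfolding B_def by (rule dil_shift_represents(2)[OF M sobolevD(1,2)[OF \<phi>]])
  define Bi where "Bi = matrix_inv B"
  have Bi: "det Bi \<noteq> 0" using B by (simp add: Bi_def det_matrix_inv)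
  have cancel: "Bi *v (B *v x) = x" for x unfolding Bi_def by (rule matrix_inv_cancel[OF B])
  have [measurable]: "g \<in> borel_measurable borel" "fhat f \<in> borel_measurable borel"
    using g fhat_measurable[OF g] by (auto simp: represents_def)
  define F where "F u = g (B *v u)" for u
  have [measurable]: "F \<in> borel_measurable borel" unfolding F_def by measurable
  have iF: "integrable lborel (\<lambda>u. (cmod (F u))\<^sup>2 * weight s u)"
    unfolding F_def by (rule weighted_integral_matrix(1)[OF B s _ ig]) simp
  define a where "a = \<bar>det B\<bar>"
  have a: "a > 0" using B by (simp add: a_def)
  define c where "c k = fcoeff (per F) k" for k
  \<comment> \<open>The Jacobian \<open>a\<close> against the normalisation
    \<open>1 / sqrt a\<close> leaves \<open>sqrt a\<close>, which cancels the normalisation of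
    \<open>dil_shift M j k \<phi>\<close> in the partial sums \<open>P\<close>.\<close>
  have pairing: "pairing f (dil_shift M j k \<phi>') = of_real (sqrt a) * c k" for k
  proof -
    have [measurable]: "fhat (dil_shift M j k \<phi>') \<in> borel_measurable borel" by (rule fhat_measurable[OF dil'])
    have "pairing f (dil_shift M j k \<phi>') = (LINT \<xi>|lborel. g \<xi> * cnj (of_real (1 / sqrt a) * (tchar k (Bi *v \<xi>) * fhat \<phi>' (Bi *v \<xi>))))"
      unfolding pairing_def
    proof (rule integral_cong_AE)
      show "AE \<xi> in lborel. fhat f \<xi> * cnj (fhat (dil_shift M j k \<phi>') \<xi>) = g \<xi> * cnj (of_real (1 / sqrt a) * (tchar k (Bi *v \<xi>) * fhat \<phi>' (Bi *v \<xi>)))"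
        using fhat_AE_eq[OF dil', of k] fhat_AE_eq[OF g] unfolding Bi_def a_def by eventually_elim simp
    qed measurable
    also have "\<dots> = a *\<^sub>R (LINT u|lborel. F u * cnj (of_real (1 / sqrt a) * (tchar k u * fhat \<phi>' u)))"
      unfolding a_def F_def by (subst integral_matrix[OF B]) (simp_all add: cancel)
    also have "(\<lambda>u. F u * cnj (of_real (1 / sqrt a) * (tchar k u * fhat \<phi>' u))) = (\<lambda>u. of_real (1 / sqrt a) * (F u * cnj (fhat \<phi>' u) * cnj (tchar k u)))"
      by (simp add: fun_eq_iff)
    also have "a *\<^sub>R (LINT u|lborel. of_real (1 / sqrt a) * (F u * cnj (fhat \<phi>' u) * cnj (tchar k u))) = of_real (a * (1 / sqrt a)) * c k"
      unfolding integral_mult_right_zero c_def fcoeff_per[OF \<open>F \<in> borel_measurable borel\<close> iF] by (simp add: scaleR_conv_of_real)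
    also have "a * (1 / sqrt a) = sqrt a" using a by (simp add: real_div_sqrt)
    finally show ?thesis .
  qed
  define S where "S A u = (\<Sum>k\<in>A. c k * tchar k u)" for A u
  have [measurable]: "S A \<in> borel_measurable borel" for A unfolding S_def by measurable
  define P where "P A \<psi> = (\<Sum>k\<in>A. pairing f (dil_shift M j k \<phi>') * dil_shift M j k \<phi> \<psi>)" for A \<psi>
  have P: "represents (\<lambda>\<xi>. S A (Bi *v \<xi>) * fhat \<phi> (Bi *v \<xi>)) (fourier_distr (P A))" for A
  proof -
    have "represents (\<lambda>\<xi>. \<Sum>k\<in>A. pairing f (dil_shift M j k \<phi>') * (of_real (1 / sqrt a) * (tchar k (Bi *v \<xi>) * fhat \<phi> (Bi *v \<xi>)))) (fourier_distr (P A))"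
      unfolding P_def a_def Bi_def by (intro represents_sum represents_cmult dil)
    moreover have "of_real (sqrt a) * c k * (of_real (1 / sqrt a) * (t * z)) = c k * t * z" for k t z
      using a by simp
    ultimately show ?thesis unfolding pairing S_def sum_distrib_right by simp
  qed
  define G where "G \<xi> = per F (Bi *v \<xi>) * fhat \<phi> (Bi *v \<xi>)" for \<xi>
  have [measurable]: "G \<in> borel_measurable borel" unfolding G_def by measurable
  have "integrable lborel (\<lambda>u. (cmod (per F u * fhat \<phi> u))\<^sup>2 * weight s u)"
    by (rule periodic_times_symbol(1)[OF _ per_periodic per_square_integrable[OF _ iF]]) measurable
  from weighted_integral_matrix(1)[OF Bi s _ this]
  have iG: "integrable lborel (\<lambda>\<xi>. (cmod (G \<xi>))\<^sup>2 * weight s \<xi>)" unfolding G_def by simp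
  note g0 = sobolev_exists[OF \<open>G \<in> borel_measurable borel\<close> iG]
  define E where "E A \<xi> = S A (Bi *v \<xi>) * fhat \<phi> (Bi *v \<xi>)" for A \<xi>
  have [measurable]: "E A \<in> borel_measurable borel" for A unfolding E_def by measurable
  have "((\<lambda>A. LINT u|lborel. (cmod ((per F u - S A u) * fhat \<phi> u))\<^sup>2 * weight s u) \<longlongrightarrow> 0) (finite_subsets_at_top UNIV)"
    unfolding S_def c_def by (rule symbol_series_tendsto(2)[OF _ iF]) simp
  from tendsto_mult_left[OF this, of "(1 + (op_norm (matrix_inv Bi))\<^sup>2) powr s / \<bar>det Bi\<bar>"]
  have lim0: "((\<lambda>A. (1 + (op_norm (matrix_inv Bi))\<^sup>2) powr s / \<bar>det Bi\<bar> * (LINT u|lborel. (cmod ((per F u - S A u) * fhat \<phi> u))\<^sup>2 * weight s u)) \<longlongrightarrow> 0) (finite_subsets_at_top UNIV)" by (simp only: mult_zero_right)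
  have GE: "G \<xi> - E A \<xi> = (per F (Bi *v \<xi>) - S A (Bi *v \<xi>)) * fhat \<phi> (Bi *v \<xi>)" for A \<xi>
    by (simp add: G_def E_def left_diff_distrib)
  have iE: "integrable lborel (\<lambda>u. (cmod ((per F u - S A u) * fhat \<phi> u))\<^sup>2 * weight s u)" for A
    unfolding S_def c_def by (rule symbol_series_tendsto(1)[OF _ iF]) simp
  have iGE: "integrable lborel (\<lambda>\<xi>. (cmod (G \<xi> - E A \<xi>))\<^sup>2 * weight s \<xi>)" for A
    unfolding GE by (rule weighted_integral_matrix(1)[OF Bi s _ iE]) simp
  have lim: "((\<lambda>A. LINT \<xi>|lborel. (cmod (G \<xi> - E A \<xi>))\<^sup>2 * weight s \<xi>) \<longlongrightarrow> 0) (finite_subsets_at_top UNIV)"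
  proof (rule Lim_null_comparison[OF always_eventually lim0], rule allI)
    fix A
    have "0 \<le> (LINT \<xi>|lborel. (cmod (G \<xi> - E A \<xi>))\<^sup>2 * weight s \<xi>)" by simp
    moreover have "(LINT \<xi>|lborel. (cmod (G \<xi> - E A \<xi>))\<^sup>2 * weight s \<xi>) \<le> (1 + (op_norm (matrix_inv Bi))\<^sup>2) powr s / \<bar>det Bi\<bar> * (LINT u|lborel. (cmod ((per F u - S A u) * fhat \<phi> u))\<^sup>2 * weight s u)"
      unfolding GE by (rule weighted_integral_matrix(2)[OF Bi s _ iE]) simp
    ultimately show "norm (LINT \<xi>|lborel. (cmod (G \<xi> - E A \<xi>))\<^sup>2 * weight s \<xi>) \<le> (1 + (op_norm (matrix_inv Bi))\<^sup>2) powr s / \<bar>det Bi\<bar> * (LINT u|lborel. (cmod ((per F u - S A u) * fhat \<phi> u))\<^sup>2 * weight s u)"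
      by simp
  qed
  have norm_eq: "sobolev_norm s (\<lambda>\<psi>. g \<psi> - P A \<psi>) = sqrt (LINT \<xi>|lborel. (cmod (h \<xi> - E A \<xi>))\<^sup>2 * weight s \<xi>)"
    if "represents h (fourier_distr g)" for g h A
    unfolding E_def by (rule sobolev_norm_represents[OF represents_diff[OF that P]])
  have "quasi_proj s M \<phi> \<phi>' j f = inv_fourier_distr G"
    unfolding quasi_proj_def P_def[symmetric]
  proof (rule the_equality, intro conjI g0(1))
    have "((\<lambda>A. sqrt (LINT \<xi>|lborel. (cmod (G \<xi> - E A \<xi>))\<^sup>2 * weight s \<xi>)) \<longlongrightarrow> 0) (finite_subsets_at_top UNIV)"
      using tendsto_real_sqrt[OF lim] by simp
    then show "((\<lambda>A. sobolev_norm s (\<lambda>\<psi>. inv_fourier_distr G \<psi> - P A \<psi>)) \<longlongrightarrow> 0) (finite_subsets_at_top UNIV)"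
      unfolding norm_eq[OF g0(2)] .
  next
    fix g' assume "g' \<in> sobolev s \<and> ((\<lambda>A. sobolev_norm s (\<lambda>\<psi>. g' \<psi> - P A \<psi>)) \<longlongrightarrow> 0) (finite_subsets_at_top UNIV)"
    then have g': "g' \<in> sobolev s" and lg: "((\<lambda>A. sobolev_norm s (\<lambda>\<psi>. g' \<psi> - P A \<psi>)) \<longlongrightarrow> 0) (finite_subsets_at_top UNIV)" by auto
    have [measurable]: "fhat g' \<in> borel_measurable borel" by (rule sobolevD(3)[OF g'])
    have "((\<lambda>A. (sobolev_norm s (\<lambda>\<psi>. g' \<psi> - P A \<psi>))\<^sup>2) \<longlongrightarrow> 0) (finite_subsets_at_top UNIV)"
      using tendsto_power[OF lg, of 2] by simp
    then have lg2: "((\<lambda>A. LINT \<xi>|lborel. (cmod (fhat g' \<xi> - E A \<xi>))\<^sup>2 * weight s \<xi>) \<longlongrightarrow> 0) (finite_subsets_at_top UNIV)"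
      unfolding norm_eq[OF sobolevD(2)[OF g']] by simp
    \<comment> \<open>Any competitor \<open>g'\<close> is within a vanishing distance of the same
      partial sums as \<open>G\<close>, so the squared distance \<open>I\<close> between the two
      transforms is 0, and they agree almost everywhere.\<close>
    define I where "I = (LINT \<xi>|lborel. (cmod (fhat g' \<xi> - G \<xi>))\<^sup>2 * weight s \<xi>)"
    have i0: "integrable lborel (\<lambda>\<xi>. (cmod (fhat g' \<xi> - 0))\<^sup>2 * weight s \<xi>)"
      "integrable lborel (\<lambda>\<xi>. (cmod (G \<xi> - 0))\<^sup>2 * weight s \<xi>)"
      using sobolevD(4)[OF g'] iG by simp_all
    have i1: "integrable lborel (\<lambda>\<xi>. (cmod (fhat g' \<xi> - G \<xi>))\<^sup>2 * weight s \<xi>)"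
      by (rule weighted_square_triangle(1)[OF _ _ _ i0]) simp_all
    have i1': "integrable lborel (\<lambda>\<xi>. (cmod (E A \<xi> - G \<xi>))\<^sup>2 * weight s \<xi>)" for A
      using iGE[of A] by (simp add: norm_minus_commute)
    have i2: "integrable lborel (\<lambda>\<xi>. (cmod (fhat g' \<xi> - E A \<xi>))\<^sup>2 * weight s \<xi>)" for A
      by (rule weighted_square_triangle(1)[OF _ _ _ i1 i1']) simp_all
    have "I \<le> 2 * (LINT \<xi>|lborel. (cmod (fhat g' \<xi> - E A \<xi>))\<^sup>2 * weight s \<xi>) + 2 * (LINT \<xi>|lborel. (cmod (G \<xi> - E A \<xi>))\<^sup>2 * weight s \<xi>)" for A
      unfolding I_def by (rule weighted_square_triangle(2)[OF _ _ _ i2 iGE]) simp_all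
    then have ev: "\<forall>\<^sub>F A in finite_subsets_at_top UNIV. I \<le> 2 * (LINT \<xi>|lborel. (cmod (fhat g' \<xi> - E A \<xi>))\<^sup>2 * weight s \<xi>) + 2 * (LINT \<xi>|lborel. (cmod (G \<xi> - E A \<xi>))\<^sup>2 * weight s \<xi>)"
      by (intro always_eventually allI)
    have "I \<le> 2 * 0 + 2 * 0"
      by (rule tendsto_lowerbound[OF _ ev]) (intro tendsto_add tendsto_mult_left lg2 lim, simp)
    moreover have "I \<ge> 0" unfolding I_def by simp
    ultimately have "I = 0" by simp
    then have "AE \<xi> in lborel. (cmod (fhat g' \<xi> - G \<xi>))\<^sup>2 * weight s \<xi> = 0"
      unfolding I_def by (subst (asm) integral_nonneg_eq_0_iff_AE[OF i1]) simp_all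
    then have ae: "AE \<xi> in lborel. fhat g' \<xi> = G \<xi>"
    proof eventually_elim
      case (elim \<xi>)
      have "1 + (norm \<xi>)\<^sup>2 \<noteq> 0" using zero_le_power2[of "norm \<xi>"] by linarith
      then show ?case using elim by simp
    qed
    show "g' = inv_fourier_distr G"
      by (rule fourier_distr_inj[OF _ _ sobolevD(2)[OF g'] g0(2) ae])
        (auto intro: temperedD(1)[OF sobolevD(1)[OF g']] temperedD(1)[OF sobolevD(1)[OF g0(1)]])
  qed
  then show ?thesis using g0(2) unfolding G_def F_def[abs_def] Bi_def by simp
qed

section \<open>From the symbol conditions to the error bound\<close>

lemma sum_le_nn_integral_count_space:
  fixes f :: "'a \<Rightarrow> ennreal"
  assumes "finite E" "E \<subseteq> A" shows "sum f E \<le> (\<integral>\<^sup>+k. f k \<partial>count_space A)"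
proof -
  have "sum f E = (\<integral>\<^sup>+k. f k * indicator E k \<partial>count_space A)"
    by (subst nn_integral_count_space'[OF assms(1) _ assms(2)]) simp_all
  also have "\<dots> \<le> (\<integral>\<^sup>+k. f k \<partial>count_space A)" by (intro nn_integral_mono) (auto simp: indicator_def)
  finally show ?thesis .
qed

text \<open>The set is exhausted by its finite pieces with \<open>to_nat k \<le> n\<close>, and the
  integral is the supremum over these by monotone convergence.\<close>

lemma nn_integral_count_space_le:
  fixes f :: "'a::countable \<Rightarrow> ennreal"
  assumes "\<And>E. finite E \<Longrightarrow> E \<subseteq> A \<Longrightarrow> sum f E \<le> c" shows "(\<integral>\<^sup>+k. f k \<partial>count_space A) \<le> c"
proof -
  define g where "g n k = (if to_nat k \<le> n then f k else 0)" for n and k :: 'a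
  have "f k = (SUP n. g n k)" for k
  proof (rule antisym)
    show "f k \<le> (SUP n. g n k)" by (intro SUP_upper2[of "to_nat k"]) (auto simp: g_def)
    show "(SUP n. g n k) \<le> f k" by (intro SUP_least) (auto simp: g_def)
  qed
  then have "(\<integral>\<^sup>+k. f k \<partial>count_space A) = (\<integral>\<^sup>+k. (SUP n. g n k) \<partial>count_space A)" by simp
  also have "\<dots> = (SUP n. \<integral>\<^sup>+k. g n k \<partial>count_space A)"
    by (rule nn_integral_monotone_convergence_SUP) (auto simp: g_def incseq_def le_fun_def)
  also have "\<dots> \<le> c"
  proof (rule SUP_least)
    fix n
    define E where "E = {k\<in>A. to_nat k \<le> n}"
    have E: "finite E"
      by (rule finite_subset[OF _ finite_vimageI[of "{..n}" to_nat]]) (auto simp: E_def)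
    have "(\<integral>\<^sup>+k. g n k \<partial>count_space A) = (\<Sum>k\<in>E. g n k)"
      by (rule nn_integral_count_space'[OF E]) (auto simp: E_def g_def)
    also have "\<dots> = sum f E" by (rule sum.cong) (auto simp: E_def g_def)
    also have "\<dots> \<le> c" using E by (rule assms) (auto simp: E_def)
    finally show "(\<integral>\<^sup>+k. g n k \<partial>count_space A) \<le> c" .
  qed
  finally show ?thesis .
qed

text \<open>Links the infinite sum in the theorem to counting measure, for which Tonelli's theorem
  and monotone convergence are at hand.\<close>

lemma infsum_eq_nn_integral_count_space:
  fixes f :: "'a::countable \<Rightarrow> ennreal"
  shows "(\<Sum>\<^sub>\<infinity>k\<in>A. f k) = (\<integral>\<^sup>+k. f k \<partial>count_space A)"
proof (rule antisym)
  have eq: "(\<Sum>\<^sub>\<infinity>k\<in>A. f k) = (SUP E\<in>{E. finite E \<and> E \<subseteq> A}. sum f E)" by (rule nonneg_infsum_complete) simp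
  show "(\<Sum>\<^sub>\<infinity>k\<in>A. f k) \<le> (\<integral>\<^sup>+k. f k \<partial>count_space A)"
    unfolding eq by (rule SUP_least) (simp add: sum_le_nn_integral_count_space)
  show "(\<integral>\<^sup>+k. f k \<partial>count_space A) \<le> (\<Sum>\<^sub>\<infinity>k\<in>A. f k)"
    unfolding eq by (rule nn_integral_count_space_le) (simp add: SUP_upper)
qed

lemma integral_count_space_singleton:
  fixes c :: complex
  shows "integrable (count_space UNIV) (\<lambda>l. indicator {a} l *\<^sub>R c)"
    and "(LINT l|count_space UNIV. indicator {a} l *\<^sub>R c) = c"
proof -
  have "has_bochner_integral (count_space UNIV) (\<lambda>l. indicator {a} l *\<^sub>R c) (measure (count_space UNIV) {a} *\<^sub>R c)"
    by (rule has_bochner_integral_indicator) simp_all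
  then show "integrable (count_space UNIV) (\<lambda>l. indicator {a} l *\<^sub>R c)"
    "(LINT l|count_space UNIV. indicator {a} l *\<^sub>R c) = c"
    by (auto simp: has_bochner_integral_iff measure_def)
qed

lemma lattice_far_from_cube:
  fixes \<zeta> :: "real^'d"
  assumes "\<zeta> \<in> unit_cube" "l \<noteq> 0" shows "norm (\<zeta> + real_vec l) \<ge> 1/2"
proof -
  obtain i where i: "l $ i \<noteq> 0" using assms(2) by (auto simp: vec_eq_iff)
  have "- 1/2 \<le> \<zeta> $ i" "\<zeta> $ i < 1/2" using assms(1) by (auto simp: unit_cube_def)
  moreover have "real_of_int (l $ i) \<ge> 1 \<or> real_of_int (l $ i) \<le> - 1" using i by linarith
  ultimately have "\<bar>(\<zeta> + real_vec l) $ i\<bar> \<ge> 1/2" by (auto simp: real_vec_def)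
  then show ?thesis using component_le_norm_cart[of "\<zeta> + real_vec l" i] by linarith
qed

text \<open>Outside the ball of radius 1/2 one has \<open>1 \<le> 4 * (norm x)^2\<close>, whence the
  5, and \<open>1 / norm x \<le> 2\<close>, raised to the nonnegative power
  \<open>2 * n - 2 * s\<close>. Away from 0 the homogeneous weight of order \<open>n\<close> thus
  dominates the inhomogeneous one of order \<open>s\<close>.\<close>

lemma weight_le_far:
  assumes "0 \<le> s" "s \<le> n" "norm x \<ge> 1/2"
  shows "weight s x \<le> 5 powr s * 2 powr (2 * n - 2 * s) * norm x powr (2 * n)"
proof -
  have x: "norm x > 0" using assms(3) by linarith
  have x2: "(norm x)\<^sup>2 = norm x powr 2" using x by simp
  have "(1/2)\<^sup>2 \<le> (norm x)\<^sup>2" by (rule power_mono[OF assms(3)]) simp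
  then have "1 + (norm x)\<^sup>2 \<le> 5 * (norm x)\<^sup>2" by (simp add: power2_eq_square)
  then have "weight s x \<le> (5 * (norm x)\<^sup>2) powr s" using assms(1) by (intro powr_mono2) auto
  also have "\<dots> = 5 powr s * norm x powr (2 * s)" unfolding powr_mult x2 powr_powr ..
  also have "\<dots> = 5 powr s * ((1 / norm x) powr (2 * n - 2 * s) * norm x powr (2 * n))"
    using x by (simp add: powr_divide powr_diff)
  also have "\<dots> \<le> 5 powr s * (2 powr (2 * n - 2 * s) * norm x powr (2 * n))"
    using assms x by (intro mult_left_mono mult_right_mono powr_mono2) (auto simp: field_simps)
  finally show ?thesis by (simp only: mult.assoc)
qed

lemma norm_powr_le_weight:
  assumes "t \<ge> 0" shows "norm x powr (2 * t) \<le> weight t x"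
proof -
  have "norm x powr (2 * t) = ((norm x)\<^sup>2) powr t"
    by (cases "norm x = 0") (simp_all add: powr_powr[symmetric])
  also have "\<dots> \<le> weight t x" using assms by (intro powr_mono2) auto
  finally show ?thesis .
qed

lemma cmod_power2_diff_le: "(cmod (a - b))\<^sup>2 \<le> 2 * (cmod a)\<^sup>2 + 2 * (cmod b)\<^sup>2"
  using cmod_power2_add_le[of a "- b"] by simp

context symbol_pair
begin

lemma p_term: "(cmod (p u))\<^sup>2 * weight s u \<le> b"
  and q_term: "(cmod (q u))\<^sup>2 * weight (- s) u \<le> b"
proof -
  have "ennreal ((cmod (p u))\<^sup>2 * weight s u) \<le> ennreal b"
    using order_trans[OF sum_le_nn_integral_count_space[of "{0}" UNIV] p_bound[of u]] by simp
  then show "(cmod (p u))\<^sup>2 * weight s u \<le> b" using b_nonneg by simp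
  have "ennreal ((cmod (q u))\<^sup>2 * weight (- s) u) \<le> ennreal b"
    using order_trans[OF sum_le_nn_integral_count_space[of "{0}" UNIV] q_bound[of u]] by simp
  then show "(cmod (q u))\<^sup>2 * weight (- s) u \<le> b" using b_nonneg by simp
qed

text \<open>Only \<open>l = 0\<close> gives back the point \<open>u\<close> itself, so setting
  \<open>F\<close> to 0 at \<open>u\<close> deletes exactly this term of the absolutely convergent
  sum.\<close>

lemma per_remove_origin:
  assumes "integrable (count_space UNIV) (\<lambda>l. F (u + real_vec l) * cnj (q (u + real_vec l)))"
  shows "per F u = F u * cnj (q u) + per (\<lambda>x. if x = u then 0 else F x) u"
proof -
  let ?c = "F u * cnj (q u)"
  note h = integral_count_space_singleton[of "0 :: int^'d" ?c]
  have "real_vec l = 0 \<longleftrightarrow> l = 0" for l :: "int^'d" using real_vec_inj[of l 0] by simp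
  then have eq: "(if u + real_vec l = u then 0 else F (u + real_vec l)) * cnj (q (u + real_vec l)) =
      F (u + real_vec l) * cnj (q (u + real_vec l)) - indicator {0} l *\<^sub>R ?c" for l
    by (simp add: indicator_def)
  show ?thesis unfolding per_def eq Bochner_Integration.integral_diff[OF assms h(1)] h(2) by simp
qed

text \<open>The error at \<open>\<zeta> + k\<close> is \<open>A k - P * p\<close>, where
  \<open>A\<close> uses the origin term of \<open>per F\<close> and \<open>P\<close> is the rest.
  For \<open>k = 0\<close> the first condition bounds \<open>A\<close>; for other \<open>k\<close>
  the second condition and \<open>weight_le_far\<close> do. \<open>P\<close> involves only points
  far from 0. Here \<open>W\<close> bounds the weight on the cube and \<open>c0\<close> is the
  constant of \<open>weight_le_far\<close>.\<close>

lemma lattice_error_bound: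
  assumes \<zeta>: "\<zeta> \<in> unit_cube" and s: "0 \<le> s" "s \<le> n" and C: "C\<^sub>1 \<ge> 0" "C\<^sub>2 \<ge> 0"
    and c1: "cmod (1 - cnj (q \<zeta>) * p \<zeta>) \<le> C\<^sub>1 * norm \<zeta> powr n"
    and c2: "(\<integral>\<^sup>+k. ennreal ((cmod (p (\<zeta> + real_vec k)))\<^sup>2 * weight s (\<zeta> + real_vec k)) \<partial>count_space (UNIV - {0})) \<le> ennreal (C\<^sub>2 * norm \<zeta> powr (2 * n))"
    and int: "integrable (count_space UNIV) (\<lambda>l. F (\<zeta> + real_vec l) * cnj (q (\<zeta> + real_vec l)))"
  defines "W \<equiv> (1 + (real DIM(real^'d))\<^sup>2) powr s" and "c0 \<equiv> 5 powr s * 2 powr (2 * n - 2 * s)"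
  shows "(\<integral>\<^sup>+k. ennreal ((cmod (F (\<zeta> + real_vec k) - per F \<zeta> * p (\<zeta> + real_vec k)))\<^sup>2 * weight s (\<zeta> + real_vec k)) \<partial>count_space UNIV)
    \<le> ennreal (2 * (W * C\<^sub>1\<^sup>2 + 2 * c0 + 2 * b * W * C\<^sub>2) + 2 * b * (b * c0)) *
      (\<integral>\<^sup>+k. ennreal (norm (\<zeta> + real_vec k) powr (2 * n) * (cmod (F (\<zeta> + real_vec k)))\<^sup>2) \<partial>count_space UNIV)"
proof -
  define w where "w k = weight s (\<zeta> + real_vec k)" for k
  define v where "v k = norm (\<zeta> + real_vec k) powr (2 * n) * (cmod (F (\<zeta> + real_vec k)))\<^sup>2" for k
  define N where "N = (\<integral>\<^sup>+k. ennreal (v k) \<partial>count_space UNIV)"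
  define P where "P = per (\<lambda>x. if x = \<zeta> then 0 else F x) \<zeta>"
  define A where "A k = F (\<zeta> + real_vec k) - F \<zeta> * cnj (q \<zeta>) * p (\<zeta> + real_vec k)" for k
  \<comment> \<open>The value 0 at \<open>k = 0\<close> encodes the restriction of the second
    condition to nonzero lattice points, so that all sums run over the same index set.\<close>
  define g where "g k = (if k = 0 then 0 else (cmod (p (\<zeta> + real_vec k)))\<^sup>2 * w k)" for k
  have nn: "v k \<ge> 0" "g k \<ge> 0" "w k \<ge> 0" for k by (simp_all add: v_def g_def w_def)
  have c0: "c0 \<ge> 0" and W0: "W \<ge> 0" by (simp_all add: c0_def W_def)
  have far: "w k \<le> c0 * norm (\<zeta> + real_vec k) powr (2 * n)" if "k \<noteq> 0" for k
    unfolding w_def c0_def by (rule weight_le_far[OF s lattice_far_from_cube[OF \<zeta> that]])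
  have farF: "(cmod (F (\<zeta> + real_vec k)))\<^sup>2 * w k \<le> c0 * v k" if "k \<noteq> 0" for k
    using mult_left_mono[OF far[OF that], of "(cmod (F (\<zeta> + real_vec k)))\<^sup>2"] by (simp add: v_def mult_ac)
  have v0: "ennreal (v 0) \<le> N"
    unfolding N_def using sum_le_nn_integral_count_space[of "{0}" UNIV "\<lambda>k. ennreal (v k)"] by simp
  have wW: "weight s \<zeta> \<le> W"
    unfolding W_def using s cube_norm_le[OF \<zeta>] by (intro powr_mono2 add_left_mono power_mono) auto
  have q: "(cmod (q \<zeta>))\<^sup>2 \<le> b * W"
  proof -
    have "1 + (norm \<zeta>)\<^sup>2 \<noteq> 0" using zero_le_power2[of "norm \<zeta>"] by linarith
    then have "(cmod (q \<zeta>))\<^sup>2 = (cmod (q \<zeta>))\<^sup>2 * weight (- s) \<zeta> * weight s \<zeta>"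
      by (simp add: mult.assoc powr_add[symmetric])
    also have "\<dots> \<le> b * W" using q_term wW b_nonneg by (intro mult_mono) auto
    finally show ?thesis .
  qed
  \<comment> \<open>\<open>per_bound\<close> for the function with the origin removed; each
    remaining term is far from 0 and costs the factor \<open>c0\<close>.\<close>
  have P2: "ennreal ((cmod P)\<^sup>2) \<le> ennreal (b * c0) * N"
  proof -
    have "ennreal ((cmod P)\<^sup>2) \<le> ennreal b * (\<integral>\<^sup>+l. ennreal ((cmod (if \<zeta> + real_vec l = \<zeta> then 0 else F (\<zeta> + real_vec l)))\<^sup>2 * weight s (\<zeta> + real_vec l)) \<partial>count_space UNIV)"
      unfolding P_def by (rule per_bound)
    also have "\<dots> \<le> ennreal b * (\<integral>\<^sup>+l. ennreal c0 * ennreal (v l) \<partial>count_space UNIV)"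
    proof (intro mult_left_mono nn_integral_mono)
      fix l :: "int^'d"
      have "(cmod (if \<zeta> + real_vec l = \<zeta> then 0 else F (\<zeta> + real_vec l)))\<^sup>2 * w l \<le> c0 * v l"
        using farF[of l] nn c0 by (cases "l = 0") auto
      then show "ennreal ((cmod (if \<zeta> + real_vec l = \<zeta> then 0 else F (\<zeta> + real_vec l)))\<^sup>2 * weight s (\<zeta> + real_vec l)) \<le> ennreal c0 * ennreal (v l)"
        unfolding w_def ennreal_mult[OF c0 nn(1), symmetric] by (rule ennreal_leI)
    qed simp
    also have "\<dots> = ennreal (b * c0) * N"
      unfolding N_def using b_nonneg c0 by (simp add: nn_integral_cmult ennreal_mult mult.assoc)
    finally show ?thesis .
  qed
  \<comment> \<open>The last term carries the value of \<open>F\<close> at \<open>\<zeta>\<close>.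
    After summation the second condition attaches the factor
    \<open>norm \<zeta> powr (2 * n)\<close> to it, which turns it into \<open>v 0\<close>.\<close>
  have A: "(cmod (A k))\<^sup>2 * w k \<le> (W * C\<^sub>1\<^sup>2 + 2 * c0) * v k + 2 * b * W * (cmod (F \<zeta>))\<^sup>2 * g k" for k
  proof (cases "k = 0")
    case True
    have "A k = F \<zeta> * (1 - cnj (q \<zeta>) * p \<zeta>)" unfolding A_def True by (simp add: algebra_simps)
    then have "(cmod (A k))\<^sup>2 * w k = (cmod (1 - cnj (q \<zeta>) * p \<zeta>))\<^sup>2 * weight s \<zeta> * (cmod (F \<zeta>))\<^sup>2"
      unfolding w_def True by (simp add: norm_mult power_mult_distrib mult_ac)
    also have "\<dots> \<le> (C\<^sub>1 * norm \<zeta> powr n)\<^sup>2 * W * (cmod (F \<zeta>))\<^sup>2"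
      using wW by (intro mult_right_mono mult_mono power_mono c1) auto
    also have "\<dots> = W * C\<^sub>1\<^sup>2 * v k"
      unfolding v_def True power_mult_distrib by (simp add: power2_eq_square powr_add[symmetric] mult_ac)
    also have "\<dots> \<le> (W * C\<^sub>1\<^sup>2 + 2 * c0) * v k" using c0 nn by (intro mult_right_mono) auto
    finally show ?thesis using True by (simp add: g_def)
  next
    case False
    have "(cmod (A k))\<^sup>2 \<le> 2 * (cmod (F (\<zeta> + real_vec k)))\<^sup>2 + 2 * (cmod (F \<zeta> * cnj (q \<zeta>) * p (\<zeta> + real_vec k)))\<^sup>2"
      unfolding A_def by (rule cmod_power2_diff_le)
    then have "(cmod (A k))\<^sup>2 * w k \<le> (2 * (cmod (F (\<zeta> + real_vec k)))\<^sup>2 + 2 * (cmod (F \<zeta> * cnj (q \<zeta>) * p (\<zeta> + real_vec k)))\<^sup>2) * w k"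
      using nn by (intro mult_right_mono) auto
    also have "\<dots> = 2 * ((cmod (F (\<zeta> + real_vec k)))\<^sup>2 * w k) + 2 * ((cmod (q \<zeta>))\<^sup>2 * ((cmod (F \<zeta>))\<^sup>2 * g k))"
      using False by (simp add: g_def norm_mult power_mult_distrib algebra_simps)
    also have "\<dots> \<le> 2 * (c0 * v k) + 2 * ((b * W) * ((cmod (F \<zeta>))\<^sup>2 * g k))"
      using farF[OF False] q nn by (intro add_mono mult_left_mono mult_right_mono) auto
    also have "\<dots> \<le> (W * C\<^sub>1\<^sup>2 + 2 * c0) * v k + 2 * b * W * (cmod (F \<zeta>))\<^sup>2 * g k"
      using W0 nn[of k] by (simp add: distrib_right mult.assoc)
    finally show ?thesis .
  qed
  have g: "(\<integral>\<^sup>+k. ennreal (g k) \<partial>count_space UNIV) \<le> ennreal (C\<^sub>2 * norm \<zeta> powr (2 * n))"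
  proof -
    have "(\<integral>\<^sup>+k. ennreal (g k) \<partial>count_space UNIV) = (\<integral>\<^sup>+k. ennreal ((cmod (p (\<zeta> + real_vec k)))\<^sup>2 * weight s (\<zeta> + real_vec k)) \<partial>count_space (UNIV - {0}))"
      by (subst (2) nn_integral_count_space_indicator) (auto intro!: nn_integral_cong simp: g_def w_def indicator_def)
    then show ?thesis using c2 by simp
  qed
  have A2: "(\<integral>\<^sup>+k. ennreal ((cmod (A k))\<^sup>2 * w k) \<partial>count_space UNIV) \<le> ennreal (W * C\<^sub>1\<^sup>2 + 2 * c0 + 2 * b * W * C\<^sub>2) * N"
  proof -
    have "(\<integral>\<^sup>+k. ennreal ((cmod (A k))\<^sup>2 * w k) \<partial>count_space UNIV) \<le>
        (\<integral>\<^sup>+k. ennreal (W * C\<^sub>1\<^sup>2 + 2 * c0) * ennreal (v k) + ennreal (2 * b * W * (cmod (F \<zeta>))\<^sup>2) * ennreal (g k) \<partial>count_space UNIV)"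
    proof (rule nn_integral_mono)
      fix k
      have "ennreal (W * C\<^sub>1\<^sup>2 + 2 * c0) * ennreal (v k) + ennreal (2 * b * W * (cmod (F \<zeta>))\<^sup>2) * ennreal (g k) =
          ennreal ((W * C\<^sub>1\<^sup>2 + 2 * c0) * v k + 2 * b * W * (cmod (F \<zeta>))\<^sup>2 * g k)"
        using nn[of k] c0 W0 b_nonneg by (simp add: ennreal_mult[symmetric] del: ennreal_plus add: ennreal_plus[symmetric])
      then show "ennreal ((cmod (A k))\<^sup>2 * w k) \<le> ennreal (W * C\<^sub>1\<^sup>2 + 2 * c0) * ennreal (v k) + ennreal (2 * b * W * (cmod (F \<zeta>))\<^sup>2) * ennreal (g k)"
        using ennreal_leI[OF A] by simp
    qed
    also have "\<dots> = ennreal (W * C\<^sub>1\<^sup>2 + 2 * c0) * N + ennreal (2 * b * W * (cmod (F \<zeta>))\<^sup>2) * (\<integral>\<^sup>+k. ennreal (g k) \<partial>count_space UNIV)"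
      unfolding N_def by (subst nn_integral_add) (simp_all add: nn_integral_cmult)
    also have "\<dots> \<le> ennreal (W * C\<^sub>1\<^sup>2 + 2 * c0) * N + ennreal (2 * b * W * (cmod (F \<zeta>))\<^sup>2) * ennreal (C\<^sub>2 * norm \<zeta> powr (2 * n))"
      by (intro add_left_mono mult_left_mono g) simp
    also have "ennreal (2 * b * W * (cmod (F \<zeta>))\<^sup>2) * ennreal (C\<^sub>2 * norm \<zeta> powr (2 * n)) = ennreal (2 * b * W * C\<^sub>2) * ennreal (v 0)"
      using C b_nonneg W0 by (simp add: ennreal_mult[symmetric] v_def mult_ac)
    also have "ennreal (W * C\<^sub>1\<^sup>2 + 2 * c0) * N + ennreal (2 * b * W * C\<^sub>2) * ennreal (v 0) \<le> ennreal (W * C\<^sub>1\<^sup>2 + 2 * c0) * N + ennreal (2 * b * W * C\<^sub>2) * N"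
      by (intro add_left_mono mult_left_mono v0) simp
    also have "\<dots> = ennreal (W * C\<^sub>1\<^sup>2 + 2 * c0 + 2 * b * W * C\<^sub>2) * N"
      unfolding distrib_right[symmetric] using C b_nonneg W0 c0 by (subst ennreal_plus[symmetric]) simp_all
    finally show ?thesis .
  qed
  have D: "F (\<zeta> + real_vec k) - per F \<zeta> * p (\<zeta> + real_vec k) = A k - P * p (\<zeta> + real_vec k)" for k
    unfolding per_remove_origin[OF int] A_def P_def by (simp add: algebra_simps)
  have "(\<integral>\<^sup>+k. ennreal ((cmod (A k - P * p (\<zeta> + real_vec k)))\<^sup>2 * w k) \<partial>count_space UNIV) \<le>
      (\<integral>\<^sup>+k. ennreal 2 * ennreal ((cmod (A k))\<^sup>2 * w k) + ennreal (2 * (cmod P)\<^sup>2) * ennreal ((cmod (p (\<zeta> + real_vec k)))\<^sup>2 * w k) \<partial>count_space UNIV)"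
  proof (rule nn_integral_mono)
    fix k
    have "(cmod (A k - P * p (\<zeta> + real_vec k)))\<^sup>2 * w k \<le> (2 * (cmod (A k))\<^sup>2 + 2 * (cmod (P * p (\<zeta> + real_vec k)))\<^sup>2) * w k"
      using nn by (intro mult_right_mono cmod_power2_diff_le) auto
    also have "\<dots> = 2 * ((cmod (A k))\<^sup>2 * w k) + 2 * (cmod P)\<^sup>2 * ((cmod (p (\<zeta> + real_vec k)))\<^sup>2 * w k)"
      by (simp add: norm_mult power_mult_distrib algebra_simps)
    finally have "ennreal ((cmod (A k - P * p (\<zeta> + real_vec k)))\<^sup>2 * w k) \<le> ennreal (2 * ((cmod (A k))\<^sup>2 * w k) + 2 * (cmod P)\<^sup>2 * ((cmod (p (\<zeta> + real_vec k)))\<^sup>2 * w k))"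
      by (rule ennreal_leI)
    also have "\<dots> = ennreal 2 * ennreal ((cmod (A k))\<^sup>2 * w k) + ennreal (2 * (cmod P)\<^sup>2) * ennreal ((cmod (p (\<zeta> + real_vec k)))\<^sup>2 * w k)"
      using nn[of k] by (subst ennreal_plus) (simp_all only: ennreal_mult zero_le_mult_iff zero_le_power2 zero_le_numeral simp_thms mult_nonneg_nonneg)
    finally show "ennreal ((cmod (A k - P * p (\<zeta> + real_vec k)))\<^sup>2 * w k) \<le> ennreal 2 * ennreal ((cmod (A k))\<^sup>2 * w k) + ennreal (2 * (cmod P)\<^sup>2) * ennreal ((cmod (p (\<zeta> + real_vec k)))\<^sup>2 * w k)" .
  qed
  also have "\<dots> = ennreal 2 * (\<integral>\<^sup>+k. ennreal ((cmod (A k))\<^sup>2 * w k) \<partial>count_space UNIV) + ennreal (2 * (cmod P)\<^sup>2) * (\<integral>\<^sup>+k. ennreal ((cmod (p (\<zeta> + real_vec k)))\<^sup>2 * w k) \<partial>count_space UNIV)"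
    by (subst nn_integral_add) (simp_all only: nn_integral_cmult measurable_count_space_eq1 UNIV_I Pi_UNIV borel_measurable_count_space space_borel)
  also have "\<dots> \<le> ennreal 2 * (ennreal (W * C\<^sub>1\<^sup>2 + 2 * c0 + 2 * b * W * C\<^sub>2) * N) + ennreal (2 * (cmod P)\<^sup>2) * ennreal b"
    unfolding w_def by (intro add_mono mult_left_mono A2[unfolded w_def] p_bound) simp_all
  also have "ennreal (2 * (cmod P)\<^sup>2) * ennreal b = ennreal (2 * b) * ennreal ((cmod P)\<^sup>2)"
    using b_nonneg by (simp add: ennreal_mult[symmetric] mult_ac)
  also have "ennreal 2 * (ennreal (W * C\<^sub>1\<^sup>2 + 2 * c0 + 2 * b * W * C\<^sub>2) * N) + ennreal (2 * b) * ennreal ((cmod P)\<^sup>2) \<le>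
      ennreal 2 * (ennreal (W * C\<^sub>1\<^sup>2 + 2 * c0 + 2 * b * W * C\<^sub>2) * N) + ennreal (2 * b) * (ennreal (b * c0) * N)"
    by (intro add_left_mono mult_left_mono P2) simp
  also have "\<dots> = ennreal (2 * (W * C\<^sub>1\<^sup>2 + 2 * c0 + 2 * b * W * C\<^sub>2) + 2 * b * (b * c0)) * N"
  proof -
    have "ennreal (2 * X + 2 * b * Y) * N = ennreal 2 * (ennreal X * N) + ennreal (2 * b) * (ennreal Y * N)" if "X \<ge> 0" "Y \<ge> 0" for X Y
    proof -
      have "ennreal (2 * X + 2 * b * Y) = ennreal (2 * X) + ennreal (2 * b * Y)"
        using that b_nonneg by (intro ennreal_plus) auto
      also have "ennreal (2 * X) = ennreal 2 * ennreal X" using that by (intro ennreal_mult) auto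
      also have "ennreal (2 * b * Y) = ennreal (2 * b) * ennreal Y" using that b_nonneg by (intro ennreal_mult) auto
      finally show ?thesis by (simp only: distrib_right mult.assoc)
    qed
    from this[of "W * C\<^sub>1\<^sup>2 + 2 * c0 + 2 * b * W * C\<^sub>2" "b * c0"] show ?thesis using C b_nonneg W0 c0 by simp
  qed
  finally show ?thesis unfolding D N_def v_def w_def .
qed

text \<open>Integration of the coset estimate over the cube. The absolute convergence required there
  holds for almost every coset, and \<open>K\<close> depends on the symbols and constants but not on
  \<open>F\<close>.\<close>

lemma error_bound:
  assumes s: "0 \<le> s" "s \<le> n" and C: "C\<^sub>1 \<ge> 0" "C\<^sub>2 \<ge> 0"
    and c1: "\<And>\<zeta>. \<zeta> \<in> unit_cube \<Longrightarrow> cmod (1 - cnj (q \<zeta>) * p \<zeta>) \<le> C\<^sub>1 * norm \<zeta> powr n"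
    and c2: "\<And>\<zeta>. \<zeta> \<in> unit_cube \<Longrightarrow> (\<integral>\<^sup>+k. ennreal ((cmod (p (\<zeta> + real_vec k)))\<^sup>2 * weight s (\<zeta> + real_vec k)) \<partial>count_space (UNIV - {0})) \<le> ennreal (C\<^sub>2 * norm \<zeta> powr (2 * n))"
  shows "\<exists>K\<ge>0. \<forall>F\<in>borel_measurable borel. integrable lborel (\<lambda>u. (cmod (F u))\<^sup>2 * weight n u) \<longrightarrow>
    integrable lborel (\<lambda>u. (cmod (F u - per F u * p u))\<^sup>2 * weight s u) \<and>
    (LINT u|lborel. (cmod (F u - per F u * p u))\<^sup>2 * weight s u) \<le> K * (LINT u|lborel. norm u powr (2 * n) * (cmod (F u))\<^sup>2)"
proof -
  define W where "W = (1 + (real DIM(real^'d))\<^sup>2) powr s"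
  define c0 where "c0 = (5::real) powr s * 2 powr (2 * n - 2 * s)"
  define K where "K = 2 * (W * C\<^sub>1\<^sup>2 + 2 * c0 + 2 * b * W * C\<^sub>2) + 2 * b * (b * c0)"
  have K: "K \<ge> 0" using C b_nonneg by (simp add: K_def W_def c0_def)
  show ?thesis
  proof (rule exI[of _ K], intro conjI K ballI impI)
    fix F :: "real^'d \<Rightarrow> complex"
    assume [measurable]: "F \<in> borel_measurable borel" and i: "integrable lborel (\<lambda>u. (cmod (F u))\<^sup>2 * weight n u)"
    have iS: "integrable lborel (\<lambda>u. (cmod (F u))\<^sup>2 * weight s u)"
      by (rule Bochner_Integration.integrable_bound[OF i])
        (simp, intro AE_I2, use s in \<open>auto intro!: mult_left_mono powr_mono simp: abs_mult\<close>)
    have in': "integrable lborel (\<lambda>u. norm u powr (2 * n) * (cmod (F u))\<^sup>2)"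
      by (rule Bochner_Integration.integrable_bound[OF i])
        (simp, intro AE_I2, use norm_powr_le_weight[of n] s in \<open>auto intro!: mult_left_mono simp: abs_mult mult.commute\<close>)
    have ae: "AE \<zeta> in cube_measure. integrable (count_space UNIV) (\<lambda>l. F (\<zeta> + real_vec l) * cnj (q (\<zeta> + real_vec l)))"
      by (rule integral_lattice_cube(1)[OF product_integrable[OF _ iS]]) simp
    have "(\<integral>\<^sup>+u. ennreal ((cmod (F u - per F u * p u))\<^sup>2 * weight s u) \<partial>lborel) =
        (\<integral>\<^sup>+\<zeta>. (\<integral>\<^sup>+k. ennreal ((cmod (F (\<zeta> + real_vec k) - per F \<zeta> * p (\<zeta> + real_vec k)))\<^sup>2 * weight s (\<zeta> + real_vec k)) \<partial>count_space UNIV) \<partial>cube_measure)"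
      by (subst nn_integral_lattice_cube) (simp_all add: per_periodic)
    also have "\<dots> \<le> (\<integral>\<^sup>+\<zeta>. (\<integral>\<^sup>+k. ennreal K * ennreal (norm (\<zeta> + real_vec k) powr (2 * n) * (cmod (F (\<zeta> + real_vec k)))\<^sup>2) \<partial>count_space UNIV) \<partial>cube_measure)"
    proof (rule nn_integral_mono_AE, use ae in \<open>rule AE_mp\<close>, intro AE_I2 impI)
      fix \<zeta> :: "real^'d" assume "\<zeta> \<in> space cube_measure"
        and int: "integrable (count_space UNIV) (\<lambda>l. F (\<zeta> + real_vec l) * cnj (q (\<zeta> + real_vec l)))"
      then have \<zeta>: "\<zeta> \<in> unit_cube" by simp
      show "(\<integral>\<^sup>+k. ennreal ((cmod (F (\<zeta> + real_vec k) - per F \<zeta> * p (\<zeta> + real_vec k)))\<^sup>2 * weight s (\<zeta> + real_vec k)) \<partial>count_space UNIV)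
          \<le> (\<integral>\<^sup>+k. ennreal K * ennreal (norm (\<zeta> + real_vec k) powr (2 * n) * (cmod (F (\<zeta> + real_vec k)))\<^sup>2) \<partial>count_space UNIV)"
        using lattice_error_bound[OF \<zeta> s C c1[OF \<zeta>] c2[OF \<zeta>] int]
        unfolding K_def[unfolded W_def c0_def, symmetric] by (simp add: nn_integral_cmult)
    qed
    also have "\<dots> = (\<integral>\<^sup>+u. ennreal K * ennreal (norm u powr (2 * n) * (cmod (F u))\<^sup>2) \<partial>lborel)"
      by (rule nn_integral_lattice_cube[symmetric]) measurable
    also have "\<dots> = ennreal (K * (LINT u|lborel. norm u powr (2 * n) * (cmod (F u))\<^sup>2))"
      using nn_integral_eq_integral[OF in'] K by (simp add: nn_integral_cmult ennreal_mult')
    finally have le: "(\<integral>\<^sup>+u. ennreal ((cmod (F u - per F u * p u))\<^sup>2 * weight s u) \<partial>lborel) \<le> ennreal (K * (LINT u|lborel. norm u powr (2 * n) * (cmod (F u))\<^sup>2))" .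
    have nn: "K * (LINT u|lborel. norm u powr (2 * n) * (cmod (F u))\<^sup>2) \<ge> 0" using K by simp
    show "integrable lborel (\<lambda>u. (cmod (F u - per F u * p u))\<^sup>2 * weight s u)"
      "(LINT u|lborel. (cmod (F u - per F u * p u))\<^sup>2 * weight s u) \<le> K * (LINT u|lborel. norm u powr (2 * n) * (cmod (F u))\<^sup>2)"
      by (rule ennreal_integral_le[OF _ _ nn le]; simp)+
  qed
qed

end

section \<open>From the error bound to the symbol conditions\<close>

lemma nn_integral_cube_measure:
  fixes f :: "real^'d \<Rightarrow> ennreal"
  assumes [measurable]: "f \<in> borel_measurable borel"
  shows "(\<integral>\<^sup>+u. f u \<partial>cube_measure) = (\<integral>\<^sup>+u. f u * indicator unit_cube u \<partial>lborel)"
  unfolding cube_measure_def by (subst nn_integral_restrict_space) simp_all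

lemma open_cube_subset: "open_cube \<subseteq> unit_cube"
  by (auto simp: open_cube_def unit_cube_def less_imp_le)

lemma unit_cube_subset_closure: "unit_cube \<subseteq> closure (open_cube :: (real^'d) set)"
proof -
  have "0 \<in> box (- (\<chi> i. 1/2)) ((\<chi> i. 1/2) :: real^'d)" by (simp add: mem_box_cart)
  then have "box (- (\<chi> i. 1/2)) ((\<chi> i. 1/2) :: real^'d) \<noteq> {}" by blast
  then have "closure open_cube = cbox (- (\<chi> i. 1/2)) ((\<chi> i. 1/2) :: real^'d)"
    unfolding open_cube_eq_box by (rule closure_box)
  then show ?thesis by (auto simp: unit_cube_def mem_box_cart less_imp_le)
qed

context symbol_pair
begin

lemma error_integrable:
  assumes [measurable]: "F \<in> borel_measurable borel" and i: "integrable lborel (\<lambda>u. (cmod (F u))\<^sup>2 * weight s u)"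
  shows "integrable lborel (\<lambda>u. (cmod (F u - per F u * p u))\<^sup>2 * weight s u)"
proof (rule weighted_square_triangle(1)[where h="\<lambda>_. 0"])
  have "integrable lborel (\<lambda>u. (cmod (per F u * p u))\<^sup>2 * weight s u)"
    by (rule periodic_times_symbol(1)[OF _ per_periodic per_square_integrable[OF _ i]]) measurable
  then show "integrable lborel (\<lambda>u. (cmod (per F u * p u - 0))\<^sup>2 * weight s u)" by simp
qed (use i in simp_all)

text \<open>A coset meets the cube in one point, so the lattice sum has a single nonzero
  term.\<close>

lemma per_cube_supported:
  assumes "\<And>u. u \<notin> unit_cube \<Longrightarrow> F u = 0" "\<zeta> \<in> unit_cube"
  shows "F (\<zeta> + real_vec k) = (if k = 0 then F \<zeta> else 0)" "per F \<zeta> = F \<zeta> * cnj (q \<zeta>)"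
proof -
  have "\<zeta> + real_vec k \<notin> unit_cube" if "k \<noteq> 0" for k
    using cube_translate_unique[of "\<zeta> + real_vec k" k 0] assms(2) that by auto
  then show *: "F (\<zeta> + real_vec k) = (if k = 0 then F \<zeta> else 0)" for k using assms(1) by auto
  have "F (\<zeta> + real_vec l) * cnj (q (\<zeta> + real_vec l)) = indicator {0} l *\<^sub>R (F \<zeta> * cnj (q \<zeta>))" for l
    by (simp add: * indicator_def)
  then show "per F \<zeta> = F \<zeta> * cnj (q \<zeta>)" unfolding per_def by (simp only: integral_count_space_singleton(2))
qed

text \<open>Tested on the indicator of the set \<open>A\<close> where the claim fails, the
  hypothesis says that the integral of \<open>\<Phi> - \<rho>\<close> over \<open>A\<close> is at
  most 0, although the integrand is positive there. So \<open>A\<close> is a null set, and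
  continuity removes the exception.\<close>

lemma pointwise_of_error_bound:
  assumes pc: "continuous_on UNIV p" and qc: "continuous_on UNIV q" and s: "0 \<le> s" "s \<le> n" "0 < n" and K: "K \<ge> 0"
    and H: "\<And>F. F \<in> borel_measurable borel \<Longrightarrow> integrable lborel (\<lambda>u. (cmod (F u))\<^sup>2 * weight n u) \<Longrightarrow>
      (LINT u|lborel. (cmod (F u - per F u * p u))\<^sup>2 * weight s u) \<le> K * (LINT u|lborel. norm u powr (2 * n) * (cmod (F u))\<^sup>2)"
    and E: "finite E" and \<zeta>: "\<zeta> \<in> unit_cube"
  shows "(\<Sum>k\<in>E. (cmod ((if k = 0 then 1 else 0) - p (\<zeta> + real_vec k) * cnj (q \<zeta>)))\<^sup>2 * weight s (\<zeta> + real_vec k)) \<le> K * norm \<zeta> powr (2 * n)"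
proof -
  \<comment> \<open>Restricting the coset sum to the finite set \<open>E\<close> keeps
    \<open>\<Phi>\<close> continuous; the infinite sum is recovered later as a supremum.\<close>
  define \<Phi> where "\<Phi> u = (\<Sum>k\<in>E. (cmod ((if k = 0 then 1 else 0) - p (u + real_vec k) * cnj (q u)))\<^sup>2 * weight s (u + real_vec k))" for u
  define \<rho> where "\<rho> u = K * norm u powr (2 * n)" for u :: "real^'d"
  have cp: "continuous_on UNIV (\<lambda>u. p (u + c))" for c
    by (rule continuous_on_compose2[OF pc]) (auto intro!: continuous_intros)
  have cw: "continuous_on UNIV (\<lambda>u. weight s (u + c))" for c :: "real^'d"
    by (intro continuous_on_powr continuous_intros) (simp add: add_nonneg_eq_0_iff)
  have c\<Phi>: "continuous_on UNIV \<Phi>" unfolding \<Phi>_def by (intro continuous_intros cp cw qc)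
  have "continuous_on UNIV (\<lambda>u :: real^'d. norm u powr (2 * n))"
    by (rule continuous_on_powr') (use s in \<open>auto intro!: continuous_intros\<close>)
  then have c\<rho>: "continuous_on UNIV \<rho>" unfolding \<rho>_def by (rule continuous_on_mult_left)
  have [measurable]: "\<Phi> \<in> borel_measurable borel" "\<rho> \<in> borel_measurable borel"
    using c\<Phi> c\<rho> by (auto intro: borel_measurable_continuous_onI)
  have \<Phi>0: "\<Phi> u \<ge> 0" for u unfolding \<Phi>_def by (intro sum_nonneg) simp
  \<comment> \<open>The violating points are taken in the open cube, where a closed set of full
    measure contains every point.\<close>
  define A where "A = {u \<in> open_cube. \<rho> u < \<Phi> u}"
  have [measurable]: "open_cube \<in> sets (borel :: (real^'d) measure)" by (rule borel_open[OF open_open_cube])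
  have A [measurable]: "A \<in> sets borel" unfolding A_def by measurable
  have AC: "A \<subseteq> unit_cube" using open_cube_subset by (auto simp: A_def)
  have finA: "emeasure lborel A < \<infinity>"
    using emeasure_mono[OF AC, of lborel] by (simp add: emeasure_unit_cube le_less_trans)
  define F where "F u = complex_of_real (indicator A u)" for u
  have [measurable]: "F \<in> borel_measurable borel" unfolding F_def by measurable
  have F0: "u \<notin> unit_cube \<Longrightarrow> F u = 0" for u using AC by (auto simp: F_def indicator_def)
  have F2: "(cmod (F u))\<^sup>2 = indicator A u" for u by (simp add: F_def indicator_def)
  have bnd: "integrable lborel (\<lambda>u. indicator A u * h u)" if [measurable]: "h \<in> borel_measurable borel" and h: "\<And>u. u \<in> unit_cube \<Longrightarrow> \<bar>h u\<bar> \<le> c" for h and c :: real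
  proof (rule Bochner_Integration.integrable_bound)
    show "integrable lborel (\<lambda>u. indicator A u * c)" using finA by simp
    show "AE u in lborel. norm (indicator A u * h u) \<le> norm (indicator A u * c)"
      using h AC by (intro AE_I2) (force simp: indicator_def)
  qed measurable
  have iF: "integrable lborel (\<lambda>u. (cmod (F u))\<^sup>2 * weight n u)"
    unfolding F2
  proof (rule bnd)
    fix u :: "real^'d" assume u: "u \<in> unit_cube"
    have "weight n u \<le> (1 + (real DIM(real^'d))\<^sup>2) powr n"
      using s cube_norm_le[OF u] by (intro powr_mono2 add_left_mono power_mono) auto
    then show "\<bar>weight n u\<bar> \<le> (1 + (real DIM(real^'d))\<^sup>2) powr n" by simp
  qed measurable
  have i\<rho>: "integrable lborel (\<lambda>u. indicator A u * \<rho> u)"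
  proof (rule bnd)
    fix u :: "real^'d" assume u: "u \<in> unit_cube"
    show "\<bar>\<rho> u\<bar> \<le> K * real DIM(real^'d) powr (2 * n)"
      using s K cube_norm_le[OF u] by (auto simp: \<rho>_def abs_mult intro!: mult_left_mono powr_mono2)
  qed measurable
  have iFs: "integrable lborel (\<lambda>u. (cmod (F u))\<^sup>2 * weight s u)"
    by (rule Bochner_Integration.integrable_bound[OF iF])
      (simp, intro AE_I2, use s in \<open>auto intro!: mult_left_mono powr_mono simp: abs_mult\<close>)
  note iD = error_integrable[OF _ iFs]
  have R: "K * (LINT u|lborel. norm u powr (2 * n) * (cmod (F u))\<^sup>2) = (LINT u|lborel. indicator A u * \<rho> u)"
    unfolding F2 \<rho>_def by (subst integral_mult_right_zero[symmetric]) (simp add: mult_ac)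
  have "(\<integral>\<^sup>+u. ennreal (indicator A u * \<Phi> u) \<partial>lborel) = (\<integral>\<^sup>+u. ennreal (indicator A u * \<Phi> u) \<partial>cube_measure)"
    by (subst nn_integral_cube_measure) (use AC in \<open>auto intro!: nn_integral_cong simp: indicator_def\<close>)
  also have "\<dots> \<le> (\<integral>\<^sup>+u. (\<integral>\<^sup>+k. ennreal ((cmod (F (u + real_vec k) - per F (u + real_vec k) * p (u + real_vec k)))\<^sup>2 * weight s (u + real_vec k)) \<partial>count_space UNIV) \<partial>cube_measure)"
  proof (rule nn_integral_mono)
    fix u :: "real^'d" assume "u \<in> space cube_measure"
    then have u: "u \<in> unit_cube" by simp
    have Fu: "F (u + real_vec k) = (if k = 0 then F u else 0)" "per F u = F u * cnj (q u)" for k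
      by (rule per_cube_supported[OF _ u]; simp add: F0)+
    have eq: "(cmod (F (u + real_vec k) - per F (u + real_vec k) * p (u + real_vec k)))\<^sup>2 =
        indicator A u * (cmod ((if k = 0 then 1 else 0) - p (u + real_vec k) * cnj (q u)))\<^sup>2" for k
      unfolding per_periodic Fu by (simp add: F_def indicator_def mult.commute norm_mult)
    have "ennreal (indicator A u * \<Phi> u) = (\<Sum>k\<in>E. ennreal ((cmod (F (u + real_vec k) - per F (u + real_vec k) * p (u + real_vec k)))\<^sup>2 * weight s (u + real_vec k)))"
      unfolding eq \<Phi>_def sum_distrib_left by (subst sum_ennreal) (simp_all add: mult.assoc)
    also have "\<dots> \<le> (\<integral>\<^sup>+k. ennreal ((cmod (F (u + real_vec k) - per F (u + real_vec k) * p (u + real_vec k)))\<^sup>2 * weight s (u + real_vec k)) \<partial>count_space UNIV)"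
      by (rule sum_le_nn_integral_count_space[OF E]) simp
    finally show "ennreal (indicator A u * \<Phi> u) \<le> (\<integral>\<^sup>+k. ennreal ((cmod (F (u + real_vec k) - per F (u + real_vec k) * p (u + real_vec k)))\<^sup>2 * weight s (u + real_vec k)) \<partial>count_space UNIV)" .
  qed
  also have "\<dots> = (\<integral>\<^sup>+u. ennreal ((cmod (F u - per F u * p u))\<^sup>2 * weight s u) \<partial>lborel)"
    by (rule nn_integral_lattice_cube[symmetric]) measurable
  also have "\<dots> = ennreal (LINT u|lborel. (cmod (F u - per F u * p u))\<^sup>2 * weight s u)"
    by (rule nn_integral_eq_integral[OF iD]) simp_all
  also have "\<dots> \<le> ennreal (LINT u|lborel. indicator A u * \<rho> u)"
    unfolding R[symmetric] by (intro ennreal_leI H iF) simp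
  finally have le: "(\<integral>\<^sup>+u. ennreal (indicator A u * \<Phi> u) \<partial>lborel) \<le> ennreal (LINT u|lborel. indicator A u * \<rho> u)" .
  have nn: "(LINT u|lborel. indicator A u * \<rho> u) \<ge> 0" using K by (simp add: \<rho>_def)
  have i\<Phi>: "integrable lborel (\<lambda>u. indicator A u * \<Phi> u)"
    and le': "(LINT u|lborel. indicator A u * \<Phi> u) \<le> (LINT u|lborel. indicator A u * \<rho> u)"
    using ennreal_integral_le[OF _ _ nn le] \<Phi>0 by simp_all
  have i\<Delta>: "integrable lborel (\<lambda>u. indicator A u * \<Phi> u - indicator A u * \<rho> u)"
    by (rule Bochner_Integration.integrable_diff[OF i\<Phi> i\<rho>])
  have \<Delta>0: "0 \<le> indicator A u * \<Phi> u - indicator A u * \<rho> u" for u by (auto simp: indicator_def A_def)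
  have "(LINT u|lborel. indicator A u * \<Phi> u - indicator A u * \<rho> u) \<le> 0"
    using le' by (simp add: Bochner_Integration.integral_diff[OF i\<Phi> i\<rho>])
  moreover have "(LINT u|lborel. indicator A u * \<Phi> u - indicator A u * \<rho> u) \<ge> 0"
    using \<Delta>0 by (intro integral_nonneg_AE AE_I2)
  ultimately have "(LINT u|lborel. indicator A u * \<Phi> u - indicator A u * \<rho> u) = 0" by linarith
  then have "AE u in lborel. indicator A u * \<Phi> u - indicator A u * \<rho> u = 0"
    using integral_nonneg_eq_0_iff_AE[OF i\<Delta>] \<Delta>0 by simp
  then have "AE u in lborel. u \<in> open_cube \<longrightarrow> u \<in> {u. \<Phi> u \<le> \<rho> u}"
    by eventually_elim (auto simp: A_def indicator_def split: if_splits)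
  then have ae: "AE u in lebesgue. u \<in> open_cube \<longrightarrow> u \<in> {u. \<Phi> u \<le> \<rho> u}" by (rule AE_completion)
  have closed: "closed {u. \<Phi> u \<le> \<rho> u}" by (rule closed_Collect_le[OF c\<Phi> c\<rho>])
  \<comment> \<open>Almost every point of an open set lies in the closed set, hence every point
    does. Passing to the closure adds the faces that belong to the half-open cube.\<close>
  have "open_cube \<subseteq> {u. \<Phi> u \<le> \<rho> u}"
    using mem_closed_if_AE_lebesgue_open[OF open_open_cube closed ae] by (rule subsetI)
  then have cl: "closure open_cube \<subseteq> {u. \<Phi> u \<le> \<rho> u}" using closed by (rule closure_minimal)
  have "\<zeta> \<in> {u. \<Phi> u \<le> \<rho> u}" by (rule subsetD[OF cl subsetD[OF unit_cube_subset_closure \<zeta>]])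
  then show ?thesis unfolding \<Phi>_def \<rho>_def by simp
qed

text \<open>\<open>E = {0}\<close> gives the first condition, since the weight is at least 1. Sets
  \<open>E\<close> without 0 give the second one multiplied by the squared modulus of
  \<open>q\<close>; this factor is removed near 0 by a lower bound, and away from 0 the bound
  \<open>b\<close> on the coset sum already suffices.\<close>

lemma error_bound_converse:
  assumes pc: "continuous_on UNIV p" and qc: "continuous_on UNIV q" and s: "0 \<le> s" "s \<le> n" "0 < n" and K: "K \<ge> 0"
    and H: "\<And>F. F \<in> borel_measurable borel \<Longrightarrow> integrable lborel (\<lambda>u. (cmod (F u))\<^sup>2 * weight n u) \<Longrightarrow>
      (LINT u|lborel. (cmod (F u - per F u * p u))\<^sup>2 * weight s u) \<le> K * (LINT u|lborel. norm u powr (2 * n) * (cmod (F u))\<^sup>2)"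
  shows "\<exists>C\<^sub>1>0. \<exists>C\<^sub>2>0. \<forall>\<zeta>\<in>unit_cube. cmod (1 - cnj (q \<zeta>) * p \<zeta>) \<le> C\<^sub>1 * norm \<zeta> powr n \<and>
    (\<integral>\<^sup>+k. ennreal ((cmod (p (\<zeta> + real_vec k)))\<^sup>2 * weight s (\<zeta> + real_vec k)) \<partial>count_space (UNIV - {0})) \<le> ennreal (C\<^sub>2 * norm \<zeta> powr (2 * n))"
proof -
  have pw: "(\<Sum>k\<in>E. (cmod ((if k = 0 then 1 else 0) - p (\<zeta> + real_vec k) * cnj (q \<zeta>)))\<^sup>2 * weight s (\<zeta> + real_vec k)) \<le> K * norm \<zeta> powr (2 * n)"
    if "finite E" "\<zeta> \<in> unit_cube" for E \<zeta>
    by (rule pointwise_of_error_bound[OF pc qc s K H that])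
  define S where "S E \<zeta> = (\<Sum>k\<in>E. (cmod (p (\<zeta> + real_vec k)))\<^sup>2 * weight s (\<zeta> + real_vec k))" for E \<zeta>
  have S0: "S E \<zeta> \<ge> 0" for E \<zeta> unfolding S_def by (intro sum_nonneg) simp
  have Sb: "S E \<zeta> \<le> b" if "finite E" for E \<zeta>
  proof -
    have "ennreal (S E \<zeta>) = (\<Sum>k\<in>E. ennreal ((cmod (p (\<zeta> + real_vec k)))\<^sup>2 * weight s (\<zeta> + real_vec k)))"
      unfolding S_def by (rule sum_ennreal[symmetric]) simp
    also have "\<dots> \<le> ennreal b"
      by (rule order_trans[OF sum_le_nn_integral_count_space[OF that] p_bound]) simp
    finally show ?thesis using b_nonneg by simp
  qed
  have w1: "1 \<le> weight s x" for x :: "real^'d" using s by (intro ge_one_powr_ge_zero) auto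
  have c1: "cmod (1 - cnj (q \<zeta>) * p \<zeta>) \<le> sqrt K * norm \<zeta> powr n" if \<zeta>: "\<zeta> \<in> unit_cube" for \<zeta>
  proof (rule power2_le_imp_le)
    have "(cmod (1 - cnj (q \<zeta>) * p \<zeta>))\<^sup>2 * 1 \<le> (cmod (1 - cnj (q \<zeta>) * p \<zeta>))\<^sup>2 * weight s \<zeta>"
      by (intro mult_left_mono w1) simp
    also have "\<dots> \<le> K * norm \<zeta> powr (2 * n)" using pw[of "{0}", OF _ \<zeta>] by (simp add: mult.commute)
    also have "\<dots> = (sqrt K * norm \<zeta> powr n)\<^sup>2"
      using K by (simp add: power_mult_distrib) (simp add: power2_eq_square powr_add[symmetric])
    finally show "(cmod (1 - cnj (q \<zeta>) * p \<zeta>))\<^sup>2 \<le> (sqrt K * norm \<zeta> powr n)\<^sup>2" by simp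
  qed (use K in simp)
  have qS: "(cmod (q \<zeta>))\<^sup>2 * S E \<zeta> \<le> K * norm \<zeta> powr (2 * n)" if \<zeta>: "\<zeta> \<in> unit_cube" and E: "finite E" "E \<subseteq> UNIV - {0}" for E \<zeta>
  proof -
    have "(cmod (q \<zeta>))\<^sup>2 * S E \<zeta> = (\<Sum>k\<in>E. (cmod ((if k = 0 then 1 else 0) - p (\<zeta> + real_vec k) * cnj (q \<zeta>)))\<^sup>2 * weight s (\<zeta> + real_vec k))"
      unfolding S_def sum_distrib_left using E(2) by (intro sum.cong) (auto simp: norm_mult power_mult_distrib mult_ac)
    then show ?thesis using pw[OF E(1) \<zeta>] by simp
  qed
  \<comment> \<open>Chosen so that \<open>sqrt K * d powr n \<le> 1/2\<close>, which keeps
    \<open>cnj q * p\<close> at modulus at least 1/2 on the ball of radius \<open>d\<close>. The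
    added 1 keeps the denominator positive when \<open>K = 0\<close>.\<close>
  define d where "d = (1 / (2 * (sqrt K + 1))) powr (1 / n)"
  have d: "d > 0" using K by (simp add: d_def add_nonneg_eq_0_iff)
  have dn: "d powr n = 1 / (2 * (sqrt K + 1))" using s K by (simp add: d_def powr_powr)
  \<comment> \<open>The constants of the cases inside and outside the ball of radius
    \<open>d\<close> are added, and 1 ensures positivity. The 4 is the inverse square of the lower
    bound 1/2.\<close>
  define C2 where "C2 = 4 * b * K + b / d powr (2 * n) + 1"
  have C2: "C2 > 0" using b_nonneg K by (simp add: C2_def add_nonneg_pos)
  have S_le: "S E \<zeta> \<le> C2 * norm \<zeta> powr (2 * n)" if \<zeta>: "\<zeta> \<in> unit_cube" and E: "finite E" "E \<subseteq> UNIV - {0}" for E \<zeta>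
  proof (cases "norm \<zeta> \<le> d")
    case True
    then have "norm \<zeta> powr n \<le> 1 / (2 * (sqrt K + 1))" unfolding dn[symmetric] using s by (intro powr_mono2) auto
    then have "sqrt K * norm \<zeta> powr n \<le> sqrt K * (1 / (2 * (sqrt K + 1)))" using K by (intro mult_left_mono) auto
    also have "\<dots> \<le> 1/2"
    proof -
      have "2 * (sqrt K + 1) > 0" using K by (simp add: add_nonneg_pos)
      from pos_divide_le_eq[OF this, of "sqrt K" "1/2"] show ?thesis by simp
    qed
    finally have "cmod (1 - cnj (q \<zeta>) * p \<zeta>) \<le> 1/2" using c1[OF \<zeta>] by linarith
    then have "1/2 \<le> cmod (cnj (q \<zeta>) * p \<zeta>)"
      using norm_triangle_ineq2[of 1 "cnj (q \<zeta>) * p \<zeta>"] by simp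
    then have "(1/2)\<^sup>2 \<le> (cmod (cnj (q \<zeta>) * p \<zeta>))\<^sup>2" by (intro power_mono) auto
    also have "\<dots> = (cmod (q \<zeta>))\<^sup>2 * ((cmod (p \<zeta>))\<^sup>2 * 1)" by (simp add: norm_mult power_mult_distrib)
    also have "\<dots> \<le> (cmod (q \<zeta>))\<^sup>2 * ((cmod (p \<zeta>))\<^sup>2 * weight s \<zeta>)"
      by (intro mult_left_mono w1) auto
    also have "\<dots> \<le> (cmod (q \<zeta>))\<^sup>2 * b" by (intro mult_left_mono p_term) simp
    finally have "1 \<le> 4 * b * (cmod (q \<zeta>))\<^sup>2" by (simp add: power2_eq_square mult_ac)
    then have "1 * S E \<zeta> \<le> 4 * b * (cmod (q \<zeta>))\<^sup>2 * S E \<zeta>" by (rule mult_right_mono[OF _ S0])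
    also have "\<dots> = 4 * b * ((cmod (q \<zeta>))\<^sup>2 * S E \<zeta>)" by simp
    also have "\<dots> \<le> 4 * b * (K * norm \<zeta> powr (2 * n))" using b_nonneg by (intro mult_left_mono qS[OF \<zeta> E]) auto
    also have "\<dots> \<le> C2 * norm \<zeta> powr (2 * n)"
      unfolding mult.assoc[symmetric] using b_nonneg by (intro mult_right_mono) (auto simp: C2_def)
    finally show ?thesis by simp
  next
    case False
    have "d powr (2 * n) \<le> norm \<zeta> powr (2 * n)" using False d s by (intro powr_mono2) auto
    then have "1 \<le> norm \<zeta> powr (2 * n) / d powr (2 * n)" using d by simp
    then have "b * 1 \<le> b * (norm \<zeta> powr (2 * n) / d powr (2 * n))" by (rule mult_left_mono[OF _ b_nonneg])
    also have "\<dots> = b / d powr (2 * n) * norm \<zeta> powr (2 * n)" by simp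
    also have "\<dots> \<le> C2 * norm \<zeta> powr (2 * n)" using b_nonneg K by (intro mult_right_mono) (auto simp: C2_def)
    finally show ?thesis using Sb[OF E(1), of \<zeta>] by simp
  qed
  show ?thesis
  proof (intro exI conjI ballI)
    show "sqrt K + 1 > 0" using K by (simp add: add_nonneg_pos)
    show "C2 > 0" by (rule C2)
    fix \<zeta> :: "real^'d" assume \<zeta>: "\<zeta> \<in> unit_cube"
    have "sqrt K * norm \<zeta> powr n \<le> (sqrt K + 1) * norm \<zeta> powr n" by (intro mult_right_mono) auto
    with c1[OF \<zeta>] show "cmod (1 - cnj (q \<zeta>) * p \<zeta>) \<le> (sqrt K + 1) * norm \<zeta> powr n" by linarith
    show "(\<integral>\<^sup>+k. ennreal ((cmod (p (\<zeta> + real_vec k)))\<^sup>2 * weight s (\<zeta> + real_vec k)) \<partial>count_space (UNIV - {0})) \<le> ennreal (C2 * norm \<zeta> powr (2 * n))"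
    proof (rule nn_integral_count_space_le)
      fix E :: "(int^'d) set" assume E: "finite E" "E \<subseteq> UNIV - {0}"
      have "(\<Sum>k\<in>E. ennreal ((cmod (p (\<zeta> + real_vec k)))\<^sup>2 * weight s (\<zeta> + real_vec k))) = ennreal (S E \<zeta>)"
        unfolding S_def by (rule sum_ennreal) simp
      also have "\<dots> \<le> ennreal (C2 * norm \<zeta> powr (2 * n))" by (rule ennreal_leI[OF S_le[OF \<zeta> E]])
      finally show "(\<Sum>k\<in>E. ennreal ((cmod (p (\<zeta> + real_vec k)))\<^sup>2 * weight s (\<zeta> + real_vec k))) \<le> ennreal (C2 * norm \<zeta> powr (2 * n))" .
    qed
  qed
qed

end

section \<open>Simultaneous approximation order\<close>

lemma sobolev_seminorm_matrix:
  fixes B :: "real^'d^'d"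
  assumes g: "represents g (fourier_distr f)" and B: "det B \<noteq> 0"
  shows "sobolev_seminorm r f = sqrt (\<bar>det B\<bar> * (LINT u|lborel. norm (B *v u) powr (2 * r) * (cmod (g (B *v u)))\<^sup>2))"
proof -
  have [measurable]: "g \<in> borel_measurable borel" using g by (simp add: represents_def)
  show ?thesis
    unfolding sobolev_seminorm_represents[OF g] by (subst integral_matrix[OF B]) simp_all
qed

text \<open>After the substitution \<open>\<xi> = B u\<close> the error is
  \<open>F - per F * p\<close>, and the dilation survives only in the homogeneous weight and in the
  Jacobian.\<close>

lemma quasi_proj_error_seminorm:
  fixes M :: "int^'d^'d" and \<phi> \<phi>' f :: "(real^'d) distr" and j :: int
  assumes M: "dilation_matrix M" and \<phi>: "\<phi> \<in> sobolev s" and \<phi>': "\<phi>' \<in> sobolev (- s)"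
    and sp: "symbol_pair (fhat \<phi>) (fhat \<phi>') s b" and s: "s \<ge> 0"
    and g: "represents g (fourier_distr f)" and ig: "integrable lborel (\<lambda>\<xi>. (cmod (g \<xi>))\<^sup>2 * weight s \<xi>)"
  defines "B \<equiv> mat_powi (transpose (real_mat M)) j"
  shows "sobolev_seminorm r (\<lambda>\<psi>. f \<psi> - quasi_proj s M \<phi> \<phi>' j f \<psi>) = sqrt (\<bar>det B\<bar> * (LINT u|lborel.
    norm (B *v u) powr (2 * r) * (cmod (g (B *v u) - symbol_pair.per (fhat \<phi>') (\<lambda>u. g (B *v u)) u * fhat \<phi> u))\<^sup>2))"
proof -
  have B: "det B \<noteq> 0" unfolding B_def by (rule dil_shift_represents(2)[OF M sobolevD(1,2)[OF \<phi>]])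
  note Q = quasi_proj_represents[OF M \<phi> \<phi>' sp s g ig, of j, folded B_def]
  show ?thesis
    by (rule sobolev_seminorm_matrix[OF represents_diff[OF g Q] B, of r, unfolded matrix_inv_cancel(1)[OF B]])
qed

theorem theorem3p4:
  fixes M :: "int^'d^'d" and \<phi> \<phi>' :: "(real^'d) distr" and s :: nat and n :: real
  assumes "dilation_matrix M"
    and "n > real s"
    and "\<phi> \<in> sobolev (real s)" and "\<phi>' \<in> sobolev (- real s)"
    and "compact (distr_support \<phi>)" and "compact (distr_support \<phi>')"
  shows "simultaneous_approx_order M \<phi> \<phi>' s n \<longleftrightarrow>
    (\<exists>C\<^sub>1>0. \<exists>C\<^sub>2>0. \<forall>\<xi>\<in>unit_cube.
       cmod (1 - cnj (fhat \<phi>' \<xi>) * fhat \<phi> \<xi>) \<le> C\<^sub>1 * norm \<xi> powr n \<and>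
       (\<Sum>\<^sub>\<infinity>k\<in>UNIV - {0}. ennreal ((1 + (norm (\<xi> + real_vec k))\<^sup>2) ^ s * (cmod (fhat \<phi> (\<xi> + real_vec k)))\<^sup>2))
         \<le> ennreal (C\<^sub>2 * norm \<xi> powr (2 * n)))"
proof -
  obtain b where sp: "symbol_pair (fhat \<phi>) (fhat \<phi>') (real s) b"
    using symbol_pair_exists[OF assms(3-6)] by blast
  interpret symbol_pair "fhat \<phi>" "fhat \<phi>'" "real s" b by (rule sp)
  have s: "0 \<le> real s" "real s \<le> n" "0 < n" "0 \<le> n" using assms(2) by simp_all
  have weight_power: "weight (real s) x = (1 + (norm x)\<^sup>2) ^ s" for x :: "real^'d"
    by (intro powr_realpow) (simp add: add_pos_nonneg)
  have sum_eq: "(\<Sum>\<^sub>\<infinity>k\<in>UNIV - {0}. ennreal ((1 + (norm (\<xi> + real_vec k))\<^sup>2) ^ s * (cmod (fhat \<phi> (\<xi> + real_vec k)))\<^sup>2)) =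
      (\<integral>\<^sup>+k. ennreal ((cmod (fhat \<phi> (\<xi> + real_vec k)))\<^sup>2 * weight (real s) (\<xi> + real_vec k)) \<partial>count_space (UNIV - {0}))" for \<xi>
    unfolding infsum_eq_nn_integral_count_space weight_power by (simp only: mult.commute)
  define B where "B j = mat_powi (transpose (real_mat M)) j" for j
  have B: "det (B j) \<noteq> 0" for j
    unfolding B_def by (rule dil_shift_represents(2)[OF assms(1) sobolevD(1,2)[OF assms(3)]])
  have B_neg: "B (- j) = matrix_inv (B j)" for j
    unfolding B_def by (rule mat_powi_neg) (simp add: det_transpose dilation_matrix_det_nonzero[OF assms(1)])
  have error: "sobolev_seminorm r (\<lambda>\<psi>. f \<psi> - quasi_proj (real s) M \<phi> \<phi>' j f \<psi>) = sqrt (\<bar>det (B j)\<bar> * (LINT u|lborel.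
      norm (B j *v u) powr (2 * r) * (cmod (g (B j *v u) - per (\<lambda>u. g (B j *v u)) u * fhat \<phi> u))\<^sup>2))"
    if "represents g (fourier_distr f)" "integrable lborel (\<lambda>\<xi>. (cmod (g \<xi>))\<^sup>2 * weight (real s) \<xi>)" for f g j r
    unfolding B_def by (rule quasi_proj_error_seminorm[OF assms(1,3,4) sp s(1) that])
  show ?thesis unfolding sum_eq
  proof
    assume "simultaneous_approx_order M \<phi> \<phi>' s n"
    then obtain C where C: "(\<Sum>r=0..s. inverse (op_norm (B j)) ^ r * sobolev_seminorm (real r) (\<lambda>\<psi>. f \<psi> - quasi_proj (real s) M \<phi> \<phi>' j f \<psi>))
        \<le> C * op_norm (B (- j)) powr n * sobolev_seminorm n f" if "f \<in> sobolev n" for f j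
      unfolding simultaneous_approx_order_def B_def by blast
    \<comment> \<open>The converse evaluates the hypothesis at \<open>j = 0\<close>, where both
      operator norms are 1.\<close>
    have B0: "B 0 = mat 1" by (simp add: B_def mat_powi_def)
    have op1: "op_norm (mat 1 :: real^'d^'d) = 1" by (simp add: op_norm_def onorm_id)
    show "\<exists>C\<^sub>1>0. \<exists>C\<^sub>2>0. \<forall>\<xi>\<in>unit_cube. cmod (1 - cnj (fhat \<phi>' \<xi>) * fhat \<phi> \<xi>) \<le> C\<^sub>1 * norm \<xi> powr n \<and>
       (\<integral>\<^sup>+k. ennreal ((cmod (fhat \<phi> (\<xi> + real_vec k)))\<^sup>2 * weight (real s) (\<xi> + real_vec k)) \<partial>count_space (UNIV - {0})) \<le> ennreal (C\<^sub>2 * norm \<xi> powr (2 * n))"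
    proof (rule error_bound_converse[OF fhat_reproducing(2)[OF assms(3,5)] fhat_reproducing(2)[OF assms(4,6)] s(1-3)])
      \<comment> \<open>The constant comes from \<open>(1 + t)^s \<le> 2^s * (1 + t^s)\<close>, with
        the seminorms of orders 0 and \<open>s\<close> each contributing the square of
        \<open>C\<close>.\<close>
      show "2 ^ s * (2 * C\<^sup>2) \<ge> 0" by simp
      fix F :: "real^'d \<Rightarrow> complex"
      assume F [measurable]: "F \<in> borel_measurable borel" and i: "integrable lborel (\<lambda>u. (cmod (F u))\<^sup>2 * weight n u)"
      note f = sobolev_exists[OF F i]
      have iS: "integrable lborel (\<lambda>u. (cmod (F u))\<^sup>2 * weight (real s) u)"
        by (rule Bochner_Integration.integrable_bound[OF i])
          (simp, intro AE_I2, use s in \<open>auto intro!: mult_left_mono powr_mono simp: abs_mult\<close>)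
      define D where "D u = F u - per F u * fhat \<phi> u" for u
      have [measurable]: "D \<in> borel_measurable borel" unfolding D_def by measurable
      have iD: "integrable lborel (\<lambda>u. (cmod (D u))\<^sup>2 * weight (real s) u)"
        unfolding D_def by (rule error_integrable[OF F iS])
      define I where "I = (LINT u|lborel. norm u powr (2 * n) * (cmod (F u))\<^sup>2)"
      define X where "X r = (LINT u|lborel. norm u powr (2 * real r) * (cmod (D u))\<^sup>2)" for r :: nat
      have I0: "I \<ge> 0" and X0: "X r \<ge> 0" for r unfolding I_def X_def by simp_all
      have iX: "integrable lborel (\<lambda>u. norm u powr (2 * real r) * (cmod (D u))\<^sup>2)" if "r \<le> s" for r
      proof (rule Bochner_Integration.integrable_bound[OF iD])
        have "norm u powr (2 * real r) \<le> weight (real s) u" for u :: "real^'d"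
          by (rule order_trans[OF norm_powr_le_weight]) (use that in \<open>auto intro!: powr_mono\<close>)
        then show "AE u in lborel. norm (norm u powr (2 * real r) * (cmod (D u))\<^sup>2) \<le> norm ((cmod (D u))\<^sup>2 * weight (real s) u)"
          by (intro AE_I2) (auto intro!: mult_left_mono simp: abs_mult mult.commute)
      qed measurable
      have X: "X r \<le> C\<^sup>2 * I" if r: "r \<le> s" for r
      proof -
        have "(\<Sum>r=0..s. sqrt (X r)) \<le> C * sqrt I"
          using C[OF f(1), of 0] unfolding error[OF f(2) iS] sobolev_seminorm_represents[OF f(2)]
          by (simp add: B0 op1 X_def I_def D_def)
        moreover have "sqrt (X r) \<le> (\<Sum>r=0..s. sqrt (X r))"
          using r X0 by (intro member_le_sum) auto
        ultimately have "sqrt (X r) \<le> C * sqrt I" by linarith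
        then have "(sqrt (X r))\<^sup>2 \<le> (C * sqrt I)\<^sup>2" using X0 by (intro power_mono) auto
        then show ?thesis using X0[of r] I0 by (simp add: power_mult_distrib)
      qed
      have "(LINT u|lborel. (cmod (D u))\<^sup>2 * weight (real s) u) \<le>
          (LINT u|lborel. 2 ^ s * (norm u powr (2 * real 0) * (cmod (D u))\<^sup>2 + norm u powr (2 * real s) * (cmod (D u))\<^sup>2))"
      proof (rule integral_mono_AE[OF iD])
        show "integrable lborel (\<lambda>u. 2 ^ s * (norm u powr (2 * real 0) * (cmod (D u))\<^sup>2 + norm u powr (2 * real s) * (cmod (D u))\<^sup>2))"
          by (intro integrable_mult_right Bochner_Integration.integrable_add iX) simp_all
        show "AE u in lborel. (cmod (D u))\<^sup>2 * weight (real s) u \<le> 2 ^ s * (norm u powr (2 * real 0) * (cmod (D u))\<^sup>2 + norm u powr (2 * real s) * (cmod (D u))\<^sup>2)"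
          \<comment> \<open>The origin is excluded because \<open>0 powr 0 = 0\<close>, which would
            break the comparison with the term of order 0.\<close>
          using AE_lborel_singleton[of "0 :: real^'d"]
        proof eventually_elim
          case (elim u)
          then have "norm u powr (2 * real s) = ((norm u)\<^sup>2) ^ s"
            by (simp add: powr_realpow[of "norm u" "2 * s", simplified] power_mult)
          moreover have "(1 + (norm u)\<^sup>2) ^ s \<le> 2 ^ s * (1 + ((norm u)\<^sup>2) ^ s)"
          proof (cases "(norm u)\<^sup>2 \<le> 1")
            case True
            then have "(1 + (norm u)\<^sup>2) ^ s \<le> 2 ^ s" by (intro power_mono) auto
            also have "\<dots> \<le> 2 ^ s * (1 + ((norm u)\<^sup>2) ^ s)" by simp
            finally show ?thesis .
          next
            case False
            then have "(1 + (norm u)\<^sup>2) ^ s \<le> (2 * (norm u)\<^sup>2) ^ s" by (intro power_mono) auto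
            also have "\<dots> \<le> 2 ^ s * (1 + ((norm u)\<^sup>2) ^ s)" by (simp add: power_mult_distrib)
            finally show ?thesis .
          qed
          ultimately have "weight (real s) u \<le> 2 ^ s * (norm u powr (2 * real 0) + norm u powr (2 * real s))"
            using elim unfolding weight_power by simp
          then have "(cmod (D u))\<^sup>2 * weight (real s) u \<le> (cmod (D u))\<^sup>2 * (2 ^ s * (norm u powr (2 * real 0) + norm u powr (2 * real s)))"
            by (rule mult_left_mono) simp
          then show ?case by (simp only: distrib_left mult_ac)
        qed
      qed
      also have "\<dots> = 2 ^ s * (X 0 + X s)"
        unfolding X_def integral_mult_right_zero by (subst Bochner_Integration.integral_add[OF iX iX]) simp_all
      also have "\<dots> \<le> 2 ^ s * (C\<^sup>2 * I + C\<^sup>2 * I)" by (intro mult_left_mono add_mono X) simp_all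
      finally show "(LINT u|lborel. (cmod (F u - per F u * fhat \<phi> u))\<^sup>2 * weight (real s) u) \<le> 2 ^ s * (2 * C\<^sup>2) * (LINT u|lborel. norm u powr (2 * n) * (cmod (F u))\<^sup>2)"
        unfolding D_def I_def by simp
    qed
  next
    assume "\<exists>C\<^sub>1>0. \<exists>C\<^sub>2>0. \<forall>\<xi>\<in>unit_cube. cmod (1 - cnj (fhat \<phi>' \<xi>) * fhat \<phi> \<xi>) \<le> C\<^sub>1 * norm \<xi> powr n \<and>
       (\<integral>\<^sup>+k. ennreal ((cmod (fhat \<phi> (\<xi> + real_vec k)))\<^sup>2 * weight (real s) (\<xi> + real_vec k)) \<partial>count_space (UNIV - {0})) \<le> ennreal (C\<^sub>2 * norm \<xi> powr (2 * n))"
    then obtain C1 C2 where C: "0 \<le> C1" "0 \<le> C2" and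
      c1: "\<And>\<xi>. \<xi> \<in> unit_cube \<Longrightarrow> cmod (1 - cnj (fhat \<phi>' \<xi>) * fhat \<phi> \<xi>) \<le> C1 * norm \<xi> powr n" and
      c2: "\<And>\<xi>. \<xi> \<in> unit_cube \<Longrightarrow> (\<integral>\<^sup>+k. ennreal ((cmod (fhat \<phi> (\<xi> + real_vec k)))\<^sup>2 * weight (real s) (\<xi> + real_vec k)) \<partial>count_space (UNIV - {0})) \<le> ennreal (C2 * norm \<xi> powr (2 * n))"
      by (meson less_imp_le)
    obtain K where K: "K \<ge> 0" and KF: "\<And>F. F \<in> borel_measurable borel \<Longrightarrow> integrable lborel (\<lambda>u. (cmod (F u))\<^sup>2 * weight n u) \<Longrightarrow>
        integrable lborel (\<lambda>u. (cmod (F u - per F u * fhat \<phi> u))\<^sup>2 * weight (real s) u) \<and>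
        (LINT u|lborel. (cmod (F u - per F u * fhat \<phi> u))\<^sup>2 * weight (real s) u) \<le> K * (LINT u|lborel. norm u powr (2 * n) * (cmod (F u))\<^sup>2)"
      using error_bound[OF s(1,2) C c1 c2] by auto
    \<comment> \<open>Each of the \<open>s + 1\<close> summands obeys the same bound, whence the
      factor \<open>real s + 1\<close>.\<close>
    have "(\<Sum>r=0..s. inverse (op_norm (B j)) ^ r * sobolev_seminorm (real r) (\<lambda>\<psi>. f \<psi> - quasi_proj (real s) M \<phi> \<phi>' j f \<psi>))
        \<le> (real s + 1) * sqrt K * op_norm (B (- j)) powr n * sobolev_seminorm n f" if f: "f \<in> sobolev n" for f j
    proof -
      define \<beta> where "\<beta> = op_norm (B j)"
      define \<gamma> where "\<gamma> = op_norm (B (- j))"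
      define a where "a = \<bar>det (B j)\<bar>"
      have \<beta>: "\<beta> \<ge> 0" and \<gamma>: "\<gamma> \<ge> 0" and a: "a \<ge> 0" by (simp_all add: \<beta>_def \<gamma>_def a_def op_norm_nonneg)
      note rep = sobolevD(2)[OF f]
      have [measurable]: "fhat f \<in> borel_measurable borel" by (rule sobolevD(3)[OF f])
      define F where "F u = fhat f (B j *v u)" for u
      have F [measurable]: "F \<in> borel_measurable borel" unfolding F_def by measurable
      have iF: "integrable lborel (\<lambda>u. (cmod (F u))\<^sup>2 * weight n u)"
        unfolding F_def by (rule weighted_integral_matrix(1)[OF B s(4) _ sobolevD(4)[OF f]]) simp
      define D where "D u = F u - per F u * fhat \<phi> u" for u
      have [measurable]: "D \<in> borel_measurable borel" unfolding D_def by measurable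
      define ID where "ID = (LINT u|lborel. (cmod (D u))\<^sup>2 * weight (real s) u)"
      define J where "J = (LINT u|lborel. norm (B j *v u) powr (2 * n) * (cmod (F u))\<^sup>2)"
      have iD: "integrable lborel (\<lambda>u. (cmod (D u))\<^sup>2 * weight (real s) u)"
        and ID: "ID \<le> K * (LINT u|lborel. norm u powr (2 * n) * (cmod (F u))\<^sup>2)"
        using KF[OF F iF] unfolding D_def ID_def by simp_all
      have ID0: "ID \<ge> 0" and J0: "J \<ge> 0" unfolding ID_def J_def by simp_all
      have seminorm_f: "sobolev_seminorm n f = sqrt (a * J)"
        unfolding a_def J_def F_def by (rule sobolev_seminorm_matrix[OF rep B])
      have err: "inverse \<beta> ^ r * sobolev_seminorm (real r) (\<lambda>\<psi>. f \<psi> - quasi_proj (real s) M \<phi> \<phi>' j f \<psi>) \<le> sqrt (a * ID)" if r: "r \<le> s" for r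
      proof -
        have "(LINT u|lborel. norm (B j *v u) powr (2 * real r) * (cmod (D u))\<^sup>2) \<le> (LINT u|lborel. \<beta> powr (2 * real r) * ((cmod (D u))\<^sup>2 * weight (real s) u))"
        proof (rule integral_mono'[OF integrable_mult_right[OF iD]])
          fix u :: "real^'d"
          have "norm (B j *v u) powr (2 * real r) \<le> (\<beta> * norm u) powr (2 * real r)"
            unfolding \<beta>_def by (intro powr_mono2 norm_matrix_le) auto
          also have "\<dots> = \<beta> powr (2 * real r) * norm u powr (2 * real r)" by (rule powr_mult)
          also have "\<dots> \<le> \<beta> powr (2 * real r) * weight (real s) u"
            by (intro mult_left_mono order_trans[OF norm_powr_le_weight]) (use r in \<open>auto intro!: powr_mono\<close>)
          finally have "norm (B j *v u) powr (2 * real r) * (cmod (D u))\<^sup>2 \<le> \<beta> powr (2 * real r) * weight (real s) u * (cmod (D u))\<^sup>2"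
            by (rule mult_right_mono) simp
          then show "norm (B j *v u) powr (2 * real r) * (cmod (D u))\<^sup>2 \<le> \<beta> powr (2 * real r) * ((cmod (D u))\<^sup>2 * weight (real s) u)"
            by (simp only: mult_ac)
        qed simp
        also have "\<dots> = \<beta> powr (2 * real r) * ID" unfolding ID_def by (rule integral_mult_right_zero)
        finally have le: "(LINT u|lborel. norm (B j *v u) powr (2 * real r) * (cmod (D u))\<^sup>2) \<le> \<beta> powr (2 * real r) * ID" .
        have "sobolev_seminorm (real r) (\<lambda>\<psi>. f \<psi> - quasi_proj (real s) M \<phi> \<phi>' j f \<psi>) \<le> sqrt (a * (\<beta> powr (2 * real r) * ID))"
          unfolding error[OF rep sobolevD(4)[OF sobolev_mono[OF f s(2)]]] a_def[symmetric]
          using mult_left_mono[OF le a] by (simp add: F_def[abs_def] D_def[abs_def])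
        also have "\<dots> = sqrt (\<beta> powr (2 * real r)) * sqrt (a * ID)" by (simp add: real_sqrt_mult mult_ac)
        finally have "inverse \<beta> ^ r * sobolev_seminorm (real r) (\<lambda>\<psi>. f \<psi> - quasi_proj (real s) M \<phi> \<phi>' j f \<psi>) \<le> inverse \<beta> ^ r * (sqrt (\<beta> powr (2 * real r)) * sqrt (a * ID))"
          using \<beta> by (intro mult_left_mono) auto
        also have "\<dots> = inverse \<beta> ^ r * sqrt (\<beta> powr (2 * real r)) * sqrt (a * ID)" by simp
        also have "\<dots> \<le> 1 * sqrt (a * ID)"
        proof (rule mult_right_mono)
          show "inverse \<beta> ^ r * sqrt (\<beta> powr (2 * real r)) \<le> 1"
          \<comment> \<open>For \<open>\<beta> = 0\<close> the conventions for
            \<open>inverse\<close> and \<open>powr\<close> make the product 0.\<close>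
          proof (cases "\<beta> = 0")
            case False
            then have "\<beta> powr (2 * real r) = (\<beta> ^ r)\<^sup>2"
              using \<beta> powr_realpow[of \<beta> "2 * r"] by (simp add: power_mult[symmetric] mult.commute)
            then have "sqrt (\<beta> powr (2 * real r)) = \<beta> ^ r" using \<beta> by simp
            then show ?thesis using False by (simp add: power_mult_distrib[symmetric])
          qed simp
        qed (use a ID0 in simp)
        finally show ?thesis by simp
      qed
      have "integrable lborel (\<lambda>\<xi>. norm \<xi> powr (2 * n) * (cmod (fhat f \<xi>))\<^sup>2)"
        by (rule Bochner_Integration.integrable_bound[OF sobolevD(4)[OF f]])
          (simp, intro AE_I2, use norm_powr_le_weight[of n] s in \<open>auto intro!: mult_left_mono simp: abs_mult mult.commute\<close>)
      then have iJ: "integrable lborel (\<lambda>u. norm (B j *v u) powr (2 * n) * (cmod (F u))\<^sup>2)"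
        unfolding F_def by (subst integrable_matrix[OF B, where f="\<lambda>\<xi>. norm \<xi> powr (2 * n) * (cmod (fhat f \<xi>))\<^sup>2"]) simp_all
      have "(LINT u|lborel. norm u powr (2 * n) * (cmod (F u))\<^sup>2) \<le> (LINT u|lborel. \<gamma> powr (2 * n) * (norm (B j *v u) powr (2 * n) * (cmod (F u))\<^sup>2))"
      proof (rule integral_mono'[OF integrable_mult_right[OF iJ]])
        fix u :: "real^'d"
        \<comment> \<open>Writing \<open>u\<close> as the inverse matrix applied to
          \<open>B j *v u\<close> is where the operator norm on the right-hand side of the
          approximation order enters.\<close>
        have "norm u \<le> \<gamma> * norm (B j *v u)"
          using norm_matrix_le[of "matrix_inv (B j)" "B j *v u"] unfolding matrix_inv_cancel(1)[OF B] \<gamma>_def B_neg .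
        then have "norm u powr (2 * n) \<le> (\<gamma> * norm (B j *v u)) powr (2 * n)" using s by (intro powr_mono2) auto
        then have "norm u powr (2 * n) * (cmod (F u))\<^sup>2 \<le> (\<gamma> * norm (B j *v u)) powr (2 * n) * (cmod (F u))\<^sup>2"
          by (rule mult_right_mono) simp
        then show "norm u powr (2 * n) * (cmod (F u))\<^sup>2 \<le> \<gamma> powr (2 * n) * (norm (B j *v u) powr (2 * n) * (cmod (F u))\<^sup>2)"
          by (simp only: powr_mult mult.assoc)
      qed simp
      also have "\<dots> = \<gamma> powr (2 * n) * J" unfolding J_def by (rule integral_mult_right_zero)
      finally have "ID \<le> K * (\<gamma> powr (2 * n) * J)" using ID mult_left_mono[OF _ K] by (meson order_trans)
      then have "a * ID \<le> a * (K * (\<gamma> powr (2 * n) * J))" by (rule mult_left_mono[OF _ a])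
      then have "sqrt (a * ID) \<le> sqrt (K * (\<gamma> powr n)\<^sup>2 * (a * J))"
        by (intro real_sqrt_le_mono) (simp add: power2_eq_square powr_add[symmetric] mult_ac)
      also have "\<dots> = sqrt K * \<gamma> powr n * sobolev_seminorm n f"
        unfolding seminorm_f by (simp add: real_sqrt_mult)
      finally have le: "sqrt (a * ID) \<le> sqrt K * \<gamma> powr n * sobolev_seminorm n f" .
      have "(\<Sum>r=0..s. inverse \<beta> ^ r * sobolev_seminorm (real r) (\<lambda>\<psi>. f \<psi> - quasi_proj (real s) M \<phi> \<phi>' j f \<psi>))
          \<le> of_nat (card {0..s}) * (sqrt K * \<gamma> powr n * sobolev_seminorm n f)"
        by (rule sum_bounded_above) (use order_trans[OF err le] in auto)
      then show ?thesis unfolding \<beta>_def \<gamma>_def by (simp add: mult_ac add.commute)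
    qed
    then show "simultaneous_approx_order M \<phi> \<phi>' s n"
      unfolding simultaneous_approx_order_def B_def by blast
  qed
qed

end
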